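(* (Quasi-parabolic case.) Let $n\ge2$, $\lambda>n$, $H=P(n)$, $z_0=\frac1{\sqrt{2(n-1)}}(1,\dots,1,0)\in\mathbb{B}^n$, and let $R$ be the restriction operator $(Rf)(h)=D_\lambda(h)f(h\cdot z_0)$ for $f\in\mathcal{H}^2_\lambda(\mathbb{B}^n)$, $h\in\widetilde{P(n)}$, where $D_\lambda(t,y,x)=e^{-2\pi i\lambda x}(1-\frac{iy}2)^{-\lambda}$. Then $D_\lambda\in L^2_{\chi_\lambda}(P(n)\cdot z_0)$ (indeed for all $\lambda>1/2$). Put $$\phi(t,y)=\Big(1-\frac{iy}2-\frac1{2(n-1)}\sum_{i=1}^{n-1}t_i\Big)^{-\lambda},\qquad(t,y)\in\mathbb{T}^{n-1}\times\mathbb{R}.$$ Then $\phi\in L^1(\mathbb{T}^{n-1}\times\mathbb{R})$ (indeed for all $\lambda>1$), and $$RR^*f(t,y,x)=e^{-2\pi i\lambda x}(\widetilde f*\phi)(t,y);$$ hence $RR^*$, $R$ and $R^*$ are bounded. The Fourier transform of $\phi$ is, for $\alpha\in\mathbb{Z}^{n-1}$, $\xi\in\mathbb{R}$, $$\widehat\phi(\alpha,\xi)=\begin{cases}\dfrac{2^{\lambda+1/2}\sqrt\pi}{\Gamma(\lambda)}\,e^{-2\xi}\,\dfrac{\xi^{\lambda+|\alpha|-1}}{(n-1)^{|\alpha|}}\,\dfrac1{\alpha_1!\cdots\alpha_{n-1}!}&\xi>0,\ \alpha_1\ge0,\dots,\alpha_{n-1}\ge0,\\[2mm]0&\text{otherwise.}\end{cases}$$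 Consequently the closure of the range of $RR^*$ (and of $\sqrt{RR^*}$) is $$\mathcal{B}_\lambda=\{f\in L^2_{\chi_\lambda}(P(n)\cdot z_0):\ \widehat{\widetilde f}(\alpha,\xi)=0\text{ for all }(\alpha,\xi)\text{ such that }\widehat\phi(\alpha,\xi)=0\},$$ and $\sqrt{RR^*}f(t,y,x)=e^{-2\pi i\lambda x}(\widetilde f*\omega)(t,y)$ for all $f\in L^2_{\chi_\lambda}(P(n)\cdot z_0)$, where $\omega$ is defined by $\widehat\omega=\sqrt{\widehat\phi}$ (and exists at least as a tempered distribution on $\mathbb{T}^{n-1}\times\mathbb{R}$).
   Context: $\mathbb{B}^n$ is the unit ball of $\mathbb{C}^n$; $d\mu_\lambda=c_\lambda(1-|z|^2)^{\lambda-n-1}dv$ is a probability measure ($dv$ normalized Lebesgue measure); $\mathcal{H}^2_\lambda(\mathbb{B}^n)$ is the space of holomorphic functions in $L^2(\mathbb{B}^n,\mu_\lambda)$, with reproducing kernel $(1-z^t\bar w)^{-\lambda}$. $\mathrm{SU}(n,1)$ acts on $\mathbb{B}^n$ by $\begin{pmatrix}A&v\\ w^t&d\end{pmatrix}\cdot z=\frac{Az+v}{w^tz+d}$. $\mathbb{T}$ is the unit circle. $P(n)\subset\mathrm{SU}(n,1)$ is the group of block diagonal matrices $\mathrm{diag}\Big(at_1,\dots,at_{n-1},a\begin{pmatrix}1+iy/2&iy/2\\-iy/2&1-iy/2\end{pmatrix}\Big)$ with $a,t_i\in\mathbb{T}$, $y\in\mathbb{R}$, $a^{n+1}t_1\cdots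 t_{n-1}=1$; it acts by $(z',0)\mapsto\big(\frac{2}{2-iy}tz',\frac{iy}{2-iy}\big)$ on points with $z_n=0$. The corresponding subgroup of the universal cover of $\mathrm{SU}(n,1)$ is $\widetilde{P(n)}=\{(t,y,x)\in\mathbb{T}^{n-1}\times\mathbb{R}\times\mathbb{R}: e^{2\pi i(n+1)x}t_1\cdots t_{n-1}=1\}$ with product $(tt',y+y',x+x')$ and $a=e^{2\pi ix}$; the stabilizer of $z_0$ is $\{(1,0,\frac m{n+1}): m\in\mathbb{Z}\}$, and the orbit $P(n)\cdot z_0$ is identified with $\mathbb{T}^{n-1}\times\mathbb{R}$ via $(t,y,x)\mapsto(t,y)$, with measure $dt\,dy$ ($dt$ Haar measure of total mass one). $L^2_{\chi_\lambda}(P(n)\cdot z_0)$ is the space of measurable $f:\widetilde{P(n)}\to\mathbb{C}$ with $f(t,y,x+\frac m{n+1})=e^{-2\pi i\lambda m/(n+1)}f(t,y,x)$ for $m\in\mathbb{Z}$ and $|f|\in L^2(\mathbb{T}^{n-1}\times\mathbb{R})$, with the corresponding norm; here $\chi_\lambda(t,y,x)=e^{2\pi i\lambda x}$. For such $f$, $\widetilde f(t,y)=e^{2\pi i\lambda x}f(t,y,x)\in L^2(\mathbb{T}^{n-1}\times\mathbb{R})$. $*$ is convolution on $\mathbb{T}^{n-1}\times\mathbb{R}$. Fourier transform: $\widehat g(\alpha,\xi)=\frac1{\sqrt{2\pi}}\int_{\mathbb{T}^{n-1}}\int_{\mathbb{R}}g(t,y)\overline{t^\alpha}e^{-iy\xi}\,dy\,dt$;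 $|\alpha|=\sum\alpha_i$; vanishing of Fourier transforms of $L^2$ functions is understood almost everywhere. $R^*$ is the Hilbert space adjoint.
   Formalization: With the stated normalizations (f*g)^ = √(2π) f^ g^, so the displayed formula for √(RR* ) is off by a constant; it is proved with the factor (2π)^(-1/4) in front: √(RR* )f = (2π)^(-1/4) e^(-2πiλx)(f~*ω), for almost every (t,y). *)

theory Defs
  imports "HOL-Analysis.Analysis"
begin

text \<open>
  The index type \<open>'m\<close> has \<open>n - 1\<close> elements.  Coordinates of \<open>\<complex>\<^sup>n\<close> are indexed by
  \<open>'m option\<close>, where \<open>None\<close> is the index \<open>n\<close>; rows and columns of \<open>(n + 1) \<times> (n + 1)\<close> matrices are
  indexed by \<open>'m option option\<close>, where \<open>Some None\<close> is the index \<open>n\<close> and \<open>None\<close> is the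
  index \<open>n + 1\<close>.
\<close>


section \<open>Spaces with a positive semidefinite inner product\<close>

text \<open>
  Hilbert spaces of functions are represented by a carrier \<open>V\<close> of functions and an
  inner product \<open>ip\<close>, linear in the first argument; elements at distance zero are equal in the
  Hilbert space.
\<close>

definition ip_norm :: "(('a \<Rightarrow> complex) \<Rightarrow> ('a \<Rightarrow> complex) \<Rightarrow> complex) \<Rightarrow> ('a \<Rightarrow> complex) \<Rightarrow> real"
  where "ip_norm ip f = sqrt (Re (ip f f))"

definition ip_dist ::
  "(('a \<Rightarrow> complex) \<Rightarrow> ('a \<Rightarrow> complex) \<Rightarrow> complex) \<Rightarrow> ('a \<Rightarrow> complex) \<Rightarrow> ('a \<Rightarrow> complex) \<Rightarrow> real"
  where "ip_dist ip f g = ip_norm ip (\<lambda>x. f x - g x)"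

definition bounded_operator ::
  "('a \<Rightarrow> complex) set \<Rightarrow> (('a \<Rightarrow> complex) \<Rightarrow> ('a \<Rightarrow> complex) \<Rightarrow> complex) \<Rightarrow>
   ('b \<Rightarrow> complex) set \<Rightarrow> (('b \<Rightarrow> complex) \<Rightarrow> ('b \<Rightarrow> complex) \<Rightarrow> complex) \<Rightarrow>
   (('a \<Rightarrow> complex) \<Rightarrow> ('b \<Rightarrow> complex)) \<Rightarrow> bool"
  where "bounded_operator V ipV W ipW T \<longleftrightarrow>
    (\<forall>f\<in>V. T f \<in> W) \<and>
    (\<forall>f\<in>V. \<forall>g\<in>V. ip_dist ipW (T (\<lambda>x. f x + g x)) (\<lambda>y. T f y + T g y) = 0) \<and>
    (\<forall>f\<in>V. \<forall>c. ip_dist ipW (T (\<lambda>x. c * f x)) (\<lambda>y. c * T f y) = 0) \<and>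
    (\<exists>C. \<forall>f\<in>V. ip_norm ipW (T f) \<le> C * ip_norm ipV f)"

text \<open>
  Adjoint of the operator \<open>f \<mapsto> T f\<close> with domain \<open>{f \<in> V. T f \<in> W}\<close>, which need not be
  bounded a priori.
\<close>

definition hilbert_adjoint ::
  "('a \<Rightarrow> complex) set \<Rightarrow> (('a \<Rightarrow> complex) \<Rightarrow> ('a \<Rightarrow> complex) \<Rightarrow> complex) \<Rightarrow>
   ('b \<Rightarrow> complex) set \<Rightarrow> (('b \<Rightarrow> complex) \<Rightarrow> ('b \<Rightarrow> complex) \<Rightarrow> complex) \<Rightarrow>
   (('a \<Rightarrow> complex) \<Rightarrow> ('b \<Rightarrow> complex)) \<Rightarrow> ('b \<Rightarrow> complex) \<Rightarrow> ('a \<Rightarrow> complex)"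
  where "hilbert_adjoint V ipV W ipW T g =
    (SOME h. h \<in> V \<and> (\<forall>f\<in>V. T f \<in> W \<longrightarrow> ipW (T f) g = ipV f h))"

definition is_positive_sqrt ::
  "('a \<Rightarrow> complex) set \<Rightarrow> (('a \<Rightarrow> complex) \<Rightarrow> ('a \<Rightarrow> complex) \<Rightarrow> complex) \<Rightarrow>
   (('a \<Rightarrow> complex) \<Rightarrow> ('a \<Rightarrow> complex)) \<Rightarrow> (('a \<Rightarrow> complex) \<Rightarrow> ('a \<Rightarrow> complex)) \<Rightarrow> bool"
  where "is_positive_sqrt V ip A S \<longleftrightarrow>
    bounded_operator V ip V ip S \<and>
    (\<forall>f\<in>V. \<forall>g\<in>V. ip (S f) g = ip f (S g)) \<and>
    (\<forall>f\<in>V. 0 \<le> Re (ip (S f) f)) \<and>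
    (\<forall>f\<in>V. ip_dist ip (S (S f)) (A f) = 0)"

definition closure_of_range ::
  "('a \<Rightarrow> complex) set \<Rightarrow> (('a \<Rightarrow> complex) \<Rightarrow> ('a \<Rightarrow> complex) \<Rightarrow> complex) \<Rightarrow>
   (('a \<Rightarrow> complex) \<Rightarrow> ('a \<Rightarrow> complex)) \<Rightarrow> ('a \<Rightarrow> complex) set"
  where "closure_of_range V ip A = {f\<in>V. \<forall>e>0. \<exists>g\<in>V. ip_dist ip f (A g) < e}"

definition sq_integrable :: "'a measure \<Rightarrow> ('a \<Rightarrow> complex) \<Rightarrow> bool"
  where "sq_integrable M f \<longleftrightarrow> f \<in> borel_measurable M \<and> integrable M (\<lambda>x. (cmod (f x))\<^sup>2)"

definition L2_ip :: "'a measure \<Rightarrow> ('a \<Rightarrow> complex) \<Rightarrow> ('a \<Rightarrow> complex) \<Rightarrow> complex"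
  where "L2_ip M f g = (LINT x|M. f x * cnj (g x))"


section \<open>Weighted Bergman spaces on the unit ball\<close>

definition mv_holomorphic_on :: "(complex^'k::finite \<Rightarrow> complex) \<Rightarrow> (complex^'k) set \<Rightarrow> bool"
  where "mv_holomorphic_on f U \<longleftrightarrow>
    (\<forall>z\<in>U. \<exists>L. (f has_derivative L) (at z) \<and> (\<forall>c v. L (c *s v) = c * L v))"

definition ball_volume :: "(complex^'k::finite) measure"
  where "ball_volume = uniform_measure (restrict_space lborel (ball 0 1)) (ball 0 1)"

definition bergman_measure :: "real \<Rightarrow> (complex^'k::finite) measure"
  where "bergman_measure l =
    (let w = (\<lambda>z::complex^'k. (1 - (norm z)\<^sup>2) powr (l - real CARD('k) - 1))
     in density ball_volume (\<lambda>z. ennreal (w z / (LINT u|ball_volume. w u))))"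

definition bergman_space :: "real \<Rightarrow> (complex^'k::finite \<Rightarrow> complex) set"
  where "bergman_space l = {f. mv_holomorphic_on f (ball 0 1) \<and> sq_integrable (bergman_measure l) f}"

abbreviation bergman_ip ::
  "real \<Rightarrow> (complex^'k::finite \<Rightarrow> complex) \<Rightarrow> (complex^'k \<Rightarrow> complex) \<Rightarrow> complex"
  where "bergman_ip l \<equiv> L2_ip (bergman_measure l)"


section \<open>The quasi-parabolic group and its universal cover\<close>

definition moebius_action ::
  "complex^('k::finite option)^('k option) \<Rightarrow> complex^'k \<Rightarrow> complex^'k"
  where "moebius_action g z =
    (\<chi> i. ((\<Sum>j\<in>UNIV. g $ Some i $ Some j * z $ j) + g $ Some i $ None) /
          ((\<Sum>j\<in>UNIV. g $ None $ Some j * z $ j) + g $ None $ None))"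

definition torus :: "(complex^'m::finite) set"
  where "torus = {t. \<forall>i. cmod (t $ i) = 1}"

text \<open>Here \<open>CARD('m) + 2\<close> is \<open>n + 1\<close>.\<close>

definition P_cover :: "((complex^'m::finite) \<times> real \<times> real) set"
  where "P_cover = {(t, y, x). t \<in> torus \<and>
    exp (2 * complex_of_real pi * \<i> * of_nat (CARD('m) + 2) * complex_of_real x) *
      (\<Prod>i\<in>UNIV. t $ i) = 1}"

text \<open>The covering map onto \<open>P(n)\<close>.\<close>

definition P_matrix ::
  "(complex^'m::finite) \<times> real \<times> real \<Rightarrow> complex^('m option option)^('m option option)"
  where "P_matrix = (\<lambda>(t, y, x).
    let a = exp (2 * complex_of_real pi * \<i> * complex_of_real x);
        b = \<i> * complex_of_real y / 2
    in (\<chi> r c. case (r, c) of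
          (Some (Some i), Some (Some j)) \<Rightarrow> (if i = j then a * t $ i else 0)
        | (Some None, Some None) \<Rightarrow> a * (1 + b)
        | (Some None, None) \<Rightarrow> a * b
        | (None, Some None) \<Rightarrow> - (a * b)
        | (None, None) \<Rightarrow> a * (1 - b)
        | _ \<Rightarrow> 0))"

definition z0 :: "complex^('m::finite option)"
  where "z0 = (\<chi> i. case i of
     Some _ \<Rightarrow> complex_of_real (1 / sqrt (2 * real CARD('m))) | None \<Rightarrow> 0)"

definition torus_haar :: "(complex^'m::finite) measure"
  where "torus_haar = distr (uniform_measure lborel (cbox 0 1 :: (real^'m) set))
    (restrict_space borel torus) (\<lambda>\<theta>. \<chi> i. cis (2 * pi * \<theta> $ i))"

definition TR_measure :: "((complex^'m::finite) \<times> real) measure"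
  where "TR_measure = torus_haar \<Otimes>\<^sub>M lborel"

text \<open>
  The function \<open>\<lambda>(t, y). exp (2 \<pi> \<i> \<lambda> x) f (t, y, x)\<close>, which does not depend on the choice of
  \<open>x\<close> above \<open>(t, y)\<close> when \<open>f\<close> has the equivariance required in \<open>L2_chi\<close> below; its absolute
  value is that of \<open>f\<close>.
\<close>

definition untwist ::
  "real \<Rightarrow> ((complex^'m::finite) \<times> real \<times> real \<Rightarrow> complex) \<Rightarrow> (complex^'m) \<times> real \<Rightarrow> complex"
  where "untwist l f = (\<lambda>(t, y).
    let x = (SOME x. (t, y, x) \<in> P_cover)
    in exp (2 * complex_of_real pi * \<i> * complex_of_real l * complex_of_real x) * f (t, y, x))"

definition L2_chi :: "real \<Rightarrow> ((complex^'m::finite) \<times> real \<times> real \<Rightarrow> complex) set"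
  where "L2_chi l = {f. f \<in> borel_measurable (restrict_space borel P_cover) \<and>
    (\<forall>(t, y, x)\<in>P_cover. \<forall>m::int.
       f (t, y, x + real_of_int m / real (CARD('m) + 2)) =
       exp (- 2 * complex_of_real pi * \<i> * complex_of_real l * of_int m / of_nat (CARD('m) + 2))
         * f (t, y, x)) \<and>
    integrable TR_measure (\<lambda>p. (cmod (untwist l f p))\<^sup>2)}"

definition chi_ip ::
  "real \<Rightarrow> ((complex^'m::finite) \<times> real \<times> real \<Rightarrow> complex) \<Rightarrow>
   ((complex^'m) \<times> real \<times> real \<Rightarrow> complex) \<Rightarrow> complex"
  where "chi_ip l f g = L2_ip TR_measure (untwist l f) (untwist l g)"

definition D_fun :: "real \<Rightarrow> (complex^'m::finite) \<times> real \<times> real \<Rightarrow> complex"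
  where "D_fun l = (\<lambda>(t, y, x).
    exp (- 2 * complex_of_real pi * \<i> * complex_of_real l * complex_of_real x) *
    (1 - \<i> * complex_of_real y / 2) powr (- complex_of_real l))"

definition restriction_op ::
  "real \<Rightarrow> (complex^('m::finite option) \<Rightarrow> complex) \<Rightarrow> (complex^'m) \<times> real \<times> real \<Rightarrow> complex"
  where "restriction_op l f h = D_fun l h * f (moebius_action (P_matrix h) z0)"

definition restriction_adj ::
  "real \<Rightarrow> ((complex^'m::finite) \<times> real \<times> real \<Rightarrow> complex) \<Rightarrow> complex^('m option) \<Rightarrow> complex"
  where "restriction_adj l =
    hilbert_adjoint (bergman_space l) (bergman_ip l) (L2_chi l) (chi_ip l) (restriction_op l)"

definition RR_adj ::
  "real \<Rightarrow> ((complex^'m::finite) \<times> real \<times> real \<Rightarrow> complex) \<Rightarrow>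
   (complex^'m) \<times> real \<times> real \<Rightarrow> complex"
  where "RR_adj l f = restriction_op l (restriction_adj l f)"

definition phi :: "real \<Rightarrow> (complex^'m::finite) \<times> real \<Rightarrow> complex"
  where "phi l = (\<lambda>(t, y).
    (1 - \<i> * complex_of_real y / 2 - 1 / (2 * of_nat CARD('m)) * (\<Sum>i\<in>UNIV. t $ i))
      powr (- complex_of_real l))"


section \<open>Convolution and Fourier transform on \<open>T\<^sup>m \<times> \<real>\<close>\<close>

definition TR_mult ::
  "(complex^'m::finite) \<times> real \<Rightarrow> (complex^'m) \<times> real \<Rightarrow> (complex^'m) \<times> real"
  where "TR_mult p q = ((\<chi> i. fst p $ i * fst q $ i), snd p + snd q)"

definition TR_div ::
  "(complex^'m::finite) \<times> real \<Rightarrow> (complex^'m) \<times> real \<Rightarrow> (complex^'m) \<times> real"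
  where "TR_div p q = ((\<chi> i. fst p $ i / fst q $ i), snd p - snd q)"

definition TR_conv ::
  "((complex^'m::finite) \<times> real \<Rightarrow> complex) \<Rightarrow> ((complex^'m) \<times> real \<Rightarrow> complex) \<Rightarrow>
   (complex^'m) \<times> real \<Rightarrow> complex"
  where "TR_conv f g p = (LINT q|TR_measure. f q * g (TR_div p q))"

definition dual_measure :: "((int^'m::finite) \<times> real) measure"
  where "dual_measure = count_space UNIV \<Otimes>\<^sub>M lborel"

definition fourier ::
  "((complex^'m::finite) \<times> real \<Rightarrow> complex) \<Rightarrow> (int^'m) \<times> real \<Rightarrow> complex"
  where "fourier g = (\<lambda>(\<alpha>, \<xi>). 1 / complex_of_real (sqrt (2 * pi)) *
    (LINT (t, y)|TR_measure. g (t, y) * cnj (\<Prod>i\<in>UNIV. t $ i powi \<alpha> $ i) *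
       exp (- \<i> * complex_of_real y * complex_of_real \<xi>)))"

text \<open>Extension to \<open>L\<^sup>2\<close> by continuity (Plancherel); it is determined almost everywhere.\<close>

definition is_fourier_L2 ::
  "((complex^'m::finite) \<times> real \<Rightarrow> complex) \<Rightarrow> ((int^'m) \<times> real \<Rightarrow> complex) \<Rightarrow> bool"
  where "is_fourier_L2 g G \<longleftrightarrow>
    sq_integrable TR_measure g \<and> sq_integrable dual_measure G \<and>
    (\<exists>s::nat \<Rightarrow> (complex^'m) \<times> real \<Rightarrow> complex.
       (\<forall>k. integrable TR_measure (s k) \<and> sq_integrable TR_measure (s k) \<and>
            sq_integrable dual_measure (fourier (s k))) \<and>
       (\<lambda>k. LINT p|TR_measure. (cmod (s k p - g p))\<^sup>2) \<longlonglongrightarrow> 0 \<and>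
       (\<lambda>k. LINT q|dual_measure. (cmod (fourier (s k) q - G q))\<^sup>2) \<longlonglongrightarrow> 0)"

definition fourier_L2 ::
  "((complex^'m::finite) \<times> real \<Rightarrow> complex) \<Rightarrow> (int^'m) \<times> real \<Rightarrow> complex"
  where "fourier_L2 g = (SOME G. is_fourier_L2 g G)"

definition B_space :: "real \<Rightarrow> ((complex^'m::finite) \<times> real \<times> real \<Rightarrow> complex) set"
  where "B_space l = {f \<in> L2_chi l. AE q in dual_measure.
    fourier (phi l :: (complex^'m) \<times> real \<Rightarrow> complex) q = 0 \<longrightarrow> fourier_L2 (untwist l f) q = 0}"


section \<open>Tempered distributions on \<open>T\<^sup>m \<times> \<real>\<close>\<close>

text \<open>
  Smoothness is expressed by the translation-invariant vector fields \<open>\<partial>/\<partial>\<theta>\<^sub>i\<close>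
  (with \<open>t\<^sub>i = e\<^bsup>\<i>\<theta>\<^sub>i\<^esup>\<close>; direction \<open>Some i\<close>) and \<open>\<partial>/\<partial>y\<close> (direction \<open>None\<close>).
\<close>

fun TR_flow ::
  "'m::finite option \<Rightarrow> real \<Rightarrow> (complex^'m) \<times> real \<Rightarrow> (complex^'m) \<times> real"
  where
    "TR_flow (Some i) s (t, y) = ((\<chi> j. if j = i then t $ j * cis s else t $ j), y)"
  | "TR_flow None s (t, y) = (t, y + s)"

definition TR_partial ::
  "'m::finite option \<Rightarrow> ((complex^'m) \<times> real \<Rightarrow> complex) \<Rightarrow> (complex^'m) \<times> real \<Rightarrow> complex"
  where "TR_partial d f p = vector_derivative (\<lambda>s. f (TR_flow d s p)) (at 0)"

definition TR_partials ::
  "'m::finite option list \<Rightarrow> ((complex^'m) \<times> real \<Rightarrow> complex) \<Rightarrow> (complex^'m) \<times> real \<Rightarrow> complex"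
  where "TR_partials ds f = foldr TR_partial ds f"

definition TR_smooth :: "((complex^'m::finite) \<times> real \<Rightarrow> complex) \<Rightarrow> bool"
  where "TR_smooth f \<longleftrightarrow>
    (\<forall>ds. continuous_on (torus \<times> UNIV) (TR_partials ds f) \<and>
       (\<forall>d. \<forall>p\<in>torus \<times> UNIV. (\<lambda>s. TR_partials ds f (TR_flow d s p)) differentiable (at 0)))"

definition schwartz_space :: "((complex^'m::finite) \<times> real \<Rightarrow> complex) set"
  where "schwartz_space = {f. TR_smooth f \<and>
    (\<forall>k ds. bounded ((\<lambda>p. complex_of_real (snd p) ^ k * TR_partials ds f p) ` (torus \<times> UNIV)))}"

definition schwartz_seminorm ::
  "nat \<times> 'm::finite option list \<Rightarrow> ((complex^'m) \<times> real \<Rightarrow> complex) \<Rightarrow> real"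
  where "schwartz_seminorm = (\<lambda>(k, ds) f.
    (SUP p\<in>torus \<times> UNIV. \<bar>snd p\<bar> ^ k * cmod (TR_partials ds f p)))"

definition tempered_distribution ::
  "(((complex^'m::finite) \<times> real \<Rightarrow> complex) \<Rightarrow> complex) \<Rightarrow> bool"
  where "tempered_distribution u \<longleftrightarrow>
    (\<forall>f\<in>schwartz_space. \<forall>g\<in>schwartz_space. u (\<lambda>p. f p + g p) = u f + u g) \<and>
    (\<forall>f\<in>schwartz_space. \<forall>c. u (\<lambda>p. c * f p) = c * u f) \<and>
    (\<exists>C. \<exists>K. finite K \<and> (\<forall>f\<in>schwartz_space. cmod (u f) \<le> C * (\<Sum>\<kappa>\<in>K. schwartz_seminorm \<kappa> f)))"

text \<open>
  The Fourier transform of the distribution \<open>u\<close> is the function \<open>G\<close>.  For \<open>u = g \<in> L\<^sup>1\<close> the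
  equation is Parseval's formula \<open>\<integral>g f = \<Sum>\<^sub>\<alpha> \<integral>fourier g (\<alpha>, \<xi>) fourier f (-\<alpha>, -\<xi>) d\<xi>\<close>, with
  the normalisation of \<open>fourier\<close>.
\<close>

definition distribution_fourier ::
  "(((complex^'m::finite) \<times> real \<Rightarrow> complex) \<Rightarrow> complex) \<Rightarrow> ((int^'m) \<times> real \<Rightarrow> complex) \<Rightarrow> bool"
  where "distribution_fourier u G \<longleftrightarrow>
    (\<forall>f\<in>schwartz_space.
       integrable dual_measure (\<lambda>(\<alpha>, \<xi>). G (\<alpha>, \<xi>) * fourier f (- \<alpha>, - \<xi>)) \<and>
       u f = (LINT (\<alpha>, \<xi>)|dual_measure. G (\<alpha>, \<xi>) * fourier f (- \<alpha>, - \<xi>)))"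

text \<open>
  The convolution of \<open>f\<close> with the distribution \<open>u\<close> exists and is the \<open>L\<^sup>2\<close> function \<open>g\<close>:
  \<open>(f * u)(\<psi>) = \<integral>f(p) u(q \<mapsto> \<psi>(q p)) dp\<close> for all test functions \<open>\<psi>\<close>.
  Convolution uses \<open>dt dy\<close> without the factor \<open>1 / sqrt (2 \<pi>)\<close> of \<open>fourier\<close>, so the Fourier
  transform of \<open>f * u\<close> is \<open>sqrt (2 \<pi>)\<close> times the product of the transforms.  Hence if the
  transform of \<open>\<omega>\<close> is the square root of that of \<open>\<phi>\<close>, then the positive square root of
  \<open>f \<mapsto> f * \<phi>\<close> is \<open>f \<mapsto> (2 \<pi>) powr (- 1/4) (f * \<omega>)\<close>.
\<close>

definition is_distribution_conv ::
  "((complex^'m::finite) \<times> real \<Rightarrow> complex) \<Rightarrow> (((complex^'m) \<times> real \<Rightarrow> complex) \<Rightarrow> complex) \<Rightarrow>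
   ((complex^'m) \<times> real \<Rightarrow> complex) \<Rightarrow> bool"
  where "is_distribution_conv f u g \<longleftrightarrow>
    sq_integrable TR_measure g \<and>
    (\<forall>\<psi>\<in>schwartz_space.
       integrable TR_measure (\<lambda>p. f p * u (\<lambda>q. \<psi> (TR_mult q p))) \<and>
       (LINT p|TR_measure. f p * u (\<lambda>q. \<psi> (TR_mult q p))) = (LINT p|TR_measure. g p * \<psi> p))"

end

(*
  The kernel of R R^* is bkernel (orbit q) (orbit p) weighted by the two automorphy factors, and
  this depends on p q^-1 only: it is phi. On functions g supported in |y| <= N everything converges
  absolutely and |R^* g|^2 = <g * phi, g> <= |phi|_1 |g|^2; boundedness of R^* and of R follows by
  monotone limits, and the reproducing kernels identify R^* pointwise.

  The transform of phi is found backwards: summing the claimed formula over alpha gives an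
  exponential and then a Gamma integral, so its inverse transform is phi, and injectivity of the
  Fourier transform together with continuity in xi gives equality everywhere.

  Plancherel is obtained from the Gram matrices of the functions t^alpha exp(c y - y^2/2) and of
  their transforms, which agree; both families are total. Under Plancherel R R^* is multiplication
  by a bounded symbol a >= 0. A positive square root commutes with R R^*, hence with all limits of
  polynomials in a, in particular with multiplication by sqrt a; therefore it is this multiplication.

  The reproducing property on the ball needs no integration over spheres: weighted ball integrals of
  homogeneous functions are Gaussian integrals up to a Gamma factor, and this transfers the
  reproducing property of the Fock space degree by degree.
*)

theory Submission
  imports Defs "HOL-Probability.Probability" "HOL-Complex_Analysis.Complex_Analysis"
begin

text \<open>Vectors are functions rather than classes, and operators are determined only up to null
  functions. Hence equality of vectors is distance zero, the transform on L^2 enters as the relation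
  \<open>Plancherel.pair\<close>, and an operator is described by the symbol shared by all its
  representatives.

  The obstacle to boundedness is that the orbit runs into the unit sphere as y grows, so it is not
  visible directly that R f is square integrable or that the adjoint integral lands in the Bergman
  space. Over |y| \<le> N the orbit stays in a compact part of the ball. The bound becomes
  independent of N because it is read off from the symbol of convolution with phi, whose supremum is
  at most the L^1 norm of phi.

  \<open>hilbert_adjoint\<close> merely chooses some function with the adjoint property, so its
  values have to be recovered from that property.

  The powers of 2 pi are a matter of normalisation: \<open>fourier\<close> carries 1 / sqrt (2 pi),
  convolution does not, so the symbol of R R^* is sqrt (2 pi) times \<open>Phi\<close> and its root
  carries (2 pi) powr (1/4).\<close>

no_notation fps_nth (infixl "$" 75)

type_synonym 'm TR = "(complex^'m) \<times> real"
type_synonym 'm cov = "(complex^'m) \<times> real \<times> real"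
type_synonym 'm DR = "(int^'m) \<times> real"

abbreviation (input) cor :: "real => complex" where "cor == complex_of_real"
abbreviation (input) bmeas :: "'a measure => ('a => 'b::topological_space) set" where "bmeas M == borel_measurable M"
abbreviation (input) TRm :: "'m::finite TR measure" where "TRm == TR_measure"
abbreviation (input) DRm :: "'m::finite DR measure" where "DRm == dual_measure"
abbreviation (input) TR2 :: "('m::finite TR => complex) => bool" where "TR2 == sq_integrable TR_measure"
abbreviation (input) DR2 :: "('m::finite DR => complex) => bool" where "DR2 == sq_integrable dual_measure"
abbreviation (input) TR_nrm :: "('m::finite TR => complex) => real" where "TR_nrm == ip_norm (L2_ip TR_measure)"
abbreviation (input) chi_d :: "real => ('m::finite cov => complex) => ('m cov => complex) => real" where "chi_d l == ip_dist (chi_ip l)"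

abbreviation (input) seq_lim ("((_)/ ----> (_))" [60, 60] 60) where "X ----> L == X \<longlonglongrightarrow> L"

lemmas LINT_cong = Bochner_Integration.integral_cong
lemmas LINT_bound = Bochner_Integration.integrable_bound
lemmas LINT_cnj = Bochner_Integration.integral_cnj
lemmas LINT_mult_right = Bochner_Integration.integral_mult_right_zero

section \<open>Semi-inner product spaces of functions\<close>

text \<open>The form is only semidefinite, because functions agreeing almost everywhere are kept
  distinct; a vector of norm zero need not vanish.\<close>

locale ip_space =
 fixes V :: "('a => complex) set" and ip :: "('a => complex) => ('a => complex) => complex"
 assumes zero: "(%x. 0) \<in> V"
  and add: "f \<in> V ==> g \<in> V ==> (%x. f x + g x) \<in> V"
  and scale: "f \<in> V ==> (%x. c * f x) \<in> V"
  and ip_add: "f \<in> V ==> g \<in> V ==> h \<in> V ==> ip (%x. f x + g x) h = ip f h + ip g h"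
  and ip_scale: "f \<in> V ==> h \<in> V ==> ip (%x. c * f x) h = c * ip f h"
  and ip_cnj: "f \<in> V ==> g \<in> V ==> ip g f = cnj (ip f g)"
  and ip_pos: "f \<in> V ==> 0 <= Re (ip f f)"
begin

lemma diff: "f \<in> V ==> g \<in> V ==> (%x. f x - g x) \<in> V"
 using add[of f "%x. - 1 * g x"] scale[of g "-1"] by simp

lemma ip_add2: "f \<in> V ==> g \<in> V ==> h \<in> V ==> ip h (%x. f x + g x) = ip h f + ip h g"
 using ip_cnj[of "%x. f x + g x" h] ip_cnj[of f h] ip_cnj[of g h] by(simp add:add ip_add)

lemma ip_scale2: "f \<in> V ==> h \<in> V ==> ip h (%x. c * f x) = cnj c * ip h f"
 using ip_cnj[of "%x. c * f x" h] ip_cnj[of f h] by(simp add:scale ip_scale)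

lemma ip_diff: "f \<in> V ==> g \<in> V ==> h \<in> V ==> ip (%x. f x - g x) h = ip f h - ip g h"
 using ip_add[of f "%x. - 1 * g x" h] scale[of g "-1"] ip_scale[of g h "-1"] by simp

lemma ip_diff2: "f \<in> V ==> g \<in> V ==> h \<in> V ==> ip h (%x. f x - g x) = ip h f - ip h g"
 using ip_cnj[of "%x. f x - g x" h] ip_cnj[of f h] ip_cnj[of g h] by(simp add:diff ip_diff)

lemma nrm_sq: "f \<in> V ==> (ip_norm ip f)\<^sup>2 = Re (ip f f)"
 by(simp add:ip_norm_def ip_pos)

lemma ip_self: "f \<in> V ==> ip f f = cor ((ip_norm ip f)^2)"
proof -
 assume f: "f \<in> V"
 have "Im (ip f f) = 0" using ip_cnj[OF f f] by(metis Reals_cnj_iff complex_is_Real_iff)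
 thus ?thesis using nrm_sq[OF f] by(simp add:complex_eq_iff)
qed

lemma nrm_nonneg: "f \<in> V ==> 0 <= ip_norm ip f"
 by(simp add:ip_norm_def ip_pos)

lemma nrm_scale: "f \<in> V ==> ip_norm ip (%x. c * f x) = cmod c * ip_norm ip f"
proof -
 assume f: "f \<in> V"
 have "ip (%x. c * f x) (%x. c * f x) = c * cnj c * ip f f"
  using f by(simp add:ip_scale ip_scale2 scale)
 also have "... = cor ((cmod c)^2 * (ip_norm ip f)^2)"
  by(simp only:complex_norm_square[symmetric] ip_self[OF f] of_real_mult)
 finally show ?thesis unfolding ip_norm_def[of ip "%x. c * f x"]
  by(simp add:real_sqrt_mult nrm_nonneg[OF f])
qed

lemma nrm_diff_sq: "f \<in> V ==> g \<in> V ==>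
 (ip_norm ip (%x. f x - g x))\<^sup>2 = (ip_norm ip f)^2 - 2 * Re (ip f g) + (ip_norm ip g)^2"
 using ip_cnj[of f g] by(simp add:nrm_sq diff ip_diff ip_diff2)

lemma nrm_add_sq: "f \<in> V ==> g \<in> V ==>
 (ip_norm ip (%x. f x + g x))\<^sup>2 = (ip_norm ip f)^2 + 2 * Re (ip f g) + (ip_norm ip g)^2"
 using ip_cnj[of f g] by(simp add:nrm_sq add ip_add ip_add2)

text \<open>The squared norm of f - s <f,g> g is a nonnegative quadratic polynomial in s. A null g
  cannot be replaced by 0, hence the case split on its norm.\<close>

lemma Cauchy_Schwarz:
 assumes f: "f \<in> V" and g: "g \<in> V"
 shows "cmod (ip f g) <= ip_norm ip f * ip_norm ip g"
proof -
 define a where "a = ip f g"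
 define F G where "F = ip_norm ip f" and "G = ip_norm ip g"
 have FG: "0 <= F" "0 <= G" using f g by(simp_all add: F_def G_def nrm_nonneg)
 have key: "0 <= F\<^sup>2 - 2 * s * (cmod a)^2 + s\<^sup>2 * (cmod a)^2 * G\<^sup>2" for s :: real
 proof -
  have "0 <= (ip_norm ip (%x. f x - (s * a) * g x))^2" by simp
  also have "... = F\<^sup>2 - 2 * Re (ip f (%x. (s * a) * g x)) + (ip_norm ip (%x. (s * a) * g x))^2"
   using f g by(simp add:nrm_diff_sq scale F_def)
  also have "ip f (%x. (s * a) * g x) = cor (s * (cmod a)^2)"
   using ip_scale2[OF g f, of "s * a"] complex_norm_square[of a]
   by(simp add:a_def[symmetric] mult_ac)
  also have "ip_norm ip (%x. (s * a) * g x) = \<bar>s\<bar> * cmod a * G"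
   using nrm_scale[OF g, of "s * a"] by(simp add:G_def norm_mult)
  finally show ?thesis by(simp add:power_mult_distrib mult_ac)
 qed
 show ?thesis
 proof (cases "G = 0")
  case True
  have "cmod a = 0"
  proof (rule ccontr)
   assume "cmod a ~= 0"
   hence a: "(cmod a)^2 ~= 0" by simp
   \<comment> \<open>For a null g the polynomial is affine in s, and at this value of s it equals
     -F^2 - 2.\<close>
   have "0 <= F\<^sup>2 - 2 * ((F\<^sup>2 + 1) / (cmod a)^2) * (cmod a)^2"
    using key[of "(F\<^sup>2 + 1) / (cmod a)^2"] True by simp
   also have "2 * ((F\<^sup>2 + 1) / (cmod a)^2) * (cmod a)^2 = 2 * (F\<^sup>2 + 1)" using a by simp
   finally have "F\<^sup>2 + 2 <= 0" by simp
   thus False using zero_le_power2[of F] by linarith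
  qed
  thus ?thesis using FG by(simp add:a_def F_def G_def)
 next
  case False
  hence "0 <= F\<^sup>2 - (cmod a)\<^sup>2 / G\<^sup>2"
   using key[of "1 / G\<^sup>2"] by(simp add:power2_eq_square field_simps)
  hence "(cmod a)^2 <= (F * G)^2" using False FG
   by(simp add:field_simps power_mult_distrib)
  thus ?thesis using FG by(simp add:a_def F_def G_def abs_le_square_iff[symmetric])
 qed
qed

lemma triangle:
 assumes f: "f \<in> V" and g: "g \<in> V"
 shows "ip_norm ip (%x. f x + g x) <= ip_norm ip f + ip_norm ip g"
proof (rule power2_le_imp_le)
 have "Re (ip f g) <= ip_norm ip f * ip_norm ip g"
  using Cauchy_Schwarz[OF f g] complex_Re_le_cmod order_trans by blast
 thus "(ip_norm ip (%x. f x + g x))^2 <= (ip_norm ip f + ip_norm ip g)^2"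
  by(simp add:nrm_add_sq[OF f g] power2_sum)
qed (use f g nrm_nonneg in auto)

lemma dist_nonneg: "f \<in> V ==> g \<in> V ==> 0 <= ip_dist ip f g"
 by(simp add:ip_dist_def nrm_nonneg diff)

lemma dist_commute: "f \<in> V ==> g \<in> V ==> ip_dist ip f g = ip_dist ip g f"
 using nrm_scale[OF diff, of f g "-1"] by(simp add:ip_dist_def)

lemma dist_triangle: "f \<in> V ==> g \<in> V ==> h \<in> V ==> ip_dist ip f h <= ip_dist ip f g + ip_dist ip g h"
 using triangle[OF diff diff, of f g g h] by(simp add:ip_dist_def)

lemma nrm_zero: "ip_norm ip (%x. 0) = 0"
 using nrm_scale[OF zero, of 0] by simp

lemma dist_self: "ip_dist ip f f = 0"
 by(simp add:ip_dist_def nrm_zero)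

lemma nrm_zero_ip: "f \<in> V ==> g \<in> V ==> ip_norm ip f = 0 ==> ip f g = 0"
 using Cauchy_Schwarz[of f g] by simp

lemma nrm_le_dist: "f \<in> V ==> g \<in> V ==> ip_norm ip f <= ip_norm ip g + ip_dist ip f g"
 using triangle[OF diff, of f g g] by(simp add:ip_dist_def)

lemma nrm_cong_dist: "f \<in> V ==> g \<in> V ==> ip_dist ip f g = 0 ==> ip_norm ip f = ip_norm ip g"
 using nrm_le_dist[of f g] nrm_le_dist[of g f] dist_commute[of f g] by simp

lemma dist_zero_ip: "f \<in> V ==> g \<in> V ==> h \<in> V ==> ip_dist ip f g = 0 ==> ip f h = ip g h"
 using nrm_zero_ip[OF diff, of f g h] by(simp add:ip_dist_def ip_diff)

lemma ip_tendsto: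
 assumes s: "!!k. s k \<in> V" and g: "g \<in> V" and h: "h \<in> V"
  and lim: "(%k. ip_dist ip (s k) g) ----> 0"
 shows "(%k. ip (s k) h) ----> ip g h"
proof -
 have le: "norm (ip (s k) h - ip g h) <= ip_dist ip (s k) g * ip_norm ip h" for k
  using Cauchy_Schwarz[OF diff[OF s g] h] by(simp add:ip_diff s g h ip_dist_def)
 have "(%k. ip_dist ip (s k) g * ip_norm ip h) ----> 0"
  using tendsto_mult_right[OF lim] by simp
 from this have "(%k. ip (s k) h - ip g h) ----> 0"
  by(rule Lim_null_comparison[OF always_eventually[OF allI[OF le]]])
 thus ?thesis using LIM_zero_iff by blast
qed

lemma nrm_tendsto:
 assumes s: "!!k. s k \<in> V" and g: "g \<in> V"
  and lim: "(%k. ip_dist ip (s k) g) ----> 0"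
 shows "(%k. ip_norm ip (s k)) ----> ip_norm ip g"
proof -
 have le: "norm (ip_norm ip (s k) - ip_norm ip g) <= ip_dist ip (s k) g" for k
  using nrm_le_dist[OF s g, of k] nrm_le_dist[OF g s, of k] dist_commute[OF s g, of k] by auto
 have "(%k. ip_norm ip (s k) - ip_norm ip g) ----> 0"
  by(rule Lim_null_comparison[OF always_eventually[OF allI[OF le]] lim])
 thus ?thesis using LIM_zero_iff by blast
qed

text \<open>Additivity and homogeneity hold only at distance zero, so subtraction goes through f +
  (-1) g and two null distances are chained.\<close>

lemma bounded_operator_diff:
 assumes W: "ip_space W ipW" and T: "bounded_operator V ip W ipW T"
  and f: "f \<in> V" and g: "g \<in> V"
 shows "ip_dist ipW (T (%x. f x - g x)) (%y. T f y - T g y) = 0"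
proof -
 interpret W: ip_space W ipW by fact
 define ng where "ng = (%x. - 1 * g x)"
 have ng: "ng \<in> V" using scale[OF g, of "-1"] by(simp add:ng_def)
 have TV: "T h \<in> W" if "h \<in> V" for h using T that by(simp add:bounded_operator_def)
 have Tadd: "ip_dist ipW (T (%x. f x + ng x)) (%y. T f y + T ng y) = 0"
  using T f ng by(simp add:bounded_operator_def)
 have Tscale: "ip_dist ipW (T ng) (%y. - 1 * T g y) = 0"
  using T g unfolding bounded_operator_def ng_def by blast
 define mg where "mg = (%y. - 1 * T g y)"
 have mg: "mg \<in> W" using W.scale[OF TV[OF g], of "-1"] by(simp add:mg_def)
 have e1: "(%x. f x + ng x) = (%x. f x - g x)" by(simp add:ng_def)
 have e2: "(%y. T f y - T g y) = (%y. T f y + mg y)" by(simp add:mg_def)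
 have "ip_dist ipW (%y. T f y + T ng y) (%y. T f y + mg y) = ip_dist ipW (T ng) mg"
  by(simp add:ip_dist_def)
 moreover have "ip_dist ipW (T (%x. f x - g x)) (%y. T f y + mg y) <=
   ip_dist ipW (T (%x. f x - g x)) (%y. T f y + T ng y) +
   ip_dist ipW (%y. T f y + T ng y) (%y. T f y + mg y)"
  using diff[OF f g] f ng mg by(intro W.dist_triangle W.add TV)
 moreover have "0 <= ip_dist ipW (T (%x. f x - g x)) (%y. T f y + mg y)"
  using diff[OF f g] f mg by(intro W.dist_nonneg W.add TV)
 ultimately show ?thesis using Tadd Tscale unfolding e1 e2 by(simp add:mg_def)
qed

lemma bounded_operator_dist:
 assumes W: "ip_space W ipW" and T: "bounded_operator V ip W ipW T"
  and C: "!!f. f \<in> V ==> ip_norm ipW (T f) <= C * ip_norm ip f"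
  and f: "f \<in> V" and g: "g \<in> V"
 shows "ip_dist ipW (T f) (T g) <= C * ip_dist ip f g"
proof -
 interpret W: ip_space W ipW by fact
 have TV: "T h \<in> W" if "h \<in> V" for h using T that by(simp add:bounded_operator_def)
 have "ip_norm ipW (T (%x. f x - g x)) = ip_norm ipW (%y. T f y - T g y)"
  using bounded_operator_diff[OF W T f g] f g by(intro W.nrm_cong_dist TV W.diff diff)
 thus ?thesis using C[OF diff[OF f g]] by(simp add:ip_dist_def)
qed


text \<open>The projection argument: a sequence in S minimising the distance to g converges to some
  v, the error g - v is orthogonal to S, and totality makes it null. The same sequence therefore
  converges to g.\<close>

lemma total_imp_dense:
 assumes complete: "!!s. (!!k. s k \<in> V) ==>
   (!!e. 0 < e ==> \<exists>N. \<forall>i\<ge>N. \<forall>j\<ge>N. ip_dist ip (s i) (s j) < e) ==>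
   \<exists>g\<in>V. (%k. ip_dist ip (s k) g) ----> 0"
  and S: "S \<subseteq> V" "(%x. 0) \<in> S"
  and S_add: "!!f g. f \<in> S ==> g \<in> S ==> (%x. f x + g x) \<in> S"
  and S_scale: "!!f c. f \<in> S ==> (%x. c * f x) \<in> S"
  and total: "!!f. f \<in> V ==> (!!s. s \<in> S ==> ip f s = 0) ==> ip_norm ip f = 0"
  and g: "g \<in> V"
 shows "\<exists>s. (\<forall>k::nat. s k \<in> S) \<and> (%k. ip_dist ip (s k) g) ----> 0"
proof -
 define q where "q = (%s. (ip_norm ip (%x. g x - s x))^2)"
 define \<delta> where "\<delta> = Inf (q ` S)"
 have bdd: "bdd_below (q ` S)" by(rule bdd_belowI[of _ 0]) (auto simp:q_def)
 have lower: "\<delta> <= q s" if "s \<in> S" for s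
  unfolding \<delta>_def using bdd that by(intro cInf_lower) auto
 have "\<exists>s\<in>S. q s < \<delta> + 1 / real (Suc k)" for k
  using cInf_lessD[of "q ` S" "\<delta> + 1 / real (Suc k)"] S(2) by(auto simp:\<delta>_def)
 then obtain s where s: "!!k. s k \<in> S" and sq: "!!k. q (s k) < \<delta> + 1 / real (Suc k)" by metis
 have sV: "s k \<in> V" for k using s S by auto
 \<comment> \<open>Parallelogram law: the midpoint of \<open>s i\<close> and \<open>s j\<close> lies
   in S, so its squared distance to g is at least \<delta>, which forces \<open>s i\<close> and
   \<open>s j\<close> together.\<close>
 have par: "(ip_dist ip (s i) (s j))^2 <= 2 / real (Suc i) + 2 / real (Suc j)" for i j
 proof -
  let ?a = "%x. g x - s i x" and ?b = "%x. g x - s j x"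
  have ab: "?a \<in> V" "?b \<in> V" by(simp_all add: diff g sV)
  have m: "(%x. (1/2) * (s i x + s j x)) \<in> S" by(intro S_scale S_add s)
  have "(%x. ?b x - ?a x) = (%x. s i x - s j x)" by auto
  hence "(ip_dist ip (s i) (s j))^2 = (ip_norm ip ?b)^2 - 2 * Re (ip ?b ?a) + (ip_norm ip ?a)^2"
   using nrm_diff_sq[OF ab(2,1)] by(simp add:ip_dist_def)
  moreover have "(%x. ?b x + ?a x) = (%x. 2 * (g x - (1/2) * (s i x + s j x)))"
   by(simp add:algebra_simps)
  hence "(2 * ip_norm ip (%x. g x - (1/2) * (s i x + s j x)))^2 =
    (ip_norm ip ?b)\<^sup>2 + 2 * Re (ip ?b ?a) + (ip_norm ip ?a)^2"
   using nrm_add_sq[OF ab(2,1)] nrm_scale[OF diff[OF g], of "%x. (1/2) * (s i x + s j x)" 2] m S(1)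
   by auto
  moreover have "\<delta> <= (ip_norm ip (%x. g x - (1/2) * (s i x + s j x)))^2"
   using lower[OF m] by(simp add:q_def)
  moreover have "(ip_norm ip ?a)^2 < \<delta> + 1 / real (Suc i)" "(ip_norm ip ?b)^2 < \<delta> + 1 / real (Suc j)"
   using sq by(simp_all add: q_def)
  ultimately show ?thesis by(simp add:power_mult_distrib)
 qed
 have "\<exists>N. \<forall>i\<ge>N. \<forall>j\<ge>N. ip_dist ip (s i) (s j) < e" if e: "0 < e" for e
 proof -
  obtain N where N: "4 / e\<^sup>2 < real N" using reals_Archimedean2 by blast
  have "ip_dist ip (s i) (s j) < e" if "i >= N" "j >= N" for i j
  proof -
   have N0: "0 < real N" using N e by(smt (verit) zero_less_divide_iff zero_less_power)
   have "2 / real (Suc i) <= 2 / real N" "2 / real (Suc j) <= 2 / real N"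
    using that N0 by(intro divide_left_mono; simp)+
   hence "(ip_dist ip (s i) (s j))^2 <= 4 / real N" using par[of i j] by simp
   also have "... < e\<^sup>2" using N N0 e by(simp add:field_simps)
   finally show ?thesis using e by(simp add:power2_less_imp_less)
  qed
  thus ?thesis by blast
 qed
 then obtain v where v: "v \<in> V" and lim: "(%k. ip_dist ip (s k) v) ----> 0"
  using complete[of s] sV by blast
 let ?w = "%x. g x - v x"
 have w: "?w \<in> V" by(simp add:diff g v)
 have lim2: "(%k. ip_norm ip (%x. (g x - s k x) - u x)) ----> ip_norm ip (%x. ?w x - u x)"
  if u: "u \<in> V" for u
 proof (rule nrm_tendsto)
  have "ip_dist ip (%x. (g x - s k x) - u x) (%x. ?w x - u x) = ip_dist ip v (s k)" for k
   by(simp add:ip_dist_def algebra_simps)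
  thus "(%k. ip_dist ip (%x. (g x - s k x) - u x) (%x. ?w x - u x)) ----> 0"
   using lim by(simp add:dist_commute[OF v sV])
 qed (simp_all add: diff g sV v u)
 have "(%k. q (s k)) ----> (ip_norm ip ?w)\<^sup>2"
  using tendsto_power[OF lim2[OF zero], of 2] by(simp add:q_def)
 moreover have "(%k. \<delta> + 1 / real (Suc k)) ----> \<delta> + 0"
  by(intro tendsto_intros LIMSEQ_Suc[OF lim_1_over_n])
 ultimately have wd: "(ip_norm ip ?w)^2 <= \<delta>"
  using sq by(intro LIMSEQ_le[of "%k. q (s k)"]) (auto intro:less_imp_le)
 have orth: "ip ?w u = 0" if u: "u \<in> S" for u
 proof -
  have uV: "u \<in> V" using u S by auto
  define a N where "a = ip ?w u" and "N = (ip_norm ip u)^2"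
  \<comment> \<open>The optimal coefficient would be 1 / N; adding 1 covers a null u and still gives
    t N \<le> 1.\<close>
  define t where "t = 1 / (N + 1)"
  define c where "c = cor t * a"
  have N: "0 <= N" by(simp add:N_def)
  hence t: "0 < t" "t * N <= 1" by(simp_all add: t_def)
  have cu: "(%x. c * u x) \<in> V" by(simp add:scale uV)
  have "\<delta> <= (ip_norm ip (%x. (g x - s k x) - c * u x))^2" for k
   using lower[OF S_add[OF s S_scale[OF u, of c]], of k] by(simp add:q_def diff_diff_eq)
  hence "\<delta> <= (ip_norm ip (%x. ?w x - c * u x))^2"
   by(intro LIMSEQ_le_const[OF tendsto_power[OF lim2[OF cu], of 2]]) auto
  also have "... = (ip_norm ip ?w)^2 - 2 * Re (ip ?w (%x. c * u x)) + (ip_norm ip (%x. c * u x))^2"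
   by(rule nrm_diff_sq[OF w cu])
  also have "ip ?w (%x. c * u x) = cor (t * (cmod a)^2)"
   unfolding ip_scale2[OF uV w] a_def[symmetric]
   using complex_norm_square[of a] by(simp add:c_def mult_ac)
  also have "(ip_norm ip (%x. c * u x))^2 = t * (cmod a)^2 * (t * N)"
   by(simp add:nrm_scale[OF uV] c_def N_def norm_mult power_mult_distrib power2_eq_square)
  finally have "2 * (t * (cmod a)^2) <= t * (cmod a)^2 * (t * N)" using wd by simp
  also have "... <= t * (cmod a)^2 * 1" using t by(intro mult_left_mono) auto
  finally have "t * (cmod a)^2 <= 0" by simp
  thus ?thesis using t by(simp add:mult_le_0_iff a_def)
 qed
 have "ip_dist ip v g = 0" using total[OF w orth] dist_commute[OF v g] by(simp add:ip_dist_def)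
 hence "ip_dist ip (s k) g <= ip_dist ip (s k) v" for k
  using dist_triangle[OF sV[of k] v g] by simp
 hence "(%k. ip_dist ip (s k) g) ----> 0"
  using dist_nonneg[OF sV g] by(intro tendsto_sandwich[OF _ _ tendsto_const lim]) auto
 thus ?thesis using s by blast
qed

end


section \<open>Unitary correspondence determined by two total families\<close>

text \<open>
 Two total families with the same Gram matrix determine a unitary operator between the completed
 spaces; \<open>pair g G\<close> says that this operator maps \<open>g\<close> to \<open>G\<close> (up to null vectors).
\<close>

locale ip_pair = V: ip_space V ipV + W: ip_space W ipW
 for V :: "('a => complex) set" and ipV and W :: "('b => complex) set" and ipW +
 fixes d :: "'i => 'a => complex" and e :: "'i => 'b => complex"
 assumes d_in: "d i \<in> V" and e_in: "e i \<in> W"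
  and gram: "ipV (d i) (d j) = ipW (e i) (e j)"
  and completeV: "!!s. (!!k::nat. s k \<in> V) ==>
   (!!\<epsilon>. 0 < \<epsilon> ==> \<exists>N. \<forall>i\<ge>N. \<forall>j\<ge>N. ip_dist ipV (s i) (s j) < \<epsilon>) ==>
   \<exists>g\<in>V. (%k. ip_dist ipV (s k) g) ----> 0"
  and completeW: "!!s. (!!k::nat. s k \<in> W) ==>
   (!!\<epsilon>. 0 < \<epsilon> ==> \<exists>N. \<forall>i\<ge>N. \<forall>j\<ge>N. ip_dist ipW (s i) (s j) < \<epsilon>) ==>
   \<exists>g\<in>W. (%k. ip_dist ipW (s k) g) ----> 0"
  and totalV: "f \<in> V ==> (!!i. ipV f (d i) = 0) ==> ip_norm ipV f = 0"
  and totalW: "F \<in> W ==> (!!i. ipW F (e i) = 0) ==> ip_norm ipW F = 0"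
begin

text \<open>The hypotheses are symmetric in the two sides, so existence of partners for V also
  yields it for W.\<close>

lemma converse_pair: "ip_pair W ipW V ipV e d"
 by unfold_locales (use d_in e_in gram completeV completeW totalV totalW in auto)

definition pair :: "('a => complex) => ('b => complex) => bool"
 where "pair g G \<longleftrightarrow> g \<in> V \<and> G \<in> W \<and> (\<forall>i. ipV g (d i) = ipW G (e i))"

text \<open>Finite linear combinations of the two families with common coefficients. Generating them
  one term at a time replaces sums over finite index sets by rule induction.\<close>

inductive comb :: "('a => complex) => ('b => complex) => bool"
 where
  comb_zero: "comb (%x. 0) (%x. 0)"
 | comb_step: "comb v w ==> comb (%x. v x + c * d i x) (%x. w x + c * e i x)"

lemma comb_in: "comb v w ==> v \<in> V \<and> w \<in> W"
 by(induction rule: comb.induct)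
  (auto intro!:V.zero W.zero V.add W.add V.scale W.scale d_in e_in)

lemma comb_add: "comb v' w' ==> comb v w ==> comb (%x. v x + v' x) (%x. w x + w' x)"
proof (induction rule: comb.induct)
 case (comb_step v' w' c i)
 from comb.comb_step[OF comb_step.IH[OF comb_step.prems], of c i] show ?case
  by(simp add:add.assoc)
qed simp

lemma comb_scale: "comb v w ==> comb (%x. c * v x) (%x. c * w x)"
proof (induction rule: comb.induct)
 case (comb_step v w c' i)
 from comb.comb_step[OF comb_step.IH, of "c * c'" i] show ?case
  by(simp add:distrib_left mult.assoc)
qed (simp add:comb.comb_zero)

lemma comb_d: "comb (d i) (e i)"
 using comb_step[OF comb_zero, of 1 i] by simp

lemma comb_pair: "comb v w ==> pair v w"
proof (induction rule: comb.induct)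
 case comb_zero
 have "ipV (%x. 0) (d i) = 0" "ipW (%x. 0) (e i) = 0" for i
  by(auto intro!:V.nrm_zero_ip W.nrm_zero_ip V.nrm_zero W.nrm_zero V.zero W.zero d_in e_in)
 thus ?case by(simp add:pair_def V.zero W.zero)
next
 case (comb_step v w c i)
 thus ?case
  by(auto simp:pair_def V.add W.add V.scale W.scale d_in e_in V.ip_add W.ip_add V.ip_scale
    W.ip_scale gram)
qed

lemma pair_V: "pair g G ==> g \<in> V" and pair_W: "pair g G ==> G \<in> W"
 by(simp_all add: pair_def)

lemma pair_add: "pair g G ==> pair h H ==> pair (%x. g x + h x) (%x. G x + H x)"
 by(auto simp:pair_def V.add W.add V.ip_add W.ip_add d_in e_in)

lemma pair_scale: "pair g G ==> pair (%x. c * g x) (%x. c * G x)"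
 by(auto simp:pair_def V.scale W.scale V.ip_scale W.ip_scale d_in e_in)

lemma pair_diff: "pair g G ==> pair h H ==> pair (%x. g x - h x) (%x. G x - H x)"
 by(auto simp:pair_def V.diff W.diff V.ip_diff W.ip_diff d_in e_in)

lemma pair_comb_ip: "comb v w ==> pair g G ==> ipV g v = ipW G w"
proof (induction rule: comb.induct)
 case comb_zero
 show ?case using V.nrm_zero_ip[OF V.zero pair_V[OF comb_zero] V.nrm_zero]
   W.nrm_zero_ip[OF W.zero pair_W[OF comb_zero] W.nrm_zero]
   V.ip_cnj[OF V.zero pair_V[OF comb_zero]] W.ip_cnj[OF W.zero pair_W[OF comb_zero]] by simp
next
 case (comb_step v w c i)
 thus ?case using comb_in[OF comb_step.hyps]
  by(auto simp:pair_def V.ip_add2 W.ip_add2 V.ip_scale2 W.ip_scale2 V.scale W.scale d_in e_in)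
qed

text \<open>Equal Gram matrices make the correspondence between combinations isometric.\<close>

lemma comb_dist: "comb v w ==> comb v' w' ==> ip_dist ipV v v' = ip_dist ipW w w'"
 using pair_comb_ip[OF comb_add comb_pair[OF comb_add], of "%x. (-1) * v' x" "%x. (-1) * w' x" v w
   "%x. (-1) * v' x" "%x. (-1) * w' x" v w] comb_scale[of v' w' "-1"]
 by(simp add:ip_dist_def ip_norm_def)

lemma comb_dense:
 assumes g: "g \<in> V"
 shows "\<exists>s t. (\<forall>k::nat. comb (s k) (t k)) \<and> (%k. ip_dist ipV (s k) g) ----> 0"
proof -
 have "\<exists>s. (\<forall>k::nat. s k \<in> {v. \<exists>w. comb v w}) \<and> (%k. ip_dist ipV (s k) g) ----> 0"
 proof (rule V.total_imp_dense[OF completeV _ _ _ _ _ g])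
  fix f assume f: "f \<in> V" "!!s. s \<in> {v. \<exists>w. comb v w} ==> ipV f s = 0"
  show "ip_norm ipV f = 0" by(rule totalV[OF f(1)]) (use f(2) comb_d in auto)
 qed (use comb_in comb_zero comb_add comb_scale in \<open>auto; blast\<close>)+
 thus ?thesis by(simp add:choice_iff') metis
qed

text \<open>Combinations approaching g form a Cauchy sequence; the isometry makes their counterparts
  Cauchy in W, and the limit there is the partner. The sequences are exported because
  \<open>pair_ip\<close> passes to the limit along them.\<close>

lemma pair_approx:
 assumes g: "g \<in> V"
 obtains G s t where "pair g G" "!!k::nat. comb (s k) (t k)"
  "(%k. ip_dist ipV (s k) g) ----> 0" "(%k. ip_dist ipW (t k) G) ----> 0"
proof -
 obtain s t where st: "!!k::nat. comb (s k) (t k)" and lim: "(%k. ip_dist ipV (s k) g) ----> 0"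
  using comb_dense[OF g] by auto
 have sV: "s k \<in> V" and tW: "t k \<in> W" for k using comb_in[OF st] by auto
 have "\<exists>N. \<forall>i\<ge>N. \<forall>j\<ge>N. ip_dist ipW (t i) (t j) < \<epsilon>" if "0 < \<epsilon>" for \<epsilon>
 proof -
  have "eventually (%k. ip_dist ipV (s k) g < \<epsilon> / 2) sequentially"
   using order_tendstoD(2)[OF lim, of "\<epsilon> / 2"] that by simp
  then obtain N where N: "!!k. k >= N ==> ip_dist ipV (s k) g < \<epsilon> / 2"
   unfolding eventually_sequentially by blast
  have "ip_dist ipW (t i) (t j) < \<epsilon>" if "i >= N" "j >= N" for i j
   using V.dist_triangle[OF sV[of i] g sV[of j]] V.dist_commute[OF g sV[of j]]
    N[OF that(1)] N[OF that(2)] comb_dist[OF st[of i] st[of j]] by linarith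
  thus ?thesis by blast
 qed
 from completeW[OF tW this] obtain G where G: "G \<in> W" "(%k. ip_dist ipW (t k) G) ----> 0" by blast
 have "ipV g (d i) = ipW G (e i)" for i
 proof (rule LIMSEQ_unique)
  show "(%k. ipV (s k) (d i)) ----> ipV g (d i)" by(rule V.ip_tendsto[OF sV g d_in lim])
  have "(%k. ipW (t k) (e i)) ----> ipW G (e i)" by(rule W.ip_tendsto[OF tW G(1) e_in G(2)])
  moreover have "ipV (s k) (d i) = ipW (t k) (e i)" for k using comb_pair[OF st] by(simp add:pair_def)
  ultimately show "(%k. ipV (s k) (d i)) ----> ipW G (e i)" by simp
 qed
 hence "pair g G" using g G by(simp add:pair_def)
 from that[OF this st lim G(2)] show thesis .
qed

lemma pair_exists: "g \<in> V ==> \<exists>G. pair g G"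
 using pair_approx by metis

lemma pair_exists_inv: "G \<in> W ==> \<exists>g. pair g G"
 using ip_pair.pair_exists[OF converse_pair, of G] ip_pair.pair_def[OF converse_pair]
 by(auto simp:pair_def)

lemma pair_unique:
 assumes "pair g G" "pair g H" shows "ip_dist ipW G H = 0"
 unfolding ip_dist_def
 by(rule totalW) (use assms in \<open>auto simp:pair_def W.diff W.ip_diff e_in\<close>)

lemma pair_cong:
 assumes "pair g G" "g' \<in> V" "G' \<in> W" "ip_dist ipV g g' = 0" "ip_dist ipW G G' = 0"
 shows "pair g' G'"
 using assms V.dist_zero_ip[of g g'] W.dist_zero_ip[of G G'] d_in e_in by(auto simp:pair_def)

text \<open>Parseval. It holds with a combination in the first slot and survives the limit; the
  partner G' reached by the approximation may differ from G by a null vector.\<close>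

lemma pair_ip:
 assumes g: "pair g G" and h: "pair h H" shows "ipV g h = ipW G H"
proof -
 obtain G' s t where G': "pair g G'" and st: "!!k::nat. comb (s k) (t k)"
  and lim: "(%k. ip_dist ipV (s k) g) ----> 0" "(%k. ip_dist ipW (t k) G') ----> 0"
  using pair_approx[OF pair_V[OF g]] by metis
 have in_st: "s k \<in> V" "t k \<in> W" for k using comb_in[OF st] by auto
 have eq: "ipV (s k) h = ipW (t k) H" for k
  using pair_comb_ip[OF st h, of k] in_st[of k] h V.ip_cnj[of h "s k"] W.ip_cnj[of H "t k"]
  by(simp add:pair_def)
 have "ipV g h = ipW G' H"
  by(rule LIMSEQ_unique[OF V.ip_tendsto[OF in_st(1) pair_V[OF g] pair_V[OF h] lim(1)]])
   (simp add:eq W.ip_tendsto[OF in_st(2) pair_W[OF G'] pair_W[OF h] lim(2)])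
 also have "... = ipW G H"
  using W.dist_zero_ip[OF pair_W[OF G'] pair_W[OF g] pair_W[OF h] pair_unique[OF G' g]] .
 finally show ?thesis .
qed

lemma pair_nrm: "pair g G ==> ip_norm ipV g = ip_norm ipW G"
 using pair_ip[of g G g G] by(simp add:ip_norm_def)

lemma pair_dist: "pair g G ==> pair h H ==> ip_dist ipV g h = ip_dist ipW G H"
 using pair_nrm[OF pair_diff, of g G h H] by(simp add:ip_dist_def)

text \<open>Closedness of the graph. It connects the definition of the L^2 transform by
  approximating sequences with \<open>pair\<close>.\<close>

lemma pair_limit:
 assumes st: "!!k. pair (s k) (t k)" and g: "g \<in> V" and G: "G \<in> W"
  and lim: "(%k. ip_dist ipV (s k) g) ----> 0" "(%k. ip_dist ipW (t k) G) ----> 0"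
 shows "pair g G"
proof -
 have "ipV g (d i) = ipW G (e i)" for i
 proof (rule LIMSEQ_unique)
  show "(%k. ipV (s k) (d i)) ----> ipV g (d i)"
   by(rule V.ip_tendsto[OF pair_V[OF st] g d_in lim(1)])
  have "(%k. ipW (t k) (e i)) ----> ipW G (e i)"
   by(rule W.ip_tendsto[OF pair_W[OF st] G e_in lim(2)])
  thus "(%k. ipV (s k) (d i)) ----> ipW G (e i)" using st by(simp add:pair_def)
 qed
 thus ?thesis using g G by(simp add:pair_def)
qed

end


section \<open>Completeness of square integrable functions\<close>

lemma borel_measurable_cnj [measurable (raw)]:
 "f \<in> bmeas M ==> (%x. cnj (f x)) \<in> bmeas M"
 by(rule borel_measurable_continuous_on[where f = cnj]) (intro continuous_intros)

lemma sq_integrable_mult: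
 assumes "sq_integrable M f" "sq_integrable M g"
 shows "integrable M (%x. f x * g x)"
proof (rule LINT_bound)
 show "integrable M (%x. (cmod (f x))^2 + (cmod (g x))^2)"
  using assms by(simp add:sq_integrable_def)
 show "(%x. f x * g x) \<in> bmeas M"
  using assms by(auto simp:sq_integrable_def)
 show "AE x in M. norm (f x * g x) <= norm ((cmod (f x))^2 + (cmod (g x))^2)"
 proof (rule AE_I2)
  fix x
  have "2 * (cmod (f x) * cmod (g x)) <= (cmod (f x))^2 + (cmod (g x))^2"
   using sum_squares_bound[of "cmod (f x)" "cmod (g x)"] by(simp add:mult.assoc)
  moreover have "0 <= cmod (f x) * cmod (g x)" by simp
  ultimately have "cmod (f x) * cmod (g x) <= (cmod (f x))^2 + (cmod (g x))^2"
   by linarith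
  thus "norm (f x * g x) <= norm ((cmod (f x))^2 + (cmod (g x))^2)"
   by(simp add:norm_mult)
 qed
qed

lemma sq_integrable_cnj: "sq_integrable M f ==> sq_integrable M (%x. cnj (f x))"
 by(simp add:sq_integrable_def borel_measurable_cnj)

lemma sq_integrable_scale: "sq_integrable M f ==> sq_integrable M (%x. c * f x)"
 by(auto simp:sq_integrable_def norm_mult power_mult_distrib intro!:borel_measurable_times)

lemma sq_integrable_bound:
 assumes f: "sq_integrable M f" and g: "g \<in> bmeas M"
  and le: "AE x in M. cmod (g x) <= C * cmod (f x)"
 shows "sq_integrable M g"
 unfolding sq_integrable_def
proof
 show "integrable M (%x. (cmod (g x))^2)"
 proof (rule LINT_bound)
  show "integrable M (%x. C\<^sup>2 * (cmod (f x))^2)" using f by(simp add:sq_integrable_def)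
  show "AE x in M. norm ((cmod (g x))^2) <= norm (C\<^sup>2 * (cmod (f x))^2)"
   using le by eventually_elim
    (simp add:power_mult_distrib[symmetric], rule power_mono, auto)
 qed (use g in auto)
qed (use g in auto)

lemma sq_integrable_add:
 assumes f: "sq_integrable M f" and g: "sq_integrable M g"
 shows "sq_integrable M (%x. f x + g x)"
 unfolding sq_integrable_def
proof
 have [measurable]: "f \<in> bmeas M" "g \<in> bmeas M"
  using f g by(auto simp:sq_integrable_def)
 show "(%x. f x + g x) \<in> bmeas M" by measurable
 have eq: "(cmod (f x + g x))^2 = (cmod (f x))^2 + (cmod (g x))^2 + 2 * Re (f x * cnj (g x))" for x
  by(simp only:cmod_power2) (simp add:power2_eq_square algebra_simps)
 show "integrable M (%x. (cmod (f x + g x))^2)"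
  unfolding eq using f g integrable_Re[OF sq_integrable_mult[OF f sq_integrable_cnj[OF g]]]
  by(intro Bochner_Integration.integrable_add integrable_mult_right) (auto simp:sq_integrable_def)
qed

lemma ip_space_L2: "ip_space (Collect (sq_integrable M)) (L2_ip M)"
proof
 fix f g h :: "'a => complex" and c
 show "(%x. 0) \<in> Collect (sq_integrable M)" by(simp add:sq_integrable_def)
 assume f: "f \<in> Collect (sq_integrable M)"
 show "(%x. c * f x) \<in> Collect (sq_integrable M)"
  using f by(simp add:sq_integrable_scale)
 have "L2_ip M f f = cor (LINT x|M. (cmod (f x))^2)"
  by(simp only:L2_ip_def complex_norm_square[symmetric] integral_complex_of_real)
 thus "0 <= Re (L2_ip M f f)" by simp
 assume h: "h \<in> Collect (sq_integrable M)"
 have fh: "integrable M (%x. f x * cnj (h x))"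
  using f h by(auto intro!:sq_integrable_mult sq_integrable_cnj)
 show "L2_ip M (%x. c * f x) h = c * L2_ip M f h"
  by(simp add:L2_ip_def mult.assoc)
 assume g: "g \<in> Collect (sq_integrable M)"
 have gh: "integrable M (%x. g x * cnj (h x))"
  using g h by(auto intro!:sq_integrable_mult sq_integrable_cnj)
 show "(%x. f x + g x) \<in> Collect (sq_integrable M)"
  using f g by(simp add:sq_integrable_add)
 show "L2_ip M (%x. f x + g x) h = L2_ip M f h + L2_ip M g h"
  using fh gh by(simp add:L2_ip_def distrib_right)
 show "L2_ip M g f = cnj (L2_ip M f g)"
  unfolding L2_ip_def by(subst LINT_cnj[symmetric]) (simp add:mult.commute)
qed

lemma L2_nrm: "ip_norm (L2_ip M) f = sqrt (LINT x|M. (cmod (f x))^2)"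
proof -
 have "L2_ip M f f = cor (LINT x|M. (cmod (f x))^2)"
  by(simp only:L2_ip_def complex_norm_square[symmetric] integral_complex_of_real)
 thus ?thesis by(simp add:ip_norm_def)
qed

lemma L2_nrm_sq: "(ip_norm (L2_ip M) f)^2 = (LINT x|M. (cmod (f x))^2)"
 by(simp add:L2_nrm)

lemma L2_nrm_zero_iff:
 assumes "sq_integrable M f"
 shows "ip_norm (L2_ip M) f = 0 \<longleftrightarrow> (AE x in M. f x = 0)"
proof -
 have "ip_norm (L2_ip M) f = 0 \<longleftrightarrow> (LINT x|M. (cmod (f x))^2) = 0"
  by(simp add:L2_nrm)
 also have "... \<longleftrightarrow> (AE x in M. (cmod (f x))^2 = 0)"
  using assms by(intro integral_nonneg_eq_0_iff_AE) (auto simp:sq_integrable_def)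
 finally show ?thesis by simp
qed

lemma L2_dist_zero_iff:
 assumes "sq_integrable M f" "sq_integrable M g"
 shows "ip_dist (L2_ip M) f g = 0 \<longleftrightarrow> (AE x in M. f x = g x)"
proof -
 have "sq_integrable M (%x. f x - g x)"
  using ip_space.diff[OF ip_space_L2, of f M g] assms by auto
 thus ?thesis unfolding ip_dist_def by(subst L2_nrm_zero_iff) auto
qed

lemma L2_Cauchy_Schwarz:
 assumes "sq_integrable M f" "sq_integrable M g"
 shows "(LINT x|M. cmod (f x) * cmod (g x)) <= ip_norm (L2_ip M) f * ip_norm (L2_ip M) g"
proof -
 let ?f = "%x. cor (cmod (f x))" and ?g = "%x. cor (cmod (g x))"
 have "?f \<in> Collect (sq_integrable M)" "?g \<in> Collect (sq_integrable M)"
  using assms by(auto simp:sq_integrable_def)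
 from ip_space.Cauchy_Schwarz[OF ip_space_L2 this]
 have "cmod (L2_ip M ?f ?g) <= ip_norm (L2_ip M) f * ip_norm (L2_ip M) g"
  by(simp add:L2_nrm)
 moreover have "L2_ip M ?f ?g = cor (LINT x|M. cmod (f x) * cmod (g x))"
  unfolding L2_ip_def by(subst integral_complex_of_real[symmetric]) simp
 ultimately show ?thesis by simp
qed

lemma L2_dominated_convergence:
 assumes s: "!!k. s k \<in> bmeas M" and g: "g \<in> bmeas M"
  and u: "sq_integrable M u" and le: "!!k. AE x in M. cmod (s k x - g x) <= cmod (u x)"
  and lim: "AE x in M. (%k. s k x) ----> g x"
 shows "(%k. ip_dist (L2_ip M) (s k) g) ----> 0"
proof -
 have "(%k. LINT x|M. (cmod (s k x - g x))^2) ----> (LINT x|M. 0)"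
 proof (rule integral_dominated_convergence)
  show "integrable M (%x. (cmod (u x))^2)" using u by(simp add:sq_integrable_def)
  show "AE x in M. norm ((cmod (s k x - g x))^2) <= (cmod (u x))^2" for k
   using le[of k] by eventually_elim (simp add:power_mono)
  show "AE x in M. (%k. (cmod (s k x - g x))^2) ----> 0"
   using lim
  proof eventually_elim
   case (elim x)
   hence "(%k. s k x - g x) ----> 0" using LIM_zero by blast
   from tendsto_power[OF tendsto_norm[OF this], of 2] show ?case by simp
  qed
 qed (use s g in auto)
 hence "(%k. sqrt (LINT x|M. (cmod (s k x - g x))^2)) ----> sqrt 0"
  by(intro tendsto_real_sqrt) simp
 thus ?thesis by(simp add:ip_dist_def L2_nrm)
qed

text \<open>Multiplication by a positive integrable u \<le> 1 turns an L^2 Cauchy sequence into an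
  L^1 Cauchy sequence, even when the measure is infinite. This yields an almost everywhere
  convergent subsequence; dividing by u and applying Fatou finish the argument.\<close>

lemma (in sigma_finite_measure) L2_complete:
 fixes s :: "nat => 'a => complex"
 assumes s: "!!k. sq_integrable M (s k)"
  and Cauchy: "!!e. 0 < e ==> \<exists>N. \<forall>i\<ge>N. \<forall>j\<ge>N. ip_dist (L2_ip M) (s i) (s j) < e"
 obtains g where "sq_integrable M g" "(%k. ip_dist (L2_ip M) (s k) g) ----> 0"
proof -
 interpret L: ip_space "Collect (sq_integrable M)" "L2_ip M" by(rule ip_space_L2)
 obtain u :: "'a => real" where u: "u \<in> bmeas M" "!!x. 0 < u x" "!!x. u x <= 1"
  "integrable M u" using obtain_positive_integrable_function by blast
 have [measurable]: "s k \<in> bmeas M" "u \<in> bmeas M" for k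
  using s u by(auto simp:sq_integrable_def)
 \<comment> \<open>Since u \<le> 1, also u^2 \<le> u, so u is square integrable and Cauchy-Schwarz
   bounds the L^1 norm of u times a difference.\<close>
 have usq: "sq_integrable M (%x. cor (u x))"
  unfolding sq_integrable_def
 proof
  show "integrable M (%x. (cmod (cor (u x)))^2)"
   by(rule LINT_bound[OF u(4)])
    (use u(2,3) mult_left_le[OF u(3) less_imp_le[OF u(2)]] in \<open>auto simp:power2_eq_square abs_of_pos\<close>)
 qed measurable
 define U where "U = ip_norm (L2_ip M) (%x. cor (u x))"
 have U: "0 <= U" using L.nrm_nonneg usq by(simp add:U_def)
 define t where "t = (%k x. cor (u x) * s k x)"
 have sd: "sq_integrable M (%x. s i x - s j x)" for i j
  using L.diff[of "s i" "s j"] s by simp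
 obtain r where r: "strict_mono r" "AE x in M. Cauchy (%i. t (r i) x)"
 proof (rule cauchy_L1_AE_cauchy_subseq[where M = M and s = t])
  show "integrable M (t k)" for k
   unfolding t_def by(rule sq_integrable_mult[OF usq s])
  show "\<exists>N. \<forall>i\<ge>N. \<forall>j\<ge>N. (LINT x|M. norm (t i x - t j x)) < e" if e: "0 < e" for e
  proof -
   obtain N where N: "\<forall>i\<ge>N. \<forall>j\<ge>N. ip_dist (L2_ip M) (s i) (s j) < e / (U + 1)"
    using Cauchy[of "e / (U + 1)"] e U by auto
   have "(LINT x|M. norm (t i x - t j x)) < e" if "i >= N" "j >= N" for i j
   proof -
    have "(LINT x|M. norm (t i x - t j x)) = (LINT x|M. cmod (cor (u x)) * cmod (s i x - s j x))"
     by(simp add:t_def right_diff_distrib[symmetric] norm_mult)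
    also have "... <= U * ip_dist (L2_ip M) (s i) (s j)"
     using L2_Cauchy_Schwarz[OF usq sd] by(simp add:U_def ip_dist_def)
    also have "... <= U * (e / (U + 1))" using N that U by(intro mult_left_mono) (auto simp:less_imp_le)
    also have "... < e" using e U by(simp add:field_simps)
    finally show ?thesis .
   qed
   thus ?thesis by blast
  qed
 qed auto
 define g where "g = (%x. lim (%i. s (r i) x))"
 have [measurable]: "g \<in> bmeas M" unfolding g_def by measurable
 have conv: "AE x in M. (%i. s (r i) x) ----> g x"
  using r(2)
 proof eventually_elim
  case (elim x)
  then obtain c where "(%i. t (r i) x) ----> c" using Cauchy_convergent_iff convergent_def by metis
  hence "(%i. t (r i) x / u x) ----> c / u x" by(intro tendsto_intros) (use u(2)[of x] in auto)
  hence "convergent (%i. s (r i) x)" using u(2)[of x] by(auto simp:t_def convergent_def)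
  thus ?case by(simp add:g_def convergent_LIMSEQ_iff)
 qed
 \<comment> \<open>Fatou along the subsequence: a Cauchy bound for pairs of indices becomes a bound
   for the distance to g.\<close>
 have bd: "(\<integral>\<^sup>+x. ennreal ((cmod (s k x - g x))^2) \<partial>M) <= ennreal (e\<^sup>2)"
  if e: "0 < e" and N: "\<forall>i\<ge>N. \<forall>j\<ge>N. ip_dist (L2_ip M) (s i) (s j) < e" and k: "k >= N" for e N k
 proof -
  have "(\<integral>\<^sup>+x. ennreal ((cmod (s k x - g x))^2) \<partial>M) =
    (\<integral>\<^sup>+x. liminf (%i. ennreal ((cmod (s k x - s (r i) x))^2)) \<partial>M)"
  proof (rule nn_integral_cong_AE)
   show "AE x in M. ennreal ((cmod (s k x - g x))^2) = liminf (%i. ennreal ((cmod (s k x - s (r i) x))^2))"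
    using conv
   proof eventually_elim
    case (elim x)
    hence "(%i. ennreal ((cmod (s k x - s (r i) x))^2)) ----> ennreal ((cmod (s k x - g x))^2)"
     by(intro tendsto_intros) 
    thus ?case by(metis lim_imp_Liminf trivial_limit_sequentially)
   qed
  qed
  also have "... <= liminf (%i. \<integral>\<^sup>+x. ennreal ((cmod (s k x - s (r i) x))^2) \<partial>M)"
   by(rule nn_integral_liminf) simp
  also have "... <= ennreal (e\<^sup>2)"
  proof (rule order_trans[OF Liminf_le_Limsup Limsup_bounded])
   have "(\<integral>\<^sup>+x. ennreal ((cmod (s k x - s (r i) x))^2) \<partial>M) <= ennreal (e\<^sup>2)" if "i >= N" for i
   proof -
    have "r i >= N" using that seq_suble[OF r(1), of i] by simp
    hence d: "ip_dist (L2_ip M) (s k) (s (r i)) < e" using N k by simp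
    have "(\<integral>\<^sup>+x. ennreal ((cmod (s k x - s (r i) x))^2) \<partial>M) = ennreal ((ip_dist (L2_ip M) (s k) (s (r i)))^2)"
     using sd[of k "r i"] unfolding ip_dist_def L2_nrm_sq
     by(intro nn_integral_eq_integral) (auto simp:sq_integrable_def)
    also have "... <= ennreal (e\<^sup>2)"
     using d L.dist_nonneg[of "s k" "s (r i)"] s by(intro ennreal_leI power_mono) auto
    finally show ?thesis .
   qed
   thus "\<forall>\<^sub>F i in sequentially. (\<integral>\<^sup>+x. ennreal ((cmod (s k x - s (r i) x))^2) \<partial>M) <= ennreal (e\<^sup>2)"
    using eventually_sequentially by blast
  qed simp
  finally show ?thesis .
 qed
 have sq: "sq_integrable M (%x. s k x - g x)"
  if "0 < e" "\<forall>i\<ge>N. \<forall>j\<ge>N. ip_dist (L2_ip M) (s i) (s j) < e" "k >= N" for e N k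
  unfolding sq_integrable_def using bd[OF that]
  by(auto simp:integrable_iff_bounded intro:le_less_trans)
 have gsq: "sq_integrable M g"
 proof -
  obtain N where "\<forall>i\<ge>N. \<forall>j\<ge>N. ip_dist (L2_ip M) (s i) (s j) < 1" using Cauchy[of 1] by auto
  from sq[OF _ this, of N] have "sq_integrable M (%x. s N x - g x)" by simp
  thus ?thesis using L.diff[of "s N" "%x. s N x - g x"] s by simp
 qed
 moreover have "(%k. ip_dist (L2_ip M) (s k) g) ----> 0"
 proof (rule LIMSEQ_I)
  fix e :: real assume "0 < e"
  hence e2: "0 < e / 2" by simp
  obtain N where N: "\<forall>i\<ge>N. \<forall>j\<ge>N. ip_dist (L2_ip M) (s i) (s j) < e / 2" using Cauchy[OF e2] by auto
  have "norm (ip_dist (L2_ip M) (s k) g - 0) < e" if "k >= N" for k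
  proof -
   have "(\<integral>\<^sup>+x. ennreal ((cmod (s k x - g x))^2) \<partial>M) = ennreal ((ip_dist (L2_ip M) (s k) g)^2)"
    using sq[OF e2 N that] unfolding ip_dist_def L2_nrm_sq
    by(intro nn_integral_eq_integral) (auto simp:sq_integrable_def)
   hence "(ip_dist (L2_ip M) (s k) g)^2 <= (e / 2)^2"
    using bd[OF e2 N that] by(simp add:ennreal_le_iff)
   hence "ip_dist (L2_ip M) (s k) g <= e / 2" using e2 by(simp add:power2_le_iff_abs_le)
   thus ?thesis using L.dist_nonneg[of "s k" g] s gsq \<open>0 < e\<close> by simp
  qed
  thus "\<exists>N. \<forall>k\<ge>N. norm (ip_dist (L2_ip M) (s k) g - 0) < e" by blast
 qed
 ultimately show thesis by(rule that)
qed

section \<open>Characters of the torus\<close>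

definition chr :: "int^'m::finite => complex^'m => complex"
 where "chr \<alpha> t = (\<Prod>i\<in>UNIV. t $ i powi \<alpha> $ i)"

lemma torus_nz: "t \<in> torus ==> t $ i ~= 0"
proof -
 assume "t \<in> torus"
 hence "cmod (t $ i) = 1" by(simp add:torus_def)
 thus ?thesis by auto
qed

lemma cmod_chr: "t \<in> torus ==> cmod (chr \<alpha> t) = 1"
 by(simp add:chr_def torus_def prod_norm[symmetric] norm_power_int)

lemma chr_0 [simp]: "chr 0 t = 1"
 by(simp add:chr_def)

lemma chr_add: "t \<in> torus ==> chr (\<alpha> + \<beta>) t = chr \<alpha> t * chr \<beta> t"
 by(simp add:chr_def torus_nz power_int_add prod.distrib)

lemma chr_minus: "t \<in> torus ==> chr (- \<alpha>) t = cnj (chr \<alpha> t)"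
proof -
 assume t: "t \<in> torus"
 have "t $ i powi (- k) = cnj (t $ i powi k)" for i k
 proof -
  define z where "z = t $ i powi k"
  have "cmod z = 1" using t by(simp add:torus_def norm_power_int z_def)
  hence "z * cnj z = 1" by(simp add:complex_norm_square[symmetric])
  hence "inverse z = cnj z" by(rule inverse_unique)
  thus ?thesis by(simp add:power_int_minus z_def)
 qed
 thus ?thesis by(simp add:chr_def)
qed

lemma chr_axis: "chr (axis i k) t = t $ i powi k"
proof -
 have "chr (axis i k) t = (\<Prod>j\<in>UNIV. if j = i then t $ i powi k else 1)"
  unfolding chr_def by(intro prod.cong) (auto simp:axis_def)
 thus ?thesis by simp
qed

lemma borel_measurable_powi: "(%z::complex. z powi k) \<in> bmeas borel"
 unfolding power_int_def by measurable

lemma borel_measurable_nth_vec [measurable (raw)]: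
 fixes f :: "'a => 'b::second_countable_topology ^ 'n::finite"
 assumes "f \<in> bmeas M"
 shows "(%x. f x $ i) \<in> bmeas M"
 by(rule borel_measurable_continuous_on[OF _ assms]) (intro continuous_intros)

lemma borel_measurable_cis [measurable (raw)]:
 "f \<in> bmeas M ==> (%x. cis (f x)) \<in> bmeas M"
 by(rule borel_measurable_continuous_on[where f = cis]) (intro continuous_intros)

lemma borel_measurable_chr [measurable]: "chr \<alpha> \<in> bmeas borel"
 unfolding chr_def
 by(intro borel_measurable_prod measurable_compose[OF _ borel_measurable_powi]) measurable

section \<open>Haar measure on the torus\<close>

lemma closed_torus: "closed (torus :: (complex^'m::finite) set)"
proof -
 have "closed (\<Inter>i. {t :: complex^'m. cmod (t $ i) = 1})"
  by(intro closed_INT ballI closed_Collect_eq continuous_intros)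
 also have "(\<Inter>i. {t :: complex^'m. cmod (t $ i) = 1}) = torus" by(auto simp:torus_def)
 finally show ?thesis .
qed

lemma compact_torus: "compact (torus :: (complex^'m::finite) set)"
proof -
 have "norm t <= real CARD('m)" if "t \<in> torus" for t :: "complex^'m"
  using L2_set_le_sum[of UNIV "%i. norm (t $ i)"] that by(simp add:norm_vec_def torus_def)
 thus ?thesis
  using closed_torus by(auto simp:compact_eq_bounded_closed bounded_iff)
qed

lemma torus_sets [measurable]: "torus \<in> sets borel"
 by(simp add:closed_torus borel_closed)

lemma unit_cube_emeasure: "emeasure lborel (cbox 0 1 :: (real^'m::finite) set) = 1"
proof -
 have "(1 :: real^'m) \<bullet> b = 1" if "b \<in> Basis" for b
  using that by(auto simp:Basis_vec_def inner_axis)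
 thus ?thesis by(subst emeasure_lborel_cbox_eq) simp
qed

lemma torus_param_measurable:
 "(%\<theta>::real^'m::finite. \<chi> i. cis (2 * pi * \<theta> $ i)) \<in>
  measurable (uniform_measure lborel (cbox 0 1)) (restrict_space borel torus)"
proof (rule measurable_restrict_space2)
 have "continuous_on UNIV (%\<theta>::real^'m. \<chi> i. cis (2 * pi * \<theta> $ i))"
  by(intro continuous_intros)
 thus "(%\<theta>::real^'m. \<chi> i. cis (2 * pi * \<theta> $ i)) \<in> bmeas (uniform_measure lborel (cbox 0 1))"
  by(subst measurable_cong_sets[OF sets_uniform_measure refl]) (simp add:borel_measurable_continuous_onI)
qed (auto simp:torus_def)

lemma space_torus_haar [simp]: "space torus_haar = torus"
 by(simp add:torus_haar_def space_restrict_space)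

lemma sets_torus_haar [measurable_cong]: "sets torus_haar = sets (restrict_space borel torus)"
 by(simp add:torus_haar_def)

lemma prob_space_torus_haar: "prob_space (torus_haar :: (complex^'m::finite) measure)"
 unfolding torus_haar_def
 by(intro prob_space.prob_space_distr prob_space_uniform_measure torus_param_measurable)
  (simp_all add: unit_cube_emeasure)

interpretation torus_haar: prob_space "torus_haar :: (complex^'m::finite) measure"
 by(rule prob_space_torus_haar)

interpretation TR: pair_sigma_finite "torus_haar :: (complex^'m::finite) measure" "lborel :: real measure"
 by unfold_locales

interpretation dual: pair_sigma_finite "count_space UNIV :: (int^'m::finite) measure" "lborel :: real measure"
 by(intro pair_sigma_finite.intro sigma_finite_measure_count_space_countable lborel.sigma_finite_measure_axioms)
  simp

lemma torus_integrable_bounded: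
 fixes g :: "complex^'m::finite => complex"
 assumes "g \<in> bmeas torus_haar" "!!t. t \<in> torus ==> cmod (g t) <= B"
 shows "integrable torus_haar g"
 by(rule torus_haar.integrable_const_bound[of _ B]) (use assms in auto)

lemma measurable_torus_haar: "f \<in> bmeas borel ==> f \<in> bmeas torus_haar"
 by(simp add:measurable_cong_sets[OF sets_torus_haar refl] measurable_restrict_space1)

lemma integral_cis_period:
 "(LINT x|lborel. indicator {0..1} x * cis (2 * pi * (of_int k * x))) = (if k = 0 then 1 else 0)"
proof -
 have int: "integrable lborel (%x::real. indicator {0..1} x *\<^sub>R cis (2 * pi * (of_int k * x)))"
  by(rule borel_integrable_compact) (auto intro!:continuous_intros)
 have "(LINT x|lborel. indicator {0..1} x *\<^sub>R cis (2 * pi * (of_int k * x))) =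
   integral {0..1} (%x. cis (2 * pi * (of_int k * x)))"
  using set_borel_integral_eq_integral(2)[of "{0..1::real}" "%x. cis (2 * pi * (of_int k * x))"] int
  by(simp add:set_integrable_def set_lebesgue_integral_def)
 also have "... = (if k = 0 then 1 else 0)"
 proof (cases "k = 0")
  case False
  have "((%x. cis (2 * pi * (of_int k * x))) has_integral
    (cis (2 * pi * (of_int k * 1)) / (2 * pi * of_int k * \<i>) - cis (2 * pi * (of_int k * 0)) / (2 * pi * of_int k * \<i>))) {0..1}"
  proof (rule fundamental_theorem_of_calculus)
   fix x :: real
   have "((%x. cis (2 * pi * (of_int k * x)) / (2 * pi * of_int k * \<i>)) has_vector_derivative
     ((2 * pi * of_int k) *\<^sub>R (\<i> * cis (2 * pi * (of_int k * x)))) / (2 * pi * of_int k * \<i>)) (at x within {0..1})"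
    unfolding cis_conv_exp
    by(rule derivative_eq_intros has_vector_derivative_real_field refl | simp add:scaleR_conv_of_real)+
   also have "((2 * pi * of_int k) *\<^sub>R (\<i> * cis (2 * pi * (of_int k * x)))) / (2 * pi * of_int k * \<i>) =
     cis (2 * pi * (of_int k * x))"
    using False by(simp add:scaleR_conv_of_real field_simps)
   finally show "((%x. cis (2 * pi * (of_int k * x)) / (2 * pi * of_int k * \<i>)) has_vector_derivative
     cis (2 * pi * (of_int k * x))) (at x within {0..1})" .
  qed simp
  moreover have "cis (2 * pi * (of_int k * 1)) = 1" 
   using cis_multiple_2pi[of "of_int k"] by(simp add:mult_ac)
  ultimately show ?thesis using False by(simp add:integral_unique)
 qed simp
 finally show ?thesis by(simp add:scaleR_conv_of_real of_real_indicator)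
qed

text \<open>\<open>torus_haar\<close> is the image of the unit cube, and Lebesgue measure on vectors
  is a product over \<open>Basis\<close>; the integrand then splits into one-dimensional integrals
  over a period.\<close>

lemma integral_chr:
 fixes \<alpha> :: "int^'m::finite"
 shows "(LINT t|torus_haar. chr \<alpha> t) = (if \<alpha> = 0 then 1 else 0)"
proof -
 let ?h = "%k (x::real). indicator {0..1} x * cis (2 * pi * (of_int k * x))"
 have B: "Basis = (%i. axis i 1 :: real^'m) ` UNIV" by(auto simp:Basis_vec_def)
 have inj: "inj (%i. axis i 1 :: real^'m)" by(auto simp:inj_on_def axis_eq_axis)
 interpret P: product_sigma_finite "%b::real^'m. lborel :: real measure" by standard
 have "(LINT t|torus_haar. chr \<alpha> t) =
   (LINT \<theta>|uniform_measure lborel (cbox 0 1 :: (real^'m) set). chr \<alpha> (\<chi> i. cis (2 * pi * \<theta> $ i)))"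
  unfolding torus_haar_def
  by(rule integral_distr[OF torus_param_measurable]) (simp add:measurable_restrict_space1)
 also have "... = (LINT \<theta>|lborel. indicator (cbox 0 1 :: (real^'m) set) \<theta> *\<^sub>R chr \<alpha> (\<chi> i. cis (2 * pi * \<theta> $ i)))"
 proof -
  have "uniform_measure lborel (cbox 0 1 :: (real^'m) set) =
    density lborel (%x. ennreal (indicator (cbox 0 1 :: (real^'m) set) x))"
   unfolding uniform_measure_def unit_cube_emeasure by(auto intro!:arg_cong2[where f = density] split: split_indicator)
  moreover have "(%\<theta>::real^'m. chr \<alpha> (\<chi> i. cis (2 * pi * \<theta> $ i))) \<in> bmeas lborel"
   by(rule measurable_compose[OF _ borel_measurable_chr])
    (auto intro!:borel_measurable_continuous_onI continuous_intros)
  ultimately show ?thesis by(simp add:integral_density)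
 qed
 also have "(%\<theta>. indicator (cbox 0 1 :: (real^'m) set) \<theta> *\<^sub>R chr \<alpha> (\<chi> i. cis (2 * pi * \<theta> $ i))) =
   (%\<theta>. \<Prod>i\<in>UNIV. ?h (\<alpha> $ i) (\<theta> $ i))"
 proof
  fix \<theta> :: "real^'m"
  have "(indicator (cbox 0 1) \<theta> :: complex) = (\<Prod>i\<in>UNIV. indicator {0..1} (\<theta> $ i))"
  proof (cases "\<theta> \<in> cbox 0 1")
   case True
   thus ?thesis by(auto simp:mem_box_cart intro!:prod.neutral[symmetric])
  next
   case False
   then obtain i where "\<theta> $ i \<notin> {0..1}" by(auto simp:mem_box_cart)
   hence "(\<Prod>i\<in>UNIV. indicator {0..1} (\<theta> $ i) :: complex) = 0" by(auto intro!:prod_zero exI[of _ i])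
   thus ?thesis using False by simp
  qed
  moreover have "chr \<alpha> (\<chi> i. cis (2 * pi * \<theta> $ i)) = (\<Prod>i\<in>UNIV. cis (2 * pi * (of_int (\<alpha> $ i) * \<theta> $ i)))"
   by(simp add:chr_def cis_power_int mult_ac)
  ultimately show "indicator (cbox 0 1) \<theta> *\<^sub>R chr \<alpha> (\<chi> i. cis (2 * pi * \<theta> $ i)) = (\<Prod>i\<in>UNIV. ?h (\<alpha> $ i) (\<theta> $ i))"
   by(simp add:scaleR_conv_of_real of_real_indicator prod.distrib)
 qed
 also have "(LINT \<theta>|lborel. (\<Prod>i\<in>UNIV. ?h (\<alpha> $ i) (\<theta> $ i))) =
   (LINT f|(\<Pi>\<^sub>M b\<in>(Basis::(real^'m) set). lborel). (\<Prod>i\<in>UNIV. ?h (\<alpha> $ i) ((\<Sum>b\<in>Basis. f b *\<^sub>R b) $ i)))"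
  by(subst lborel_eq, rule integral_distr) measurable
 \<comment> \<open>The product measure is indexed by basis vectors, not by coordinates; the inner
   sum reads off the exponent belonging to b = \<open>axis i 1\<close>.\<close>
 also have "... = (LINT f|(\<Pi>\<^sub>M b\<in>(Basis::(real^'m) set). lborel). (\<Prod>b\<in>Basis. ?h (\<Sum>i\<in>UNIV. if b = axis i 1 then \<alpha> $ i else 0) (f b)))"
 proof (rule LINT_cong[OF refl])
  fix f :: "real^'m => real"
  have e1: "(\<Sum>b\<in>Basis. f b *\<^sub>R b) $ i = f (axis i 1)" for i
  proof -
   have "(\<Sum>b\<in>Basis. f b *\<^sub>R b) $ i = (\<Sum>j\<in>UNIV. f (axis j 1) *\<^sub>R (axis j 1 :: real^'m)) $ i"
    unfolding B by(subst sum.reindex[OF inj]) simp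
   also have "... = (\<Sum>j\<in>UNIV. if j = i then f (axis i 1) else 0)"
    unfolding sum_component by(intro sum.cong) (auto simp:axis_def)
   finally show ?thesis by simp
  qed
  have e2: "(\<Sum>i\<in>UNIV. if (axis j 1 :: real^'m) = axis i 1 then \<alpha> $ i else 0) = \<alpha> $ j" for j
   by(simp add:axis_eq_axis)
  show "(\<Prod>i\<in>UNIV. ?h (\<alpha> $ i) ((\<Sum>b\<in>Basis. f b *\<^sub>R b) $ i)) =
   (\<Prod>b\<in>Basis. ?h (\<Sum>i\<in>UNIV. if b = axis i 1 then \<alpha> $ i else 0) (f b))"
   unfolding e1 unfolding B prod.reindex[OF inj] comp_def e2 ..
 qed
 also have "... = (\<Prod>b\<in>(Basis::(real^'m) set). (LINT x|lborel. ?h (\<Sum>i\<in>UNIV. if b = axis i 1 then \<alpha> $ i else 0) x))"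
 proof (rule P.product_integral_prod)
  show "integrable lborel (?h k)" for k
   using borel_integrable_compact[of "{0..1::real}" "%x. cis (2 * pi * (of_int k * x))"]
   by(simp add:scaleR_conv_of_real of_real_indicator continuous_intros)
 qed simp
 also have "... = (\<Prod>j\<in>UNIV. if \<alpha> $ j = 0 then 1 else 0)"
  unfolding integral_cis_period B by(subst prod.reindex[OF inj]) (simp add:axis_eq_axis)
 also have "... = (if \<alpha> = 0 then 1 else 0)"
  by(auto simp:vec_eq_iff)
 finally show ?thesis .
qed


section \<open>Injectivity of the Fourier transform\<close>

text \<open>The transform at 0 shows that the positive and negative parts of r have the same mass c.
  If c > 0, dividing by c gives two probability distributions with equal characteristic functions,
  to which Levy's uniqueness theorem applies.\<close>

lemma real_Fourier_injective:
 fixes r :: "real => real"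
 assumes r: "integrable lborel r" and zero: "!!b. (LINT y|lborel. r y *\<^sub>R iexp (b * y)) = 0"
 shows "AE y in lborel. r y = 0"
proof -
 have [measurable]: "r \<in> bmeas borel" using r by auto
 let ?p = "%y. max 0 (r y)" and ?n = "%y. max 0 (- r y)"
 have pn: "integrable lborel ?p" "integrable lborel ?n" using r by auto
 define c where "c = (LINT y|lborel. ?p y)"
 have eq: "?p y - ?n y = r y" for y by(simp add:max_def)
 have "(LINT y|lborel. r y) = 0"
  using zero[of 0] by(simp add:scaleR_conv_of_real)
 hence "(LINT y|lborel. ?p y - ?n y) = 0" by(simp only:eq)
 hence c2: "c = (LINT y|lborel. ?n y)"
  using pn by(simp add:c_def)
 have c0: "0 <= c" by(simp add:c_def)
 show ?thesis
 proof (cases "c = 0")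
  case True
  have "AE y in lborel. ?p y = 0" "AE y in lborel. ?n y = 0"
   using True c2 integral_nonneg_eq_0_iff_AE[OF pn(1)] integral_nonneg_eq_0_iff_AE[OF pn(2)]
   by(auto simp:c_def)
  thus ?thesis by eventually_elim (auto simp:max_def split: if_splits)
 next
  case False
  hence c: "0 < c" using c0 by simp
  define P N where "P = density lborel (%y. ennreal (?p y / c))" and "N = density lborel (%y. ennreal (?n y / c))"
  have dist: "real_distribution (density lborel (%y. ennreal (q y / c)))"
   if q: "integrable lborel q" "!!y. 0 <= q y" "(LINT y|lborel. q y) = c" for q :: "real => real"
  proof -
   have [measurable]: "q \<in> bmeas borel" using q by auto
   have "(\<integral>\<^sup>+y. ennreal (q y / c) \<partial>lborel) = ennreal (LINT y|lborel. q y / c)"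
    using q c by(intro nn_integral_eq_integral) auto
   also have "... = 1" using q c by simp
   finally have "prob_space (density lborel (%y. ennreal (q y / c)))"
    by(intro prob_spaceI) (simp add:emeasure_density)
   thus ?thesis by(simp add:real_distribution_def real_distribution_axioms_def)
  qed
  have char: "char (density lborel (%y. ennreal (q y / c))) b = (LINT y|lborel. q y *\<^sub>R iexp (b * y)) / c"
   if q: "integrable lborel q" "!!y. 0 <= q y" for q b
  proof -
   have [measurable]: "q \<in> bmeas borel" using q by auto
   have "char (density lborel (%y. ennreal (q y / c))) b = (LINT y|lborel. (q y / c) *\<^sub>R iexp (b * y))"
    unfolding char_def using q c by(subst integral_density) auto
   also have "... = (LINT y|lborel. (q y *\<^sub>R iexp (b * y)) / c)"
    by(simp add:scaleR_conv_of_real)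
   finally show ?thesis by simp
  qed
  have iint: "integrable lborel (%y. q y *\<^sub>R iexp (b * y))" if q: "integrable lborel q" for q b
   by(rule LINT_bound[OF q]) (use q in auto)
  have "char P = char N"
  proof
   fix b
   have "(LINT y|lborel. ?p y *\<^sub>R iexp (b * y) - ?n y *\<^sub>R iexp (b * y)) = 0"
    unfolding scaleR_diff_left[symmetric] eq by(rule zero)
   hence "(LINT y|lborel. ?p y *\<^sub>R iexp (b * y)) = (LINT y|lborel. ?n y *\<^sub>R iexp (b * y))"
    using iint[OF pn(1)] iint[OF pn(2)] by simp
   thus "char P b = char N b" unfolding P_def N_def by(subst (1 2) char) (use pn in auto)
  qed
  hence "P = N"
   by(intro Levy_uniqueness) (auto simp:P_def N_def c2[symmetric] c_def[symmetric] intro!:dist pn)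
  hence "AE y in lborel. ennreal (?p y / c) = ennreal (?n y / c)"
   unfolding P_def N_def by(intro sigma_finite_measure.density_unique[OF sigma_finite_lborel]) auto
  thus ?thesis
   by eventually_elim (use c in \<open>auto simp:max_def divide_simps split: if_splits\<close>)
 qed
qed

text \<open>The transform of the conjugate at b is the conjugate of the transform at -b, so it
  vanishes as well; real and imaginary parts are combinations of h and its conjugate.\<close>

lemma Fourier_injective_R:
 fixes h :: "real => complex"
 assumes h: "integrable lborel h" and zero: "!!b. (LINT y|lborel. h y * iexp (b * y)) = 0"
 shows "AE y in lborel. h y = 0"
proof -
 have hint: "integrable lborel (%y. h y * iexp (b * y))" for b
  by(rule LINT_bound[OF h]) (use h in \<open>auto simp:norm_mult\<close>)
 have zero': "(LINT y|lborel. cnj (h y) * iexp (b * y)) = 0" for b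
 proof -
  have "(LINT y|lborel. cnj (h y) * iexp (b * y)) = (LINT y|lborel. cnj (h y * iexp ((- b) * y)))"
   by(simp add:exp_cnj)
  also have "... = cnj (LINT y|lborel. h y * iexp ((- b) * y))" by(rule LINT_cnj)
  finally show ?thesis by(simp only:zero complex_cnj_zero)
 qed
 have hint': "integrable lborel (%y. cnj (h y) * iexp (b * y))" for b
  by(rule LINT_bound[OF h]) (use h in \<open>auto simp:norm_mult\<close>)
 have "AE y in lborel. Re (h y) = 0"
 proof (rule real_Fourier_injective)
  fix b
  have "(LINT y|lborel. Re (h y) *\<^sub>R iexp (b * y)) = (LINT y|lborel. (h y * iexp (b * y) + cnj (h y) * iexp (b * y)) / 2)"
   by(intro LINT_cong refl) (simp add:distrib_right[symmetric] complex_add_cnj scaleR_conv_of_real)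
  also have "... = 0" using hint hint' by(simp add:zero zero' del: of_real_mult)
  finally show "(LINT y|lborel. Re (h y) *\<^sub>R iexp (b * y)) = 0" .
 qed (use h in auto)
 moreover have "AE y in lborel. Im (h y) = 0"
 proof (rule real_Fourier_injective)
  fix b
  have "(LINT y|lborel. Im (h y) *\<^sub>R iexp (b * y)) = (LINT y|lborel. (h y * iexp (b * y) - cnj (h y) * iexp (b * y)) / (2 * \<i>))"
  proof (intro LINT_cong refl)
   fix y
   have "cor (Im (h y)) = (h y - cnj (h y)) / (2 * \<i>)"
    by(simp add:complex_eq_iff)
   thus "Im (h y) *\<^sub>R iexp (b * y) = (h y * iexp (b * y) - cnj (h y) * iexp (b * y)) / (2 * \<i>)"
    by(simp add:scaleR_conv_of_real left_diff_distrib)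
  qed
  also have "... = 0" using hint hint' by(simp add:zero zero' del: of_real_mult)
  finally show "(LINT y|lborel. Im (h y) *\<^sub>R iexp (b * y)) = 0" .
 qed (use h in auto)
 ultimately show ?thesis by eventually_elim (simp add:complex_eq_iff)
qed

section \<open>Trigonometric polynomials on the torus\<close>

inductive trig_poly :: "(complex^'m::finite => complex) => bool"
 where
  trig_poly_zero: "trig_poly (%t. 0)"
 | trig_poly_step: "trig_poly p ==> trig_poly (%t. p t + c * chr \<alpha> t)"

lemma trig_poly_add: "trig_poly q ==> trig_poly p ==> trig_poly (%t. p t + q t)"
proof (induction rule: trig_poly.induct)
 case (trig_poly_step q c \<alpha>)
 from trig_poly.trig_poly_step[OF trig_poly_step.IH[OF trig_poly_step.prems], of c \<alpha>] show ?case
  by(simp add:add.assoc)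
qed simp

lemma trig_poly_chr: "trig_poly (%t. c * chr \<alpha> t)"
 using trig_poly_step[OF trig_poly_zero] by simp

text \<open>Products are identified on the torus only, since the law chr (\<alpha> + \<beta>) = chr
  \<alpha> chr \<beta> can fail at a zero coordinate.\<close>

lemma trig_poly_mult_chr:
 "trig_poly p ==> \<exists>r. trig_poly r \<and> (\<forall>t\<in>torus. r t = p t * (c * chr \<alpha> t))"
proof (induction rule: trig_poly.induct)
 case trig_poly_zero
 show ?case by(rule exI[of _ "%t. 0"]) (simp add:trig_poly.trig_poly_zero)
next
 case (trig_poly_step p c' \<beta>)
 then obtain r where r: "trig_poly r" "\<forall>t\<in>torus. r t = p t * (c * chr \<alpha> t)" by blast
 show ?case
  by(rule exI[of _ "%t. r t + (c' * c) * chr (\<beta> + \<alpha>) t"], rule conjI)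
   (use r in \<open>auto simp:chr_add distrib_right intro:trig_poly.trig_poly_step\<close>)
qed

lemma trig_poly_mult:
 "trig_poly q ==> trig_poly p ==> \<exists>r. trig_poly r \<and> (\<forall>t\<in>torus. r t = p t * q t)"
proof (induction rule: trig_poly.induct)
 case trig_poly_zero
 show ?case by(rule exI[of _ "%t. 0"]) (simp add:trig_poly.trig_poly_zero)
next
 case (trig_poly_step q c \<alpha>)
 obtain r where r: "trig_poly r" "\<forall>t\<in>torus. r t = p t * q t"
  using trig_poly_step.IH[OF trig_poly_step.prems] by blast
 obtain r' where r': "trig_poly r'" "\<forall>t\<in>torus. r' t = p t * (c * chr \<alpha> t)"
  using trig_poly_mult_chr[OF trig_poly_step.prems] by blast
 show ?case
  by(rule exI[of _ "%t. r t + r' t"]) (use r r' in \<open>auto simp:algebra_simps intro:trig_poly_add\<close>)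
qed

lemma trig_poly_sum:
 "finite A ==> (!!i. i \<in> A ==> trig_poly (p i)) ==> trig_poly (%t. \<Sum>i\<in>A. p i t)"
 by(induction A rule: finite_induct) (auto simp:trig_poly_zero intro:trig_poly_add)

text \<open>Bridge to Stone-Weierstrass. On the torus a real-linear functional is a combination of
  the coordinates and their conjugates, and the conjugate of \<open>t $ i\<close> is the character
  with exponent -1 there.\<close>

lemma real_polynomial_function_trig_poly:
 fixes g :: "complex^'m::finite => real"
 assumes "real_polynomial_function g"
 shows "\<exists>p. trig_poly p \<and> (\<forall>t\<in>torus. cor (g t) = p t)"
 using assms
proof (induction rule: real_polynomial_function.induct)
 case (linear f)
 interpret f: bounded_linear f by fact
 let ?a = "%i. cor (f (axis i 1))" and ?b = "%i. cor (f (axis i \<i>))"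
 let ?q = "%i t. ((?a i - \<i> * ?b i) / 2) * chr (axis i 1) t + ((?a i + \<i> * ?b i) / 2) * chr (axis i (-1)) t"
 have "cor (f t) = (\<Sum>i\<in>UNIV. ?q i t)" if t: "t \<in> torus" for t
 proof -
  have "t = (\<Sum>i\<in>UNIV. Re (t $ i) *\<^sub>R axis i 1 + Im (t $ i) *\<^sub>R axis i \<i>)"
  proof (subst vec_eq_iff, intro allI)
   fix j
   have "(\<Sum>i\<in>UNIV. Re (t $ i) *\<^sub>R axis i 1 + Im (t $ i) *\<^sub>R axis i \<i>) $ j =
     (\<Sum>i\<in>UNIV. if i = j then Re (t $ j) *\<^sub>R 1 + Im (t $ j) *\<^sub>R \<i> else 0)"
    unfolding sum_component by(intro sum.cong) (auto simp:axis_def)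
   thus "t $ j = (\<Sum>i\<in>UNIV. Re (t $ i) *\<^sub>R axis i 1 + Im (t $ i) *\<^sub>R axis i \<i>) $ j"
    by(simp add:complex_eq_iff)
  qed
  hence "f t = f (\<Sum>i\<in>UNIV. Re (t $ i) *\<^sub>R axis i 1 + Im (t $ i) *\<^sub>R axis i \<i>)" by simp
  also have "... = (\<Sum>i\<in>UNIV. Re (t $ i) * f (axis i 1) + Im (t $ i) * f (axis i \<i>))"
   by(simp add:f.sum f.add f.scaleR)
  also have "cor ... = (\<Sum>i\<in>UNIV. ?q i t)"
  proof (subst of_real_sum, rule sum.cong[OF refl])
   fix i
   have "chr (axis i (-1)) t = cnj (t $ i)"
   proof -
    have "axis i (-1) = - (axis i 1 :: int^'m)" by(simp add:vec_eq_iff axis_def)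
    thus ?thesis using chr_minus[OF t, of "axis i 1"] by(simp add:chr_axis)
   qed
   thus "cor (Re (t $ i) * f (axis i 1) + Im (t $ i) * f (axis i \<i>)) = ?q i t"
    unfolding chr_axis \<open>chr (axis i (-1)) t = cnj (t $ i)\<close>[unfolded chr_axis]
    by(simp add:complex_eq_iff) (simp add:field_simps)
  qed
  finally show ?thesis .
 qed
 moreover have "trig_poly (%t. \<Sum>i\<in>UNIV. ?q i t)"
  by(intro trig_poly_sum trig_poly_add trig_poly_chr) simp
 ultimately show ?case by blast
next
 case (const c)
 show ?case by(rule exI[of _ "%t. c * chr 0 t"]) (use trig_poly_chr[of "cor c" 0] in simp)
next
 case (add f g)
 then obtain p q where "trig_poly p" "\<forall>t\<in>torus. cor (f t) = p t"
  "trig_poly q" "\<forall>t\<in>torus. cor (g t) = q t" by blast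
 thus ?case by(intro exI[of _ "%t. p t + q t"]) (simp add:trig_poly_add)
next
 case (mult f g)
 then obtain p q where p: "trig_poly p" "\<forall>t\<in>torus. cor (f t) = p t"
  and q: "trig_poly q" "\<forall>t\<in>torus. cor (g t) = q t" by blast
 obtain r where "trig_poly r" "\<forall>t\<in>torus. r t = p t * q t"
  using trig_poly_mult[OF q(1) p(1)] by blast
 thus ?case using p(2) q(2) by(intro exI[of _ r]) simp
qed

text \<open>The functions annihilated by h are enlarged from characters to continuous functions by
  Stone-Weierstrass, to indicators of closed sets by dominated convergence, and to indicators of
  Borel sets because closed sets are a generator stable under intersection.\<close>

lemma Fourier_injective_torus:
 fixes h :: "complex^'m::finite => complex"
 assumes h: "integrable torus_haar h" and zero: "!!\<alpha>. (LINT t|torus_haar. h t * chr \<alpha> t) = 0"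
 shows "AE t in torus_haar. h t = 0"
proof -
 have [measurable]: "h \<in> bmeas torus_haar" using h by auto
 have hg: "integrable torus_haar (%t. h t * g t)"
  if "g \<in> bmeas torus_haar" "!!t. t \<in> torus ==> cmod (g t) <= B" for g :: "complex^'m => complex" and B
 proof (rule LINT_bound[OF integrable_mult_left[OF integrable_norm[OF h], of B]])
  show "AE t in torus_haar. norm (h t * g t) <= norm (norm (h t) * B)"
  proof (rule AE_I2)
   fix t assume "t \<in> space (torus_haar :: (complex^'m) measure)"
   hence "cmod (g t) <= B" using that by simp
   thus "norm (h t * g t) <= norm (norm (h t) * B)"
    using order_trans[OF norm_ge_zero[of "g t"]] by(simp add:norm_mult abs_mult mult_left_mono)
  qed
 qed (use that in simp)
 have chr_m: "chr \<alpha> \<in> bmeas torus_haar" for \<alpha> :: "int^'m"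
  by(rule measurable_torus_haar) measurable
 have poly: "integrable torus_haar (%t. h t * p t) \<and> (LINT t|torus_haar. h t * p t) = 0" if "trig_poly p" for p
  using that
 proof (induction rule: trig_poly.induct)
  case (trig_poly_step p c \<alpha>)
  have "integrable torus_haar (%t. h t * chr \<alpha> t)" by(rule hg[where B = 1]) (simp_all add: chr_m cmod_chr)
  hence "integrable torus_haar (%t. c * (h t * chr \<alpha> t))" by simp
  moreover have "(%t. h t * (p t + c * chr \<alpha> t)) = (%t. h t * p t + c * (h t * chr \<alpha> t))"
   by(simp add:algebra_simps)
  ultimately show ?case using trig_poly_step.IH zero[of \<alpha>] by simp
 qed simp
 define H where "H = (LINT t|torus_haar. cmod (h t))"
 have H: "0 <= H" by(simp add:H_def)
 have cont: "(LINT t|torus_haar. h t * cor (g t)) = 0" if g: "continuous_on UNIV g" for g :: "complex^'m => real"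
 proof -
  have gm: "(%t. cor (g t)) \<in> bmeas torus_haar"
   by(intro measurable_torus_haar borel_measurable_continuous_onI continuous_intros g)
  have "bounded (g ` torus)"
   by(intro compact_imp_bounded compact_continuous_image compact_torus continuous_on_subset[OF g]) simp
  then obtain B where "\<forall>t\<in>torus. \<bar>g t\<bar> <= B" by(auto simp:bounded_iff)
  hence gint: "integrable torus_haar (%t. h t * cor (g t))" by(intro hg[where B = B]) (auto simp:gm)
  have "cmod (LINT t|torus_haar. h t * cor (g t)) <= e" if e: "0 < e" for e
  proof -
   have "0 < e / (H + 1)" using e H by simp
   then obtain q where q: "real_polynomial_function q" "!!t. t \<in> torus ==> \<bar>g t - q t\<bar> < e / (H + 1)"
    using Stone_Weierstrass_real_polynomial_function[OF compact_torus continuous_on_subset[OF g]] by blast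
   obtain p where p: "trig_poly p" "!!t. t \<in> torus ==> cor (q t) = p t"
    using real_polynomial_function_trig_poly[OF q(1)] by blast
   have "(LINT t|torus_haar. h t * cor (g t)) = (LINT t|torus_haar. h t * cor (g t) - h t * p t)"
    using poly[OF p(1)] gint by simp
   also have "cmod ... <= (LINT t|torus_haar. cmod (h t * cor (g t) - h t * p t))"
    by(rule integral_norm_bound)
   also have "... <= (LINT t|torus_haar. cmod (h t) * (e / (H + 1)))"
   proof (rule integral_mono)
    fix t :: "complex^'m" assume "t \<in> space torus_haar"
    hence t: "t \<in> torus" by simp
    have "cmod (h t * cor (g t) - h t * p t) = cmod (h t) * \<bar>g t - q t\<bar>"
     by(simp add:right_diff_distrib[symmetric] norm_mult p(2)[OF t, symmetric] of_real_diff[symmetric] del: of_real_diff)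
    also have "... <= cmod (h t) * (e / (H + 1))"
     using q(2)[OF t] by(intro mult_left_mono) auto
    finally show "cmod (h t * cor (g t) - h t * p t) <= cmod (h t) * (e / (H + 1))" .
   qed (use gint poly[OF p(1)] h in auto)
   also have "... = H * (e / (H + 1))" by(simp add:H_def)
   also have "... <= e" using H e by(simp add:field_simps)
   finally show ?thesis .
  qed
  hence "cmod (LINT t|torus_haar. h t * cor (g t)) <= 0" by(rule field_le_epsilon[of _ 0, simplified])
  thus ?thesis by simp
 qed
 have ind_m: "indicator A \<in> bmeas torus_haar" if "A \<in> sets borel" for A :: "(complex^'m) set"
  using that by(intro measurable_torus_haar) simp
 have closed: "(LINT t|torus_haar. h t * indicator C t) = 0" if C: "closed C" for C :: "(complex^'m) set"
 proof (cases "C = {}")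
  case False
  \<comment> \<open>Continuous functions with values in [0, 1] that decrease to the indicator of
    C.\<close>
  define g where "g = (%k t. max 0 (1 - real k * infdist t C))"
  have "(%k. LINT t|torus_haar. h t * cor (g k t)) ----> (LINT t|torus_haar. h t * indicator C t)"
  proof (rule integral_dominated_convergence[where w = "%t. cmod (h t)"])
   show "(%t. h t * indicator C t) \<in> bmeas torus_haar"
    using ind_m[of C] C by(intro borel_measurable_times) (auto simp:borel_closed)
   have gc: "continuous_on UNIV (g k)" for k unfolding g_def by(intro continuous_intros)
   show "(%t. h t * cor (g k t)) \<in> bmeas torus_haar" for k
    by(rule borel_measurable_times[OF _ measurable_torus_haar[OF borel_measurable_continuous_onI]])
     (auto intro!:continuous_intros gc)
   show "AE t in torus_haar. (%k. h t * cor (g k t)) ----> h t * indicator C t"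
   proof (rule AE_I2)
    fix t :: "complex^'m"
    have "(%k. g k t) ----> indicator C t"
    proof (cases "t \<in> C")
     case False
     hence d: "0 < infdist t C" using C \<open>C ~= {}\<close> by(simp add:in_closed_iff_infdist_zero less_le infdist_nonneg)
     obtain K where K: "1 / infdist t C < real K" using reals_Archimedean2 by blast
     have "g k t = 0" if "k >= K" for k
     proof -
      have "1 < real K * infdist t C" using K d by(simp add:field_simps)
      also have "... <= real k * infdist t C" using that d by(intro mult_right_mono) auto
      finally show ?thesis by(simp add:g_def)
     qed
     hence "\<forall>\<^sub>F k in sequentially. g k t = 0" by(auto simp:eventually_sequentially)
     thus ?thesis using False by(simp add:tendsto_eventually)
    qed (simp add:g_def)
    hence "(%k. h t * cor (g k t)) ----> h t * cor (indicator C t)"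
     by(intro tendsto_intros)
    thus "(%k. h t * cor (g k t)) ----> h t * indicator C t" by(simp add:of_real_indicator)
   qed
   show "AE t in torus_haar. norm (h t * cor (g k t)) <= cmod (h t)" for k
   proof (rule AE_I2)
    fix t :: "complex^'m"
    have "0 <= g k t" "g k t <= 1" by(auto simp:g_def infdist_nonneg)
    thus "norm (h t * cor (g k t)) <= cmod (h t)" by(simp add:norm_mult mult_left_le)
   qed
   show "integrable torus_haar (%t. cmod (h t))" using h by simp
  qed
  moreover have "(LINT t|torus_haar. h t * cor (g k t)) = 0" for k
   by(rule cont) (auto simp:g_def intro!:continuous_intros)
  ultimately show ?thesis using LIMSEQ_unique[OF tendsto_const] by fastforce
 qed simp
 have hA: "integrable torus_haar (%t. h t * indicator A t)" if "A \<in> sets borel" for A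
  by(rule hg[where B = 1]) (use ind_m[OF that] in \<open>auto split: split_indicator\<close>)
 have borel: "(LINT t|torus_haar. h t * indicator A t) = 0" if "A \<in> sets borel" for A
 proof -
  have "A \<in> sigma_sets UNIV (Collect closed)" using that by(simp add:borel_eq_closed)
  thus ?thesis
  proof (rule sigma_sets_induct_disjoint[rotated 2])
   show "Int_stable (Collect closed :: (complex^'m) set set)" by(auto simp:Int_stable_def)
   fix A :: "(complex^'m) set" assume "A \<in> sigma_sets UNIV (Collect closed)"
   hence A: "A \<in> sets borel" by(simp add:borel_eq_closed)
   assume "(LINT t|torus_haar. h t * indicator A t) = 0"
   moreover have "(LINT t|torus_haar. h t * indicator UNIV t) = 0" by(rule closed) simp
   moreover have "(%t. h t * indicator (UNIV - A) t) = (%t. h t * indicator UNIV t - h t * indicator A t)"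
    by(auto split: split_indicator)
   ultimately show "(LINT t|torus_haar. h t * indicator (UNIV - A) t) = 0"
    using hA[OF A] hA[of UNIV] by simp
  next
   fix A :: "nat => (complex^'m) set"
   assume disj: "disjoint_family A" and A: "range A \<subseteq> sigma_sets UNIV (Collect closed)"
    and z: "!!i. (LINT t|torus_haar. h t * indicator (A i) t) = 0"
   have Ab: "A i \<in> sets borel" for i using A by(auto simp:borel_eq_closed)
   have TA: "T \<inter> torus \<in> sets (torus_haar :: (complex^'m) measure)" if "T \<in> sets borel" for T
    using that by(auto simp:sets_torus_haar sets_restrict_space)
   have eq: "(LINT t|torus_haar. h t * indicator T t) = set_lebesgue_integral torus_haar (T \<inter> torus) h" for T
    unfolding set_lebesgue_integral_def
    by(intro LINT_cong) (auto split: split_indicator)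
   have "set_lebesgue_integral torus_haar (\<Union>i. A i \<inter> torus) h = (\<Sum>i. set_lebesgue_integral torus_haar (A i \<inter> torus) h)"
   proof (rule lebesgue_integral_countable_add)
    show "(A i \<inter> torus) \<inter> (A j \<inter> torus) = {}" if "i ~= j" for i j
     using disj that by(auto simp:disjoint_family_on_def)
    have "(\<Union>i. A i \<inter> torus) \<in> sets torus_haar" by(intro sets.countable_UN image_subsetI TA Ab)
    thus "set_integrable torus_haar (\<Union>i. A i \<inter> torus) h"
     unfolding set_integrable_def using h by(rule integrable_mult_indicator)
   qed (use TA[OF Ab] in auto)
   moreover have "(\<Union>i. A i \<inter> torus) = (\<Union>i. A i) \<inter> torus" by auto
   ultimately show "(LINT t|torus_haar. h t * indicator (\<Union>i. A i) t) = 0"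
    using z by(simp add:eq)
  qed (use closed in auto)
 qed
 have "AE t in torus_haar. h t = (%_. 0) t"
 proof (rule torus_haar.density_unique_banach[OF h])
  fix A :: "(complex^'m) set" assume "A \<in> sets torus_haar"
  hence "A \<in> sets borel"
   using torus_sets by(auto simp:sets_torus_haar sets_restrict_space)
  from borel[OF this] show "set_lebesgue_integral torus_haar A h = set_lebesgue_integral torus_haar A (%_. 0)"
   by(simp add:set_lebesgue_integral_def scaleR_conv_of_real of_real_indicator mult.commute)
 qed simp
 thus ?thesis by simp
qed

section \<open>Plancherel theorem for the product of the torus and the line\<close>

definition echar :: "'m::finite DR => 'm TR => complex"
 where "echar \<beta> p = chr (fst \<beta>) (fst p) * iexp (snd \<beta> * snd p)"

definition inv_fourier :: "('m::finite DR => complex) => 'm TR => complex"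
 where "inv_fourier G p = 1 / cor (sqrt (2 * pi)) * (LINT \<beta>|DRm. G \<beta> * echar \<beta> p)"

lemma fourier_eq:
 "fourier g \<beta> = 1 / cor (sqrt (2 * pi)) * (LINT p|TRm. g p * cnj (echar \<beta> p))"
 by(cases \<beta>) (simp add:fourier_def echar_def chr_def case_prod_unfold exp_cnj mult_ac)

lemma space_TR [simp]: "space TRm = torus \<times> UNIV"
 by(simp add:TR_measure_def space_pair_measure)

lemma space_dual [simp]: "space DRm = UNIV"
 by(simp add:dual_measure_def space_pair_measure)

lemma cmod_echar: "p \<in> space TRm ==> cmod (echar \<beta> p) = 1"
 by(auto simp:echar_def norm_mult cmod_chr)

lemma fst_TR [measurable]: "fst \<in> bmeas TRm"
 unfolding TR_measure_def by(rule measurable_compose[OF measurable_fst measurable_torus_haar]) simp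

lemma snd_TR [measurable]: "snd \<in> bmeas TRm"
 unfolding TR_measure_def by(simp add:measurable_compose[OF measurable_snd])

lemma measurable_TR:
 assumes "f \<in> bmeas borel" shows "f \<in> bmeas TRm"
proof -
 have "(%p. (fst p, snd p)) \<in> measurable TRm (borel \<Otimes>\<^sub>M borel)" by measurable
 hence "(%p. p) \<in> measurable TRm borel" by(simp add:borel_prod)
 from measurable_compose[OF this assms] show ?thesis by simp
qed

lemma measurable_dual:
 assumes "!!\<alpha>. (%\<xi>. f (\<alpha>, \<xi>)) \<in> bmeas borel"
 shows "f \<in> bmeas DRm"
 unfolding dual_measure_def using assms by(intro measurable_pair_measure_countable1) auto

lemma measurable_dual_slice:
 "f \<in> bmeas DRm ==> (%\<xi>. f (\<alpha>, \<xi>)) \<in> bmeas borel"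
 using measurable_Pair2[of f "count_space UNIV" lborel borel \<alpha>] by(simp add:dual_measure_def)

lemma sigma_finite_TR: "sigma_finite_measure TRm"
 unfolding TR_measure_def by unfold_locales

lemma sigma_finite_dual: "sigma_finite_measure DRm"
 unfolding dual_measure_def by unfold_locales

interpretation dTR: pair_sigma_finite "DRm :: 'm::finite DR measure"
 "TRm :: 'm TR measure"
 using sigma_finite_TR sigma_finite_dual by(simp add:pair_sigma_finite_def)

text \<open>The frequency \<alpha> ranges over a countable set, so joint measurability reduces to
  measurability for each fixed \<alpha>.\<close>

lemma echar_measurable_joint:
 "(%x. echar (fst x) (snd x)) \<in> bmeas (DRm \<Otimes>\<^sub>M TRm)"
proof -
 let ?M = "DRm \<Otimes>\<^sub>M TRm"
 have [measurable]: "(%x. snd (fst x)) \<in> bmeas ?M"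
  by(rule measurable_compose[OF measurable_fst]) (simp add:dual_measure_def)
 have [measurable]: "(%x. fst (fst x)) \<in> measurable ?M (count_space UNIV)"
  by(rule measurable_compose[OF measurable_fst]) (simp add:dual_measure_def)
 have "(%x. (%\<alpha> x. chr \<alpha> (fst (snd x)) * iexp (snd (fst x) * snd (snd x))) (fst (fst x)) x) \<in> bmeas ?M"
  by(rule measurable_compose_countable) measurable
 thus ?thesis by(simp add:echar_def)
qed

lemma echar_measurable_TR [measurable]: "echar \<beta> \<in> bmeas TRm"
 unfolding echar_def[abs_def] by measurable

lemma echar_measurable_dual [measurable]: "(%\<beta>. echar \<beta> p) \<in> bmeas DRm"
 by(rule measurable_dual) (simp add:echar_def)

lemma inv_fourier_measurable:
 assumes [measurable]: "G \<in> bmeas DRm"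
 shows "inv_fourier G \<in> bmeas TRm"
proof -
 have [measurable]: "(%x. echar (snd x) (fst x)) \<in> bmeas (TRm \<Otimes>\<^sub>M DRm)"
  using measurable_compose[OF measurable_pair_swap' echar_measurable_joint] by(simp add:case_prod_unfold)
 have "(%p. LINT \<beta>|DRm. (%p \<beta>. G \<beta> * echar \<beta> p) p \<beta>) \<in> bmeas TRm"
  using sigma_finite_dual
  by(intro sigma_finite_measure.borel_measurable_lebesgue_integral) (simp_all add: case_prod_unfold)
 thus ?thesis unfolding inv_fourier_def[abs_def] by simp
qed

lemma fourier_measurable:
 assumes [measurable]: "f \<in> bmeas TRm"
 shows "fourier f \<in> bmeas DRm"
proof -
 have [measurable]: "(%x. echar (fst x) (snd x)) \<in> bmeas (DRm \<Otimes>\<^sub>M TRm)"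
  by(rule echar_measurable_joint)
 have "(%\<beta>. LINT p|TRm. (%\<beta> p. f p * cnj (echar \<beta> p)) \<beta> p) \<in> bmeas DRm"
  using sigma_finite_TR
  by(intro sigma_finite_measure.borel_measurable_lebesgue_integral) (simp_all add: case_prod_unfold)
 thus ?thesis unfolding fourier_eq[abs_def] by simp
qed

lemma integrable_bounded_mult:
 fixes f u :: "'a => complex"
 assumes u: "integrable M u" and f: "f \<in> bmeas M" and B: "!!x. x \<in> space M ==> cmod (f x) <= B"
 shows "integrable M (%x. f x * u x)"
proof (rule LINT_bound)
 show "integrable M (%x. B * cmod (u x))" by(rule integrable_mult_right[OF integrable_norm[OF u]])
 show "AE x in M. norm (f x * u x) <= norm (B * cmod (u x))"
 proof (rule AE_I2)
  fix x assume "x \<in> space M"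
  hence "cmod (f x) * cmod (u x) <= B * cmod (u x)" by(intro mult_right_mono B) auto
  thus "norm (f x * u x) <= norm (B * cmod (u x))"
   using order_trans[OF _ abs_ge_self] by(simp add:norm_mult)
 qed
qed (use u f in auto)

section \<open>Iterated integration over the group and over its dual\<close>

lemma emeasure_torus: "emeasure torus_haar (torus :: (complex^'m::finite) set) = 1"
 using torus_haar.emeasure_space_1 unfolding space_torus_haar .

lemma nn_integral_TR_snd:
 assumes [measurable]: "g \<in> bmeas borel"
 shows "(\<integral>\<^sup>+p. g (snd p) \<partial>(TRm :: 'a::finite TR measure)) = (\<integral>\<^sup>+y. g y \<partial>lborel)"
proof -
 have "(\<integral>\<^sup>+p. g (snd p) \<partial>(TRm :: 'a TR measure)) = (\<integral>\<^sup>+t. \<integral>\<^sup>+y. g (snd (t, y)) \<partial>lborel \<partial>(torus_haar :: (complex^'a) measure))"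
 proof -
  have "(%p. g (snd p)) \<in> bmeas ((torus_haar :: (complex^'a) measure) \<Otimes>\<^sub>M lborel)" by measurable
  from sigma_finite_measure.nn_integral_fst[OF sigma_finite_lborel this, symmetric] show ?thesis
   by(simp only:TR_measure_def)
 qed
 thus ?thesis by(simp add:emeasure_torus)
qed

lemma TR_prod:
 fixes u :: "complex^'m::finite => complex" and v :: "real => complex"
 assumes u: "u \<in> bmeas torus_haar" "!!t. t \<in> torus ==> cmod (u t) <= B"
  and v: "integrable lborel v"
 shows "integrable TRm (%p. u (fst p) * v (snd p))"
  and "(LINT p|TRm. u (fst p) * v (snd p)) = (LINT t|torus_haar. u t) * (LINT y|lborel. v y)"
proof -
 have [measurable]: "v \<in> bmeas borel" using v by auto
 have um: "(%p. u (fst p)) \<in> bmeas TRm"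
  unfolding TR_measure_def by(rule measurable_compose[OF measurable_fst u(1)])
 have "integrable TRm (%p. v (snd p) :: complex)"
  using v by(simp add:integrable_iff_bounded nn_integral_TR_snd[of "%y. ennreal (cmod (v y))"])
 hence "integrable TRm (%p::'m TR. B * cmod (v (snd p)))"
  by(intro integrable_mult_right integrable_norm)
 thus int: "integrable TRm (%p. u (fst p) * v (snd p))"
 proof (rule LINT_bound)
  show "AE p in TRm. norm (u (fst p) * v (snd p)) <= norm (B * cmod (v (snd p)))"
  proof (rule AE_I2)
   fix p :: "'m TR" assume "p \<in> space TRm"
   hence "cmod (u (fst p)) <= B" using u by auto
   thus "norm (u (fst p) * v (snd p)) <= norm (B * cmod (v (snd p)))"
    using order_trans[OF norm_ge_zero] by(auto simp:norm_mult abs_mult intro!:mult_right_mono)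
  qed
 qed (use um in measurable)
 have "(LINT p|TRm. u (fst p) * v (snd p)) = (LINT t|torus_haar. LINT y|lborel. u t * v y)"
  using TR.integral_fst'[OF int[unfolded TR_measure_def]] by(simp add:TR_measure_def)
 thus "(LINT p|TRm. u (fst p) * v (snd p)) = (LINT t|torus_haar. u t) * (LINT y|lborel. v y)"
  by simp
qed

lemma dual_single:
 fixes v :: "real => complex" and \<alpha> :: "int^'m::finite"
 assumes v: "integrable lborel v"
 shows "integrable DRm (%\<beta>. if fst \<beta> = \<alpha> then v (snd \<beta>) else 0)"
  and "(LINT \<beta>|DRm. (if fst \<beta> = \<alpha> then v (snd \<beta>) else 0)) = (LINT \<xi>|lborel. v \<xi>)"
proof -
 have vm [measurable]: "v \<in> bmeas borel" using v by auto
 let ?f = "%\<beta>. if fst \<beta> = \<alpha> then v (snd \<beta>) else 0"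
 have fm: "?f \<in> bmeas DRm"
 proof (rule measurable_dual)
  show "(%\<xi>. ?f (a, \<xi>)) \<in> bmeas borel" for a by(cases "a = \<alpha>") simp_all
 qed
 have fm': "(%\<beta>. ennreal (cmod (?f \<beta>))) \<in> bmeas (count_space UNIV \<Otimes>\<^sub>M lborel)"
  using fm by(simp add:dual_measure_def)
 have "(\<integral>\<^sup>+\<beta>. ennreal (cmod (?f \<beta>)) \<partial>DRm) =
   (\<integral>\<^sup>+a. \<integral>\<^sup>+\<xi>. ennreal (cmod (?f (a, \<xi>))) \<partial>lborel \<partial>count_space UNIV)"
  unfolding dual_measure_def by(rule sigma_finite_measure.nn_integral_fst[OF sigma_finite_lborel fm', symmetric])
 also have "... = (\<Sum>a\<in>{\<alpha>}. \<integral>\<^sup>+\<xi>. ennreal (cmod (?f (a, \<xi>))) \<partial>lborel)"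
  by(rule nn_integral_count_space') auto
 also have "... < \<infinity>" using v by(simp add:integrable_iff_bounded)
 finally show int: "integrable DRm ?f" using fm by(simp add:integrable_iff_bounded)
 have "(LINT \<beta>|DRm. ?f \<beta>) = (LINT a|count_space UNIV. LINT \<xi>|lborel. ?f (a, \<xi>))"
  using dual.integral_fst'[OF int[unfolded dual_measure_def]] by(simp add:dual_measure_def)
 also have "... = (LINT \<xi>|lborel. v \<xi>)"
 proof -
  define X where "X a = (LINT \<xi>|lborel. ?f (a, \<xi>))" for a
  have X0: "X a = 0" if "a ~= \<alpha>" for a using that by(simp add:X_def)
  have X1: "X \<alpha> = (LINT \<xi>|lborel. v \<xi>)" by(simp add:X_def)
  have sub: "{a \<in> UNIV. X a ~= 0} \<subseteq> {\<alpha>}" using X0 by auto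
  have "(LINT a|count_space UNIV. X a) = (\<Sum>a | a \<in> UNIV \<and> X a ~= 0. X a)"
   by(rule lebesgue_integral_count_space_finite_support[OF finite_subset[OF sub]]) simp
  also have "... = (\<Sum>a\<in>{\<alpha>}. X a)" by(rule sum.mono_neutral_left) (use sub in auto)
  finally show ?thesis using X1 by(simp add:X_def)
 qed
 finally show "(LINT \<beta>|DRm. ?f \<beta>) = (LINT \<xi>|lborel. v \<xi>)" .
qed

lemma (in pair_sigma_finite) integrable_mult_pair:
 fixes f :: "'a => complex" and g :: "'b => complex"
 assumes f: "integrable M1 f" and g: "integrable M2 g"
 shows "integrable (M1 \<Otimes>\<^sub>M M2) (%x. f (fst x) * g (snd x))"
proof (rule Fubini_integrable)
 have [measurable]: "f \<in> bmeas M1" "g \<in> bmeas M2" using f g by auto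
 show "(%x. f (fst x) * g (snd x)) \<in> bmeas (M1 \<Otimes>\<^sub>M M2)" by measurable
 show "integrable M1 (%x. \<integral>y. norm (f (fst (x, y)) * g (snd (x, y))) \<partial>M2)"
  using f by(simp add:norm_mult)
 show "AE x in M1. integrable M2 (%y. f (fst (x, y)) * g (snd (x, y)))" using g by simp
qed

text \<open>Fubini: the characters have modulus 1 on the group, so f and G control the double
  integral. The integral transforms are linked to the L^2 correspondence through this
  identity.\<close>

lemma fourier_adjoint:
 assumes f: "integrable TRm f" and G: "integrable DRm G"
 shows "(LINT p|TRm. f p * cnj (inv_fourier G p)) = (LINT \<beta>|DRm. fourier f \<beta> * cnj (G \<beta>))"
proof -
 let ?c = "1 / cor (sqrt (2 * pi))"
 let ?K = "%\<beta> p. f p * cnj (G \<beta>) * cnj (echar \<beta> p)"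
 have [measurable]: "f \<in> bmeas TRm" "G \<in> bmeas DRm" using f G by auto
 have [measurable]: "(%x. echar (fst x) (snd x)) \<in> bmeas (DRm \<Otimes>\<^sub>M TRm)"
  by(rule echar_measurable_joint)
 have G': "integrable DRm (%\<beta>. cnj (G \<beta>))" using G by simp
 have K: "integrable (DRm \<Otimes>\<^sub>M TRm) (case_prod ?K)"
 proof (rule LINT_bound[OF dTR.integrable_mult_pair[OF G' f]])
  show "AE x in DRm \<Otimes>\<^sub>M TRm. norm (case x of (\<beta>, p) => ?K \<beta> p) <= norm (cnj (G (fst x)) * f (snd x))"
   by(rule AE_I2) (auto simp:space_pair_measure norm_mult cmod_echar mult.commute)
 qed (simp add:case_prod_unfold)
 have "(LINT p|TRm. f p * cnj (inv_fourier G p)) = (LINT p|TRm. ?c * (LINT \<beta>|DRm. ?K \<beta> p))"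
  unfolding inv_fourier_def complex_cnj_mult LINT_cnj[symmetric]
  by(simp add:mult_ac)
 also have "... = ?c * (LINT \<beta>|DRm. LINT p|TRm. ?K \<beta> p)"
  using dTR.Fubini_integral[OF K] by simp
 also have "... = (LINT \<beta>|DRm. fourier f \<beta> * cnj (G \<beta>))"
 proof -
  have "(LINT p|TRm. ?K \<beta> p) = cnj (G \<beta>) * (LINT p|TRm. f p * cnj (echar \<beta> p))" for \<beta>
   by(subst LINT_mult_right[symmetric]) (simp add:mult_ac)
  thus ?thesis unfolding fourier_eq
   by(subst LINT_mult_right[symmetric]) (simp add:mult_ac)
 qed
 finally show ?thesis .
qed

text \<open>With w = a + i b, translation by a completes the square and leaves the characteristic
  function of the standard normal distribution at b.\<close>

lemma gaussian_integral:
 fixes w :: complex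
 shows "integrable lborel (%y. exp (w * cor y - (cor y)\<^sup>2 / 2))"
  and "(LINT y|lborel. exp (w * cor y - (cor y)\<^sup>2 / 2)) = sqrt (2 * pi) * exp (w\<^sup>2 / 2)"
proof -
 define a b where "a = Re w" and "b = Im w"
 have w: "w = cor a + \<i> * cor b" by(simp add:a_def b_def complex_eq_iff)
 let ?f = "%y. exp (w * cor y - (cor y)\<^sup>2 / 2)"
 let ?g = "%y::real. (exp (- y\<^sup>2 / 2)) *\<^sub>R iexp (b * y)"
 have std: "sqrt (2 * pi) * std_normal_density y = exp (- y\<^sup>2 / 2)" for y
  by(simp add:std_normal_density_def)
 have "integrable lborel (%y. sqrt (2 * pi) * std_normal_density y)" 
  using integrable_std_normal_moment[of 0] by simp
 hence "integrable lborel (%y::real. exp (- y\<^sup>2 / 2))" unfolding std .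
 hence gint: "integrable lborel ?g"
  by(rule LINT_bound) auto
 have "cor (exp (- b\<^sup>2 / 2)) = (LINT y|lborel. std_normal_density y *\<^sub>R iexp (b * y))"
  using fun_cong[OF char_std_normal_distribution, of b] unfolding char_def
  by(subst (asm) integral_density) auto
 hence "(LINT y|lborel. sqrt (2 * pi) *\<^sub>R (std_normal_density y *\<^sub>R iexp (b * y))) = sqrt (2 * pi) * exp (- b\<^sup>2 / 2)"
  by(simp add:scaleR_conv_of_real)
 moreover have "sqrt (2 * pi) *\<^sub>R (std_normal_density y *\<^sub>R iexp (b * y)) = ?g y" for y
  unfolding scaleR_scaleR std ..
 ultimately have gval: "(LINT y|lborel. ?g y) = sqrt (2 * pi) * exp (- b\<^sup>2 / 2)" by(simp only:)
 have shift: "?f (a + 1 * y) = exp (a\<^sup>2 / 2 + \<i> * a * b) * ?g y" for y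
 proof -
  have "w * cor (a + 1 * y) - (cor (a + 1 * y))\<^sup>2 / 2 =
    (a\<^sup>2 / 2 + \<i> * a * b) + (cor (- y\<^sup>2 / 2) + \<i> * cor (b * y))"
   by(simp add:w power2_eq_square field_simps)
  thus ?thesis by(simp only:exp_add exp_of_real scaleR_conv_of_real)
 qed
 have "integrable lborel (%y. ?f (a + 1 * y))" unfolding shift by(rule integrable_mult_right[OF gint])
 thus "integrable lborel ?f" using lborel_integrable_real_affine_iff[of 1 ?f a] by simp
 have "(LINT y|lborel. ?f y) = (LINT y|lborel. ?f (a + 1 * y))"
  using lborel_integral_real_affine[of 1 ?f a] by simp
 also have "... = exp (a\<^sup>2 / 2 + \<i> * a * b) * (sqrt (2 * pi) * exp (- b\<^sup>2 / 2))"
  unfolding shift by(simp only:LINT_mult_right gval)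
 also have "... = sqrt (2 * pi) * exp (w\<^sup>2 / 2)"
 proof -
  have "w\<^sup>2 / 2 = (a\<^sup>2 / 2 + \<i> * a * b) + cor (- b\<^sup>2 / 2)"
   by(simp add:w power2_eq_square field_simps)
  thus ?thesis by(simp only:exp_add exp_of_real of_real_mult mult_ac)
 qed
 finally show "(LINT y|lborel. exp (w * cor y - (cor y)\<^sup>2 / 2)) = sqrt (2 * pi) * exp (w\<^sup>2 / 2)"
  by simp
qed

text \<open>
 The Gaussian packets: \<open>gauss_dual i\<close> is the Fourier transform of \<open>gauss i\<close>.  Imaginary
 \<open>c\<close> makes the first family total, real \<open>c\<close> the second.
\<close>

definition gauss :: "(int^'m::finite) \<times> complex => 'm TR => complex"
 where "gauss i p = chr (fst i) (fst p) * exp (snd i * cor (snd p) - (cor (snd p))\<^sup>2 / 2)"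

definition gauss_dual :: "(int^'m::finite) \<times> complex => 'm DR => complex"
 where "gauss_dual i \<beta> = (if fst \<beta> = fst i then exp ((snd i - \<i> * snd \<beta>)^2 / 2) else 0)"

section \<open>Gaussian packets and their transforms\<close>

lemma chr_measurable_haar: "chr \<alpha> \<in> bmeas torus_haar"
 by(rule measurable_torus_haar) measurable

lemma gauss_integrable: "integrable TRm (gauss i)"
 unfolding gauss_def[abs_def]
 by(rule TR_prod(1)[of _ 1 "%y. exp (snd i * cor y - (cor y)\<^sup>2 / 2)"])
  (simp_all add: chr_measurable_haar cmod_chr gaussian_integral(1))

lemma gaussian_sq_integrable: "integrable lborel (%y. (cmod (exp (w * cor y - (cor y)\<^sup>2 / 2)))^2)"
proof (rule LINT_bound)
 show "integrable lborel (%y. exp (cor (2 * Re w) * cor y - (cor y)\<^sup>2 / 2))"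
  by(rule gaussian_integral(1))
 show "AE y in lborel. norm ((cmod (exp (w * cor y - (cor y)\<^sup>2 / 2)))^2) <=
   norm (exp (cor (2 * Re w) * cor y - (cor y)\<^sup>2 / 2))"
 proof (rule AE_I2)
  fix y :: real
  have "(exp (Re w * y - y\<^sup>2 / 2))^2 = exp (2 * (Re w * y - y\<^sup>2 / 2))" by(rule exp_double[symmetric])
  also have "... <= exp (2 * Re w * y - y\<^sup>2 / 2)" by simp
  finally show "norm ((cmod (exp (w * cor y - (cor y)\<^sup>2 / 2)))^2) <=
   norm (exp (cor (2 * Re w) * cor y - (cor y)\<^sup>2 / 2))"
   by(simp add:Re_power2)
 qed
qed simp

lemma gauss_sq_integrable: "TR2 (gauss i)"
proof -
 have m: "gauss i \<in> bmeas TRm" by(rule borel_measurable_integrable[OF gauss_integrable])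
 let ?v = "%y. cor ((cmod (exp (snd i * cor y - (cor y)\<^sup>2 / 2)))^2)"
 have "integrable TRm (%p::'a TR. (%t. 1) (fst p) * ?v (snd p))"
  by(rule TR_prod(1)[of _ 1]) (simp, simp, rule integrable_of_real[OF gaussian_sq_integrable])
 hence "integrable TRm (%p::'a TR. (cmod (exp (snd i * cor (snd p) - (cor (snd p))\<^sup>2 / 2)))^2)"
  using integrable_Re by fastforce
 hence "integrable TRm (%p. (cmod (gauss i p))^2)"
  by(rule Bochner_Integration.integrable_cong[THEN iffD1, OF refl, rotated])
   (auto simp:gauss_def norm_mult cmod_chr)
 thus ?thesis using m by(simp add:sq_integrable_def)
qed

lemma gauss_dual_eq:
 "exp ((c - \<i> * cor \<xi>)^2 / 2) = exp (c\<^sup>2 / 2) * exp ((- \<i> * c) * cor \<xi> - (cor \<xi>)\<^sup>2 / 2)"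
 by(simp add:exp_add[symmetric] power2_eq_square algebra_simps diff_divide_distrib add_divide_distrib)

lemma gauss_dual_integrable: "integrable DRm (gauss_dual i)"
 unfolding gauss_dual_def[abs_def]
 by(rule dual_single(1)[of "%\<xi>. exp ((snd i - \<i> * cor \<xi>)^2 / 2)"])
  (unfold gauss_dual_eq, rule integrable_mult_right, rule gaussian_integral(1))

lemma gauss_dual_sq_integrable: "DR2 (gauss_dual i)"
proof -
 have m: "gauss_dual i \<in> bmeas DRm" by(rule borel_measurable_integrable[OF gauss_dual_integrable])
 let ?v = "%\<xi>. cor ((cmod (exp ((snd i - \<i> * cor \<xi>)^2 / 2)))^2)"
 have "integrable DRm (%\<beta>. if fst \<beta> = fst i then ?v (snd \<beta>) else 0)"
  by(rule dual_single(1), unfold gauss_dual_eq norm_mult power_mult_distrib of_real_mult)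
   (intro integrable_mult_right integrable_of_real gaussian_sq_integrable)
 hence "integrable DRm (%\<beta>. Re (if fst \<beta> = fst i then ?v (snd \<beta>) else 0))" by(rule integrable_Re)
 hence "integrable DRm (%\<beta>. (cmod (gauss_dual i \<beta>))^2)"
  by(rule Bochner_Integration.integrable_cong[THEN iffD1, OF refl, rotated])
   (auto simp:gauss_dual_def simp del: of_real_power)
 thus ?thesis using m by(simp add:sq_integrable_def)
qed

lemma fourier_gauss: "fourier (gauss i) = gauss_dual i"
proof
 fix \<beta> :: "'a DR"
 obtain \<alpha> c where i: "i = (\<alpha>, c)" by(cases i)
 obtain \<gamma> \<xi> where \<beta>: "\<beta> = (\<gamma>, \<xi>)" by(cases \<beta>)
 let ?u = "%t. chr \<alpha> t * cnj (chr \<gamma> t)"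
 let ?v = "%y. exp ((c - \<i> * \<xi>) * cor y - (cor y)\<^sup>2 / 2)"
 have "(LINT p|TRm. gauss i p * cnj (echar \<beta> p)) = (LINT p|TRm. ?u (fst p) * ?v (snd p))"
  by(intro LINT_cong refl)
   (simp add:i \<beta> gauss_def echar_def exp_cnj mult_ac exp_add[symmetric] algebra_simps)
 also have "... = (LINT t|torus_haar. ?u t) * (LINT y|lborel. ?v y)"
  by(rule TR_prod(2)[where B = 1])
   (use gaussian_integral(1)[of "c - \<i> * \<xi>"] in \<open>auto simp:norm_mult cmod_chr intro!:borel_measurable_times borel_measurable_cnj chr_measurable_haar\<close>)
 also have "(LINT t|torus_haar. ?u t) = (LINT t|torus_haar. chr (\<alpha> + (- \<gamma>)) t)"
  by(intro LINT_cong refl) (simp add:chr_add[of _ \<alpha> "- \<gamma>"] chr_minus del: add_uminus_conv_diff)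
 also have "... = (if \<gamma> = \<alpha> then 1 else 0)" by(simp only:integral_chr) auto
 finally show "fourier (gauss i) \<beta> = gauss_dual i \<beta>"
  unfolding fourier_eq using gaussian_integral(2)[of "c - \<i> * \<xi>"] by(simp add:i \<beta> gauss_dual_def)
qed

lemma inv_fourier_gauss_dual: "inv_fourier (gauss_dual i) = gauss i"
proof
 fix p :: "'a TR"
 obtain \<alpha> c where i: "i = (\<alpha>, c)" by(cases i)
 obtain t y where p: "p = (t, y)" by(cases p)
 let ?w = "\<i> * y - \<i> * c"
 let ?v = "%\<xi>::real. (chr \<alpha> t * exp (c\<^sup>2 / 2)) * exp (?w * cor \<xi> - (cor \<xi>)\<^sup>2 / 2)"
 have "(LINT \<beta>|DRm. gauss_dual i \<beta> * echar \<beta> p) =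
   (LINT \<beta>|DRm. (if fst \<beta> = \<alpha> then ?v (snd \<beta>) else 0))"
  by(intro LINT_cong refl)
   (simp add:i p gauss_dual_def echar_def gauss_dual_eq, simp add:exp_add[symmetric] algebra_simps)
 also have "... = chr \<alpha> t * exp (c\<^sup>2 / 2) * (sqrt (2 * pi) * exp (?w\<^sup>2 / 2))"
  using gaussian_integral[of ?w] by(subst dual_single(2)) auto
 also have "... = chr \<alpha> t * (sqrt (2 * pi) * exp (c * cor y - (cor y)\<^sup>2 / 2))"
 proof -
  have "c\<^sup>2 / 2 + ?w\<^sup>2 / 2 = c * cor y - (cor y)\<^sup>2 / 2"
   by(simp add:power2_eq_square algebra_simps add_divide_distrib diff_divide_distrib)
  hence "exp (c\<^sup>2 / 2) * exp (?w\<^sup>2 / 2) = exp (c * cor y - (cor y)\<^sup>2 / 2)"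
   by(simp only:exp_add[symmetric])
  thus ?thesis by(simp add:mult.left_commute mult.assoc)
 qed
 finally show "inv_fourier (gauss_dual i) p = gauss i p"
  by(simp add:inv_fourier_def gauss_def i p)
qed

text \<open>For fixed \<alpha>, injectivity on the line makes the \<alpha>-th torus coefficient
  vanish for almost every y. Countability of the frequencies gives one null set for all \<alpha>,
  and then the torus result applies to almost every slice.\<close>

lemma TR_Fourier_injective:
 fixes h :: "'m::finite TR => complex"
 assumes h: "integrable TRm h" and zero: "!!\<beta>. (LINT p|TRm. h p * echar \<beta> p) = 0"
 shows "AE p in TRm. h p = 0"
proof -
 have [measurable]: "h \<in> bmeas TRm" using h by auto
 have hc: "integrable TRm (%p. h p * echar (\<alpha>, \<xi>) p)" for \<alpha> \<xi>
  by(rule LINT_bound[OF h]) (auto simp:norm_mult cmod_echar)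
 have hchr: "integrable TRm (%p. h p * chr \<alpha> (fst p))" for \<alpha>
  using hc[of \<alpha> 0] by(simp add:echar_def)
 have "AE y in lborel. (LINT t|torus_haar. h (t, y) * chr \<alpha> t) = 0" for \<alpha>
 proof (rule Fourier_injective_R)
  show "integrable lborel (%y. LINT t|torus_haar. h (t, y) * chr \<alpha> t)"
   using TR.integrable_snd[of "%t y. h (t, y) * chr \<alpha> t"] hchr[of \<alpha>]
   by(simp add:TR_measure_def case_prod_unfold)
  fix b
  have "(LINT y|lborel. (LINT t|torus_haar. h (t, y) * chr \<alpha> t) * iexp (b * y)) =
    (LINT y|lborel. LINT t|torus_haar. h (t, y) * echar (\<alpha>, b) (t, y))"
   by(simp add:echar_def mult.assoc[symmetric])
  also have "... = (LINT p|TRm. h p * echar (\<alpha>, b) p)"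
   using TR.integral_snd[of "%t y. h (t, y) * echar (\<alpha>, b) (t, y)"] hc[of \<alpha> b]
   by(simp add:TR_measure_def case_prod_unfold)
  finally show "(LINT y|lborel. (LINT t|torus_haar. h (t, y) * chr \<alpha> t) * iexp (b * y)) = 0"
   by(simp only:zero)
 qed
 hence "AE y in lborel. \<forall>\<alpha>. (LINT t|torus_haar. h (t, y) * chr \<alpha> t) = 0"
  by(simp add:AE_all_countable)
 moreover have "AE y in lborel. integrable torus_haar (%t. h (t, y))"
  using TR.AE_integrable_snd[of "%t y. h (t, y)"] h by(simp add:TR_measure_def case_prod_unfold)
 ultimately have "AE y in lborel. AE t in torus_haar. h (t, y) = 0"
  by eventually_elim (rule Fourier_injective_torus, auto)
 moreover have m: "{p \<in> space TRm. h p = 0} \<in> sets TRm" by measurable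
 ultimately have "AE t in torus_haar. AE y in lborel. h (t, y) = 0"
  using TR.AE_commute[of "%t y. h (t, y) = 0"] by(simp add:TR_measure_def)
 thus ?thesis
  unfolding TR_measure_def by(rule TR.AE_pair_measure[OF m[unfolded TR_measure_def]])
qed

text \<open>The packets with c = -i \<xi> are characters times the Gaussian weight, so this is
  injectivity for the weighted function. Integrability is asked of the weighted function, which
  admits bounded functions besides square integrable ones; both kinds occur in
  \<open>pair_inv_fourier\<close>.\<close>

lemma gauss_total:
 fixes h :: "'m::finite TR => complex"
 assumes h: "integrable TRm (%p. h p * exp (- ((cor (snd p))^2 / 2)))"
  and zero: "!!i. (LINT p|TRm. h p * cnj (gauss i p)) = 0"
 shows "AE p in TRm. h p = 0"
proof -
 have "AE p in TRm. h p * exp (- ((cor (snd p))^2 / 2)) = 0"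
 proof (rule TR_Fourier_injective[OF h])
  fix \<beta> :: "'m DR"
  obtain \<alpha> \<xi> where \<beta>: "\<beta> = (\<alpha>, \<xi>)" by(cases \<beta>)
  have e: "cnj (exp (- (\<i> * \<xi>) * cor y - (cor y)\<^sup>2 / 2)) =
    exp (- ((cor y)^2 / 2)) * iexp (\<xi> * y)" for y
   by(simp add:exp_cnj exp_add[symmetric] mult.assoc)
  have "(LINT p|TRm. h p * exp (- ((cor (snd p))^2 / 2)) * echar \<beta> p) =
    (LINT p|TRm. h p * cnj (gauss (- \<alpha>, - (\<i> * \<xi>)) p))"
  proof (rule LINT_cong[OF refl])
   fix p :: "'m TR" assume "p \<in> space TRm"
   hence "chr (- \<alpha>) (fst p) = cnj (chr \<alpha> (fst p))" by(auto intro:chr_minus)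
   thus "h p * exp (- ((cor (snd p))^2 / 2)) * echar \<beta> p = h p * cnj (gauss (- \<alpha>, - (\<i> * \<xi>)) p)"
    unfolding gauss_def echar_def \<beta> fst_conv snd_conv complex_cnj_mult e by(simp add:mult_ac)
  qed
  thus "(LINT p|TRm. h p * exp (- ((cor (snd p))^2 / 2)) * echar \<beta> p) = 0"
   by(simp only:zero)
 qed
 thus ?thesis by simp
qed

text \<open>Each packet lives on one frequency, so the argument runs slice by slice; after
  conjugation the packet with real c = b contributes exp (i b \<xi>) times the Gaussian weight, up
  to a constant.\<close>

lemma gauss_dual_total:
 fixes h :: "'m::finite DR => complex"
 assumes m: "h \<in> bmeas DRm"
  and h: "!!\<alpha>. integrable lborel (%\<xi>. h (\<alpha>, \<xi>) * exp (- ((cor \<xi>)^2 / 2)))"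
  and zero: "!!i. (LINT \<beta>|DRm. h \<beta> * cnj (gauss_dual i \<beta>)) = 0"
 shows "AE \<beta> in DRm. h \<beta> = 0"
proof -
 have "AE \<xi> in lborel. h (\<alpha>, \<xi>) = 0" for \<alpha>
 proof -
  have "AE \<xi> in lborel. h (\<alpha>, \<xi>) * exp (- ((cor \<xi>)^2 / 2)) = 0"
  proof (rule Fourier_injective_R[OF h])
   fix b :: real
   let ?v = "%\<xi>. h (\<alpha>, \<xi>) * exp (- ((cor \<xi>)^2 / 2)) * iexp (b * \<xi>)"
   have v: "integrable lborel (%\<xi>. exp ((cor b)^2 / 2) * ?v \<xi>)"
    by(rule integrable_mult_right, rule LINT_bound[OF h[of \<alpha>]])
     (use h[of \<alpha>] in \<open>auto simp:norm_mult intro!:borel_measurable_times\<close>)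
   have "0 = (LINT \<beta>|DRm. h \<beta> * cnj (gauss_dual (\<alpha>, cor b) \<beta>))"
    by(simp only:zero)
   also have "... = (LINT \<beta>|DRm. (if fst \<beta> = \<alpha> then exp ((cor b)^2 / 2) * ?v (snd \<beta>) else 0))"
   proof (rule LINT_cong[OF refl])
    fix \<beta> :: "'m DR"
    have "h \<beta> = h (\<alpha>, snd \<beta>)" if "fst \<beta> = \<alpha>" using that by(metis prod.collapse)
    thus "h \<beta> * cnj (gauss_dual (\<alpha>, cor b) \<beta>) =
      (if fst \<beta> = \<alpha> then exp ((cor b)^2 / 2) * ?v (snd \<beta>) else 0)"
     by(simp add:gauss_dual_def gauss_dual_eq exp_cnj exp_add[symmetric] mult_ac)
   qed
   also have "... = (LINT \<xi>|lborel. exp ((cor b)^2 / 2) * ?v \<xi>)" by(rule dual_single(2)[OF v])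
   finally show "(LINT \<xi>|lborel. ?v \<xi>) = 0" by simp
  qed
  thus ?thesis by simp
 qed
 moreover have "{\<beta> \<in> space DRm. h \<beta> = 0} \<in> sets DRm" using m by measurable
 ultimately show ?thesis
  unfolding dual_measure_def by(intro dual.AE_pair_measure) (simp_all add: AE_count_space)
qed

lemma gauss_weight_sq_integrable: "TR2 (%p. exp (- ((cor (snd p))^2 / 2)))"
 using gauss_sq_integrable[of "(0, 0)"] by(simp add:gauss_def[abs_def])

lemma gauss_weight_integrable: "integrable TRm (%p. exp (- ((cor (snd p))^2 / 2)))"
 using gauss_integrable[of "(0, 0)"] by(simp add:gauss_def[abs_def])

lemma sq_integrable_dual_slice:
 assumes "DR2 G"
 shows "sq_integrable lborel (%\<xi>. G (\<alpha>, \<xi>))"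
proof -
 have "integrable (count_space UNIV \<Otimes>\<^sub>M lborel) (%\<beta>. (cmod (G \<beta>))^2)"
  using assms by(simp add:sq_integrable_def dual_measure_def)
 from dual.AE_integrable_fst'[OF this] have "integrable lborel (%\<xi>. (cmod (G (\<alpha>, \<xi>)))^2)"
  by(simp add:AE_count_space)
 thus ?thesis using assms by(simp add:sq_integrable_def measurable_dual_slice)
qed

lemma gaussian_weight_sq_integrable: "sq_integrable lborel (%\<xi>. exp (- ((cor \<xi>)^2 / 2)))"
 using gaussian_sq_integrable[of 0] by(simp add:sq_integrable_def)

interpretation Plancherel: ip_pair
 "Collect (sq_integrable (TRm :: 'm::finite TR measure))" "L2_ip TRm"
 "Collect (sq_integrable (DRm :: 'm DR measure))" "L2_ip DRm" gauss gauss_dual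
proof -
 interpret V: ip_space "Collect (sq_integrable (TRm :: 'm TR measure))" "L2_ip TRm"
  by(rule ip_space_L2)
 interpret W: ip_space "Collect (sq_integrable (DRm :: 'm DR measure))" "L2_ip DRm"
  by(rule ip_space_L2)
 show "ip_pair (Collect (sq_integrable (TRm :: 'm TR measure))) (L2_ip TRm)
  (Collect (sq_integrable (DRm :: 'm DR measure))) (L2_ip DRm) gauss gauss_dual"
 proof
  fix i j :: "(int^'m) \<times> complex"
  show "gauss i \<in> Collect (TR2)" by(simp add:gauss_sq_integrable)
  show "gauss_dual i \<in> Collect (DR2)" by(simp add:gauss_dual_sq_integrable)
  \<comment> \<open>The Gram matrices agree because \<open>fourier\<close> takes
    \<open>gauss\<close> to \<open>gauss_dual\<close> and \<open>inv_fourier\<close> takes it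
    back.\<close>
  show "L2_ip TRm (gauss i) (gauss j) = L2_ip DRm (gauss_dual i) (gauss_dual j)"
   using fourier_adjoint[OF gauss_integrable gauss_dual_integrable, of i j]
   by(simp add:inv_fourier_gauss_dual fourier_gauss L2_ip_def)
 next
  fix s :: "nat => 'm TR => complex"
  assume "!!k. s k \<in> Collect (TR2)"
   "!!\<epsilon>. 0 < \<epsilon> ==> \<exists>N. \<forall>i\<ge>N. \<forall>j\<ge>N. ip_dist (L2_ip TRm) (s i) (s j) < \<epsilon>"
  thus "\<exists>g\<in>Collect (TR2). (%k. ip_dist (L2_ip TRm) (s k) g) ----> 0"
   using sigma_finite_measure.L2_complete[OF sigma_finite_TR, of s] by(metis mem_Collect_eq)
 next
  fix s :: "nat => 'm DR => complex"
  assume "!!k. s k \<in> Collect (DR2)"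
   "!!\<epsilon>. 0 < \<epsilon> ==> \<exists>N. \<forall>i\<ge>N. \<forall>j\<ge>N. ip_dist (L2_ip DRm) (s i) (s j) < \<epsilon>"
  thus "\<exists>g\<in>Collect (DR2). (%k. ip_dist (L2_ip DRm) (s k) g) ----> 0"
   using sigma_finite_measure.L2_complete[OF sigma_finite_dual, of s] by(metis mem_Collect_eq)
 next
  fix f :: "'m TR => complex"
  assume f: "f \<in> Collect (TR2)" and z: "!!i. L2_ip TRm f (gauss i) = 0"
  have "AE p in TRm. f p = 0"
   by(rule gauss_total) (use f z in \<open>auto simp:L2_ip_def intro!:sq_integrable_mult gauss_weight_sq_integrable\<close>)
  thus "TR_nrm f = 0" using f by(simp add:L2_nrm_zero_iff)
 next
  fix F :: "'m DR => complex"
  assume F: "F \<in> Collect (DR2)" and z: "!!i. L2_ip DRm F (gauss_dual i) = 0"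
  have "AE p in DRm. F p = 0"
   by(rule gauss_dual_total)
    (use F z in \<open>auto simp:L2_ip_def sq_integrable_def[of DRm] intro!:sq_integrable_mult sq_integrable_dual_slice gaussian_weight_sq_integrable\<close>)
  thus "ip_norm (L2_ip DRm) F = 0" using F by(simp add:L2_nrm_zero_iff)
 qed
qed

section \<open>Integral transforms inside the L^2 correspondence\<close>

lemma norm_fourier_le:
 assumes f: "integrable TRm f"
 shows "cmod (fourier f \<beta>) <= (LINT p|TRm. cmod (f p)) / sqrt (2 * pi)"
proof -
 have "cmod (LINT p|TRm. f p * cnj (echar \<beta> p)) <= (LINT p|TRm. cmod (f p * cnj (echar \<beta> p)))"
  by(rule integral_norm_bound)
 also have "... = (LINT p|TRm. cmod (f p))"
  by(intro LINT_cong refl) (simp add:norm_mult cmod_echar del: space_TR)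
 finally show ?thesis unfolding fourier_eq by(simp add:norm_mult norm_divide divide_right_mono)
qed

lemma norm_inv_fourier_le:
 assumes G: "integrable DRm G" and p: "p \<in> space TRm"
 shows "cmod (inv_fourier G p) <= (LINT \<beta>|DRm. cmod (G \<beta>)) / sqrt (2 * pi)"
proof -
 have "cmod (LINT \<beta>|DRm. G \<beta> * echar \<beta> p) <= (LINT \<beta>|DRm. cmod (G \<beta> * echar \<beta> p))"
  by(rule integral_norm_bound)
 also have "... = (LINT \<beta>|DRm. cmod (G \<beta>))"
  by(simp add:norm_mult cmod_echar[OF p])
 finally show ?thesis unfolding inv_fourier_def by(simp add:norm_mult norm_divide divide_right_mono)
qed

text \<open>The abstract partner of f and the integral \<open>fourier f\<close> have the same
  pairings with all \<open>gauss_dual i\<close>, so totality identifies them. Square integrability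
  of \<open>fourier f\<close> comes out of this comparison.\<close>

lemma pair_fourier:
 assumes f: "integrable TRm f" and f2: "TR2 f"
 shows "Plancherel.pair f (fourier f)"
proof -
 obtain G where G: "Plancherel.pair f G" using Plancherel.pair_exists[of f] f2 by auto
 have G2: "DR2 G" using Plancherel.pair_W[OF G] by simp
 have fm: "fourier f \<in> bmeas DRm" using f by(intro fourier_measurable) auto
 have Gm: "G \<in> bmeas DRm" using G2 by(simp add:sq_integrable_def)
 have fB: "integrable DRm (%\<beta>. fourier f \<beta> * cnj (gauss_dual i \<beta>))" for i
  by(rule integrable_bounded_mult[OF _ fm norm_fourier_le[OF f]]) (simp add:gauss_dual_integrable)
 have "AE \<beta> in DRm. fourier f \<beta> - G \<beta> = 0"
 proof (rule gauss_dual_total)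
  fix \<alpha>
  have "integrable lborel (%\<xi>. fourier f (\<alpha>, \<xi>) * exp (- ((cor \<xi>)^2 / 2)))"
   by(rule integrable_bounded_mult[OF _ _ norm_fourier_le[OF f]])
    (use gaussian_integral(1)[of 0] measurable_dual_slice[OF fm] in simp_all)
  moreover have "integrable lborel (%\<xi>. G (\<alpha>, \<xi>) * exp (- ((cor \<xi>)^2 / 2)))"
   by(intro sq_integrable_mult sq_integrable_dual_slice gaussian_weight_sq_integrable G2)
  ultimately show "integrable lborel (%\<xi>. (fourier f (\<alpha>, \<xi>) - G (\<alpha>, \<xi>)) * exp (- ((cor \<xi>)^2 / 2)))"
   by(simp add:left_diff_distrib)
 next
  fix i
  have "(LINT \<beta>|DRm. fourier f \<beta> * cnj (gauss_dual i \<beta>)) = (LINT p|TRm. f p * cnj (gauss i p))"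
   using fourier_adjoint[OF f gauss_dual_integrable[of i]] by(simp add:inv_fourier_gauss_dual)
  moreover have "... = (LINT \<beta>|DRm. G \<beta> * cnj (gauss_dual i \<beta>))"
   using G[unfolded Plancherel.pair_def L2_ip_def] by blast
  ultimately show "(LINT \<beta>|DRm. (fourier f \<beta> - G \<beta>) * cnj (gauss_dual i \<beta>)) = 0"
   using fB[of i] sq_integrable_mult[OF G2 sq_integrable_cnj[OF gauss_dual_sq_integrable[of i]]]
   by(simp add:left_diff_distrib)
 qed (use fm Gm in auto)
 hence AE: "AE \<beta> in DRm. G \<beta> = fourier f \<beta>" by eventually_elim simp
 hence F2: "DR2 (fourier f)"
  by(intro sq_integrable_bound[OF G2 fm, of 1]) (auto elim: eventually_mono)
 show ?thesis
  by(rule Plancherel.pair_cong[OF G])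
   (use f2 F2 AE L2_dist_zero_iff[OF G2 F2] Plancherel.V.dist_self in auto)
qed

text \<open>Dual to \<open>pair_fourier\<close>: the bounded function \<open>inv_fourier G\<close>
  is compared with an abstract partner of G by totality of the packets.\<close>

lemma pair_inv_fourier:
 fixes G :: "'m::finite DR => complex"
 assumes G: "integrable DRm G" and G2: "DR2 G"
 shows "Plancherel.pair (inv_fourier G) G"
proof -
 obtain g where g: "Plancherel.pair g G" using Plancherel.pair_exists_inv[of G] G2 by auto
 have g2: "TR2 g" using Plancherel.pair_V[OF g] by simp
 have Im: "inv_fourier G \<in> bmeas TRm" using G by(intro inv_fourier_measurable) auto
 have gm: "g \<in> bmeas TRm" using g2 by(simp add:sq_integrable_def)
 have IB: "integrable TRm (%p. inv_fourier G p * u p)" if u: "integrable TRm u" for u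
  by(rule integrable_bounded_mult[OF u Im norm_inv_fourier_le[OF G]])
 have "AE p in TRm. inv_fourier G p - g p = 0"
 proof (rule gauss_total)
  show "integrable TRm (%p. (inv_fourier G p - g p) * exp (- ((cor (snd p))^2 / 2)))"
   using IB[OF gauss_weight_integrable] sq_integrable_mult[OF g2 gauss_weight_sq_integrable]
   by(simp add:left_diff_distrib)
  fix i :: "(int^'m) \<times> complex"
  have gi: "integrable TRm (%p. cnj (gauss i p))" using gauss_integrable by simp
  have "(LINT p|TRm. inv_fourier G p * cnj (gauss i p)) = cnj (LINT p|TRm. gauss i p * cnj (inv_fourier G p))"
   unfolding LINT_cnj[symmetric] by(simp add:mult.commute)
  also have "... = cnj (LINT \<beta>|DRm. gauss_dual i \<beta> * cnj (G \<beta>))"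
   using fourier_adjoint[OF gauss_integrable[of i] G] by(simp add:fourier_gauss)
  also have "... = (LINT \<beta>|DRm. G \<beta> * cnj (gauss_dual i \<beta>))"
   unfolding LINT_cnj[symmetric] by(simp add:mult.commute)
  also have "... = (LINT p|TRm. g p * cnj (gauss i p))"
   using g[unfolded Plancherel.pair_def L2_ip_def] by(auto simp del: split_paired_All)
  finally show "(LINT p|TRm. (inv_fourier G p - g p) * cnj (gauss i p)) = 0"
   using IB[OF gi] sq_integrable_mult[OF g2 sq_integrable_cnj[OF gauss_sq_integrable[of i]]]
   by(simp add:left_diff_distrib)
 qed
 hence AE: "AE p in TRm. g p = inv_fourier G p" by eventually_elim simp
 hence I2: "TR2 (inv_fourier G)"
  by(intro sq_integrable_bound[OF g2 Im, of 1]) (auto elim: eventually_mono)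
 show ?thesis
  by(rule Plancherel.pair_cong[OF g])
   (use g2 G2 I2 AE L2_dist_zero_iff[OF g2 I2] Plancherel.W.dist_self in auto)
qed

text \<open>An approximating sequence passes to the limit in \<open>pair\<close>. Conversely
  truncation to |y| \<le> k makes an L^2 function integrable, since the strip has finite measure,
  and the isometry transports the convergence.\<close>

lemma is_fourier_L2_iff:
 fixes g :: "'a::finite TR => complex"
 shows "is_fourier_L2 g G \<longleftrightarrow> Plancherel.pair g G"
proof
 assume L: "is_fourier_L2 g G"
 then obtain s where s: "!!k::nat. integrable TRm (s k)" "!!k. TR2 (s k)"
  and lim: "(%k. LINT p|TRm. (cmod (s k p - g p))^2) ----> 0"
   "(%k. LINT q|DRm. (cmod (fourier (s k) q - G q))^2) ----> 0"
  by(auto simp:is_fourier_L2_def)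
 show "Plancherel.pair g G"
 proof (rule Plancherel.pair_limit)
  show "Plancherel.pair (s k) (fourier (s k))" for k by(rule pair_fourier[OF s])
  show "(%k. ip_dist (L2_ip TRm) (s k) g) ----> 0"
   using tendsto_real_sqrt[OF lim(1)] by(simp add:ip_dist_def L2_nrm)
  show "(%k. ip_dist (L2_ip DRm) (fourier (s k)) G) ----> 0"
   using tendsto_real_sqrt[OF lim(2)] by(simp add:ip_dist_def L2_nrm)
 qed (use L in \<open>auto simp:is_fourier_L2_def\<close>)
next
 assume P: "Plancherel.pair g G"
 hence g: "TR2 g" and G: "DR2 G"
  using Plancherel.pair_V[OF P] Plancherel.pair_W[OF P] by auto
 have gm [measurable]: "g \<in> bmeas TRm" using g by(simp add:sq_integrable_def)
 define I :: "nat => 'a TR => complex"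
  where "I = (%k p. indicator {- real k..real k} (snd p))"
 have Im [measurable]: "I k \<in> bmeas TRm" for k
  unfolding I_def by(rule measurable_compose[OF snd_TR]) simp
 have I2: "TR2 (I k)" for k
 proof -
  have "integrable TRm (%p::'a TR. (%t. 1) (fst p) * (indicator {- real k..real k} (snd p) :: complex))"
  proof (rule TR_prod(1)[of _ 1])
   have "integrable lborel (%y. cor (indicator {- real k..real k} y))"
    by(rule integrable_of_real) simp
   thus "integrable lborel (indicator {- real k..real k} :: real => complex)" by(simp add:of_real_indicator)
  qed auto
  hence "integrable TRm (%p. cmod (I k p))" by(simp add:I_def)
  moreover have "(cmod (I k p))^2 = cmod (I k p)" for p by(simp add:I_def split: split_indicator)
  ultimately show ?thesis by(simp add:sq_integrable_def)
 qed
 define s where "s = (%k p. g p * I k p)"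
 have s1: "integrable TRm (s k)" for k unfolding s_def by(rule sq_integrable_mult[OF g I2])
 have s2: "TR2 (s k)" for k
  unfolding s_def by(rule sq_integrable_bound[OF g, of _ 1]) (auto simp:norm_mult I_def split: split_indicator)
 have lim: "(%k. ip_dist (L2_ip TRm) (s k) g) ----> 0"
 proof (rule L2_dominated_convergence[OF _ gm g])
  show "AE p in TRm. cmod (s k p - g p) <= cmod (g p)" for k
   by(rule AE_I2) (auto simp:s_def I_def split: split_indicator)
  show "AE p in TRm. (%k. s k p) ----> g p"
  proof (rule AE_I2)
   fix p :: "'a TR"
   obtain K where "\<bar>snd p\<bar> <= real K" using real_arch_simple by blast
   hence "s k p = g p" if "k >= K" for k using that by(auto simp:s_def I_def split: split_indicator)
   thus "(%k. s k p) ----> g p" by(intro tendsto_eventually) (auto simp:eventually_sequentially)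
  qed
 qed (simp add:s_def)
 have P': "Plancherel.pair (s k) (fourier (s k))" for k by(rule pair_fourier[OF s1 s2])
 have "ip_dist (L2_ip DRm) (fourier (s k)) G = ip_dist (L2_ip TRm) (s k) g" for k
  using Plancherel.pair_dist[OF P' P] by simp
 hence lim': "(%k. ip_dist (L2_ip DRm) (fourier (s k)) G) ----> 0" using lim by simp
 show "is_fourier_L2 g G"
  unfolding is_fourier_L2_def
  using g G s1 s2 Plancherel.pair_W[OF P'] tendsto_power[OF lim, of 2] tendsto_power[OF lim', of 2]
  by(auto simp:ip_dist_def L2_nrm_sq intro!:exI[of _ s])
qed

lemma pair_fourier_L2: "TR2 g ==> Plancherel.pair g (fourier_L2 g)"
proof -
 assume "TR2 g"
 hence "\<exists>G. Plancherel.pair g G" by(intro Plancherel.pair_exists) simp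
 thus ?thesis unfolding fourier_L2_def is_fourier_L2_iff by(rule someI_ex)
qed

section \<open>Linear isometries preserve Lebesgue measure\<close>

lemma integrable_gaussian_norm: "integrable lborel (%x::'a::euclidean_space. exp (- (norm x)\<^sup>2 / 2))"
proof -
 have *: "exp (- (norm x)\<^sup>2 / 2) = (\<Prod>b\<in>Basis. exp (- (x \<bullet> b)\<^sup>2 / 2))" for x :: 'a
 proof -
  have "(norm x)^2 = (\<Sum>b\<in>Basis. (x \<bullet> b)^2)"
   unfolding power2_norm_eq_inner using euclidean_inner[of x x] by(simp add:power2_eq_square)
  thus ?thesis by(simp add:exp_sum[symmetric] sum_negf sum_divide_distrib)
 qed
 have 1: "integrable lborel (%y::real. exp (- y\<^sup>2 / 2))"
  using integrable_norm[OF gaussian_integral(1)[of 0]] by simp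
 have "(\<integral>\<^sup>+x. ennreal (exp (- (norm x)\<^sup>2 / 2)) \<partial>(lborel :: 'a measure)) =
   (\<integral>\<^sup>+x. (\<Prod>b\<in>Basis. ennreal (exp (- (x \<bullet> b)\<^sup>2 / 2))) \<partial>(lborel :: 'a measure))"
  unfolding * by(simp add:prod_ennreal)
 also have "... = (\<Prod>b\<in>(Basis :: 'a set). (\<integral>\<^sup>+y. ennreal (exp (- y\<^sup>2 / 2)) \<partial>lborel))"
  by(rule nn_integral_lborel_prod) auto
 also have "... = (\<Prod>b\<in>(Basis :: 'a set). ennreal (LINT y|lborel. exp (- y\<^sup>2 / 2)))"
  by(subst nn_integral_eq_integral[OF 1]) auto
 also have "... < \<infinity>" by(simp add:ennreal_power)
 finally show ?thesis by(intro integrableI_bounded) auto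
qed

lemma nn_integral_lborel_translate:
 fixes g :: "'a::euclidean_space => ennreal"
 assumes "g \<in> bmeas borel"
 shows "(\<integral>\<^sup>+x. g (a + x) \<partial>lborel) = (\<integral>\<^sup>+x. g x \<partial>lborel)"
proof -
 have "(\<integral>\<^sup>+x. g x \<partial>lborel) = (\<integral>\<^sup>+x. g x \<partial>distr lborel borel ((+) a))"
  by(simp add:lborel_distr_plus)
 also have "... = (\<integral>\<^sup>+x. g (a + x) \<partial>lborel)"
  using assms by(subst nn_integral_distr) auto
 finally show ?thesis by simp
qed

text \<open>
 The image of Lebesgue measure is translation invariant; comparing the two measures on
 \<open>f(x) g(y + x)\<close> with a rotation invariant \<open>f\<close> gives equality, without determinants.
\<close>

lemma lborel_distr_isometry:
 fixes T :: "'a::euclidean_space => 'a"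
 assumes lin: "linear T" and norm: "!!x. norm (T x) = norm x"
 shows "distr lborel borel T = lborel"
proof -
 have surj: "surj T"
 proof (rule linear_injective_imp_surjective[OF lin])
  show "inj T" using lin norm
   by(simp add:linear_injective_0) (metis norm_eq_zero)
 qed simp
 have Tm [measurable]: "T \<in> bmeas borel"
  by(intro borel_measurable_continuous_onI linear_continuous_on linear_conv_bounded_linear[THEN iffD1] lin)
 define f where "f = (%x::'a. ennreal (exp (- (norm x)\<^sup>2 / 2)))"
 have fm [measurable]: "f \<in> bmeas borel" by(simp add:f_def)
 define F where "F = (\<integral>\<^sup>+x. f x \<partial>lborel)"
 have Ffin: "F < \<infinity>"
  using integrable_gaussian_norm[where 'a = 'a] by(simp add:integrable_iff_bounded F_def f_def)
 have F0: "F ~= 0"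
 proof
  assume "F = 0"
  hence "AE x in (lborel :: 'a measure). f x = 0" unfolding F_def by(subst (asm) nn_integral_0_iff_AE) auto
  hence "AE x in (lborel :: 'a measure). False" by eventually_elim (simp add:f_def)
  thus False by(auto simp:AE_iff_null null_sets_def)
 qed
 have transl: "(\<integral>\<^sup>+y. g (T y + x) \<partial>lborel) = (\<integral>\<^sup>+y. g (T y) \<partial>lborel)"
  if [measurable]: "g \<in> bmeas borel" for g x
 proof -
  obtain x' where x: "x = T x'" using surj by(auto simp:surj_def)
  have "(\<integral>\<^sup>+y. g (T y + x) \<partial>lborel) = (\<integral>\<^sup>+y. (%y. g (T y)) (x' + y) \<partial>lborel)"
   by(simp add:x linear_add[OF lin] add.commute)
  also have "... = (\<integral>\<^sup>+y. g (T y) \<partial>lborel)" by(rule nn_integral_lborel_translate) measurable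
  finally show ?thesis .
 qed
 have eq: "(\<integral>\<^sup>+y. g (T y) \<partial>lborel) = (\<integral>\<^sup>+y. g y \<partial>lborel)" if gm [measurable]: "g \<in> bmeas borel" for g
 proof -
  have "F * (\<integral>\<^sup>+y. g (T y) \<partial>lborel) = (\<integral>\<^sup>+x. f x * (\<integral>\<^sup>+y. g (T y + x) \<partial>lborel) \<partial>lborel)"
   by(simp add:transl F_def nn_integral_multc)
  also have "... = (\<integral>\<^sup>+x. \<integral>\<^sup>+y. f x * g (T y + x) \<partial>lborel \<partial>lborel)"
   by(simp add:nn_integral_cmult)
  also have "... = (\<integral>\<^sup>+y. \<integral>\<^sup>+x. f x * g (T y + x) \<partial>lborel \<partial>lborel)"
   by(rule lborel_pair.Fubini') measurable
  also have "... = (\<integral>\<^sup>+y. \<integral>\<^sup>+x. f (x - T y) * g x \<partial>lborel \<partial>lborel)"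
  proof (rule nn_integral_cong)
   fix y
   have "(\<integral>\<^sup>+x. (%x. f (x - T y) * g x) (T y + x) \<partial>lborel) = (\<integral>\<^sup>+x. f (x - T y) * g x \<partial>lborel)"
    by(rule nn_integral_lborel_translate) measurable
   thus "(\<integral>\<^sup>+x. f x * g (T y + x) \<partial>lborel) = (\<integral>\<^sup>+x. f (x - T y) * g x \<partial>lborel)" by simp
  qed
  also have "... = (\<integral>\<^sup>+x. \<integral>\<^sup>+y. f (x - T y) * g x \<partial>lborel \<partial>lborel)"
   by(rule lborel_pair.Fubini') measurable
  also have "... = (\<integral>\<^sup>+x. g x * (\<integral>\<^sup>+y. f (T y + (- x)) \<partial>lborel) \<partial>lborel)"
  proof (rule nn_integral_cong)
   fix x
   have "f (x - T y) = f (T y + (- x))" for y by(simp add:f_def norm_minus_commute)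
   thus "(\<integral>\<^sup>+y. f (x - T y) * g x \<partial>lborel) = g x * (\<integral>\<^sup>+y. f (T y + (- x)) \<partial>lborel)"
    by(simp add:nn_integral_cmult[symmetric] mult.commute)
  qed
  also have "... = (\<integral>\<^sup>+x. g x * F \<partial>lborel)"
  proof -
   have "(\<integral>\<^sup>+y. f (T y + (- x)) \<partial>lborel) = F" for x
    by(subst transl) (simp_all add: F_def f_def norm)
   thus ?thesis by(simp only:)
  qed
  also have "... = F * (\<integral>\<^sup>+y. g y \<partial>lborel)" by(simp add:nn_integral_cmult mult.commute[of _ F])
  finally show ?thesis using less_imp_neq[OF Ffin] F0 by(simp add:ennreal_mult_cancel_left)
 qed
 show ?thesis
 proof (rule measure_eqI)
  fix A assume "A \<in> sets (distr lborel borel T)"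
  hence A [measurable]: "A \<in> sets borel" by simp
  have "emeasure (distr lborel borel T) A = (\<integral>\<^sup>+x. indicator A x \<partial>distr lborel borel T)"
   using A by(intro nn_integral_indicator[symmetric]) simp
  also have "... = (\<integral>\<^sup>+x. indicator A (T x) \<partial>lborel)"
   by(rule nn_integral_distr) measurable
  also have "... = emeasure lborel A" by(subst eq) simp_all
  finally show "emeasure (distr lborel borel T) A = emeasure lborel A" .
 qed simp
qed


section \<open>Circle averages of holomorphic functions\<close>

definition circle :: "real measure"
 where "circle = density lborel (indicator {0..1})"

lemma sets_circle [simp, measurable_cong]: "sets circle = sets borel"
 by(simp add:circle_def)

lemma space_circle [simp]: "space circle = UNIV"
 by(simp add:circle_def)

lemma prob_space_circle: "prob_space circle"
 by(rule prob_spaceI) (simp add:circle_def emeasure_density)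

interpretation circle: prob_space circle
 by(rule prob_space_circle)

lemma circle_integral:
 fixes h :: "real => complex"
 assumes c: "continuous_on UNIV h" and h: "(h has_integral I) {0..1}"
 shows "(LINT x|circle. h x) = I"
proof -
 have "integrable lborel (%x. indicator {0..1} x *\<^sub>R h x)"
  by(rule borel_integrable_compact) (use continuous_on_subset[OF c] in auto)
 hence "(LINT x|lborel. indicator {0..1} x *\<^sub>R h x) = integral {0..1} h"
  using set_borel_integral_eq_integral(2)[of "{0..1::real}" h]
  by(simp add:set_integrable_def set_lebesgue_integral_def)
 moreover have "(LINT x|circle. h x) = (LINT x|lborel. indicator {0..1} x *\<^sub>R h x)"
 proof -
  have ceq: "circle = density lborel (%x. ennreal (indicator {0..1} x))"
   by(simp add:circle_def ennreal_indicator)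
  show ?thesis unfolding ceq
   by(subst integral_density) (use c in \<open>auto simp:borel_measurable_continuous_onI\<close>)
 qed
 ultimately show ?thesis using h by(simp add:integral_unique)
qed

lemma cis_power_neg: "cis (- (real k * t)) = inverse (cis t ^ k)"
 unfolding Complex.DeMoivre cis_inverse ..

text \<open>Cauchy's formula for the k-th derivative on the circle of radius r, parametrised by
  [0, 1].\<close>

lemma circle_coefficient:
 assumes h: "h holomorphic_on ball 0 R" and r: "0 < r" "r < R"
 shows "(LINT x|circle. h (cor r * cis (2 * pi * x)) * cis (- (real k * (2 * pi * x)))) =
  cor r ^ k * ((deriv ^^ k) h 0 / fact k)"
proof (rule circle_integral)
 have cball: "cball 0 r \<subseteq> ball 0 R" using r by auto
 have hc: "continuous_on (cball 0 r) h"
  using h cball by(meson holomorphic_on_imp_continuous_on continuous_on_subset)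
 have "((%u. h u / (u - 0) ^ Suc k) has_contour_integral 2 * pi * \<i> / fact k * (deriv ^^ k) h 0) (circlepath 0 r)"
  using r by(intro Cauchy_has_contour_integral_higher_derivative_circlepath hc holomorphic_on_subset[OF h]) auto
 hence "((%x. h (circlepath 0 r x) / (circlepath 0 r x) ^ Suc k * vector_derivative (circlepath 0 r) (at x within {0..1}))
   has_integral 2 * pi * \<i> / fact k * (deriv ^^ k) h 0) {0..1}"
  by(simp add:has_contour_integral_def)
 hence 1: "((%x. (cor r ^ k / (2 * pi * \<i>)) * (h (circlepath 0 r x) / (circlepath 0 r x) ^ Suc k * vector_derivative (circlepath 0 r) (at x within {0..1})))
   has_integral (cor r ^ k / (2 * pi * \<i>)) * (2 * pi * \<i> / fact k * (deriv ^^ k) h 0)) {0..1}"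
  by(rule has_integral_mult_right)
 have path: "circlepath 0 r x = cor r * cis (2 * pi * x)" for x
  by(simp add:circlepath cis_conv_exp mult_ac)
 have "((%x. h (cor r * cis (2 * pi * x)) * cis (- (real k * (2 * pi * x))))
   has_integral (cor r ^ k / (2 * pi * \<i>)) * (2 * pi * \<i> / fact k * (deriv ^^ k) h 0)) {0..1}"
 proof (rule has_integral_eq[OF _ 1])
  fix x :: real assume x: "x \<in> {0..1}"
  have vd: "vector_derivative (circlepath 0 r) (at x within {0..1}) = 2 * pi * \<i> * r * cis (2 * pi * x)"
   using x by(simp add:vector_derivative_circlepath01 cis_conv_exp mult_ac)
  show "(cor r ^ k / (2 * pi * \<i>)) * (h (circlepath 0 r x) / (circlepath 0 r x) ^ Suc k * vector_derivative (circlepath 0 r) (at x within {0..1})) =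
    h (cor r * cis (2 * pi * x)) * cis (- (real k * (2 * pi * x)))"
   unfolding path vd cis_power_neg using r
   by(simp add:power_mult_distrib field_simps)
 qed
 moreover have "(cor r ^ k / (2 * pi * \<i>)) * (2 * pi * \<i> / fact k * (deriv ^^ k) h 0) =
   cor r ^ k * ((deriv ^^ k) h 0 / fact k)"
  by(simp add:field_simps)
 ultimately show "((%x. h (cor r * cis (2 * pi * x)) * cis (- (real k * (2 * pi * x))))
   has_integral cor r ^ k * ((deriv ^^ k) h 0 / fact k)) {0..1}" by simp
 have "continuous_on UNIV (%x. h (cor r * cis (2 * pi * x)))"
  by(rule continuous_on_compose2[OF hc]) (use r in \<open>auto intro!:continuous_intros simp:norm_mult\<close>)
 thus "continuous_on UNIV (%x. h (cor r * cis (2 * pi * x)) * cis (- (real k * (2 * pi * x))))"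
  by(intro continuous_intros)
qed

lemma circle_mean_value:
 assumes "h holomorphic_on ball 0 R" "1 < R"
 shows "(LINT x|circle. h (cis (2 * pi * x))) = h 0"
 using circle_coefficient[OF assms(1), of 1 0] assms(2) by simp

lemma higher_deriv_exp_linear: "(deriv ^^ k) (%z. exp (a * z)) 0 = (a :: complex) ^ k"
proof -
 have "deriv exp = (exp :: complex => complex)"
  by(rule ext, rule DERIV_imp_deriv, rule DERIV_exp)
 hence "(deriv ^^ k) exp = (exp :: complex => complex)"
  by(induction k) auto
 thus ?thesis
  using higher_deriv_compose_linear[of exp UNIV UNIV 0 a k] by(simp add:holomorphic_on_exp)
qed

text \<open>Conjugating the integrand gives exp (cnj c * z) times the k-th inverse power of z on the
  unit circle, so the integral is the conjugate of a Taylor coefficient of the exponential.\<close>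

lemma circle_exp_coefficient:
 "(LINT x|circle. cis (2 * pi * x) ^ k * exp (cnj (cis (2 * pi * x)) * c)) = c ^ k / fact k"
proof -
 have hol: "(%z. exp (cnj c * z)) holomorphic_on ball 0 2" by(intro holomorphic_intros)
 have "(LINT x|circle. cis (2 * pi * x) ^ k * exp (cnj (cis (2 * pi * x)) * c)) =
   (LINT x|circle. cnj (exp (cnj c * (cor 1 * cis (2 * pi * x))) * cis (- (real k * (2 * pi * x)))))"
 proof (rule LINT_cong[OF refl])
  fix x
  have "cnj (cis (- (real k * (2 * pi * x)))) = cis (2 * pi * x) ^ k"
   by(simp only:cis_cnj minus_minus Complex.DeMoivre)
  thus "cis (2 * pi * x) ^ k * exp (cnj (cis (2 * pi * x)) * c) =
    cnj (exp (cnj c * (cor 1 * cis (2 * pi * x))) * cis (- (real k * (2 * pi * x))))"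
   by(simp add:exp_cnj mult.commute)
 qed
 also have "... = cnj (cor 1 ^ k * ((cnj c) ^ k / fact k))"
  unfolding LINT_cnj
  by(subst circle_coefficient[OF hol]) (simp_all add: higher_deriv_exp_linear)
 finally show ?thesis by simp
qed


section \<open>Hermitian geometry of complex vectors\<close>

definition herm :: "complex^'k::finite => complex^'k => complex"
 where "herm z w = (\<Sum>i\<in>UNIV. z $ i * cnj (w $ i))"

lemma norm_smult: "norm (c *s (z :: complex^'k::finite)) = cmod c * norm z"
 by(simp add:norm_vec_def norm_mult L2_set_right_distrib)

lemma herm_smult_left: "herm (c *s z) w = c * herm z w"
 and herm_smult_right: "herm z (c *s w) = cnj c * herm z w"
 by(simp_all add: herm_def sum_distrib_left mult_ac)

lemma herm_add_left: "herm (z + z') w = herm z w + herm z' w"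
 and herm_add_right: "herm z (w + w') = herm z w + herm z w'"
 by(simp_all add: herm_def sum.distrib algebra_simps)

lemma herm_cnj: "cnj (herm z w) = herm w z"
 by(simp add:herm_def mult.commute)

lemma herm_self: "herm z z = cor ((norm z)^2)"
proof -
 have "(norm z)^2 = (\<Sum>i\<in>UNIV. (cmod (z $ i))^2)"
  by(simp add:norm_vec_def L2_set_def sum_nonneg)
 thus ?thesis by(simp add:herm_def complex_norm_square[symmetric])
qed

lemma norm_herm_le: "cmod (herm z w) <= norm z * norm w"
proof -
 have "cmod (herm z w) <= (\<Sum>i\<in>UNIV. \<bar>cmod (z $ i)\<bar> * \<bar>cmod (w $ i)\<bar>)"
  unfolding herm_def by(rule order_trans[OF norm_sum]) (simp add:norm_mult)
 also have "... <= norm z * norm w"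
  unfolding norm_vec_def by(rule L2_set_mult_ineq)
 finally show ?thesis .
qed

lemma continuous_on_smult [continuous_intros]:
 fixes g :: "'a::topological_space => complex^'k::finite"
 assumes "continuous_on S f" "continuous_on S g"
 shows "continuous_on S (%x. f x *s g x)"
 unfolding vector_scalar_mult_def by(intro continuous_intros assms)

lemma continuous_on_herm [continuous_intros]:
 fixes f g :: "'a::topological_space => complex^'k::finite"
 assumes "continuous_on S f" "continuous_on S g"
 shows "continuous_on S (%x. herm (f x) (g x))"
 unfolding herm_def by(intro continuous_intros assms)

lemma linear_smult: "linear (%z::complex^'k::finite. c *s z)"
 by(rule linearI) (simp_all add: vec_eq_iff algebra_simps)

interpretation lc: pair_sigma_finite "lborel :: (complex^'k::finite) measure" circle
 by unfold_locales

text \<open>Rotations preserve Lebesgue measure, so averaging over them changes no integral; the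
  inner circle integrals are then accessible to one-variable complex analysis.\<close>

lemma rotation_average:
 fixes H :: "complex^'k::finite => complex"
 assumes H: "integrable lborel H"
 shows "(LINT w|lborel. LINT x|circle. H (cis (2 * pi * x) *s w)) = (LINT w|lborel. H w)"
proof -
 have [measurable]: "H \<in> bmeas borel" using H by auto
 have inv: "distr lborel borel (%w::complex^'k. cis (2 * pi * x) *s w) = lborel" for x
  by(rule lborel_distr_isometry) (simp_all add: linear_smult norm_smult)
 have m1: "(%w::complex^'k. c *s w) \<in> bmeas lborel" for c
  by(simp add:borel_measurable_continuous_onI continuous_intros)
 have m: "(%p. cis (2 * pi * snd p) *s fst p) \<in> bmeas (borel :: 'k TR measure)"
  by(intro borel_measurable_continuous_onI continuous_intros)
 have m': "(%p. H (cis (2 * pi * snd p) *s fst p)) \<in> bmeas (lborel \<Otimes>\<^sub>M circle)"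
  using measurable_compose[OF m, of H borel] by(simp add:borel_prod[symmetric] cong: measurable_cong_sets)
 have nn: "(\<integral>\<^sup>+w. ennreal (cmod (H (cis (2 * pi * x) *s w))) \<partial>lborel) = (\<integral>\<^sup>+w. ennreal (cmod (H w)) \<partial>lborel)" for x
 proof -
  have "(\<integral>\<^sup>+w. ennreal (cmod (H w)) \<partial>lborel) =
    (\<integral>\<^sup>+w. ennreal (cmod (H w)) \<partial>distr lborel borel (%w::complex^'k. cis (2 * pi * x) *s w))" by(simp add:inv)
  also have "... = (\<integral>\<^sup>+w. ennreal (cmod (H (cis (2 * pi * x) *s w))) \<partial>lborel)"
   by(rule nn_integral_distr[OF m1]) measurable
  finally show ?thesis by simp
 qed
 have "(\<integral>\<^sup>+p. ennreal (cmod (H (cis (2 * pi * snd p) *s fst p))) \<partial>(lborel \<Otimes>\<^sub>M circle)) =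
   (\<integral>\<^sup>+x. \<integral>\<^sup>+w. ennreal (cmod (H (cis (2 * pi * x) *s w))) \<partial>lborel \<partial>circle)"
  using lc.nn_integral_snd[of "%p. ennreal (cmod (H (cis (2 * pi * snd p) *s fst p)))"] m' by simp
 also have "... = (\<integral>\<^sup>+w. ennreal (cmod (H w)) \<partial>lborel)"
  unfolding nn using circle.emeasure_space_1 by simp
 also have "... < \<infinity>" using H by(simp add:integrable_iff_bounded)
 finally have "integrable (lborel \<Otimes>\<^sub>M circle) (%p. H (cis (2 * pi * snd p) *s fst p))"
  using m' by(simp add:integrable_iff_bounded)
 hence "integrable (lborel \<Otimes>\<^sub>M circle) (%(w, x). H (cis (2 * pi * x) *s w))"
  by(simp add:case_prod_unfold)
 from lc.Fubini_integral[OF this]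
 have "(LINT w|lborel. LINT x|circle. H (cis (2 * pi * x) *s w)) = (LINT x|circle. LINT w|lborel. H (cis (2 * pi * x) *s w))"
  by simp
 also have "... = (LINT x|circle. LINT w|lborel. H w)"
 proof (rule LINT_cong[OF refl])
  fix x
  have "(LINT w|lborel. H w) = (LINT w|distr lborel borel (%w::complex^'k. cis (2 * pi * x) *s w). H w)"
   by(simp add:inv)
  also have "... = (LINT w|lborel. H (cis (2 * pi * x) *s w))" by(rule integral_distr[OF m1]) measurable
  finally show "(LINT w|lborel. H (cis (2 * pi * x) *s w)) = (LINT w|lborel. H w)" by simp
 qed
 also have "... = (LINT w|lborel. H w)" using circle.prob_space by simp
 finally show ?thesis .
qed

lemma integral_lborel_translate:
 fixes H :: "'a::euclidean_space => complex"
 assumes "H \<in> bmeas borel"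
 shows "(LINT x|lborel. H (a + x)) = (LINT x|lborel. H x)"
proof -
 have "(LINT x|lborel. H x) = (LINT x|distr lborel borel ((+) a). H x)" by(simp add:lborel_distr_plus)
 also have "... = (LINT x|lborel. H (a + x))" using assms by(intro integral_distr) auto
 finally show ?thesis by simp
qed


section \<open>Homogeneous components of holomorphic functions on the ball\<close>

lemma mv_holomorphic_line:
 assumes f: "mv_holomorphic_on f U" and S: "!!\<zeta>. \<zeta> \<in> S ==> a + \<zeta> *s b \<in> U"
 shows "(%\<zeta>. f (a + \<zeta> *s b)) holomorphic_on S"
 unfolding holomorphic_on_def
proof
 fix \<zeta> assume "\<zeta> \<in> S"
 then obtain L where L: "(f has_derivative L) (at (a + \<zeta> *s b))" "!!c v. L (c *s v) = c * L v"
  using f S unfolding mv_holomorphic_on_def by blast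
 have "((%\<zeta>. a + \<zeta> *s b) has_derivative (%\<eta>. \<eta> *s b)) (at \<zeta> within S)"
 proof -
  have "bounded_linear (%\<eta>. \<eta> *s b)"
   by(rule linear_conv_bounded_linear[THEN iffD1], rule linearI) (simp_all add: vec_eq_iff algebra_simps)
  hence "((%\<zeta>. \<zeta> *s b) has_derivative (%\<eta>. \<eta> *s b)) (at \<zeta> within S)" by(rule bounded_linear_imp_has_derivative)
  from has_derivative_add[OF has_derivative_const this] show ?thesis by simp
 qed
 from has_derivative_compose[OF this L(1)]
 have "((%\<zeta>. f (a + \<zeta> *s b)) has_derivative (%\<eta>. \<eta> * L b)) (at \<zeta> within S)" by(simp add:L(2))
 moreover have "(%\<eta>. \<eta> * L b) = (*) (L b)" by(auto simp:mult.commute)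
 ultimately have "((%\<zeta>. f (a + \<zeta> *s b)) has_field_derivative L b) (at \<zeta> within S)"
  by(simp add:has_field_derivative_def)
 thus "(%\<zeta>. f (a + \<zeta> *s b)) field_differentiable (at \<zeta> within S)" by(auto simp:field_differentiable_def)
qed

lemma mv_holomorphic_continuous: "mv_holomorphic_on f U ==> continuous_on U f"
 unfolding mv_holomorphic_on_def
 by(metis continuous_at_imp_continuous_on has_derivative_continuous)

text \<open>The degree k part of the power series of f at 0, read off along the complex line through
  w. Small multiples of w lie in the ball, so it is meaningful for every w, as Gaussian integration
  over the whole space requires.\<close>

definition homog :: "nat => (complex^'k::finite => complex) => complex^'k => complex"
 where "homog k f w = (deriv ^^ k) (%\<zeta>. f (\<zeta> *s w)) 0 / fact k"

context
 fixes f :: "complex^'k::finite => complex"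
 assumes hol: "mv_holomorphic_on f (ball 0 1)"
begin

lemma hol_ray: "R * norm w <= 1 ==> (%\<zeta>. f (\<zeta> *s w)) holomorphic_on ball 0 R"
proof -
 assume R: "R * norm w <= 1"
 have "norm (\<zeta> *s w) < 1" if "cmod \<zeta> < R" for \<zeta>
 proof (cases "w = 0")
  case False
  hence "cmod \<zeta> * norm w < R * norm w" using that by simp
  thus ?thesis using R by(simp add:norm_smult)
 qed (simp add:norm_smult)
 thus ?thesis using mv_holomorphic_line[OF hol, of "ball 0 R" 0 w] by simp
qed

lemma homog_circle:
 assumes "0 < r" "r < R" "R * norm w <= 1"
 shows "(LINT x|circle. f ((cor r * cis (2 * pi * x)) *s w) * cis (- (real k * (2 * pi * x)))) =
  cor r ^ k * homog k f w"
 unfolding homog_def by(rule circle_coefficient[OF hol_ray[OF assms(3)] assms(1,2)])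

lemma homog_smult: "homog k f (c *s w) = c ^ k * homog k f w"
proof -
 define R where "R = 1 / ((norm w + 1) * (cmod c + 1))"
 have pos: "0 < norm w + 1" "0 < cmod c + 1" using norm_ge_zero[of w] norm_ge_zero[of c] by linarith+
 hence R: "0 < R" by(simp add:R_def)
 define T where "T = 1 / (norm w + 1)"
 have T: "0 < T" "T * norm w <= 1" using pos by(auto simp:T_def field_simps)
 have "(deriv ^^ k) (%\<zeta>. (%\<zeta>. f (\<zeta> *s w)) (c * \<zeta>)) 0 = c ^ k * (deriv ^^ k) (%\<zeta>. f (\<zeta> *s w)) (c * 0)"
 proof (rule higher_deriv_compose_linear[OF hol_ray[OF T(2)]])
  fix \<zeta> :: complex assume "\<zeta> \<in> ball 0 R"
  hence "cmod \<zeta> < R" by simp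
  have "cmod c * cmod \<zeta> <= (cmod c + 1) * cmod \<zeta>" by(intro mult_right_mono) auto
  also have "... < (cmod c + 1) * R" using \<open>cmod \<zeta> < R\<close> pos by(intro mult_strict_left_mono) auto
  also have "... = T" using pos by(simp add:R_def T_def)
  finally show "c * \<zeta> \<in> ball 0 T" by(simp add:norm_mult)
 qed (use R in auto)
 moreover have "(%\<zeta>. f ((c * \<zeta>) *s w)) = (%\<zeta>. f (\<zeta> *s (c *s w)))"
  by(simp add:vector_smult_assoc mult.commute)
 ultimately show ?thesis by(simp add:homog_def)
qed

lemma homog_sums: "norm z < 1 ==> (%k. homog k f z) sums f z"
proof -
 assume z: "norm z < 1"
 define R where "R = 2 / (1 + norm z)"
 have R: "1 < R" "R * norm z <= 1"
 proof -
  have "0 < 1 + norm z" using norm_ge_zero[of z] by linarith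
  thus "1 < R" "R * norm z <= 1" using z by(auto simp:R_def field_simps)
 qed
 show ?thesis using holomorphic_power_series[OF hol_ray[OF R(2)], of 1] R(1) by(simp add:homog_def)
qed

text \<open>Cauchy's estimate on a circle inside the closed ball of radius 1/2, where f is bounded
  by compactness.\<close>

lemma homog_bound: "\<exists>B\<ge>0. \<forall>w. cmod (homog k f w) <= B * (2 * (norm w + 1)) ^ k"
proof -
 have "compact (f ` cball 0 (1/2))"
  by(intro compact_continuous_image continuous_on_subset[OF mv_holomorphic_continuous[OF hol]]) auto
 hence "bounded (f ` cball 0 (1/2))" by(rule compact_imp_bounded)
 then obtain B where B: "\<forall>w\<in>cball 0 (1/2). cmod (f w) <= B" by(auto simp:bounded_iff)
 have "cmod (f 0) <= B" using B by simp
 hence B0: "0 <= B" using norm_ge_zero order_trans by blast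
 have "cmod (homog k f w) <= B * (2 * (norm w + 1)) ^ k" for w
 proof -
  define r where "r = 1 / (2 * (norm w + 1))"
  have pos: "0 < norm w + 1" using norm_ge_zero[of w] by linarith
  have r: "0 < r" "2 * r * norm w <= 1" "r * norm w <= 1 / 2" using pos by(auto simp:r_def field_simps)
  have hc: "(LINT x|circle. f ((cor r * cis (2 * pi * x)) *s w) * cis (- (real k * (2 * pi * x)))) =
    cor r ^ k * homog k f w"
   by(rule homog_circle[of r "2 * r"]) (use r in auto)
  have "cmod (cor r ^ k * homog k f w) <=
    (LINT x|circle. cmod (f ((cor r * cis (2 * pi * x)) *s w) * cis (- (real k * (2 * pi * x)))))"
   unfolding hc[symmetric] by(rule integral_norm_bound)
  also have "... <= (LINT x|circle. B)"
  proof (rule integral_mono_AE')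
   show "AE x in circle. cmod (f ((cor r * cis (2 * pi * x)) *s w) * cis (- (real k * (2 * pi * x)))) <= B"
    using B r by(intro AE_I2) (auto simp:norm_mult norm_smult)
  qed (use B0 in auto)
  also have "... = B" using circle.prob_space by simp
  finally have "r ^ k * cmod (homog k f w) <= B" using r by(simp add:norm_mult norm_power)
  hence "(r ^ k * cmod (homog k f w)) * (2 * (norm w + 1)) ^ k <= B * (2 * (norm w + 1)) ^ k"
   using pos by(intro mult_right_mono) auto
  moreover have "r * (2 * (norm w + 1)) = 1" using pos by(simp add:r_def)
  hence "r ^ k * (2 * (norm w + 1)) ^ k = 1" by(simp only:power_mult_distrib[symmetric] power_one)
  hence "(r ^ k * cmod (homog k f w)) * (2 * (norm w + 1)) ^ k = cmod (homog k f w)"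
   by(simp only:mult.commute[of "r ^ k"] mult.assoc mult_1_right)
  ultimately show ?thesis by(simp only:)
 qed
 thus ?thesis using B0 by blast
qed

lemma homog_measurable [measurable]: "homog k f \<in> bmeas borel"
proof -
 \<comment> \<open>Extension by zero keeps the average measurable when the circle leaves the
   ball.\<close>
 define f0 where "f0 = (%w. indicator (ball 0 1) w *\<^sub>R f w)"
 have f0 [measurable]: "f0 \<in> bmeas borel"
  unfolding f0_def using borel_measurable_continuous_on_indicator[OF _ mv_holomorphic_continuous[OF hol]] by simp
 define r where "r = (%M::nat. 1 / (2 * (real M + 1)))"
 have r0: "0 < r M" for M by(simp add:r_def)
 define \<phi> where "\<phi> = (%M w. (LINT x|circle. f0 ((cor (r M) * cis (2 * pi * x)) *s w) * cis (- (real k * (2 * pi * x)))) / cor (r M) ^ k)"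
 have "\<phi> M \<in> bmeas borel" for M
 proof -
  have m: "(%p. (cor (r M) * cis (2 * pi * snd p)) *s fst p) \<in> bmeas (borel :: 'k TR measure)"
   by(intro borel_measurable_continuous_onI continuous_intros)
  have "(%p. f0 ((cor (r M) * cis (2 * pi * snd p)) *s fst p) * cis (- (real k * (2 * pi * snd p)))) \<in>
    bmeas (borel :: 'k TR measure)"
   by(intro borel_measurable_times measurable_compose[OF m f0] borel_measurable_continuous_onI continuous_intros)
  hence "(%p. f0 ((cor (r M) * cis (2 * pi * snd p)) *s fst p) * cis (- (real k * (2 * pi * snd p)))) \<in>
    bmeas (borel \<Otimes>\<^sub>M circle)"
   by(simp add:borel_prod[symmetric] cong: measurable_cong_sets)
  hence "(%w. LINT x|circle. f0 ((cor (r M) * cis (2 * pi * x)) *s w) * cis (- (real k * (2 * pi * x)))) \<in> bmeas borel"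
   by(intro circle.borel_measurable_lebesgue_integral) (simp add:case_prod_unfold)
  thus ?thesis unfolding \<phi>_def by measurable
 qed
 moreover have "(%M. \<phi> M w) ----> homog k f w" for w
 proof (rule tendsto_eventually)
  obtain M0 :: nat where M0: "norm w <= real M0" using real_arch_simple by blast
  have "\<phi> M w = homog k f w" if "M >= M0" for M
  proof -
   have "norm w <= real M" using M0 that by linarith
   hence le: "2 * r M * norm w <= 1" by(simp add:r_def field_simps)
   hence "norm ((cor (r M) * cis (2 * pi * x)) *s w) < 1" for x
    using r0[of M] norm_ge_zero[of w] by(simp add:norm_smult norm_mult)
   hence "(LINT x|circle. f0 ((cor (r M) * cis (2 * pi * x)) *s w) * cis (- (real k * (2 * pi * x)))) =
     (LINT x|circle. f ((cor (r M) * cis (2 * pi * x)) *s w) * cis (- (real k * (2 * pi * x))))"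
    by(simp add:f0_def)
   also have "... = cor (r M) ^ k * homog k f w"
    by(rule homog_circle[of _ "2 * r M"]) (use r0[of M] le in auto)
   finally show ?thesis using r0[of M] by(simp add:\<phi>_def)
  qed
  thus "\<forall>\<^sub>F M in sequentially. \<phi> M w = homog k f w" by(auto simp:eventually_sequentially)
 qed
 ultimately show ?thesis by(rule borel_measurable_LIMSEQ_metric[of \<phi>])
qed

text \<open>Homogeneity describes \<open>homog k f\<close> along lines through 0, while this average
  runs over a line through z. So \<open>homog k f\<close> is written as a circle average of f, the
  two circles are exchanged, and the mean value property is applied to f times the exponential,
  which is 1 at the centre.\<close>

lemma homog_mean_value:
 "(LINT x|circle. homog k f (z + cis (2 * pi * x) *s u) * exp (- (cis (2 * pi * x) * c))) = homog k f z"
proof -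
 \<comment> \<open>Small enough for r times the disc of radius 2 around z in direction u to lie in
   the ball; radius 2 leaves room around the unit circle.\<close>
 define r where "r = 1 / (2 * (norm z + 2 * norm u + 1))"
 have pos: "0 < norm z + 2 * norm u + 1" using norm_ge_zero[of z] norm_ge_zero[of u] by linarith
 have r: "0 < r" "2 * r * (norm z + 2 * norm u) <= 1" using pos by(auto simp:r_def field_simps)
 have in_ball: "norm ((cor r * a) *s (z + b *s u)) < 1" if "cmod a = 1" "cmod b < 2" for a b
 proof -
  have "norm (z + b *s u) <= norm z + 2 * norm u"
   using norm_triangle_ineq[of z "b *s u"] mult_right_mono[of "cmod b" 2 "norm u"] that
   by(simp add:norm_smult)
  hence "r * norm (z + b *s u) <= r * (norm z + 2 * norm u)" using r by(intro mult_left_mono) auto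
  moreover have "norm ((cor r * a) *s (z + b *s u)) = r * norm (z + b *s u)"
   using that r by(simp only:norm_smult norm_mult) simp
  ultimately show ?thesis using r by linarith
 qed
 let ?G = "%x y. f ((cor r * cis (2 * pi * y)) *s (z + cis (2 * pi * x) *s u)) * cis (- (real k * (2 * pi * y))) * exp (- (cis (2 * pi * x) * c))"
 have rep: "cor r ^ k * homog k f (z + cis (2 * pi * x) *s u) =
   (LINT y|circle. f ((cor r * cis (2 * pi * y)) *s (z + cis (2 * pi * x) *s u)) * cis (- (real k * (2 * pi * y))))" for x
 proof (rule homog_circle[symmetric, of _ "2 * r"])
  have "norm (z + cis (2 * pi * x) *s u) <= norm z + 2 * norm u"
  proof -
   have "norm (cis (2 * pi * x) *s u) = norm u" by(simp add:norm_smult)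
   thus ?thesis
    using norm_triangle_ineq[of z "cis (2 * pi * x) *s u"] norm_ge_zero[of u] by linarith
  qed
  hence "2 * r * norm (z + cis (2 * pi * x) *s u) <= 2 * r * (norm z + 2 * norm u)"
   using r by(intro mult_left_mono) auto
  thus "2 * r * norm (z + cis (2 * pi * x) *s u) <= 1" using r by linarith
 qed (use r in auto)
 interpret cc: pair_sigma_finite circle circle by unfold_locales
 interpret ccf: finite_measure "circle \<Otimes>\<^sub>M circle"
  by(intro finite_measure_pair_measure circle.finite_measure_axioms)
 have int: "integrable (circle \<Otimes>\<^sub>M circle) (case_prod ?G)"
 proof -
  have cont: "continuous_on UNIV (%p. ?G (fst p) (snd p))"
  proof -
   have "continuous_on UNIV (%p. f ((cor r * cis (2 * pi * snd p)) *s (z + cis (2 * pi * fst p) *s u)))"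
    by(rule continuous_on_compose2[OF mv_holomorphic_continuous[OF hol]])
     (use in_ball in \<open>auto intro!:continuous_intros\<close>)
   thus ?thesis by(intro continuous_intros)
  qed
  have m: "(%p. ?G (fst p) (snd p)) \<in> bmeas (circle \<Otimes>\<^sub>M circle)"
   using borel_measurable_continuous_onI[OF cont] by(simp add:borel_prod[symmetric] cong: measurable_cong_sets)
  have "compact ((%p. ?G (fst p) (snd p)) ` ({0..1} \<times> {0..1}))"
   by(intro compact_continuous_image compact_Times continuous_on_subset[OF cont]) auto
  then obtain B where B: "!!x y. 0 <= x ==> x <= 1 ==> 0 <= y ==> y <= 1 ==> cmod (?G x y) <= B"
   by(force simp:bounded_iff dest!: compact_imp_bounded)
  \<comment> \<open>\<open>circle\<close> is a measure on the whole line, so its concentration on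
    [0, 1] is recorded almost everywhere before the compactness bound is used.\<close>
  have I: "AE x in circle. 0 <= x \<and> x <= 1"
   unfolding circle_def by(subst AE_density) (auto split: split_indicator)
  have "AE p in circle \<Otimes>\<^sub>M circle. (0 <= fst p \<and> fst p <= 1) \<and> (0 <= snd p \<and> snd p <= 1)"
  proof (rule cc.AE_pair_measure)
   show "{p \<in> space (circle \<Otimes>\<^sub>M circle). (0 <= fst p \<and> fst p <= 1) \<and> (0 <= snd p \<and> snd p <= 1)} \<in> sets (circle \<Otimes>\<^sub>M circle)"
    by measurable
   show "AE x in circle. AE y in circle. (0 <= fst (x, y) \<and> fst (x, y) <= 1) \<and> (0 <= snd (x, y) \<and> snd (x, y) <= 1)"
    using I
   proof eventually_elim
    case (elim x)
    show ?case using I by eventually_elim (use elim in auto)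
   qed
  qed
  hence "AE p in circle \<Otimes>\<^sub>M circle. cmod (?G (fst p) (snd p)) <= B"
   by eventually_elim (use B in blast)
  thus ?thesis using ccf.integrable_const_bound[OF _ m] by(simp add:case_prod_unfold)
 qed
 have inner: "(LINT x|circle. ?G x y) = f ((cor r * cis (2 * pi * y)) *s z) * cis (- (real k * (2 * pi * y)))" for y
 proof -
  let ?h = "%\<eta>. f ((cor r * cis (2 * pi * y)) *s z + \<eta> *s ((cor r * cis (2 * pi * y)) *s u)) * cis (- (real k * (2 * pi * y))) * exp (- (\<eta> * c))"
  have e: "(cor r * cis (2 * pi * y)) *s z + \<eta> *s ((cor r * cis (2 * pi * y)) *s u) = (cor r * cis (2 * pi * y)) *s (z + \<eta> *s u)" for \<eta>
   by(simp add:vec_eq_iff algebra_simps)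
  have "?h holomorphic_on ball 0 2"
   by(intro holomorphic_intros mv_holomorphic_line[OF hol]) (unfold e, use in_ball in auto)
  from circle_mean_value[OF this] show ?thesis
   unfolding e by(simp only:vector_smult_lzero add_0_right mult_zero_left minus_zero exp_zero mult_1_right)
 qed
 have "cor r ^ k * (LINT x|circle. homog k f (z + cis (2 * pi * x) *s u) * exp (- (cis (2 * pi * x) * c))) =
   (LINT x|circle. LINT y|circle. ?G x y)"
  by(simp add:rep mult.assoc[symmetric] LINT_mult_right[symmetric] del: LINT_mult_right)
 also have "... = (LINT y|circle. LINT x|circle. ?G x y)" by(rule cc.Fubini_integral[OF int, symmetric])
 also have "... = cor r ^ k * homog k f z"
  unfolding inner
 proof (rule homog_circle[of _ "2 * r"])
  have "2 * r * norm z <= 2 * r * (norm z + 2 * norm u)" using r by(intro mult_left_mono) auto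
  thus "2 * r * norm z <= 1" using r by linarith
 qed (use r in auto)
 finally show ?thesis using r by simp
qed

lemma homog_gaussian_integrable:
 assumes g: "g \<in> bmeas borel" and gb: "!!w. cmod (g w) <= A * exp (b * norm w)"
 shows "integrable lborel (%w. homog k f w * g w * exp (- (cor (norm w))\<^sup>2))"
proof -
 obtain B where B: "B >= 0" "!!w. cmod (homog k f w) <= B * (2 * (norm w + 1)) ^ k" using homog_bound by blast
 have A: "0 <= A" using gb[of 0] by(auto intro:order_trans[OF norm_ge_zero])
 \<comment> \<open>The 2 comes from x^k \<le> k! exp x at x = 2 (s + 1), the b from the growth of g;
   then c s - s^2 \<le> c^2 / 2 - s^2 / 2 leaves half of the Gaussian exponent.\<close>
 define c where "c = 2 + b"
 define D where "D = B * A * (fact k * exp 2) * exp (c\<^sup>2 / 2)"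
 have fm: "fact k * exp (x::real) >= x ^ k" if "0 <= x" for x
 proof -
  have "x ^ k /\<^sub>R fact k <= exp x"
   unfolding exp_def using that summable_exp_generic[of x]
   by(intro sum_le_suminf[of _ "{k}", simplified]) auto
  thus ?thesis by(simp add:field_simps)
 qed
 show ?thesis
 proof (rule LINT_bound[OF integrable_mult_right[OF integrable_gaussian_norm, of D]])
  show "(%w. homog k f w * g w * exp (- (cor (norm w))\<^sup>2)) \<in> bmeas lborel"
   using g by measurable
  show "AE w in lborel. norm (homog k f w * g w * exp (- (cor (norm w))\<^sup>2)) <= norm (D * exp (- (norm w)\<^sup>2 / 2))"
  proof (rule AE_I2)
   fix w :: "complex^'k"
   define s where "s = norm w"
   have s: "0 <= s" by(simp add:s_def)
   have "cmod (exp (- (cor s)\<^sup>2)) = exp (- s\<^sup>2)" by(simp add:Re_power2)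
   hence "norm (homog k f w * g w * exp (- (cor (norm w))\<^sup>2)) = cmod (homog k f w) * cmod (g w) * exp (- s\<^sup>2)"
    by(simp add:norm_mult s_def)
   also have "... <= (B * (fact k * exp (2 * (s + 1)))) * (A * exp (b * s)) * exp (- s\<^sup>2)"
   proof (intro mult_right_mono mult_mono gb[of w, folded s_def])
    have "cmod (homog k f w) <= B * (2 * (s + 1)) ^ k" using B(2) by(simp add:s_def)
    also have "... <= B * (fact k * exp (2 * (s + 1)))" using B(1) s by(intro mult_left_mono fm) auto
    finally show "cmod (homog k f w) <= B * (fact k * exp (2 * (s + 1)))" .
   qed (use B A in auto)
   also have "... = B * A * (fact k * exp 2) * exp (c * s - s\<^sup>2)"
    by(simp add:exp_add[symmetric] exp_diff[symmetric] c_def mult_ac) (simp add:exp_add[symmetric] exp_minus algebra_simps exp_diff)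
   also have "... <= B * A * (fact k * exp 2) * exp (c\<^sup>2 / 2 - s\<^sup>2 / 2)"
   proof -
    have "0 <= (c - s)^2" by simp
    hence "c * s - s\<^sup>2 <= c\<^sup>2 / 2 - s\<^sup>2 / 2" by(simp add:power2_diff) 
    thus ?thesis using B A by(intro mult_left_mono) auto
   qed
   also have "... = D * exp (- s\<^sup>2 / 2)" by(simp add:D_def exp_add[symmetric] mult.assoc)
   finally show "norm (homog k f w * g w * exp (- (cor (norm w))\<^sup>2)) <= norm (D * exp (- (norm w)\<^sup>2 / 2))"
    using order_trans[OF _ abs_ge_self] by(simp add:s_def)
  qed
 qed
qed

text \<open>
 The reproducing property of the Fock space: translating by \<open>z\<close> turns the kernel into
 \<open>exp (- herm u z)\<close>, which is holomorphic in \<open>u\<close>, so the mean value property applies.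
\<close>

lemma homog_fock:
 "(LINT w|lborel. homog k f w * exp (herm z w) * exp (- (cor (norm w))\<^sup>2)) =
  homog k f z * (LINT u|lborel. exp (- (cor (norm (u :: complex^'k)))\<^sup>2))"
proof -
 let ?E = "%w. homog k f w * exp (herm z w) * exp (- (cor (norm w))\<^sup>2)"
 have hm: "(%w. exp (herm z w)) \<in> bmeas borel"
  by(intro borel_measurable_continuous_onI continuous_intros)
 have Eint: "integrable lborel ?E"
 proof (rule homog_gaussian_integrable[OF hm, where A = 1 and b = "norm z"])
  show "cmod (exp (herm z w)) <= 1 * exp (norm z * norm w)" for w
   using order_trans[OF complex_Re_le_cmod norm_herm_le[of z w]] by simp
 qed
 hence Em: "?E \<in> bmeas borel" by auto
 have shift: "?E (z + u) = homog k f (z + u) * exp (- herm u z) * exp (- (cor (norm u))\<^sup>2)" for u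
 proof -
  have "herm z (z + u) - herm (z + u) (z + u) = - herm u z - herm u u"
   by(simp add:herm_add_left herm_add_right)
  hence "exp (herm z (z + u)) * exp (- (cor (norm (z + u)))\<^sup>2) = exp (- herm u z) * exp (- (cor (norm u))\<^sup>2)"
   by(simp add:exp_add[symmetric] herm_self)
  thus ?thesis by(simp add:mult.assoc)
 qed
 have "integrable (distr lborel borel ((+) z)) ?E" using Eint by(simp add:lborel_distr_plus)
 hence Eint': "integrable lborel (%u. ?E (z + u))"
  by(subst (asm) integrable_distr_eq) (use Em in auto)
 have "(LINT w|lborel. ?E w) = (LINT u|lborel. ?E (z + u))" by(rule integral_lborel_translate[OF Em, symmetric])
 also have "... = (LINT u|lborel. LINT x|circle. ?E (z + cis (2 * pi * x) *s u))"
  using rotation_average[OF Eint'] by simp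
 also have "... = (LINT u|lborel. homog k f z * exp (- (cor (norm (u :: complex^'k)))\<^sup>2))"
 proof (rule LINT_cong[OF refl])
  fix u :: "complex^'k"
  have "(LINT x|circle. ?E (z + cis (2 * pi * x) *s u)) =
    (LINT x|circle. homog k f (z + cis (2 * pi * x) *s u) * exp (- (cis (2 * pi * x) * herm u z)) * exp (- (cor (norm u))\<^sup>2))"
   unfolding shift by(simp add:herm_smult_left norm_smult)
  thus "(LINT x|circle. ?E (z + cis (2 * pi * x) *s u)) = homog k f z * exp (- (cor (norm u))\<^sup>2)"
   by(simp add:homog_mean_value)
 qed
 finally show ?thesis by simp
qed

text \<open>Rotating w multiplies \<open>homog k f w\<close> by the k-th power of the phase and
  \<open>herm z w\<close> by its conjugate, so the circle average keeps only the term of degree k of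
  the exponential series.\<close>

lemma homog_fock_component:
 "(LINT w|lborel. homog k f w * herm z w ^ k * exp (- (cor (norm w))\<^sup>2)) =
  fact k * homog k f z * (LINT u|lborel. exp (- (cor (norm (u :: complex^'k)))\<^sup>2))"
proof -
 let ?E = "%w. homog k f w * exp (herm z w) * exp (- (cor (norm w))\<^sup>2)"
 have hm: "(%w. exp (herm z w)) \<in> bmeas borel"
  by(intro borel_measurable_continuous_onI continuous_intros)
 have Eint: "integrable lborel ?E"
 proof (rule homog_gaussian_integrable[OF hm, where A = 1 and b = "norm z"])
  show "cmod (exp (herm z w)) <= 1 * exp (norm z * norm w)" for w
   using order_trans[OF complex_Re_le_cmod norm_herm_le[of z w]] by simp
 qed
 have "(LINT w|lborel. ?E w) = (LINT w|lborel. LINT x|circle. ?E (cis (2 * pi * x) *s w))"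
  by(rule rotation_average[OF Eint, symmetric])
 also have "... = (LINT w|lborel. (homog k f w * herm z w ^ k * exp (- (cor (norm w))\<^sup>2)) / fact k)"
 proof (rule LINT_cong[OF refl])
  fix w :: "complex^'k"
  have "(LINT x|circle. ?E (cis (2 * pi * x) *s w)) =
    (LINT x|circle. (homog k f w * exp (- (cor (norm w))\<^sup>2)) * (cis (2 * pi * x) ^ k * exp (cnj (cis (2 * pi * x)) * herm z w)))"
   by(simp add:homog_smult herm_smult_right norm_smult mult_ac)
  thus "(LINT x|circle. ?E (cis (2 * pi * x) *s w)) = (homog k f w * herm z w ^ k * exp (- (cor (norm w))\<^sup>2)) / fact k"
   by(simp add:circle_exp_coefficient)
 qed
 finally show ?thesis unfolding homog_fock by(simp add:field_simps)
qed

end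

section \<open>Radial weights on the ball\<close>

lemma nn_integral_lborel_scale:
 fixes g :: "'a::euclidean_space => ennreal"
 assumes g: "g \<in> bmeas borel" and c: "0 < c"
 shows "(\<integral>\<^sup>+x. g x \<partial>lborel) = ennreal (c ^ DIM('a)) * (\<integral>\<^sup>+x. g (c *\<^sub>R x) \<partial>lborel)"
proof -
 have m: "(%x. 0 + c *\<^sub>R x) \<in> bmeas (lborel :: 'a measure)" by simp
 have "(\<integral>\<^sup>+x. g x \<partial>lborel) = (\<integral>\<^sup>+x. g x \<partial>density (distr lborel borel (%x. 0 + c *\<^sub>R x)) (%_. \<bar>c\<bar> ^ DIM('a)))"
  using lborel_affine[of c "0::'a"] c by simp
 also have "... = (\<integral>\<^sup>+x. ennreal (c ^ DIM('a)) * g x \<partial>distr lborel borel (%x. 0 + c *\<^sub>R x))"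
  using g c by(subst nn_integral_density) auto
 also have "... = (\<integral>\<^sup>+x. ennreal (c ^ DIM('a)) * g (0 + c *\<^sub>R x) \<partial>lborel)"
  by(rule nn_integral_distr[OF m]) (use g in simp)
 also have "... = ennreal (c ^ DIM('a)) * (\<integral>\<^sup>+x. g (c *\<^sub>R x) \<partial>lborel)"
  using g by(subst nn_integral_cmult) auto
 finally show ?thesis .
qed

lemma nn_integral_Gamma:
 assumes a: "0 < a"
 shows "(\<integral>\<^sup>+s. ennreal (if 0 < s then s powr (a - 1) * exp (- s) else 0) \<partial>lborel) = ennreal (Gamma a)"
proof -
 have "(if 0 < s then s powr (a - 1) * exp (- s) else 0) = indicator {0..} s * s powr (a - 1) / exp s" for s :: real
  by(auto simp:exp_minus field_simps split: split_indicator)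
 thus ?thesis using Gamma_conv_nn_integral_real[OF a] by simp
qed

definition ball_weight :: "real => complex^'k::finite => real"
 where "ball_weight l w = indicator (ball 0 1) w * (1 - (norm w)\<^sup>2) powr (l - real CARD('k) - 1)"

lemma ball_weight_nonneg: "0 <= ball_weight l w"
 by(simp add:ball_weight_def)

lemma ball_weight_rotate: "ball_weight l (cis t *s w) = ball_weight l w"
 by(simp add:ball_weight_def norm_smult indicator_def)

lemma ball_weight_measurable [measurable]: "ball_weight l \<in> bmeas borel"
 unfolding ball_weight_def[abs_def]
 by(intro borel_measurable_times powr_real_measurable borel_measurable_indicator borel_measurable_diff
   borel_measurable_power borel_measurable_norm) auto

text \<open>Integrate g(u) (s - |u|^2)^(a - 1) exp (-s) over |u|^2 < s, with a = l -
  \<open>CARD('k)\<close>, in both orders. Integrating s first gives Gamma a and the Gaussian;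
  integrating u first, the substitution u = sqrt s w gives s^(k + l - 1) exp (-s) times the ball
  integral.\<close>

lemma homogeneous_ball_nn_integral:
 fixes g :: "complex^'k::finite => ennreal"
 assumes g [measurable]: "g \<in> bmeas borel"
  and hom: "!!s w. 0 < s ==> g (s *\<^sub>R w) = ennreal (s ^ (2 * k)) * g w"
  and l: "real CARD('k) < l"
 shows "ennreal (Gamma (real k + l)) * (\<integral>\<^sup>+w. g w * ennreal (ball_weight l w) \<partial>lborel) =
  ennreal (Gamma (l - real CARD('k))) * (\<integral>\<^sup>+u. g u * ennreal (exp (- (norm u)\<^sup>2)) \<partial>lborel)"
proof -
 define a where "a = l - real CARD('k)"
 have a: "0 < a" using l by(simp add:a_def)
 define q where "q = (%u s. g u * ennreal (if (norm u)\<^sup>2 < s then (s - (norm u)\<^sup>2) powr (a - 1) * exp (- s) else 0))"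
 have qm [measurable]: "(%p. q (fst p) (snd p)) \<in> bmeas (borel \<Otimes>\<^sub>M borel)"
  unfolding q_def by measurable
 have int_s: "(\<integral>\<^sup>+s. q u s \<partial>lborel) = ennreal (Gamma a) * (g u * ennreal (exp (- (norm u)\<^sup>2)))" for u
 proof -
  have "(\<integral>\<^sup>+s. q u s \<partial>lborel) = (\<integral>\<^sup>+s. q u ((norm u)^2 + s) \<partial>lborel)"
   by(rule nn_integral_lborel_translate[symmetric]) (simp add:q_def)
  also have "... = (\<integral>\<^sup>+s. (g u * ennreal (exp (- (norm u)\<^sup>2))) * ennreal (if 0 < s then s powr (a - 1) * exp (- s) else 0) \<partial>lborel)"
   by(intro nn_integral_cong)
    (auto simp:q_def mult.assoc ennreal_mult'[symmetric] exp_diff exp_minus exp_add field_simps)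
  also have "... = (g u * ennreal (exp (- (norm u)\<^sup>2))) * ennreal (Gamma a)"
   by(subst nn_integral_cmult) (simp_all add: nn_integral_Gamma[OF a])
  finally show ?thesis by(simp add:mult.commute)
 qed
 define I where "I = (\<integral>\<^sup>+w. g w * ennreal (ball_weight l w) \<partial>lborel)"
 have int_u: "(\<integral>\<^sup>+u. q u s \<partial>lborel) = ennreal (if 0 < s then s powr (real k + l - 1) * exp (- s) else 0) * I" for s
 proof (cases "0 < s")
  case True
  \<comment> \<open>The real dimension is twice \<open>CARD('k)\<close>, so scaling by sqrt s has
    Jacobian \<open>s ^ CARD('k)\<close>.\<close>
  have DIM: "sqrt s ^ DIM(complex^'k) = s ^ CARD('k)"
  proof -
   have "sqrt s ^ DIM(complex^'k) = ((sqrt s)^2) ^ CARD('k)" by(simp add:power_mult[symmetric] mult.commute)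
   thus ?thesis using True by simp
  qed
  have pt: "q (sqrt s *\<^sub>R w) s = ennreal (s ^ k * s powr (a - 1) * exp (- s)) * (g w * ennreal (ball_weight l w))" for w
  proof (cases "norm w < 1")
   case w: True
   have nw: "0 < 1 - (norm w)\<^sup>2" using w by(simp add:power_less_one_iff abs_square_less_1)
   have "(norm (sqrt s *\<^sub>R w))^2 = s * (norm w)^2" using True by(simp add:power_mult_distrib)
   moreover have "s * (norm w)^2 < s" using nw True by simp
   moreover have "s - s * (norm w)^2 = s * (1 - (norm w)\<^sup>2)" by(simp add:algebra_simps)
   moreover have "(s * (1 - (norm w)\<^sup>2)) powr (a - 1) = s powr (a - 1) * (1 - (norm w)\<^sup>2) powr (a - 1)"
    using True nw by(simp add:powr_mult)
   moreover have "sqrt s ^ (2 * k) = s ^ k" using True by(simp add:power_mult)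
   ultimately show ?thesis
    using w True hom[of "sqrt s" w] by(simp add:q_def ball_weight_def a_def ennreal_mult'[symmetric] mult_ac)
  next
   case w: False
   hence "s * 1 <= s * (norm w)^2" using True by(intro mult_left_mono) (simp_all add: one_le_power)
   hence "\<not> s * (norm w)^2 < s" by simp
   thus ?thesis using w True by(simp add:q_def ball_weight_def power_mult_distrib del: mult_less_cancel_left2)
  qed
  have "(\<integral>\<^sup>+u. q u s \<partial>lborel) = ennreal (sqrt s ^ DIM(complex^'k)) * (\<integral>\<^sup>+w. q (sqrt s *\<^sub>R w) s \<partial>lborel)"
   by(rule nn_integral_lborel_scale) (use True in \<open>simp_all add: q_def\<close>)
  also have "... = ennreal (s ^ CARD('k)) * (ennreal (s ^ k * s powr (a - 1) * exp (- s)) * I)"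
   unfolding DIM pt I_def by(subst nn_integral_cmult) auto
  also have "... = ennreal (s ^ CARD('k) * (s ^ k * s powr (a - 1) * exp (- s))) * I"
   using True by(simp add:ennreal_mult mult.assoc)
  also have "s ^ CARD('k) * (s ^ k * s powr (a - 1) * exp (- s)) = s powr (real k + l - 1) * exp (- s)"
  proof -
   have "s powr (real k + l - 1) = s powr real CARD('k) * (s powr real k * s powr (a - 1))"
    by(simp add:a_def powr_add[symmetric] add_diff_eq)
   thus ?thesis using True by(simp add:powr_realpow mult.assoc)
  qed
  finally show ?thesis using True by simp
 next
  case False
  hence "\<not> (norm u)\<^sup>2 < s" for u :: "complex^'k" using zero_le_power2[of "norm u"] by linarith
  hence "q u s = 0" for u by(simp add:q_def)
  thus ?thesis using False by simp
 qed
 have "(\<integral>\<^sup>+s. \<integral>\<^sup>+u. q u s \<partial>lborel \<partial>lborel) = (\<integral>\<^sup>+u. \<integral>\<^sup>+s. q u s \<partial>lborel \<partial>lborel)"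
  by(rule lborel_pair.Fubini'[of q]) (use qm in \<open>simp add:case_prod_unfold cong: measurable_cong_sets\<close>)
 moreover have "(\<integral>\<^sup>+s. \<integral>\<^sup>+u. q u s \<partial>lborel \<partial>lborel) = ennreal (Gamma (real k + l)) * I"
  unfolding int_u by(subst nn_integral_multc) (use l in \<open>simp_all add: nn_integral_Gamma add_nonneg_pos\<close>)
 moreover have "(\<integral>\<^sup>+u. \<integral>\<^sup>+s. q u s \<partial>lborel \<partial>lborel) =
   ennreal (Gamma a) * (\<integral>\<^sup>+u. g u * ennreal (exp (- (norm u)\<^sup>2)) \<partial>lborel)"
  unfolding int_s by(subst nn_integral_cmult) auto
 ultimately show ?thesis by(simp add:I_def a_def)
qed

lemma homogeneous_ball_real_integral:
 fixes g :: "complex^'k::finite => real"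
 assumes g [measurable]: "g \<in> bmeas borel"
  and hom: "!!s w. 0 < s ==> g (s *\<^sub>R w) = s ^ (2 * k) * g w"
  and l: "real CARD('k) < l"
  and int: "integrable lborel (%u. g u * exp (- (norm u)\<^sup>2))"
 shows "integrable lborel (%w. g w * ball_weight l w)"
  and "Gamma (real k + l) * (LINT w|lborel. g w * ball_weight l w) =
   Gamma (l - real CARD('k)) * (LINT u|lborel. g u * exp (- (norm u)\<^sup>2))"
proof -
 have pos: "0 < Gamma (real k + l)" "0 < Gamma (l - real CARD('k))"
  using l by(auto intro!:Gamma_real_pos add_nonneg_pos)
 \<comment> \<open>\<sigma> = 1 and \<sigma> = -1 isolate the positive and negative parts of g,
   which are homogeneous of the same degree.\<close>
 have key: "ennreal (Gamma (real k + l)) * (\<integral>\<^sup>+w. ennreal (\<sigma> * g w * ball_weight l w) \<partial>lborel) =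
   ennreal (Gamma (l - real CARD('k))) * (\<integral>\<^sup>+u. ennreal (\<sigma> * g u * exp (- (norm u)\<^sup>2)) \<partial>lborel)" for \<sigma>
 proof -
  have "(%w. ennreal (\<sigma> * g w)) \<in> bmeas borel" by measurable
  moreover have "ennreal (\<sigma> * g (s *\<^sub>R w)) = ennreal (s ^ (2 * k)) * ennreal (\<sigma> * g w)" if "0 < s" for s w
   using that by(simp add:hom ennreal_mult''[symmetric] mult_ac)
  ultimately show ?thesis
   using homogeneous_ball_nn_integral[of "%w. ennreal (\<sigma> * g w)" k l] l
   by(simp add:ennreal_mult'' ball_weight_nonneg)
 qed
 have fin: "(\<integral>\<^sup>+u. ennreal (\<sigma> * g u * exp (- (norm u)\<^sup>2)) \<partial>lborel) < \<infinity>" if "\<sigma> = 1 \<or> \<sigma> = -1" for \<sigma>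
  using int that by(auto simp:real_integrable_def less_top)
 have fin': "(\<integral>\<^sup>+w. ennreal (\<sigma> * g w * ball_weight l w) \<partial>lborel) < \<infinity>" if "\<sigma> = 1 \<or> \<sigma> = -1" for \<sigma>
 proof -
  have "ennreal (Gamma (real k + l)) * (\<integral>\<^sup>+w. ennreal (\<sigma> * g w * ball_weight l w) \<partial>lborel) < \<infinity>"
   unfolding key using fin[OF that] by(simp add:ennreal_mult_less_top)
  thus ?thesis using pos by(auto simp:ennreal_mult_less_top)
 qed
 show i: "integrable lborel (%w. g w * ball_weight l w)"
  using fin'[of 1] fin'[of "-1"] by(simp add:real_integrable_def less_top)
 have E: "Gamma (real k + l) * enn2real (\<integral>\<^sup>+w. ennreal (\<sigma> * g w * ball_weight l w) \<partial>lborel) =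
   Gamma (l - real CARD('k)) * enn2real (\<integral>\<^sup>+u. ennreal (\<sigma> * g u * exp (- (norm u)\<^sup>2)) \<partial>lborel)" for \<sigma>
  using arg_cong[OF key[of \<sigma>], of enn2real] pos by(simp add:enn2real_mult)
 show "Gamma (real k + l) * (LINT w|lborel. g w * ball_weight l w) =
   Gamma (l - real CARD('k)) * (LINT u|lborel. g u * exp (- (norm u)\<^sup>2))"
  using E[of 1] E[of "-1"] by(simp add:real_lebesgue_integral_def[OF i] real_lebesgue_integral_def[OF int] right_diff_distrib)
qed

lemma homogeneous_ball_integral:
 fixes G :: "complex^'k::finite => complex"
 assumes G [measurable]: "G \<in> bmeas borel"
  and hom: "!!s w. 0 < s ==> G (s *\<^sub>R w) = cor (s ^ (2 * k)) * G w"
  and l: "real CARD('k) < l"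
  and int: "integrable lborel (%u. G u * cor (exp (- (norm u)\<^sup>2)))"
 shows "Gamma (real k + l) * (LINT w|lborel. G w * cor (ball_weight l w)) =
   Gamma (l - real CARD('k)) * (LINT u|lborel. G u * cor (exp (- (norm u)\<^sup>2)))"
proof -
 have Re_int: "integrable lborel (%u. Re (G u) * exp (- (norm u)\<^sup>2))"
  using integrable_Re[OF int] by simp
 have Im_int: "integrable lborel (%u. Im (G u) * exp (- (norm u)\<^sup>2))"
  using integrable_Im[OF int] by simp
 note R = homogeneous_ball_real_integral[of "%w. Re (G w)" k l, OF _ _ l Re_int]
 note I = homogeneous_ball_real_integral[of "%w. Im (G w)" k l, OF _ _ l Im_int]
 have iR: "integrable lborel (%w. Re (G w) * ball_weight l w)" by(rule R(1)) (simp_all add: hom)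
 have iI: "integrable lborel (%w. Im (G w) * ball_weight l w)" by(rule I(1)) (simp_all add: hom)
 have split: "z * cor x = cor (Re z * x) + \<i> * cor (Im z * x)" for z x
  by(simp add:complex_eq_iff)
 have iG: "integrable lborel (%w. G w * cor (ball_weight l w))"
  unfolding split[of "G _"] by(intro Bochner_Integration.integrable_add integrable_mult_right integrable_of_real iR iI)
 have "Re (LINT w|lborel. G w * cor (ball_weight l w)) = (LINT w|lborel. Re (G w) * ball_weight l w)"
  "Im (LINT w|lborel. G w * cor (ball_weight l w)) = (LINT w|lborel. Im (G w) * ball_weight l w)"
  using integral_Re[OF iG] integral_Im[OF iG] by simp_all
 moreover have "Re (LINT u|lborel. G u * cor (exp (- (norm u)\<^sup>2))) = (LINT u|lborel. Re (G u) * exp (- (norm u)\<^sup>2))"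
  "Im (LINT u|lborel. G u * cor (exp (- (norm u)\<^sup>2))) = (LINT u|lborel. Im (G u) * exp (- (norm u)\<^sup>2))"
  using integral_Re[OF int] integral_Im[OF int] by simp_all
 moreover have "Gamma (real k + l) * (LINT w|lborel. Re (G w) * ball_weight l w) =
   Gamma (l - real CARD('k)) * (LINT u|lborel. Re (G u) * exp (- (norm u)\<^sup>2))"
  by(rule R(2)) (simp_all add: hom)
 moreover have "Gamma (real k + l) * (LINT w|lborel. Im (G w) * ball_weight l w) =
   Gamma (l - real CARD('k)) * (LINT u|lborel. Im (G u) * exp (- (norm u)\<^sup>2))"
  by(rule I(2)) (simp_all add: hom)
 ultimately show ?thesis by(simp add:complex_eq_iff)
qed


section \<open>The reproducing kernel of the weighted Bergman space\<close>

definition ball_mass :: "'k::finite itself => real => real"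
 where "ball_mass _ l = (LINT w|lborel. ball_weight l (w :: complex^'k))"

definition gauss_mass :: "'k::finite itself => real"
 where "gauss_mass _ = (LINT w|lborel. exp (- (norm (w :: complex^'k))\<^sup>2))"

lemma integrable_gaussian_norm2: "integrable lborel (%x::'a::euclidean_space. exp (- (norm x)\<^sup>2))"
 by(rule LINT_bound[OF integrable_gaussian_norm]) auto

lemma gauss_mass_pos: "0 < gauss_mass TYPE('k::finite)"
proof -
 have "(LINT w|lborel. exp (- (norm (w :: complex^'k))\<^sup>2)) ~= 0"
 proof
  assume "(LINT w|lborel. exp (- (norm (w :: complex^'k))\<^sup>2)) = 0"
  hence "AE w in (lborel :: (complex^'k) measure). exp (- (norm w)\<^sup>2) = 0"
   using integral_nonneg_eq_0_iff_AE[OF integrable_gaussian_norm2[where 'a = "complex^'k"]] by simp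
  hence "AE w in (lborel :: (complex^'k) measure). False" by eventually_elim simp
  thus False by(auto simp:AE_iff_null null_sets_def)
 qed
 moreover have "0 <= (LINT w|lborel. exp (- (norm (w :: complex^'k))\<^sup>2))" by simp
 ultimately show ?thesis unfolding gauss_mass_def by linarith
qed

lemma ball_weight_integrable:
 "real CARD('k) < l ==> integrable lborel (ball_weight l :: complex^'k::finite => real)"
 using homogeneous_ball_real_integral(1)[of "%w::complex^'k. 1" 0 l] integrable_gaussian_norm2[where 'a = "complex^'k"]
 by simp

lemma ball_mass_eq:
 "real CARD('k) < l ==> Gamma l * ball_mass TYPE('k::finite) l = Gamma (l - real CARD('k)) * gauss_mass TYPE('k)"
 using homogeneous_ball_real_integral(2)[of "%w::complex^'k. 1" 0 l] integrable_gaussian_norm2[where 'a = "complex^'k"]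
 by(simp add:ball_mass_def gauss_mass_def)

lemma ball_mass_pos: "real CARD('k) < l ==> 0 < ball_mass TYPE('k::finite) l"
proof -
 assume l: "real CARD('k) < l"
 hence "0 < Gamma (l - real CARD('k)) * gauss_mass TYPE('k)" "0 < Gamma l"
  by(auto intro!:mult_pos_pos Gamma_real_pos gauss_mass_pos)
 thus ?thesis using ball_mass_eq[OF l] by(metis zero_less_mult_pos)
qed

text \<open>The volume of the ball occurs both in the normalised measure and in the normalising
  integral and cancels, so only the mass of the weight remains.\<close>

lemma bergman_measure_eq:
 assumes l: "real CARD('k) < l"
 shows "(bergman_measure l :: (complex^'k::finite) measure) =
  density (restrict_space lborel (ball 0 1)) (%z. ennreal (ball_weight l z / ball_mass TYPE('k) l))"
proof -
 let ?R = "restrict_space lborel (ball 0 1) :: (complex^'k) measure"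
 let ?w = "%z::complex^'k. (1 - (norm z)\<^sup>2) powr (l - real CARD('k) - 1)"
 define V where "V = measure lborel (ball 0 1 :: (complex^'k) set)"
 have V: "0 < V" unfolding V_def by(rule content_ball_pos) simp
 have em: "emeasure ?R (ball 0 1) = ennreal V"
  unfolding V_def using emeasure_eq_ennreal_measure[OF less_imp_neq[OF emeasure_lborel_ball_finite[of "0 :: complex^'k" 1, unfolded infinity_ennreal_def]]]
  by(subst emeasure_restrict_space) auto
 have spR: "space ?R = ball 0 1" by(simp add:space_restrict_space)
 have bv: "(ball_volume :: (complex^'k) measure) = density ?R (%_. ennreal (1 / V))"
  unfolding ball_volume_def uniform_measure_def em
 proof (rule density_cong)
  show "AE x in ?R. indicator (ball 0 1) x / ennreal V = ennreal (1 / V)"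
   using V by(intro AE_I2) (simp add:spR ennreal_1[symmetric] divide_ennreal del: ennreal_1)
  show "(%x. indicator (ball 0 1) x / ennreal V) \<in> bmeas ?R"
   unfolding divide_ennreal_def
   by(rule measurable_restrict_space1, rule borel_measurable_times_ennreal) (auto intro!:borel_measurable_indicator)
 qed auto
 have wm: "?w \<in> bmeas ?R" by(rule measurable_restrict_space1) measurable
 have bw: "ball_weight l z = ?w z" if "z \<in> space ?R" for z using that by(simp add:spR ball_weight_def)
 have W: "(LINT u|ball_volume. ?w u) = ball_mass TYPE('k) l / V"
 proof -
  have "(LINT u|ball_volume. ?w u) = (LINT u|?R. (1 / V) *\<^sub>R ?w u)"
   unfolding bv using V by(intro integral_density wm) auto
  also have "... = (LINT u|?R. ball_weight l u) / V"
  proof -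
   have "(LINT u|?R. (1 / V) *\<^sub>R ?w u) = (LINT u|?R. (1 / V) *\<^sub>R ball_weight l u)"
    by(rule LINT_cong[OF refl]) (simp only:bw)
   thus ?thesis by simp
  qed
  also have "(LINT u|?R. ball_weight l u) = (LINT u|lborel. indicator (ball 0 1) u *\<^sub>R ball_weight l (u :: complex^'k))"
   by(rule integral_restrict_space) simp
  also have "... = ball_mass TYPE('k) l"
   unfolding ball_mass_def by(intro LINT_cong) (auto simp:ball_weight_def split: split_indicator)
  finally show ?thesis .
 qed
 have "(bergman_measure l :: (complex^'k) measure) =
   density (density ?R (%_. ennreal (1 / V))) (%z. ennreal (?w z / (ball_mass TYPE('k) l / V)))"
  unfolding bergman_measure_def Let_def unfolding W unfolding bv ..
 also have "... = density ?R (%z. ennreal (1 / V) * ennreal (?w z / (ball_mass TYPE('k) l / V)))"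
  using wm by(intro density_density_eq) auto
 also have "... = density ?R (%z. ennreal (ball_weight l z / ball_mass TYPE('k) l))"
 proof (rule density_cong)
  show "AE z in ?R. ennreal (1 / V) * ennreal (?w z / (ball_mass TYPE('k) l / V)) = ennreal (ball_weight l z / ball_mass TYPE('k) l)"
   using V ball_mass_pos[OF l] by(intro AE_I2) (simp add:bw ennreal_mult'[symmetric])
  show "(%z. ennreal (ball_weight l z / ball_mass TYPE('k) l)) \<in> bmeas ?R"
   by(rule measurable_restrict_space1) measurable
 qed (use wm in auto)
 finally show ?thesis .
qed

lemma space_bergman [simp]: "space (bergman_measure l :: (complex^'k::finite) measure) = ball 0 1"
 by(simp add:bergman_measure_def Let_def ball_volume_def space_restrict_space)

lemma sets_bergman: "sets (bergman_measure l :: (complex^'k::finite) measure) = sets (restrict_space borel (ball 0 1))"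
 by(simp add:bergman_measure_def Let_def ball_volume_def sets_restrict_space)

lemma measurable_bergman_iff:
 "(f :: complex^'k::finite => complex) \<in> bmeas (bergman_measure l) \<longleftrightarrow> f \<in> bmeas (restrict_space lborel (ball 0 1))"
 by(rule arg_cong[of _ _ "%S. f \<in> S"], rule measurable_cong_sets)
  (simp_all add: sets_bergman sets_restrict_space)

lemma continuous_measurable_bergman:
 "continuous_on (ball 0 1) (f :: complex^'k::finite => complex) ==> f \<in> bmeas (bergman_measure l)"
 unfolding measurable_bergman_iff
 by(subst measurable_cong_sets[OF _ refl, of _ "restrict_space borel (ball 0 1)"])
  (simp_all add: sets_restrict_space borel_measurable_continuous_on_restrict)

lemma bergman_integral:
 fixes f :: "complex^'k::finite => complex"
 assumes l: "real CARD('k) < l" and f: "f \<in> bmeas (bergman_measure l)"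
 shows "integrable (bergman_measure l) f \<longleftrightarrow> integrable lborel (%z. ball_weight l z *\<^sub>R f z)"
  and "(LINT z|bergman_measure l. f z) = (LINT z|lborel. ball_weight l z *\<^sub>R f z) / ball_mass TYPE('k) l"
proof -
 let ?R = "restrict_space lborel (ball 0 1) :: (complex^'k) measure"
 note W = ball_mass_pos[OF l]
 have fR: "f \<in> bmeas ?R" using f by(simp add:measurable_bergman_iff)
 have bm: "(%z. ball_weight l z / ball_mass TYPE('k) l) \<in> bmeas ?R"
  by(rule measurable_restrict_space1) measurable
 have eq: "indicator (ball 0 1) z *\<^sub>R ((ball_weight l z / ball_mass TYPE('k) l) *\<^sub>R f z) =
   (1 / ball_mass TYPE('k) l) *\<^sub>R (ball_weight l z *\<^sub>R f z)" for z
  by(auto simp:ball_weight_def split: split_indicator)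
 have pos: "AE z in ?R. 0 <= ball_weight l z / ball_mass TYPE('k) l"
  using W by(simp add:ball_weight_nonneg)
 have "integrable (bergman_measure l) f \<longleftrightarrow> integrable ?R (%z. (ball_weight l z / ball_mass TYPE('k) l) *\<^sub>R f z)"
  unfolding bergman_measure_eq[OF l] by(rule integrable_density[OF fR bm pos])
 also have "... \<longleftrightarrow> integrable lborel (%z. (1 / ball_mass TYPE('k) l) *\<^sub>R (ball_weight l z *\<^sub>R f z))"
  by(subst integrable_restrict_space) (simp_all only: eq, simp)
 also have "... \<longleftrightarrow> integrable lborel (%z. ball_weight l z *\<^sub>R f z)"
 proof
  assume "integrable lborel (%z. (1 / ball_mass TYPE('k) l) *\<^sub>R (ball_weight l z *\<^sub>R f z))"
  from integrable_scaleR_right[OF this, of "ball_mass TYPE('k) l"] W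
  show "integrable lborel (%z. ball_weight l z *\<^sub>R f z)" by simp
 qed (rule integrable_scaleR_right)
 finally show "integrable (bergman_measure l) f \<longleftrightarrow> integrable lborel (%z. ball_weight l z *\<^sub>R f z)" .
 have "(LINT z|bergman_measure l. f z) = (LINT z|?R. (ball_weight l z / ball_mass TYPE('k) l) *\<^sub>R f z)"
  unfolding bergman_measure_eq[OF l] by(rule integral_density[OF fR bm pos])
 also have "... = (LINT z|lborel. (1 / ball_mass TYPE('k) l) *\<^sub>R (ball_weight l z *\<^sub>R f z))"
  by(subst integral_restrict_space) (simp_all only: eq, simp)
 finally show "(LINT z|bergman_measure l. f z) = (LINT z|lborel. ball_weight l z *\<^sub>R f z) / ball_mass TYPE('k) l"
  by(simp add:scaleR_conv_of_real field_simps)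
qed

lemma finite_measure_bergman:
 assumes l: "real CARD('k) < l" shows "finite_measure (bergman_measure l :: (complex^'k::finite) measure)"
proof (rule finite_measureI)
 have "integrable (bergman_measure l :: (complex^'k) measure) (%_. 1 :: complex)"
  using ball_weight_integrable[OF l] bergman_integral(1)[OF l, of "%_. 1"] by(simp add:scaleR_conv_of_real)
 thus "emeasure (bergman_measure l :: (complex^'k) measure) (space (bergman_measure l)) ~= \<infinity>"
  by(simp add:integrable_iff_bounded less_top)
qed

text \<open>The base point comes first: \<open>bkernel l z\<close> is the kernel function of z,
  holomorphic in w, and pairing with it evaluates at z.\<close>

definition bkernel :: "real => complex^'k::finite => complex^'k => complex"
 where "bkernel l z w = (1 - herm w z) powr (- cor l)"

lemma Re_herm: "norm z <= 1 ==> norm w < 1 ==> 0 < Re (1 - herm w z)"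
proof -
 assume z: "norm z <= 1" and w: "norm w < 1"
 have "Re (herm w z) <= norm w * norm z" using norm_herm_le[of w z] complex_Re_le_cmod[of "herm w z"] by linarith
 also have "... <= norm w * 1" using z by(intro mult_left_mono) auto
 finally show ?thesis using w by simp
qed

lemma cnj_powr_real: "0 < Re z ==> cnj (z powr cor x) = cnj z powr cor x"
proof -
 assume z: "0 < Re z"
 hence "z \<notin> \<real>\<^sub>\<le>\<^sub>0" by(auto simp:complex_nonpos_Reals_iff)
 thus ?thesis using z by(auto simp:powr_def exp_cnj cnj_Ln)
qed

lemma cmod_powr_real: "z ~= 0 ==> cmod (z powr cor x) = cmod z powr x"
 by(simp add:powr_def)

lemma binomial_series_neg:
 fixes x :: complex
 assumes "cmod x < 1"
 shows "(%k. cor (pochhammer l k / fact k) * x ^ k) sums (1 - x) powr (- cor l)"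
proof -
 have "(%k. ((- cor l) gchoose k) * (- x) ^ k) sums (1 + (- x)) powr (- cor l)"
  by(rule gen_binomial_complex) (use assms in simp)
 moreover have "((- cor l) gchoose k) * (- x) ^ k = cor (pochhammer l k / fact k) * x ^ k" for k
 proof -
  have "((- cor l) gchoose k) = (- 1) ^ k * cor (pochhammer l k) / fact k"
   by(simp add:gbinomial_pochhammer pochhammer_of_real)
  moreover have "(- x) ^ k = (- 1) ^ k * x ^ k" by(metis mult_minus1 power_mult_distrib)
  moreover have "(- 1) ^ k * (- 1) ^ k = (1 :: complex)" by(simp add:power_mult_distrib[symmetric])
  ultimately show ?thesis by(simp add:mult_ac) 
 qed
 ultimately show ?thesis by simp
qed

lemma binomial_series_real:
 fixes x :: real
 assumes x: "0 <= x" "x < 1" and l: "0 < l"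
 shows "summable (%k. pochhammer l k / fact k * x ^ k)"
proof -
 have "cmod (cor x) < 1" using x by simp
 from sums_summable[OF binomial_series_neg[OF this, of l]]
 have "summable (%k. cor (pochhammer l k / fact k * x ^ k))"
  by(simp only:of_real_mult of_real_power)
 from summable_Re[OF this] show ?thesis by(simp only:Re_complex_of_real)
qed

text \<open>The conjugate kernel is a power series in \<open>herm z w\<close> with coefficients
  \<open>pochhammer l k / fact k\<close>. The circle average replaces f by its degree k part, and
  the quotient of Gamma values from passing to the Gaussian is cancelled by the Pochhammer symbol,
  so the k-th term is \<open>homog k f z\<close>.\<close>

theorem bergman_reproducing:
 fixes f :: "complex^'k::finite => complex"
 assumes l: "real CARD('k) < l" and f: "f \<in> bergman_space l" and z: "norm z < 1"
 shows "L2_ip (bergman_measure l) f (bkernel l z) = f z"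
proof -
 have hol: "mv_holomorphic_on f (ball 0 1)" and f2: "sq_integrable (bergman_measure l) f"
  using f by(auto simp:bergman_space_def)
 interpret B: finite_measure "bergman_measure l :: (complex^'k) measure" by(rule finite_measure_bergman[OF l])
 have l0: "0 < l" using l by(simp add:le_less_trans[OF of_nat_0_le_iff])
 have fm: "f \<in> bmeas (bergman_measure l)" using f2 by(simp add:sq_integrable_def)
 have fint: "integrable (bergman_measure l) f"
  using sq_integrable_mult[OF f2, of "%_. 1"] by(simp add:sq_integrable_def)
 define c where "c = (%k. pochhammer l k / fact k)"
 have c: "0 <= c k" for k using l0 by(simp add:c_def pochhammer_nonneg)
 let ?u = "%k w. cor (c k) * (f w * herm z w ^ k)"
 have hz: "cmod (herm z w) <= norm z" if "norm w < 1" for w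
  using norm_herm_le[of z w] mult_left_mono[of "norm w" 1 "norm z"] that by simp
 have hm: "(%w. f w * herm z w ^ k) \<in> bmeas (bergman_measure l)" for k
  by(rule borel_measurable_times[OF fm continuous_measurable_bergman]) (intro continuous_intros)
 have kint: "integrable (bergman_measure l) (%w. f w * herm z w ^ k)" for k
 proof (rule LINT_bound[OF fint hm])
  show "AE w in bergman_measure l. norm (f w * herm z w ^ k) <= norm (f w)"
  proof (rule AE_I2)
   fix w :: "complex^'k" assume "w \<in> space (bergman_measure l)"
   hence "cmod (herm z w) <= 1" using hz[of w] z by simp
   hence "cmod (herm z w) ^ k <= 1" by(simp add:power_le_one)
   thus "norm (f w * herm z w ^ k) <= norm (f w)" by(simp add:norm_mult norm_power mult_left_le)
  qed
 qed
 have ptsums: "(%k. ?u k w) sums (f w * cnj (bkernel l z w))" if "w \<in> space (bergman_measure l)" for w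
 proof -
  have w: "norm w < 1" using that by simp
  have "cmod (herm z w) < 1" using hz[OF w] z by simp
  from sums_mult[OF binomial_series_neg[OF this, of l], of "f w"]
  have "(%k. ?u k w) sums (f w * (1 - herm z w) powr (- cor l))" by(simp add:c_def mult_ac)
  moreover have "cnj (bkernel l z w) = (1 - herm z w) powr (- cor l)"
   using cnj_powr_real[of "1 - herm w z" "- l"] Re_herm[of z w] z w by(simp add:bkernel_def herm_cnj)
  ultimately show ?thesis by simp
 qed
 have ubd: "norm (?u k w) <= (c k * norm z ^ k) * cmod (f w)" if "w \<in> space (bergman_measure l)" for k w
 proof -
  have "cmod (herm z w) ^ k <= norm z ^ k" using hz that by(intro power_mono) auto
  hence "c k * (cmod (f w) * cmod (herm z w) ^ k) <= c k * (cmod (f w) * norm z ^ k)"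
   using c by(intro mult_left_mono) auto
  thus ?thesis using c by(simp add:norm_mult norm_power mult_ac)
 qed
 have cs: "summable (%k. c k * norm z ^ k)" unfolding c_def by(rule binomial_series_real) (use z l0 in auto)
 \<comment> \<open>Termwise integration is justified by |herm z w| \<le> norm z < 1 on the ball,
   which gives a convergent majorant proportional to |f w|.\<close>
 have "(%k. LINT w|bergman_measure l. ?u k w) sums (LINT w|bergman_measure l. (\<Sum>k. ?u k w))"
 proof (rule sums_integral)
  show "integrable (bergman_measure l) (?u k)" for k using kint by simp
  show "AE w in bergman_measure l. summable (%k. norm (?u k w))"
  proof (rule AE_I2)
   fix w :: "complex^'k" assume w: "w \<in> space (bergman_measure l)"
   show "summable (%k. norm (?u k w))"
    by(rule summable_comparison_test'[OF summable_mult2[OF cs, of "cmod (f w)"], of 0]) (use ubd[OF w] in auto)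
  qed
  show "summable (%k. LINT w|bergman_measure l. norm (?u k w))"
  proof (rule summable_comparison_test'[OF summable_mult2[OF cs, of "LINT w|bergman_measure l. cmod (f w)"], of 0])
   fix k :: nat
   have "(LINT w|bergman_measure l. norm (?u k w)) <= (LINT w|bergman_measure l. (c k * norm z ^ k) * cmod (f w))"
    by(rule integral_mono) (use ubd kint[of k] fint in auto)
   thus "norm (LINT w|bergman_measure l. norm (?u k w)) <= c k * norm z ^ k * (LINT w|bergman_measure l. cmod (f w))"
    by simp
  qed
 qed
 moreover have "(LINT w|bergman_measure l. (\<Sum>k. ?u k w)) = L2_ip (bergman_measure l) f (bkernel l z)"
  unfolding L2_ip_def by(intro LINT_cong refl) (use ptsums sums_unique in force)
 moreover have "(LINT w|bergman_measure l. ?u k w) = homog k f z" for k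
 proof -
  let ?H = "%w. ball_weight l w *\<^sub>R (f w * herm z w ^ k)"
  have Hint: "integrable lborel ?H" using kint[of k] bergman_integral(1)[OF l hm] by simp
  have "(LINT w|lborel. ?H w) = (LINT w|lborel. LINT x|circle. ?H (cis (2 * pi * x) *s w))"
   by(rule rotation_average[OF Hint, symmetric])
  also have "... = (LINT w|lborel. (homog k f w * herm z w ^ k) * cor (ball_weight l w))"
  proof (rule LINT_cong[OF refl])
   fix w :: "complex^'k"
   show "(LINT x|circle. ?H (cis (2 * pi * x) *s w)) = (homog k f w * herm z w ^ k) * cor (ball_weight l w)"
   proof (cases "norm w < 1")
    case True
    define R where "R = 2 / (1 + norm w)"
    have R: "1 < R" "R * norm w <= 1"
    proof -
     have "0 < 1 + norm w" using norm_ge_zero[of w] by linarith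
     thus "1 < R" "R * norm w <= 1" using True by(auto simp:R_def field_simps)
    qed
    have cnjp: "cnj (cis t) ^ k = cis (- (real k * t))" for t
     by(simp add:cis_cnj Complex.DeMoivre)
    have "(LINT x|circle. ?H (cis (2 * pi * x) *s w)) =
      (LINT x|circle. (herm z w ^ k * cor (ball_weight l w)) * (f ((cor 1 * cis (2 * pi * x)) *s w) * cis (- (real k * (2 * pi * x)))))"
     by(rule LINT_cong[OF refl])
      (simp add:herm_smult_right power_mult_distrib cnjp ball_weight_rotate scaleR_conv_of_real mult_ac)
    also have "... = (herm z w ^ k * cor (ball_weight l w)) * (cor 1 ^ k * homog k f w)"
     by(subst LINT_mult_right, subst homog_circle[OF hol, of 1 R]) (use R in auto)
    finally show ?thesis by(simp add:mult_ac)
   qed (simp add:ball_weight_rotate, simp add:ball_weight_def)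
  qed
  finally have avg: "(LINT w|lborel. ?H w) = (LINT w|lborel. (homog k f w * herm z w ^ k) * cor (ball_weight l w))" .
  have ex: "exp (- (cor (norm (u :: complex^'k)))\<^sup>2) = cor (exp (- (norm u)\<^sup>2))" for u
   by(simp add:exp_of_real[symmetric])
  have gint: "integrable lborel (%u. homog k f u * herm z u ^ k * cor (exp (- (norm u)\<^sup>2)))"
   unfolding ex[symmetric]
  proof (rule homog_gaussian_integrable[OF hol, where A = "fact k" and b = "norm z"])
   show "(%u. herm z u ^ k) \<in> bmeas borel" by(intro borel_measurable_continuous_onI continuous_intros)
   fix u
   have x: "x ^ k <= fact k * exp x" if "0 <= x" for x :: real
   proof -
    have "x ^ k /\<^sub>R fact k <= exp x"
     unfolding exp_def using that summable_exp_generic[of x]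
     by(intro sum_le_suminf[of _ "{k}", simplified]) auto
    thus ?thesis by(simp add:field_simps)
   qed
   have "cmod (herm z u ^ k) <= (norm z * norm u) ^ k"
    unfolding norm_power by(intro power_mono norm_herm_le) auto
   also have "... <= fact k * exp (norm z * norm u)" by(rule x) simp
   finally show "cmod (herm z u ^ k) <= fact k * exp (norm z * norm u)" .
  qed
  have "Gamma (real k + l) * (LINT w|lborel. (homog k f w * herm z w ^ k) * cor (ball_weight l w)) =
    Gamma (l - real CARD('k)) * (LINT u|lborel. homog k f u * herm z u ^ k * cor (exp (- (norm u)\<^sup>2)))"
  proof (rule homogeneous_ball_integral[OF _ _ l gint])
   show "(%w. homog k f w * herm z w ^ k) \<in> bmeas borel"
    by(intro borel_measurable_times homog_measurable[OF hol] borel_measurable_continuous_onI continuous_intros)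
   fix s :: real and w :: "complex^'k"
   have "s *\<^sub>R w = cor s *s w" by(simp add:vec_eq_iff) (simp add:scaleR_conv_of_real)
   moreover have "cor s ^ k * cor s ^ k = cor s ^ (k * 2)"
    by(simp add:power_add[symmetric] mult_2_right)
   ultimately show "homog k f (s *\<^sub>R w) * herm z (s *\<^sub>R w) ^ k = cor (s ^ (2 * k)) * (homog k f w * herm z w ^ k)"
    by(simp add:homog_smult[OF hol] herm_smult_right power_mult_distrib mult_ac)
  qed
  also have "(LINT u|lborel. homog k f u * herm z u ^ k * cor (exp (- (norm u)\<^sup>2))) =
    fact k * homog k f z * gauss_mass TYPE('k)"
   using homog_fock_component[OF hol, of k z] unfolding ex by(simp add:gauss_mass_def)
  finally have G: "Gamma (real k + l) * (LINT w|lborel. ?H w) = cor (Gamma (l - real CARD('k)) * gauss_mass TYPE('k)) * (fact k * homog k f z)"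
   unfolding avg by(simp add:mult_ac)
  have gk: "pochhammer l k * Gamma l = Gamma (real k + l)"
  proof -
   have "l \<notin> \<int>\<^sub>\<le>\<^sub>0" using l0 by(auto elim!: nonpos_Ints_cases)
   hence "pochhammer l k = Gamma (l + real k) / Gamma l" by(rule pochhammer_Gamma)
   moreover have "Gamma l ~= 0" using Gamma_real_pos[OF l0] by simp
   ultimately show ?thesis by(simp add:add.commute)
  qed
  have "0 < Gamma (real k + l)" using l0 by(intro Gamma_real_pos) auto
  hence "pochhammer l k ~= 0" using gk by auto
  have "cor (Gamma l * ball_mass TYPE('k) l) * (fact k * homog k f z) = cor (pochhammer l k * Gamma l) * (LINT w|lborel. ?H w)"
   unfolding ball_mass_eq[OF l] gk by(simp add:G)
  hence "(cor (pochhammer l k) * (LINT w|lborel. ?H w)) = cor (ball_mass TYPE('k) l) * (fact k * homog k f z)"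
   using Gamma_real_pos[OF l0] by(simp add:mult_ac)
  hence "cor (c k) * ((LINT w|lborel. ?H w) / ball_mass TYPE('k) l) = homog k f z"
   using ball_mass_pos[OF l] by(simp add:c_def field_simps)
  thus ?thesis using bergman_integral(2)[OF l hm, of k] by simp
 qed
 ultimately have "(%k. homog k f z) sums L2_ip (bergman_measure l) f (bkernel l z)" by simp
 thus ?thesis using homog_sums[OF hol z] sums_unique2 by blast
qed

section \<open>Superpositions of reproducing kernels\<close>

text \<open>For norm w \<le> 1 - \<delta> the real part of 1 - herm w p is at least \<delta>, so the
  second derivative of the power is bounded by a constant independent of p. This uniformity allows
  differentiation under an integral over p.\<close>

lemma bkernel_taylor:
 fixes p w w' :: "complex^'k::finite"
 assumes l: "0 < l" and \<delta>: "0 < \<delta>" and p: "norm p <= 1" and w: "norm w <= 1 - \<delta>" and w': "norm w' <= 1 - \<delta>"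
 shows "cmod (bkernel l p w' - bkernel l p w - cor l * (1 - herm w p) powr (- cor l - 1) * herm (w' - w) p)
  <= l * (l + 1) * \<delta> powr (- l - 2) * (norm (w' - w))^2"
proof -
 define S where "S = {x. \<delta> <= Re x}"
 define f :: "nat => complex => complex" where
  "f n x = (if n = 0 then x powr (- cor l) else if n = 1 then - cor l * x powr (- cor l - 1)
   else cor l * (cor l + 1) * x powr (- cor l - 2))" for n x
 have inS: "1 - herm v p \<in> S" if v: "norm v <= 1 - \<delta>" for v
 proof -
  have "Re (herm v p) <= norm v * norm p" using norm_herm_le[of v p] complex_Re_le_cmod[of "herm v p"] by linarith
  also have "... <= norm v * 1" using p by(intro mult_left_mono) auto
  finally show ?thesis using v by(simp add:S_def)
 qed
 let ?x = "1 - herm w p" and ?x' = "1 - herm w' p"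
 have "cmod (f 0 ?x' - (\<Sum>i\<le>1. f i ?x * (?x' - ?x) ^ i / fact i)) <= (l * (l + 1) * \<delta> powr (- l - 2)) * cmod (?x' - ?x) ^ Suc 1 / fact 1"
 proof (rule complex_Taylor)
  show "convex S" unfolding S_def by(rule convex_halfspace_Re_ge)
  fix i x assume x: "x \<in> S" and i: "i <= (1::nat)"
  have nz: "x \<notin> \<real>\<^sub>\<le>\<^sub>0" using x \<delta> by(auto simp:S_def complex_nonpos_Reals_iff)
  show "(f i has_field_derivative f (Suc i) x) (at x within S)"
  proof (cases "i = 0")
   case True
   have "((%x. x powr (- cor l)) has_field_derivative - cor l * x powr (- cor l - 1)) (at x within S)"
    by(rule has_field_derivative_at_within[OF has_field_derivative_powr[OF nz]])
   moreover have "f 0 = (%x. x powr (- cor l))" by(simp add:f_def fun_eq_iff)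
   ultimately show ?thesis using True by(simp add:f_def)
  next
   case False
   hence i1: "i = 1" using i by simp
   have "((%x. - cor l * x powr (- cor l - 1)) has_field_derivative
     - cor l * ((- cor l - 1) * x powr (- cor l - 1 - 1))) (at x within S)"
    by(intro DERIV_cmult has_field_derivative_at_within[OF has_field_derivative_powr[OF nz]])
   moreover have "f 1 = (%x. - cor l * x powr (- cor l - 1))" by(simp add:f_def fun_eq_iff)
   moreover have "f 2 x = - cor l * ((- cor l - 1) * x powr (- cor l - 1 - 1))"
    by(simp add:f_def algebra_simps)
   ultimately show ?thesis using i1 by(simp add:numeral_2_eq_2)
  qed
 next
  fix x assume x: "x \<in> S"
  have "x ~= 0" using x \<delta> by(auto simp:S_def)
  hence "cmod (x powr (- cor l - 2)) = cmod x powr (- l - 2)"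
   using cmod_powr_real[of x "- l - 2"] by simp
  also have "... <= \<delta> powr (- l - 2)"
   using x \<delta> l complex_Re_le_cmod[of x] by(intro powr_mono2') (auto simp:S_def)
  finally have "l * (l + 1) * cmod (x powr (- cor l - 2)) <= l * (l + 1) * \<delta> powr (- l - 2)"
   using l by(intro mult_left_mono) auto
  moreover have "cmod (cor l + 1) = l + 1"
   using l by(metis abs_of_pos add_pos_pos norm_of_real of_real_1 of_real_add zero_less_one)
  ultimately show "cmod (f (Suc 1) x) <= l * (l + 1) * \<delta> powr (- l - 2)"
   using l by(simp add:f_def norm_mult)
 qed (use inS w w' in auto)
 moreover have "?x' - ?x = - herm (w' - w) p"
  using herm_add_left[of w "w' - w" p] by simp
 moreover have "cmod (herm (w' - w) p) ^ 2 <= (norm (w' - w))^2"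
 proof (rule power_mono)
  show "cmod (herm (w' - w) p) <= norm (w' - w)"
   using norm_herm_le[of "w' - w" p] mult_left_mono[OF p norm_ge_zero[of "w' - w"]] by linarith
 qed simp
 hence "l * (l + 1) * \<delta> powr (- l - 2) * cmod (herm (w' - w) p) ^ 2 <= l * (l + 1) * \<delta> powr (- l - 2) * (norm (w' - w))^2"
  using l by(intro mult_left_mono) auto
 ultimately show ?thesis
  by(simp add:f_def bkernel_def diff_diff_eq numeral_2_eq_2[symmetric])
qed

text \<open>\<open>powr\<close> jumps across the negative axis; on the right half plane it is
  continuous, and multiplying by the indicator makes it a Borel function.\<close>

lemma powr_measurable:
 fixes g :: "'a => complex"
 assumes g [measurable]: "g \<in> bmeas M" and pos: "!!x. x \<in> space M ==> 0 < Re (g x)"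
 shows "(%x. g x powr c) \<in> bmeas M"
proof -
 have "continuous_on {z. 0 < Re z} (%z. z powr c)"
  by(intro continuous_intros) (auto simp:complex_nonpos_Reals_iff)
 moreover have "{z. 0 < Re z} \<in> sets borel" by(intro borel_open open_halfspace_Re_gt)
 ultimately have "(%z. indicator {z. 0 < Re z} z *\<^sub>R (z powr c)) \<in> bmeas borel"
  by(intro borel_measurable_continuous_on_indicator)
 from measurable_compose[OF g this]
 show ?thesis by(rule measurable_cong[THEN iffD1, rotated]) (simp add:pos)
qed

lemma bkernel_measurable:
 fixes p :: "'a => complex^'k::finite"
 assumes p [measurable]: "p \<in> bmeas M" and p1: "!!q. q \<in> space M ==> norm (p q) <= 1" and w: "norm w < 1"
 shows "(%q. bkernel l (p q) w) \<in> bmeas M"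
 unfolding bkernel_def
proof (rule powr_measurable)
 have "(%v. herm w v) \<in> bmeas borel" by(intro borel_measurable_continuous_onI continuous_intros)
 from measurable_compose[OF p this] show "(%q. 1 - herm w (p q)) \<in> bmeas M" by measurable
qed (use Re_herm p1 w in auto)

lemma norm_bkernel_le:
 fixes z w :: "complex^'k::finite"
 assumes l: "0 < l" and r: "norm z * norm w <= r" "r < 1"
 shows "cmod (bkernel l z w) <= (1 - r) powr (- l)"
proof -
 have "1 - r <= 1 - cmod (herm w z)" using norm_herm_le[of w z] r by(simp add:mult.commute)
 also have "... <= cmod (1 - herm w z)" using norm_triangle_ineq2[of 1 "herm w z"] by simp
 finally have *: "1 - r <= cmod (1 - herm w z)" .
 hence "1 - herm w z ~= 0" using r by auto
 hence "cmod (bkernel l z w) = cmod (1 - herm w z) powr (- l)"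
  using cmod_powr_real[of "1 - herm w z" "- l"] by(simp add:bkernel_def)
 also have "... <= (1 - r) powr (- l)" using * r l by(intro powr_mono2') auto
 finally show ?thesis .
qed

lemma bkernel_integral_bound:
 fixes p :: "'a => complex^'k::finite"
 assumes l: "0 < l" and a: "integrable M a" and p: "p \<in> bmeas M"
  and p1: "!!q. q \<in> space M ==> norm (p q) <= 1" and w: "norm w < 1"
 shows "integrable M (%q. a q * bkernel l (p q) w)"
proof -
 have "integrable M (%q. bkernel l (p q) w * a q)"
 proof (rule integrable_bounded_mult[OF a bkernel_measurable[OF p p1 w]])
  show "cmod (bkernel l (p q) w) <= (1 - norm w) powr (- l)" if "q \<in> space M" for q
   using mult_right_mono[OF p1[OF that] norm_ge_zero[of w]] w l by(intro norm_bkernel_le) auto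
 qed
 thus ?thesis by(simp add:mult.commute)
qed

text \<open>Integrating the derivatives of the kernels gives the derivative, since the Taylor
  remainder is quadratic in y - w uniformly in q. The estimate depends on the distance of w from the
  sphere, not on that of \<open>p q\<close>.\<close>

lemma bkernel_integral_holomorphic:
 fixes p :: "'a => complex^'k::finite"
 assumes l: "0 < l" and a: "integrable M a" and p: "p \<in> bmeas M"
  and p1: "!!q. q \<in> space M ==> norm (p q) <= 1"
 shows "mv_holomorphic_on (%w. LINT q|M. a q * bkernel l (p q) w) (ball 0 1)"
 unfolding mv_holomorphic_on_def
proof
 fix w :: "complex^'k" assume "w \<in> ball 0 1"
 hence w: "norm w < 1" by simp
 \<comment> \<open>Half the distance from w to the unit sphere, so that the \<delta>-neighbourhood
   of w stays in norm \<le> 1 - \<delta>.\<close>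
 define \<delta> where "\<delta> = (1 - norm w) / 2"
 have "2 * \<delta> = 1 - norm w" by(simp add:\<delta>_def)
 hence \<delta>: "0 < \<delta>" "norm w + \<delta> <= 1 - \<delta>" using w by linarith+
 let ?F = "%w. LINT q|M. a q * bkernel l (p q) w"
 let ?u = "%q. cor l * (1 - herm w (p q)) powr (- cor l - 1)"
 have hm: "(%q. herm w (p q)) \<in> bmeas M"
  by(rule measurable_compose[OF p]) (intro borel_measurable_continuous_onI continuous_intros)
 have um: "?u \<in> bmeas M"
  by(intro borel_measurable_times borel_measurable_const powr_measurable borel_measurable_diff hm Re_herm p1 w)
 have ub: "cmod (?u q) <= l * (1 - norm w) powr (- (l + 1))" if q: "q \<in> space M" for q
 proof -
  have "norm (p q) * norm w <= norm w" using mult_right_mono[OF p1[OF q] norm_ge_zero[of w]] by simp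
  hence "cmod (bkernel (l + 1) (p q) w) <= (1 - norm w) powr (- (l + 1))"
   using w l by(intro norm_bkernel_le) auto
  thus ?thesis using l by(simp add:bkernel_def norm_mult)
 qed
 have au: "integrable M (%q. ?u q * a q)" by(rule integrable_bounded_mult[OF a um ub])
 define c where "c = (%i. LINT q|M. ?u q * a q * cnj (p q $ i))"
 have pm: "(%q. cnj (p q $ i)) \<in> bmeas M" for i
  by(rule borel_measurable_cnj, rule measurable_compose[OF p]) (intro borel_measurable_continuous_onI continuous_intros)
 have aup: "integrable M (%q. ?u q * a q * cnj (p q $ i))" for i
 proof -
  have "integrable M (%q. cnj (p q $ i) * (?u q * a q))"
  proof (rule integrable_bounded_mult[OF au pm, of _ 1])
   show "cmod (cnj (p q $ i)) <= 1" if "q \<in> space M" for q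
    using order_trans[OF Finite_Cartesian_Product.norm_nth_le p1[OF that]] by simp
  qed
  thus ?thesis by(simp add:mult_ac)
 qed
 define L where "L = (%v. \<Sum>i\<in>UNIV. c i * v $ i)"
 have Lint: "L v = (LINT q|M. ?u q * a q * herm v (p q))"
  and Lintegrable: "integrable M (%q. ?u q * a q * herm v (p q))" for v
 proof -
  have e: "(%q. ?u q * a q * herm v (p q)) = (%q. \<Sum>i\<in>UNIV. ?u q * a q * cnj (p q $ i) * v $ i)"
   by(rule ext) (simp only:herm_def[of v] sum_distrib_left sum_distrib_right mult_ac)
  show "integrable M (%q. ?u q * a q * herm v (p q))"
   unfolding e by(intro Bochner_Integration.integrable_sum integrable_mult_left aup)
  show "L v = (LINT q|M. ?u q * a q * herm v (p q))"
   unfolding e L_def c_def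
   by(subst Bochner_Integration.integral_sum) (simp_all add: aup integrable_mult_left)
 qed
 have Llin: "bounded_linear L"
  by(rule linear_conv_bounded_linear[THEN iffD1], rule linearI)
   (simp_all add: L_def sum.distrib algebra_simps scaleR_sum_right)
 define C where "C = l * (l + 1) * \<delta> powr (- l - 2)"
 have C: "0 <= C" using l by(simp add:C_def)
 define A where "A = (LINT q|M. cmod (a q))"
 have bound: "cmod ((?F y - ?F w) - L (y - w)) <= C * (norm (y - w))^2 * A" if y: "dist y w < \<delta>" for y
 proof -
  have ny: "norm y <= 1 - \<delta>"
   using y \<delta> norm_triangle_sub[of y w] by(simp add:dist_norm)
  hence ny1: "norm y < 1" using \<delta> by linarith
  have i1: "integrable M (%q. a q * bkernel l (p q) y)" "integrable M (%q. a q * bkernel l (p q) w)"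
   using bkernel_integral_bound[OF l a p p1] ny1 w by auto
  have d: "(?F y - ?F w) - L (y - w) = (LINT q|M. a q * bkernel l (p q) y - a q * bkernel l (p q) w - ?u q * a q * herm (y - w) (p q))"
   unfolding Lint using i1 Lintegrable[of "y - w"] by simp
  have "cmod ((?F y - ?F w) - L (y - w)) <= (LINT q|M. cmod (a q * bkernel l (p q) y - a q * bkernel l (p q) w - ?u q * a q * herm (y - w) (p q)))"
   unfolding d by(rule integral_norm_bound)
  also have "... <= (LINT q|M. (C * (norm (y - w))^2) * cmod (a q))"
  proof (rule integral_mono)
   show "integrable M (%q. cmod (a q * bkernel l (p q) y - a q * bkernel l (p q) w - ?u q * a q * herm (y - w) (p q)))"
    by(rule integrable_norm[OF Bochner_Integration.integrable_diff[OF Bochner_Integration.integrable_diff[OF i1] Lintegrable]])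
   show "integrable M (%q. (C * (norm (y - w))^2) * cmod (a q))" using a by simp
   fix q assume q: "q \<in> space M"
   have e: "a q * bkernel l (p q) y - a q * bkernel l (p q) w - ?u q * a q * herm (y - w) (p q) =
     a q * (bkernel l (p q) y - bkernel l (p q) w - ?u q * herm (y - w) (p q))"
    by(simp add:algebra_simps)
   have "cmod (bkernel l (p q) y - bkernel l (p q) w - ?u q * herm (y - w) (p q)) <= C * (norm (y - w))^2"
    unfolding C_def using \<delta> ny by(intro bkernel_taylor[OF l \<delta>(1) p1[OF q]]) auto
   thus "cmod (a q * bkernel l (p q) y - a q * bkernel l (p q) w - ?u q * a q * herm (y - w) (p q)) <= (C * (norm (y - w))^2) * cmod (a q)"
    unfolding e norm_mult mult.commute[of _ "cmod (a q)"] by(rule mult_left_mono) simp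
  qed
  finally show ?thesis by(simp add:A_def)
 qed
 have "(?F has_derivative L) (at w)"
 proof (rule has_derivativeI_sandwich[OF \<delta>(1) Llin])
  fix y assume "y ~= w" "dist y w < \<delta>"
  thus "norm ((?F y - ?F w) - L (y - w)) / norm (y - w) <= C * A * norm (y - w)"
   using bound[of y] by(simp add:divide_simps power2_eq_square mult_ac)
 next
  have "((%y. C * A * norm (y - w)) \<longlongrightarrow> C * A * norm (w - w)) (at w)" by(intro tendsto_intros)
  thus "((%y. C * A * norm (y - w)) \<longlongrightarrow> 0) (at w)" by simp
 qed
 moreover have "\<forall>c v. L (c *s v) = c * L v" by(simp add:L_def sum_distrib_left mult_ac)
 ultimately show "\<exists>L. (?F has_derivative L) (at w) \<and> (\<forall>c v. L (c *s v) = c * L v)" by blast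
qed

text \<open>A single kernel is a superposition over a one-point measure space.\<close>

lemma bkernel_holomorphic:
 fixes z :: "complex^'k::finite"
 assumes "0 < l" "norm z <= 1"
 shows "mv_holomorphic_on (bkernel l z) (ball 0 1)"
proof -
 have "integrable (count_space {()}) (%_. 1 :: complex)" by(rule integrable_count_space) simp
 from bkernel_integral_holomorphic[OF assms(1) this, of "%_. z"] assms(2) show ?thesis
  by(simp add:lebesgue_integral_count_space_finite)
qed

lemma bounded_holomorphic_bergman:
 fixes f :: "complex^'k::finite => complex"
 assumes l: "real CARD('k) < l" and f: "mv_holomorphic_on f (ball 0 1)" and B: "!!w. norm w < 1 ==> cmod (f w) <= B"
 shows "f \<in> bergman_space l"
proof -
 interpret B: finite_measure "bergman_measure l :: (complex^'k) measure" by(rule finite_measure_bergman[OF l])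
 have m: "f \<in> bmeas (bergman_measure l)"
  by(rule continuous_measurable_bergman[OF mv_holomorphic_continuous[OF f]])
 have "integrable (bergman_measure l) (%w. (cmod (f w))^2)"
  by(rule B.integrable_const_bound[of _ "B\<^sup>2"]) (use m B in \<open>auto intro!:AE_I2 power_mono\<close>)
 thus ?thesis using f m by(simp add:bergman_space_def sq_integrable_def)
qed

lemma bkernel_bergman:
 fixes z :: "complex^'k::finite"
 assumes l: "real CARD('k) < l" and z: "norm z < 1"
 shows "bkernel l z \<in> bergman_space l"
proof (rule bounded_holomorphic_bergman[OF l])
 have l0: "0 < l" using l by(simp add:le_less_trans[OF of_nat_0_le_iff])
 show "mv_holomorphic_on (bkernel l z) (ball 0 1)" using l0 z by(intro bkernel_holomorphic) auto
 show "cmod (bkernel l z w) <= (1 - norm z) powr (- l)" if "norm w < 1" for w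
  using mult_left_mono[of "norm w" 1 "norm z"] that z l0 by(intro norm_bkernel_le) auto
qed


section \<open>The orbit of the base point\<close>

text \<open>Up to the scalar a, the denominator of the group action at points whose last coordinate
  is 0; its power with exponent -l is the automorphy factor.\<close>

definition cayley :: "real => complex"
 where "cayley y = 1 - \<i> * cor y / 2"

definition orbit :: "'m::finite TR => complex^('m option)"
 where "orbit p = (\<chi> i. case i of
   Some j => fst p $ j / (cor (sqrt (2 * real CARD('m))) * cayley (snd p))
  | None => (\<i> * cor (snd p) / 2) / cayley (snd p))"

lemma Re_cayley [simp]: "Re (cayley y) = 1" and Im_cayley: "Im (cayley y) = - y / 2"
 by(simp_all add: cayley_def)

lemma cayley_nz [simp]: "cayley y ~= 0"
 by(simp add:complex_eq_iff)

lemma cmod_cayley_sq: "(cmod (cayley y))^2 = 1 + y\<^sup>2 / 4"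
 by(simp add:cmod_power2 Im_cayley power_divide)

lemma sum_option: "(\<Sum>i\<in>(UNIV :: 'm::finite option set). f i) = f None + (\<Sum>j\<in>UNIV. f (Some j))"
 unfolding UNIV_option_conv by(subst sum.insert) (auto simp:sum.reindex)

lemma moebius_orbit:
 fixes t :: "complex^'m::finite"
 shows "moebius_action (P_matrix (t, y, x)) z0 = orbit (t, y)"
proof (subst vec_eq_iff, intro allI)
 fix i :: "'m option"
 define a where "a = exp (2 * cor pi * \<i> * cor x)"
 have a: "a ~= 0" by(simp add:a_def)
 have y: "1 - \<i> * cor y / 2 ~= 0" using cayley_nz[of y] by(simp add:cayley_def)
 have den: "(\<Sum>j\<in>UNIV. P_matrix (t, y, x) $ None $ Some j * (z0 :: complex^('m option)) $ j) + P_matrix (t, y, x) $ None $ None =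
   a * (1 - \<i> * cor y / 2)"
  by(simp add:sum_option P_matrix_def z0_def a_def Let_def)
 show "moebius_action (P_matrix (t, y, x)) z0 $ i = orbit (t, y) $ i"
 proof (cases i)
  case None
  have num: "(\<Sum>j\<in>UNIV. P_matrix (t, y, x) $ Some None $ Some j * (z0 :: complex^('m option)) $ j) + P_matrix (t, y, x) $ Some None $ None =
   a * (\<i> * cor y / 2)"
   by(simp add:sum_option P_matrix_def z0_def a_def Let_def)
  show ?thesis unfolding None moebius_action_def vec_lambda_beta num den
   using a y by(simp add:orbit_def cayley_def)
 next
  case (Some j)
  have "(\<Sum>k\<in>UNIV. P_matrix (t, y, x) $ Some (Some j) $ Some k * (z0 :: complex^('m option)) $ k) + P_matrix (t, y, x) $ Some (Some j) $ None =
   (\<Sum>k\<in>UNIV. if j = k then a * t $ j * cor (1 / sqrt (2 * real CARD('m))) else 0)"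
  proof -
   have "P_matrix (t, y, x) $ Some (Some j) $ Some (Some k) * (z0 :: complex^('m option)) $ Some k =
     (if j = k then a * t $ j * cor (1 / sqrt (2 * real CARD('m))) else 0)" for k
    by(simp add:P_matrix_def z0_def a_def Let_def)
   moreover have "P_matrix (t, y, x) $ Some (Some j) $ Some None = 0" "P_matrix (t, y, x) $ Some (Some j) $ None = 0"
    by(simp_all add: P_matrix_def Let_def)
   ultimately show ?thesis unfolding sum_option by simp
  qed
  hence num: "(\<Sum>k\<in>UNIV. P_matrix (t, y, x) $ Some (Some j) $ Some k * (z0 :: complex^('m option)) $ k) + P_matrix (t, y, x) $ Some (Some j) $ None =
   a * t $ j * cor (1 / sqrt (2 * real CARD('m)))" by simp
  show ?thesis unfolding Some moebius_action_def vec_lambda_beta num den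
   using a y by(simp add:orbit_def cayley_def)
 qed
qed

definition phi_base :: "'m::finite TR => complex"
 where "phi_base p = cayley (snd p) - 1 / (2 * of_nat CARD('m)) * (\<Sum>i\<in>UNIV. fst p $ i)"

lemma phi_eq: "phi l p = phi_base p powr (- cor l)"
 by(simp add:phi_def phi_base_def cayley_def case_prod_unfold)

text \<open>On the torus the conjugate is the inverse, so the coordinates other than the last
  contribute quotients. In the last coordinate the product of the two y-terms cancels the quadratic
  term of \<open>cayley\<close> times conjugate \<open>cayley\<close>, leaving \<open>cayley\<close>
  of the difference.\<close>

lemma orbit_herm:
 fixes p q :: "'m::finite TR"
 assumes q: "fst q \<in> torus"
 shows "(1 - herm (orbit p) (orbit q)) * (cayley (snd p) * cnj (cayley (snd q))) = phi_base (TR_div p q)"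
proof -
 define \<mu> where "\<mu> = cor (sqrt (2 * real CARD('m)))"
 have m: "\<mu> * \<mu> = 2 * of_nat CARD('m)"
 proof -
  have "\<mu> * \<mu> = cor (sqrt (2 * real CARD('m)) * sqrt (2 * real CARD('m)))" by(simp only:of_real_mult \<mu>_def)
  also have "... = cor (2 * real CARD('m))" by(subst real_sqrt_mult_self) simp
  finally show ?thesis by simp
 qed
 have m0: "\<mu> ~= 0" "cnj \<mu> = \<mu>" by(simp_all add: \<mu>_def)
 have inv: "cnj (fst q $ i) = 1 / fst q $ i" for i
 proof -
  have "fst q $ i * cnj (fst q $ i) = 1" using q by(simp add:complex_norm_square[symmetric] torus_def)
  thus ?thesis using torus_nz[OF q, of i] by(simp add:field_simps)
 qed
 have c0: "cnj (cayley (snd q)) ~= 0" by simp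
 let ?P = "cayley (snd p)" and ?Q = "cnj (cayley (snd q))"
 have "herm (orbit p) (orbit q) = (\<i> * cor (snd p) / 2 / ?P) * cnj (\<i> * cor (snd q) / 2 / cayley (snd q)) +
   (\<Sum>j\<in>UNIV. (fst p $ j / (\<mu> * ?P)) * cnj (fst q $ j / (\<mu> * cayley (snd q))))"
  unfolding herm_def sum_option by(simp add:orbit_def \<mu>_def)
 also have "(\<Sum>j\<in>UNIV. (fst p $ j / (\<mu> * ?P)) * cnj (fst q $ j / (\<mu> * cayley (snd q)))) =
   (\<Sum>j\<in>UNIV. fst p $ j / fst q $ j) / ((2 * of_nat CARD('m)) * (?P * ?Q))"
 proof -
  have "(fst p $ j / (\<mu> * ?P)) * cnj (fst q $ j / (\<mu> * cayley (snd q))) = (fst p $ j / fst q $ j) / ((\<mu> * \<mu>) * (?P * ?Q))" for j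
   using m0 torus_nz[OF q, of j] c0 by(simp add:inv field_simps)
  thus ?thesis unfolding m by(simp only:sum_divide_distrib)
 qed
 finally have "herm (orbit p) (orbit q) * (?P * ?Q) =
   (\<i> * cor (snd p) / 2) * (- \<i> * cor (snd q) / 2) + (\<Sum>j\<in>UNIV. fst p $ j / fst q $ j) / (2 * of_nat CARD('m))"
  using c0 by(simp add:distrib_right) (simp add:field_simps)
 hence "(1 - herm (orbit p) (orbit q)) * (?P * ?Q) = ?P * ?Q -
   ((\<i> * cor (snd p) / 2) * (- \<i> * cor (snd q) / 2) + (\<Sum>j\<in>UNIV. fst p $ j / fst q $ j) / (2 * of_nat CARD('m)))"
  by(simp add:left_diff_distrib)
 also have "... = cayley (snd p - snd q) - (\<Sum>j\<in>UNIV. fst p $ j / fst q $ j) / (2 * of_nat CARD('m))"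
  by(simp add:cayley_def complex_eq_iff field_simps)
 finally show ?thesis by(simp add:phi_base_def TR_div_def)
qed

text \<open>The case p = q of the preceding identity: (1 - |orbit p|^2) |cayley|^2 = 1/2. The same
  equation shows that the orbit tends to the sphere as |y| grows.\<close>

lemma orbit_in_ball:
 fixes p :: "'m::finite TR"
 assumes p: "fst p \<in> torus"
 shows "norm (orbit p) < 1"
proof -
 have "phi_base (TR_div p p) = 1 / 2"
  using torus_nz[OF p] by(simp add:phi_base_def TR_div_def cayley_def)
 hence "(1 - herm (orbit p) (orbit p)) * (cayley (snd p) * cnj (cayley (snd p))) = 1 / 2"
  using orbit_herm[OF p, of p] by simp
 moreover have "cor ((1 - (norm (orbit p))\<^sup>2) * (cmod (cayley (snd p)))^2) =
   (1 - herm (orbit p) (orbit p)) * (cayley (snd p) * cnj (cayley (snd p)))"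
  by(simp only:of_real_mult of_real_diff of_real_1 herm_self complex_norm_square)
 ultimately have "cor ((1 - (norm (orbit p))\<^sup>2) * (cmod (cayley (snd p)))^2) = cor (1 / 2)"
  by simp
 hence "(1 - (norm (orbit p))\<^sup>2) * (cmod (cayley (snd p)))^2 = 1 / 2" by(simp only:of_real_eq_iff)
 hence "0 < (1 - (norm (orbit p))\<^sup>2) * (cmod (cayley (snd p)))^2" by simp
 hence "0 < 1 - (norm (orbit p))\<^sup>2" by(simp add:zero_less_mult_iff)
 hence "(norm (orbit p))^2 < 1\<^sup>2" by simp
 thus ?thesis by(rule power2_less_imp_less) simp
qed

lemma z0_in_ball: "(z0 :: complex^('m::finite option)) \<in> ball 0 1"
proof -
 have "(z0 :: complex^('m option)) = orbit ((\<chi> i. 1), 0)"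
  by(auto simp:vec_eq_iff z0_def orbit_def cayley_def split: option.splits)
 moreover have "(\<chi> i. 1) \<in> (torus :: (complex^'m) set)" by(simp add:torus_def)
 ultimately show ?thesis using orbit_in_ball[of "((\<chi> i. 1) :: complex^'m, 0)"] by simp
qed

lemma continuous_orbit: "continuous_on UNIV (orbit :: 'm::finite TR => _)"
proof -
 have nz: "1 - \<i> * cor y / 2 ~= 0" for y using cayley_nz[of y] by(simp add:cayley_def)
 have "continuous_on UNIV (%p::'m TR. orbit p $ i)" for i
  by(cases i) (auto simp:orbit_def cayley_def nz intro!:continuous_intros)
 hence "continuous_on UNIV (%p::'m TR. \<chi> i. orbit p $ i)"
  by(rule continuous_on_vec_lambda)
 thus ?thesis by simp
qed

lemma orbit_measurable: "orbit \<in> bmeas TRm"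
 by(intro measurable_TR borel_measurable_continuous_onI continuous_orbit)

lemma Re_phi_base:
 fixes p :: "'m::finite TR"
 assumes p: "fst p \<in> torus"
 shows "1 / 2 <= Re (phi_base p)"
proof -
 have "Re (\<Sum>i\<in>UNIV. fst p $ i) <= cmod (\<Sum>i\<in>UNIV. fst p $ i)" by(rule complex_Re_le_cmod)
 also have "... <= (\<Sum>i\<in>UNIV. cmod (fst p $ i))" by(rule norm_sum)
 also have "... = real CARD('m)" using p by(simp add:torus_def)
 finally have *: "Re (\<Sum>i\<in>UNIV. fst p $ i) <= real CARD('m)" .
 have "1 / (2 * of_nat CARD('m)) * (\<Sum>i\<in>UNIV. fst p $ i) = cor (1 / (2 * real CARD('m))) * (\<Sum>i\<in>UNIV. fst p $ i)"
  by simp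
 hence "Re (phi_base p) = 1 - 1 / (2 * real CARD('m)) * Re (\<Sum>i\<in>UNIV. fst p $ i)"
 proof -
  have "Re (cor r * z) = r * Re z" for r z by simp
  thus ?thesis unfolding phi_base_def \<open>_ = cor (1 / (2 * real CARD('m))) * _\<close>
   by(simp only:minus_complex.sel Re_cayley)
 qed
 also have "... >= 1 - 1 / (2 * real CARD('m)) * real CARD('m)"
  using * by(intro diff_left_mono mult_left_mono) auto
 finally show ?thesis by simp
qed

text \<open>All four arguments lie strictly between -pi/2 and pi/2, so the logarithm of the product
  and the sum of the logarithms differ by an integer multiple of 2 pi i of modulus below 2 pi, that
  is by 0.\<close>

lemma powr_mult3:
 fixes a b c :: complex
 assumes pos: "0 < Re a" "0 < Re b" "0 < Re c" "0 < Re (a * b * c)"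
 shows "(a * b * c) powr r = a powr r * b powr r * c powr r"
proof -
 have nz: "a ~= 0" "b ~= 0" "c ~= 0" "a * b * c ~= 0" using pos by auto
 have Im: "\<bar>Im (Ln a)\<bar> < pi / 2" "\<bar>Im (Ln b)\<bar> < pi / 2" "\<bar>Im (Ln c)\<bar> < pi / 2" "\<bar>Im (Ln (a * b * c))\<bar> < pi / 2"
  using pos nz Re_Ln_pos_lt by auto
 have "exp (Ln (a * b * c)) = exp (Ln a + Ln b + Ln c)"
  using nz by(simp add:exp_add)
 then obtain n :: int where n: "Ln (a * b * c) = Ln a + Ln b + Ln c + (of_int (2 * n) * pi) * \<i>"
  unfolding exp_eq by blast
 have "Im (Ln (a * b * c)) = Im (Ln a) + Im (Ln b) + Im (Ln c) + 2 * real_of_int n * pi"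
  using arg_cong[OF n, of Im] by simp
 hence "\<bar>2 * real_of_int n * pi\<bar> < 2 * pi" using Im by linarith
 hence "\<bar>real_of_int n\<bar> < 1" by(simp add:abs_mult)
 hence "n = 0" by linarith
 hence "Ln (a * b * c) = Ln a + Ln b + Ln c" using n by simp
 thus ?thesis using nz by(simp add:powr_def distrib_left exp_add)
qed

lemma kernel_identity:
 fixes p q :: "'m::finite TR"
 assumes p: "fst p \<in> torus" and q: "fst q \<in> torus"
 shows "cayley (snd p) powr (- cor l) * (cnj (cayley (snd q) powr (- cor l)) * bkernel l (orbit q) (orbit p)) =
  phi l (TR_div p q)"
proof -
 have tq: "fst (TR_div p q) \<in> torus" using p q by(simp add:TR_div_def torus_def norm_divide)
 have b: "0 < Re (1 - herm (orbit p) (orbit q))"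
  using orbit_in_ball[OF p] orbit_in_ball[OF q] by(intro Re_herm) auto
 have e: "(1 - herm (orbit p) (orbit q)) * cayley (snd p) * cnj (cayley (snd q)) = phi_base (TR_div p q)"
  using orbit_herm[OF q, of p] by(simp add:mult.assoc)
 have "phi_base (TR_div p q) powr (- cor l) = (1 - herm (orbit p) (orbit q)) powr (- cor l) *
   cayley (snd p) powr (- cor l) * cnj (cayley (snd q)) powr (- cor l)"
  unfolding e[symmetric] using b Re_phi_base[OF tq] by(intro powr_mult3) (simp_all add: e)
 moreover have "cnj (cayley (snd q)) powr (- cor l) = cnj (cayley (snd q) powr (- cor l))"
  using cnj_powr_real[of "cayley (snd q)" "- l"] by simp
 ultimately show ?thesis by(simp add:phi_eq bkernel_def mult_ac)
qed


section \<open>Functions on the cover and on the orbit\<close>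

definition twist :: "real => ('m::finite TR => complex) => 'm cov => complex"
 where "twist l g = (%(t, y, x). exp (- 2 * cor pi * \<i> * cor l * cor x) * g (t, y))"

lemma untwist_twist [simp]: "untwist l (twist l g) = g"
 by(auto simp:untwist_def twist_def Let_def fun_eq_iff exp_minus)

lemma untwist_add: "untwist l (%h. f h + g h) = (%p. untwist l f p + untwist l g p)"
 by(auto simp:untwist_def Let_def fun_eq_iff distrib_left)

lemma untwist_scale: "untwist l (%h. c * f h) = (%p. c * untwist l f p)"
 by(auto simp:untwist_def Let_def fun_eq_iff)

lemma untwist_diff: "untwist l (%h. f h - g h) = (%p. untwist l f p - untwist l g p)"
 by(auto simp:untwist_def Let_def fun_eq_iff right_diff_distrib)

text \<open>Minus the argument of the product of the \<open>t $ i\<close>, divided by 2 pi (n + 1):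
  a Borel solution x of the equation of \<open>P_cover\<close>. The argument is built from
  \<open>arccos\<close> and the sign of the imaginary part; the clamp keeps \<open>arccos\<close> in
  its domain for t off the torus.\<close>

definition cover_section :: "complex^'m::finite => real"
 where "cover_section t = - ((if 0 <= Im (\<Prod>i\<in>UNIV. t $ i) then 1 else - 1) * arccos (max (- 1) (min 1 (Re (\<Prod>i\<in>UNIV. t $ i)))))
  / (2 * pi * real (CARD('m) + 2))"

lemma cover_section: "t \<in> torus ==> (t, y, cover_section t) \<in> P_cover" for t :: "complex^'m::finite"
proof -
 assume t: "t \<in> torus"
 define z where "z = (\<Prod>i\<in>UNIV. t $ i)"
 define s :: real where "s = (if 0 <= Im z then 1 else - 1)"
 have z: "cmod z = 1" using t by(simp add:z_def torus_def prod_norm[symmetric])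
 have z2: "(Re z)^2 + (Im z)^2 = 1" using z by(metis cmod_power2 one_power2)
 have Re: "- 1 <= Re z" "Re z <= 1" using abs_Re_le_cmod[of z] z by auto
 define \<theta> where "\<theta> = s * arccos (Re z)"
 have "cos \<theta> = Re z" using Re by(simp add:\<theta>_def s_def)
 moreover have "sin \<theta> = Im z"
 proof -
  have "sin (arccos (Re z)) = \<bar>Im z\<bar>" using z2 Re by(simp add:sin_arccos) (metis add_diff_cancel_left' real_sqrt_abs)
  thus ?thesis by(auto simp:\<theta>_def s_def)
 qed
 ultimately have cis: "cis \<theta> = z" by(simp add:complex_eq_iff)
 have "cover_section t = - \<theta> / (2 * pi * real (CARD('m) + 2))"
  using Re by(simp add:cover_section_def \<theta>_def s_def z_def[symmetric])
 hence "2 * pi * real (CARD('m) + 2) * cover_section t = - \<theta>" by simp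
 hence "2 * cor pi * \<i> * of_nat (CARD('m) + 2) * cor (cover_section t) = \<i> * cor (- \<theta>)"
  by(metis (no_types, lifting) mult.assoc mult.commute of_real_mult of_real_numeral of_real_of_nat_eq)
 hence "exp (2 * cor pi * \<i> * of_nat (CARD('m) + 2) * cor (cover_section t)) * z = cis (- \<theta>) * cis \<theta>"
  by(simp only:cis_conv_exp[symmetric] cis)
 thus ?thesis using t by(simp add:P_cover_def z_def[symmetric] cis_mult)
qed

lemma cover_section_measurable [measurable]: "cover_section \<in> bmeas borel"
proof -
 have [measurable]: "(%x::real. arccos (max (- 1) (min 1 x))) \<in> bmeas borel"
  by(intro borel_measurable_continuous_onI continuous_intros) auto
 show ?thesis unfolding cover_section_def[abs_def] by measurable
qed

lemma P_cover_fiber: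
 fixes t :: "complex^'m::finite"
 assumes "(t, y, x) \<in> P_cover" "(t, y, x') \<in> P_cover"
 shows "\<exists>k::int. x' = x + real_of_int k / real (CARD('m) + 2)"
proof -
 let ?c = "2 * cor pi * \<i> * of_nat (CARD('m) + 2)"
 have "exp (?c * cor x) * (\<Prod>i\<in>UNIV. t $ i) = exp (?c * cor x') * (\<Prod>i\<in>UNIV. t $ i)"
  using assms by(simp add:P_cover_def)
 moreover have "(\<Prod>i\<in>UNIV. t $ i) ~= 0" using assms torus_nz[of t] by(auto simp:P_cover_def)
 ultimately have "exp (?c * cor x') = exp (?c * cor x)" by simp
 then obtain k :: int where "?c * cor x' = ?c * cor x + (of_int (2 * k) * pi) * \<i>"
  unfolding exp_eq by blast
 from arg_cong[OF this, of Im]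
 have "2 * pi * real (CARD('m) + 2) * x' = 2 * pi * real (CARD('m) + 2) * x + 2 * real_of_int k * pi" by simp
 hence "2 * pi * (real (CARD('m) + 2) * x') = 2 * pi * (real (CARD('m) + 2) * x + real_of_int k)"
  by(simp add:algebra_simps)
 hence "real (CARD('m) + 2) * x' = real (CARD('m) + 2) * x + real_of_int k"
  by(simp only:mult_cancel_left) simp
 hence "x' = x + real_of_int k / real (CARD('m) + 2)" by(simp add:field_simps)
 thus ?thesis by blast
qed

text \<open>Two values of x above (t, y) differ by a multiple of 1 / (n + 1), and the equivariance
  of f cancels the change of the exponential factor; so the choice made inside
  \<open>untwist\<close> is harmless.\<close>

lemma untwist_cover:
 fixes f :: "'m::finite cov => complex"
 assumes f: "f \<in> L2_chi l" and h: "(t, y, x) \<in> P_cover"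
 shows "untwist l f (t, y) = exp (2 * cor pi * \<i> * cor l * cor x) * f (t, y, x)"
proof -
 define x' where "x' = (SOME x. (t, y, x) \<in> P_cover)"
 have x': "(t, y, x') \<in> P_cover" unfolding x'_def using h by(rule someI)
 obtain k :: int where k: "x' = x + real_of_int k / real (CARD('m) + 2)" using P_cover_fiber[OF h x'] by blast
 let ?c = "2 * cor pi * \<i> * cor l"
 have eq: "f (t, y, x') = exp (- 2 * cor pi * \<i> * cor l * of_int k / of_nat (CARD('m) + 2)) * f (t, y, x)"
  using f h unfolding L2_chi_def k by blast
 have "?c * cor x' + (- 2 * cor pi * \<i> * cor l * of_int k / of_nat (CARD('m) + 2)) = ?c * cor x"
  by(simp add:k distrib_left)
 hence "exp (?c * cor x') * exp (- 2 * cor pi * \<i> * cor l * of_int k / of_nat (CARD('m) + 2)) = exp (?c * cor x)"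
  by(simp only:exp_add[symmetric])
 thus ?thesis by(simp add:untwist_def x'_def[symmetric] Let_def eq mult.assoc[symmetric])
qed

lemma cover_eq_twist:
 assumes f: "f \<in> L2_chi l" and h: "(t, y, x) \<in> P_cover"
 shows "f (t, y, x) = exp (- 2 * cor pi * \<i> * cor l * cor x) * untwist l f (t, y)"
 unfolding untwist_cover[OF assms] by(simp add:exp_minus)

text \<open>Measurability is the point: the arbitrary choice of x in \<open>untwist\<close> is
  replaced by the Borel section.\<close>

lemma untwist_sq_integrable:
 fixes f :: "'m::finite cov => complex"
 assumes f: "f \<in> L2_chi l"
 shows "TR2 (untwist l f)"
proof -
 have fm: "f \<in> bmeas (restrict_space borel P_cover)" using f by(simp add:L2_chi_def)
 have sm: "(%p. cover_section (fst p)) \<in> bmeas (TRm :: 'm TR measure)" by measurable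
 have "(%p. (fst p, snd p, cover_section (fst p))) \<in> measurable (TRm :: 'm TR measure) (borel \<Otimes>\<^sub>M (borel \<Otimes>\<^sub>M borel))"
  using sm by measurable
 hence "(%p. (fst p, snd p, cover_section (fst p))) \<in> measurable (TRm :: 'm TR measure) borel"
  by(simp add:borel_prod)
 hence "(%p. (fst p, snd p, cover_section (fst p))) \<in> measurable TRm (restrict_space borel (P_cover :: 'm cov set))"
  by(rule measurable_restrict_space2[rotated]) (auto intro:cover_section)
 from measurable_compose[OF this fm]
 have "(%p. exp (2 * cor pi * \<i> * cor l * cor (cover_section (fst p))) * f (fst p, snd p, cover_section (fst p))) \<in> bmeas TRm"
  using sm by measurable
 hence "untwist l f \<in> bmeas TRm"
  by(rule measurable_cong[THEN iffD1, rotated]) (auto simp:untwist_cover[OF f cover_section])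
 thus ?thesis using f by(simp add:L2_chi_def sq_integrable_def)
qed

lemma twist_in_L2_chi:
 fixes g :: "'m::finite TR => complex"
 assumes g: "TR2 g"
 shows "twist l g \<in> L2_chi l"
proof -
 let ?P = "restrict_space borel (P_cover :: 'm cov set)"
 have c: "(%h. fst h) \<in> bmeas ?P" "(%h. fst (snd h)) \<in> bmeas ?P" "(%h. snd (snd h)) \<in> bmeas ?P"
  by(auto intro!:measurable_restrict_space1 borel_measurable_continuous_onI continuous_intros)
 have "(%h. fst h) \<in> measurable ?P (restrict_space borel torus)"
  by(rule measurable_restrict_space2[OF _ c(1)]) (auto simp:P_cover_def space_restrict_space)
 hence "(%h. fst h) \<in> measurable ?P torus_haar"
  by(simp add:measurable_cong_sets[OF refl sets_torus_haar])
 hence "(%h. (fst h, fst (snd h))) \<in> measurable ?P TRm"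
  unfolding TR_measure_def using c(2) by(intro measurable_Pair) auto
 moreover have "g \<in> bmeas TRm" using g by(simp add:sq_integrable_def)
 ultimately have gm: "(%h. g (fst h, fst (snd h))) \<in> bmeas ?P" by(rule measurable_compose)
 have "(%h. exp (- 2 * cor pi * \<i> * cor l * cor (snd (snd h))) * g (fst h, fst (snd h))) \<in> bmeas ?P"
 proof (rule borel_measurable_times[OF _ gm])
  have "(%x::real. exp (- 2 * cor pi * \<i> * cor l * cor x)) \<in> bmeas borel"
   by measurable
  from measurable_compose[OF c(3) this]
  show "(%h. exp (- 2 * cor pi * \<i> * cor l * cor (snd (snd h)))) \<in> bmeas ?P" .
 qed
 hence m: "twist l g \<in> bmeas ?P" by(simp add:twist_def case_prod_unfold)
 have e: "exp (- 2 * cor pi * \<i> * cor l * cor (x + real_of_int k / real (CARD('m) + 2))) =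
   exp (- 2 * cor pi * \<i> * cor l * of_int k / of_nat (CARD('m) + 2)) * exp (- 2 * cor pi * \<i> * cor l * cor x)" for x k
  unfolding exp_add[symmetric] by(simp add:algebra_simps)
 have eqv: "twist l g (t, y, x + real_of_int k / real (CARD('m) + 2)) =
   exp (- 2 * cor pi * \<i> * cor l * of_int k / of_nat (CARD('m) + 2)) * twist l g (t, y, x)" for t y x k
  unfolding twist_def prod.case e by(simp only:mult.assoc)
 show ?thesis
  unfolding L2_chi_def
 proof (intro CollectI conjI)
  show "integrable TRm (%p. (cmod (untwist l (twist l g) p))^2)"
   using g by(simp add:sq_integrable_def)
 qed (use m eqv in blast)+
qed

lemma ip_space_L2_chi: "ip_space (L2_chi l) (chi_ip l :: ('m::finite cov => complex) => _)"
proof -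
 have meas: "h \<in> bmeas (restrict_space borel P_cover)" if "h \<in> L2_chi l" for h :: "'m cov => complex"
  using that by(simp add:L2_chi_def)
 have eqv: "h (t, y, x + real_of_int k / real (CARD('m) + 2)) =
    exp (- 2 * cor pi * \<i> * cor l * of_int k / of_nat (CARD('m) + 2)) * h (t, y, x)"
  if "h \<in> L2_chi l" "(t, y, x) \<in> P_cover" for h :: "'m cov => complex" and t y x k
  using that unfolding L2_chi_def by blast
 show ?thesis
 proof
  fix f g h :: "'m cov => complex" and c
  have "twist l (%p. 0) \<in> (L2_chi l :: ('m cov => complex) set)"
   using ip_space.zero[OF ip_space_L2] by(intro twist_in_L2_chi) simp
  moreover have "twist l (%p. 0) = (%h::'m cov. 0)" by(simp add:twist_def case_prod_unfold)
  ultimately show "(%h::'m cov. 0) \<in> L2_chi l" by simp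
  assume f: "f \<in> L2_chi l"
  note f' = untwist_sq_integrable[OF f]
  show "(%x. c * f x) \<in> L2_chi l"
   using sq_integrable_scale[OF f', of c] meas[OF f] eqv[OF f]
   unfolding L2_chi_def sq_integrable_def by(auto simp:untwist_scale intro!:borel_measurable_times)
  show "0 <= Re (chi_ip l f f)" using Plancherel.V.ip_pos f' by(simp add:chi_ip_def)
  assume h: "h \<in> L2_chi l"
  note h' = untwist_sq_integrable[OF h]
  show "chi_ip l (%x. c * f x) h = c * chi_ip l f h"
   using Plancherel.V.ip_scale f' h' by(simp add:chi_ip_def untwist_scale)
  assume g: "g \<in> L2_chi l"
  note g' = untwist_sq_integrable[OF g]
  show "(%x. f x + g x) \<in> L2_chi l"
   using Plancherel.V.add[of "untwist l f" "untwist l g"] f' g' meas[OF f] meas[OF g] eqv[OF f] eqv[OF g]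
   unfolding L2_chi_def sq_integrable_def by(auto simp:untwist_add distrib_left intro!:borel_measurable_add)
  show "chi_ip l (%x. f x + g x) h = chi_ip l f h + chi_ip l g h"
   using Plancherel.V.ip_add f' g' h' by(simp add:chi_ip_def untwist_add)
  show "chi_ip l g f = cnj (chi_ip l f g)" using Plancherel.V.ip_cnj f' g' by(simp add:chi_ip_def)
 qed
qed

lemma chi_nrm: "ip_norm (chi_ip l) f = TR_nrm (untwist l f)"
 by(simp add:ip_norm_def chi_ip_def)

lemma chi_dist: "chi_d l f g = ip_dist (L2_ip TRm) (untwist l f) (untwist l g)"
 by(simp add:ip_dist_def chi_nrm untwist_diff)

lemma D_fun_eq: "D_fun l (t, y, x) = exp (- 2 * cor pi * \<i> * cor l * cor x) * cayley y powr (- cor l)"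
 by(simp add:D_fun_def cayley_def)

lemma D_fun_eq_twist: "D_fun l = twist l (%p. cayley (snd p) powr (- cor l))"
 by(auto simp:fun_eq_iff D_fun_eq twist_def)

lemma restriction_op_eq_twist:
 "restriction_op l f = twist l (%p. cayley (snd p) powr (- cor l) * f (orbit p))"
 by(auto simp:fun_eq_iff restriction_op_def D_fun_eq twist_def moebius_orbit)

section \<open>Integrability of \<open>\<phi>\<close>\<close>

text \<open>Majorant: 1 for |y| \<le> 1 and 4^s |y|^(-2 s) beyond, which is integrable because 2 s >
  1.\<close>

lemma cayley_powr_integrable:
 fixes s :: real
 assumes s: "1 / 2 < s"
 shows "integrable lborel (%y. (1 + y\<^sup>2 / 4) powr (- s))"
proof -
 let ?h = "%x. (4 :: real) powr s * (indicator {1..} x * x powr (- 2 * s))"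
 have h0: "0 <= ?h x" for x by(simp split: split_indicator)
 have hm [measurable]: "?h \<in> bmeas borel" by measurable
 have "((%x. x powr (- 2 * s)) has_integral - (1 powr (- 2 * s + 1)) / (- 2 * s + 1)) {1..}"
  by(rule has_integral_powr_to_inf) (use s in auto)
 from nn_integral_has_integral_lebesgue[OF _ this]
 have "(\<integral>\<^sup>+x. ennreal (indicator {1..} x * x powr (- 2 * s)) \<partial>lborel) < \<infinity>" by simp
 hence "integrable lborel (%x::real. indicator {1..} x * x powr (- 2 * s))"
  by(intro integrableI_bounded) (auto split: split_indicator simp:abs_mult)
 hence hi: "integrable lborel ?h" by(rule integrable_mult_right)
 have hi': "integrable lborel (%x. ?h (- x))"
  using lborel_integrable_real_affine_iff[of "-1" ?h 0] hi by simp
 have ci: "integrable lborel (indicator {-1..1} :: real => real)" by simp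
 show ?thesis
 proof (rule LINT_bound[OF Bochner_Integration.integrable_add[OF Bochner_Integration.integrable_add[OF hi hi'] ci]])
  show "AE y in lborel. norm ((1 + y\<^sup>2 / 4) powr (- s)) <= norm (?h y + ?h (- y) + indicator {-1..1} y)"
  proof (rule AE_I2)
   fix y :: real
   have nn: "0 <= ?h y" "0 <= ?h (- y)" "(0::real) <= indicator {-1..1} y" using h0 by auto
   have big: "(1 + y\<^sup>2 / 4) powr (- s) <= 4 powr s * \<bar>y\<bar> powr (- 2 * s)" if "1 <= \<bar>y\<bar>"
   proof -
    have "(1 + y\<^sup>2 / 4) powr (- s) <= (y\<^sup>2 / 4) powr (- s)"
     using that s by(intro powr_mono2') auto
    also have "(y\<^sup>2 / 4) powr (- s) = (\<bar>y\<bar>\<^sup>2) powr (- s) * 4 powr s"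
    proof -
     have "(y\<^sup>2 / 4) powr (- s) = y\<^sup>2 powr (- s) / 4 powr (- s)" by(rule powr_divide)
     thus ?thesis by(simp only:powr_minus[of 4 s] divide_inverse inverse_inverse_eq power2_abs)
    qed
    also have "(\<bar>y\<bar>\<^sup>2) powr (- s) = \<bar>y\<bar> powr (- 2 * s)"
    proof -
     have "\<bar>y\<bar>\<^sup>2 = \<bar>y\<bar> powr 2" using that by(simp add:powr_numeral)
     thus ?thesis by(simp only:powr_powr) simp
    qed
    finally show ?thesis by(simp add:mult.commute)
   qed
   have small: "(1 + y\<^sup>2 / 4) powr (- s) <= 1"
   proof -
    have "(1 + y\<^sup>2 / 4) powr (- s) <= 1 powr (- s)" using s by(intro powr_mono2') auto
    thus ?thesis by simp
   qed
   have "(1 + y\<^sup>2 / 4) powr (- s) <= ?h y + ?h (- y) + indicator {-1..1} y"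
   proof (cases "1 <= \<bar>y\<bar>")
    case True
    hence "4 powr s * \<bar>y\<bar> powr (- 2 * s) <= ?h y + ?h (- y)"
     using nn by(cases "0 <= y") (auto simp:abs_real_def)
    thus ?thesis using big[OF True] nn(3) by linarith
   next
    case False
    hence "(indicator {-1..1} y :: real) = 1" by(auto simp:abs_real_def split: if_splits)
    thus ?thesis using small nn by linarith
   qed
   thus "norm ((1 + y\<^sup>2 / 4) powr (- s)) <= norm (?h y + ?h (- y) + indicator {-1..1} y)"
    by(simp only:real_norm_def abs_of_nonneg[OF powr_ge_zero])
  qed
 qed measurable
qed

lemma cmod_cayley_powr: "cmod (cayley y powr (- cor s)) = (1 + y\<^sup>2 / 4) powr (- s / 2)"
proof -
 have "cmod (cayley y powr cor (- s)) = cmod (cayley y) powr (- s)" by(rule cmod_powr_real) simp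
 also have "... = (cmod (cayley y) powr 2) powr (- s / 2)" by(simp only:powr_powr) simp
 also have "cmod (cayley y) powr 2 = 1 + y\<^sup>2 / 4" using cmod_cayley_sq[of y] by(simp add:powr_numeral)
 finally show ?thesis by simp
qed

lemma cayley_measurable: "cayley \<in> bmeas borel"
 unfolding cayley_def[abs_def] by measurable

lemma cayley_powr_measurable: "(%p. cayley (snd p) powr c) \<in> bmeas TRm"
 by(rule powr_measurable[OF measurable_compose[OF snd_TR cayley_measurable]]) simp

lemma TR_integrable_snd:
 fixes v :: "real => real"
 assumes "integrable lborel v"
 shows "integrable TRm (%p. v (snd p))"
proof -
 have "integrable TRm (%p::'a TR. (%t. 1) (fst p) * cor (v (snd p)))"
  by(rule TR_prod(1)[where B = 1]) (use assms in auto)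
 from integrable_Re[OF this] show ?thesis by simp
qed

lemma cayley_sq_integrable:
 assumes "1 / 2 < s"
 shows "TR2 (%p :: 'm::finite TR. cayley (snd p) powr (- cor s))"
proof -
 have "(cmod (cayley y powr (- cor s)))^2 = (1 + y\<^sup>2 / 4) powr (- s)" for y
  unfolding cmod_cayley_powr by(simp add:power2_eq_square powr_add[symmetric])
 thus ?thesis
  unfolding sq_integrable_def
  by(simp only:) (intro conjI cayley_powr_measurable TR_integrable_snd cayley_powr_integrable assms)
qed

lemma D_fun_in_L2_chi: "1 / 2 < s ==> D_fun s \<in> L2_chi s"
 unfolding D_fun_eq_twist by(intro twist_in_L2_chi cayley_sq_integrable)

lemma phi_base_measurable: "phi_base \<in> bmeas TRm"
 unfolding phi_base_def[abs_def] cayley_def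
 by(intro measurable_TR borel_measurable_continuous_onI continuous_intros) auto

lemma phi_measurable: "(phi s :: 'm::finite TR => complex) \<in> bmeas TRm"
proof -
 have "(%p :: 'm TR. phi_base p powr (- cor s)) \<in> bmeas TRm"
 proof (rule powr_measurable[OF phi_base_measurable])
  fix p :: "'m TR" assume "p \<in> space TRm"
  hence "1 / 2 <= Re (phi_base p)" by(intro Re_phi_base) auto
  thus "0 < Re (phi_base p)" by linarith
 qed
 thus ?thesis by(simp add:phi_eq[abs_def])
qed

text \<open>\<open>cayley\<close> and \<open>phi_base\<close> differ by at most 1/2 in modulus, and
  |phi_base| \<ge> 1/2, so |cayley| \<le> 2 |phi_base|.\<close>

lemma cmod_phi_le:
 fixes p :: "'m::finite TR"
 assumes p: "fst p \<in> torus" and s: "0 < s"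
 shows "cmod (phi s p) <= 2 powr s * (1 + (snd p)^2 / 4) powr (- s / 2)"
proof -
 have R: "1 / 2 <= cmod (phi_base p)" using Re_phi_base[OF p] complex_Re_le_cmod[of "phi_base p"] by linarith
 have "cmod (1 / (2 * of_nat CARD('m)) * (\<Sum>i\<in>UNIV. fst p $ i)) <= 1 / (2 * real CARD('m)) * (\<Sum>i\<in>UNIV. cmod (fst p $ i))"
  unfolding norm_mult by(intro mult_mono norm_sum) (auto simp:norm_divide norm_mult)
 also have "... = 1 / 2" using p by(simp add:torus_def)
 finally have "cmod (cayley (snd p)) <= cmod (phi_base p) + 1 / 2"
  using norm_triangle_ineq[of "phi_base p" "1 / (2 * of_nat CARD('m)) * (\<Sum>i\<in>UNIV. fst p $ i)"]
  unfolding phi_base_def by simp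
 hence c: "cmod (cayley (snd p)) / 2 <= cmod (phi_base p)" using R by linarith
 have "phi_base p ~= 0" using R by auto
 hence "cmod (phi s p) = cmod (phi_base p) powr (- s)"
  using cmod_powr_real[of "phi_base p" "- s"] by(simp add:phi_eq)
 also have "... <= (cmod (cayley (snd p)) / 2) powr (- s)"
  using c s by(intro powr_mono2') auto
 also have "... = 2 powr s * cmod (cayley (snd p)) powr (- s)"
 proof -
  have "(cmod (cayley (snd p)) / 2) powr (- s) = cmod (cayley (snd p)) powr (- s) / 2 powr (- s)"
   by(rule powr_divide)
  thus ?thesis by(simp only:powr_minus[of 2 s] divide_inverse inverse_inverse_eq mult.commute)
 qed
 also have "cmod (cayley (snd p)) powr (- s) = (1 + (snd p)^2 / 4) powr (- s / 2)"
  using cmod_powr_real[of "cayley (snd p)" "- s"] cmod_cayley_powr[of "snd p" s] by simp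
 finally show ?thesis .
qed

lemma phi_integrable:
 assumes s: "1 < s" shows "integrable TRm (phi s)"
proof (rule LINT_bound)
 show "integrable TRm (%p. 2 powr s * (1 + (snd p)^2 / 4) powr (- (s / 2)))"
  by(rule integrable_mult_right, rule TR_integrable_snd, rule cayley_powr_integrable) (use s in auto)
 show "AE p in TRm. norm (phi s p) <= norm (2 powr s * (1 + (snd p)^2 / 4) powr (- (s / 2)))"
  using cmod_phi_le[of _ s] s by(intro AE_I2) auto
qed (rule phi_measurable)


section \<open>The Fourier transform of \<open>\<phi>\<close>\<close>

text \<open>For real c this is a substitution. For complex c, exp (-c x) is expanded around a real a
  with |c - a| < a, and termwise integration produces the binomial series of (c / a) powr
  (-s).\<close>

lemma Gamma_integral_complex_scale:
 assumes s: "0 < s" and c: "0 < Re c"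
 shows "integrable lborel (%x. if 0 < x then cor (x powr (s - 1)) * exp (- (c * cor x)) else 0)"
  and "(LINT x|lborel. (if 0 < x then cor (x powr (s - 1)) * exp (- (c * cor x)) else 0)) =
   cor (Gamma s) * c powr (- cor s)"
proof -
 have real: "(\<integral>\<^sup>+x. ennreal (if 0 < x then x powr (k - 1) * exp (- (a * x)) else 0) \<partial>lborel) = ennreal (Gamma k * a powr (- k))"
  if k: "0 < k" and a: "0 < a" for k a :: real
 proof -
  define g where "g x = ennreal (if 0 < x then x powr (k - 1) * exp (- x) else 0)" for x :: real
  have gm: "g \<in> bmeas borel" unfolding g_def[abs_def] by measurable
  have "ennreal (Gamma k) = (\<integral>\<^sup>+x. g x \<partial>lborel)" unfolding g_def by(rule nn_integral_Gamma[OF k, symmetric])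
  also have "... = ennreal a * (\<integral>\<^sup>+x. g (a * x) \<partial>lborel)"
   using nn_integral_real_affine[OF gm, of a 0] a by simp
  also have "(\<integral>\<^sup>+x. g (a * x) \<partial>lborel) = (\<integral>\<^sup>+x. ennreal (a powr (k - 1)) * ennreal (if 0 < x then x powr (k - 1) * exp (- (a * x)) else 0) \<partial>lborel)"
   using a by(intro nn_integral_cong) (auto simp:g_def zero_less_mult_iff powr_mult ennreal_mult'[symmetric])
  also have "... = ennreal (a powr (k - 1)) * (\<integral>\<^sup>+x. ennreal (if 0 < x then x powr (k - 1) * exp (- (a * x)) else 0) \<partial>lborel)"
   by(rule nn_integral_cmult) measurable
  also have "ennreal a * (ennreal (a powr (k - 1)) * (\<integral>\<^sup>+x. ennreal (if 0 < x then x powr (k - 1) * exp (- (a * x)) else 0) \<partial>lborel)) =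
    ennreal (a powr k) * (\<integral>\<^sup>+x. ennreal (if 0 < x then x powr (k - 1) * exp (- (a * x)) else 0) \<partial>lborel)"
  proof -
   have "a * a powr (k - 1) = a powr k" using a powr_add[of a 1 "k - 1"] by simp
   thus ?thesis using a by(simp add:mult.assoc[symmetric] ennreal_mult'[symmetric])
  qed
  finally have *: "ennreal (a powr (- k)) * ennreal (Gamma k) =
    ennreal (a powr (- k)) * (ennreal (a powr k) * (\<integral>\<^sup>+x. ennreal (if 0 < x then x powr (k - 1) * exp (- (a * x)) else 0) \<partial>lborel))"
   by simp
  have "a powr (- k) * a powr k = 1" using a by(simp add:powr_add[symmetric])
  hence inv: "ennreal (a powr (- k)) * (ennreal (a powr k) * I) = I" for I
   by(simp add:mult.assoc[symmetric] ennreal_mult'[symmetric])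
  show ?thesis using *[unfolded inv, symmetric] by(simp add:ennreal_mult'' mult.commute)
 qed
 have realint: "integrable lborel (%x. if 0 < x then x powr (k - 1) * exp (- (a * x)) else 0)"
  and realval: "(LINT x|lborel. (if 0 < x then x powr (k - 1) * exp (- (a * x)) else 0)) = Gamma k * a powr (- k)"
  if k: "0 < k" and a: "0 < a" for k a :: real
 proof -
  have nn: "0 <= (if 0 < x then x powr (k - 1) * exp (- (a * x)) else 0)" for x by simp
  have "(%x. if 0 < x then x powr (k - 1) * exp (- (a * x)) else 0) \<in> bmeas lborel" by measurable
  moreover have "(\<integral>\<^sup>+x. ennreal (norm (if 0 < x then x powr (k - 1) * exp (- (a * x)) else 0)) \<partial>lborel) < \<infinity>"
   using real[OF k a] nn by simp
  ultimately show i: "integrable lborel (%x. if 0 < x then x powr (k - 1) * exp (- (a * x)) else 0)"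
   by(rule integrableI_bounded)
  have "0 <= Gamma k * a powr (- k)" using Gamma_real_pos[OF k] by simp
  thus "(LINT x|lborel. (if 0 < x then x powr (k - 1) * exp (- (a * x)) else 0)) = Gamma k * a powr (- k)"
   using real[OF k a] nn_integral_eq_integral[OF i] nn by(simp add:integral_nonneg_AE)
 qed
 let ?f = "%x. if 0 < x then cor (x powr (s - 1)) * exp (- (c * cor x)) else 0"
 show "integrable lborel ?f"
 proof (rule LINT_bound[OF realint[OF s c]])
  show "AE x in lborel. norm (?f x) <= norm (if 0 < x then x powr (s - 1) * exp (- (Re c * x)) else 0)"
   by(rule AE_I2) (simp add:norm_mult)
 qed measurable
 obtain a where a: "0 < a" "cmod (c - cor a) < a"
 proof -
  \<comment> \<open>Discs of radius a around a exhaust the right half plane; with this a, |c - a|^2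
    = a^2 - |c|^2.\<close>
  define a where "a = (cmod c)^2 / Re c"
  have c0: "0 < (cmod c)^2" using c by auto
  hence a0: "0 < a" using c by(simp add:a_def)
  have "(cmod (c - cor a))^2 = (cmod c)^2 - 2 * a * Re c + a\<^sup>2"
   by(simp only:cmod_power2) (simp add:power2_eq_square algebra_simps)
  also have "... = a\<^sup>2 - (cmod c)\<^sup>2" using c by(simp add:a_def)
  also have "... < a\<^sup>2" using c0 by simp
  finally have "cmod (c - cor a) < a" using a0 by(simp add:power2_less_imp_less)
  with a0 show ?thesis by(rule that)
 qed
 define z where "z = (cor a - c) / cor a"
 have z: "cmod z < 1" using a by(simp add:z_def norm_divide norm_minus_commute)
 have az: "cor a - c = cor a * z" using a by(simp add:z_def)
 let ?u = "%k x. if 0 < x then cor (x powr (s - 1) * exp (- (a * x))) * ((cor a * z * cor x) ^ k / fact k) else 0"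
 have ueq: "?u k x = (cor a * z) ^ k / fact k * cor (if 0 < x then x powr (s + real k - 1) * exp (- (a * x)) else 0)" for k x
 proof (cases "0 < x")
  case True
  hence "x powr (s + real k - 1) = x powr (s - 1) * x ^ k"
   using powr_add[of x "s - 1" "real k"] by(simp add:powr_realpow algebra_simps)
  thus ?thesis using True by(simp add:power_mult_distrib mult_ac)
 qed simp
 have sk: "0 < s + real k" for k using s by simp
 have uint: "integrable lborel (?u k)" for k
  unfolding ueq by(intro integrable_mult_right integrable_of_real realint sk a)
 have uval: "(LINT x|lborel. ?u k x) = cor (Gamma s) * cor (a powr (- s)) * (cor (pochhammer s k / fact k) * z ^ k)" for k
 proof -
  have "(LINT x|lborel. ?u k x) = (cor a * z) ^ k / fact k * cor (Gamma (s + real k) * a powr (- (s + real k)))"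
   unfolding ueq by(subst LINT_mult_right, subst integral_complex_of_real, subst realval[OF sk a(1)]) simp
  moreover have "Gamma (s + real k) = pochhammer s k * Gamma s"
  proof -
   have "s \<notin> \<int>\<^sub>\<le>\<^sub>0" using s by(auto elim!: nonpos_Ints_cases)
   thus ?thesis using pochhammer_Gamma[of s k] Gamma_real_pos[OF s] by simp
  qed
  moreover have "a powr (- (s + real k)) * a ^ k = a powr (- s)"
   using a by(simp add:powr_realpow[symmetric] powr_add[symmetric])
  hence "cor (a powr (- (s + real k))) * cor a ^ k = cor (a powr (- s))"
   by(simp only:of_real_mult[symmetric] of_real_power[symmetric])
  ultimately show ?thesis by(simp add:power_mult_distrib mult_ac)
 qed
 have "(%k. LINT x|lborel. ?u k x) sums (LINT x|lborel. (\<Sum>k. ?u k x))"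
 proof (rule sums_integral)
  show "integrable lborel (?u k)" for k by(rule uint)
  show "AE x in lborel. summable (%k. norm (?u k x))"
  proof (rule AE_I2)
   fix x :: real
   show "summable (%k. norm (?u k x))"
   proof (cases "0 < x")
    case True
    have "summable (%k. cmod (cor (x powr (s - 1) * exp (- (a * x)))) * (norm (cor a * z * cor x) ^ k /\<^sub>R fact k))"
     by(intro summable_mult summable_exp_generic)
    thus ?thesis using True by(simp add:norm_mult norm_divide norm_power norm_inverse divide_inverse mult_ac)
   qed simp
  qed
  have "(LINT x|lborel. norm (?u k x)) = Gamma s * a powr (- s) * (pochhammer s k / fact k * cmod z ^ k)" for k
  proof -
   have "norm (?u k x) = (a * cmod z) ^ k / fact k * (if 0 < x then x powr (s + real k - 1) * exp (- (a * x)) else 0)" for x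
    unfolding ueq using a by(auto simp:norm_mult norm_divide norm_power)
   hence "(LINT x|lborel. norm (?u k x)) = (a * cmod z) ^ k / fact k * (Gamma (s + real k) * a powr (- (s + real k)))"
    by(simp only:LINT_mult_right realval[OF sk a(1)])
   moreover have "Gamma (s + real k) = pochhammer s k * Gamma s"
   proof -
    have "s \<notin> \<int>\<^sub>\<le>\<^sub>0" using s by(auto elim!: nonpos_Ints_cases)
    thus ?thesis using pochhammer_Gamma[of s k] Gamma_real_pos[OF s] by simp
   qed
   moreover have "a powr (- (s + real k)) * a ^ k = a powr (- s)"
    using a by(simp add:powr_realpow[symmetric] powr_add[symmetric])
   ultimately show ?thesis by(simp add:power_mult_distrib mult_ac)
  qed
  thus "summable (%k. LINT x|lborel. norm (?u k x))"
   using summable_mult[OF binomial_series_real[of "cmod z" s], of "Gamma s * a powr (- s)"] z s by simp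
 qed
 moreover have "(\<Sum>k. ?u k x) = ?f x" for x
 proof (cases "0 < x")
  case True
  have "(%k. cor (x powr (s - 1) * exp (- (a * x))) * ((cor a * z * cor x) ^ k /\<^sub>R fact k)) sums
    (cor (x powr (s - 1) * exp (- (a * x))) * exp (cor a * z * cor x))"
   by(intro sums_mult exp_converges)
  moreover have "cor (exp (- (a * x))) * exp (cor a * z * cor x) = exp (- (c * cor x))"
   unfolding az[symmetric] exp_of_real[symmetric] exp_add[symmetric] by(simp add:algebra_simps)
  ultimately show ?thesis using True by(simp add:sums_iff scaleR_conv_of_real divide_inverse mult_ac)
 qed simp
 ultimately have 1: "(%k. cor (Gamma s) * cor (a powr (- s)) * (cor (pochhammer s k / fact k) * z ^ k)) sums (LINT x|lborel. ?f x)"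
  by(simp only:uval)
 have 2: "(%k. cor (Gamma s) * cor (a powr (- s)) * (cor (pochhammer s k / fact k) * z ^ k)) sums
   (cor (Gamma s) * cor (a powr (- s)) * (1 - z) powr (- cor s))"
  by(intro sums_mult binomial_series_neg z)
 have "cor (a powr (- s)) * (1 - z) powr (- cor s) = c powr (- cor s)"
 proof -
  have "1 - z = c / cor a" using a by(simp add:z_def field_simps)
  hence c': "c = cor a * (1 - z)" using a by simp
  have "c powr (- cor s) = cor a powr (- cor s) * (1 - z) powr (- cor s)"
   unfolding c' using a by(intro powr_times_real_left) auto
  thus ?thesis using a by(simp add:powr_of_real[symmetric])
 qed
 thus "(LINT x|lborel. ?f x) = cor (Gamma s) * c powr (- cor s)"
  using sums_unique2[OF 1 2] by(simp add:mult.assoc)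
qed

text \<open>Terms of the exponential series indexed by all integers, with zeros at negative indices;
  this encodes the condition \<alpha> \<ge> 0 and lets the sum over multi-indices factor.\<close>

definition exp_coeff :: "'a::{real_normed_field,banach,second_countable_topology} => int => 'a"
 where "exp_coeff z k = (if 0 <= k then z ^ nat k / fact (nat k) else 0)"

lemma exp_coeff_sum:
 "Infinite_Set_Sum.abs_summable_on (exp_coeff z) UNIV" "infsetsum (exp_coeff z) UNIV = exp z"
proof -
 have bij: "bij_betw int UNIV {0..}"
  by(rule bij_betwI[where g = nat]) auto
 have e: "exp_coeff z (int k) = z ^ k /\<^sub>R fact k" for k
  by(simp add:exp_coeff_def scaleR_conv_of_real divide_inverse mult.commute)
 have "Infinite_Set_Sum.abs_summable_on (%k. exp_coeff z (int k)) UNIV"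
  unfolding e abs_summable_on_nat_iff' using summable_norm_exp[of z] by simp
 hence a: "Infinite_Set_Sum.abs_summable_on (exp_coeff z) {0..}"
  by(subst (asm) abs_summable_on_reindex_bij_betw[OF bij])
 thus "Infinite_Set_Sum.abs_summable_on (exp_coeff z) UNIV"
  by(rule abs_summable_on_cong_neutral[THEN iffD1, rotated -1]) (auto simp:exp_coeff_def)
 have "infsetsum (exp_coeff z) UNIV = infsetsum (exp_coeff z) {0..}"
  by(rule infsetsum_cong_neutral) (auto simp:exp_coeff_def)
 also have "... = infsetsum (%k. exp_coeff z (int k)) UNIV"
  by(rule infsetsum_reindex_bij_betw[OF bij, symmetric])
 also have "... = (\<Sum>k. exp_coeff z (int k))"
  using a by(intro infsetsum_nat') (subst abs_summable_on_reindex_bij_betw[OF bij])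
 also have "... = exp z" unfolding e exp_def ..
 finally show "infsetsum (exp_coeff z) UNIV = exp z" .
qed

text \<open>Absolute summability turns the sum over multi-indices into a product of one-variable
  exponential series.\<close>

lemma exp_coeff_prod:
 fixes z :: "'m::finite => 'a::{real_normed_field,banach,second_countable_topology}"
 shows "integrable (count_space UNIV) (%\<alpha> :: int^'m. \<Prod>i\<in>UNIV. exp_coeff (z i) (\<alpha> $ i))"
  and "(LINT \<alpha>|count_space UNIV. (\<Prod>i\<in>UNIV. exp_coeff (z i) (\<alpha> $ i))) = exp (\<Sum>i\<in>UNIV. z i)"
proof -
 let ?f = "%g :: 'm => int. \<Prod>i\<in>UNIV. exp_coeff (z i) (g i)"
 have P: "Pi\<^sub>E (UNIV :: 'm set) (%_. UNIV :: int set) = UNIV" by auto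
 have bij: "bij_betw (vec_nth :: int^'m => _) UNIV UNIV"
  by(rule bij_betwI[where g = vec_lambda]) auto
 have a: "Infinite_Set_Sum.abs_summable_on ?f UNIV"
  using abs_summable_on_prod_PiE[of "UNIV :: 'm set" "%_. UNIV" "%i. exp_coeff (z i)", OF finite _ exp_coeff_sum(1)]
  by(simp only:P) simp
 have s: "infsetsum ?f UNIV = exp (\<Sum>i\<in>UNIV. z i)"
  using infsetsum_prod_PiE[of "UNIV :: 'm set" "%_. UNIV" "%i. exp_coeff (z i)", OF finite _ exp_coeff_sum(1)]
  by(simp only:P exp_coeff_sum(2) exp_sum[OF finite]) simp
 show "integrable (count_space UNIV) (%\<alpha> :: int^'m. \<Prod>i\<in>UNIV. exp_coeff (z i) (\<alpha> $ i))"
  using a[folded abs_summable_on_reindex_bij_betw[OF bij]] by(simp add:abs_summable_on_def set_integrable_def)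
 show "(LINT \<alpha>|count_space UNIV. (\<Prod>i\<in>UNIV. exp_coeff (z i) (\<alpha> $ i))) = exp (\<Sum>i\<in>UNIV. z i)"
  using s infsetsum_reindex_bij_betw[OF bij, of ?f] by(simp add:infsetsum_def)
qed

section \<open>The candidate for the transform of phi\<close>

definition Phi :: "real => 'm::finite DR => real"
 where "Phi l = (%(\<alpha>, \<xi>). if 0 < \<xi> \<and> (\<forall>i. 0 <= \<alpha> $ i) then
   2 powr (l + 1/2) * sqrt pi / Gamma l * exp (- 2 * \<xi>) *
    (\<xi> powr (l + real_of_int (\<Sum>i\<in>UNIV. \<alpha> $ i) - 1) / real CARD('m) powi (\<Sum>i\<in>UNIV. \<alpha> $ i)) *
    (1 / (\<Prod>i\<in>UNIV. fact (nat (\<alpha> $ i))))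
   else 0)"

definition Phi_const :: "real => real"
 where "Phi_const l = 2 powr (l + 1/2) * sqrt pi / Gamma l"

lemma Phi_const_pos: "0 < l ==> 0 < Phi_const l"
 unfolding Phi_const_def by(intro divide_pos_pos mult_pos_pos) (auto simp:Gamma_real_pos)

text \<open>The power of \<xi> / (n - 1) with exponent |\<alpha>| splits over the coordinates, so
  the dependence on \<alpha> is a product of exponential coefficients at \<xi> / (n - 1).\<close>

lemma Phi_eq:
 fixes \<alpha> :: "int^'m::finite"
 shows "Phi l (\<alpha>, \<xi>) = (if 0 < \<xi> then Phi_const l * \<xi> powr (l - 1) * exp (- 2 * \<xi>) *
  (\<Prod>i\<in>UNIV. exp_coeff (\<xi> / real CARD('m)) (\<alpha> $ i)) else 0)"
proof (cases "0 < \<xi> \<and> (\<forall>i. 0 <= \<alpha> $ i)")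
 case True
 define N where "N = (\<Sum>i\<in>UNIV. nat (\<alpha> $ i))"
 have N: "(\<Sum>i\<in>UNIV. \<alpha> $ i) = int N"
  unfolding N_def of_nat_sum using True by(intro sum.cong) auto
 have "(\<Prod>i\<in>UNIV. exp_coeff (\<xi> / real CARD('m)) (\<alpha> $ i)) = (\<xi> / real CARD('m)) ^ N / (\<Prod>i\<in>UNIV. fact (nat (\<alpha> $ i)))"
  using True by(simp add:exp_coeff_def prod_dividef N_def power_sum)
 moreover have "\<xi> powr (l + real_of_int (int N) - 1) = \<xi> powr (l - 1) * \<xi> ^ N"
  using True powr_add[of \<xi> "l - 1" "real N"] by(simp add:powr_realpow algebra_simps)
 ultimately show ?thesis
  using True unfolding Phi_def Phi_const_def by(simp add:N power_divide mult_ac)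
next
 case False
 hence "0 < \<xi> ==> (\<Prod>i\<in>UNIV. exp_coeff (\<xi> / real CARD('m)) (\<alpha> $ i)) = 0"
  by(auto simp:exp_coeff_def intro:prod_zero)
 thus ?thesis using False unfolding Phi_def by auto
qed

lemma Phi_nonneg: "0 < l ==> 0 <= Phi l \<beta>"
 by(cases \<beta>) (auto simp:Phi_eq exp_coeff_def intro!:mult_nonneg_nonneg prod_nonneg less_imp_le[OF Phi_const_pos])

lemma Phi_measurable: "Phi l \<in> bmeas DRm"
proof (rule measurable_dual)
 fix \<alpha> :: "int^'a"
 show "(%\<xi>. Phi l (\<alpha>, \<xi>)) \<in> bmeas borel" unfolding Phi_eq exp_coeff_def by measurable
qed

text \<open>Summing over \<alpha> first gives exp \<xi>, which turns exp (-2 \<xi>) into exp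
  (-\<xi>) and leaves a Gamma integral.\<close>

lemma Phi_integrable:
 assumes l: "0 < l"
 shows "integrable DRm (Phi l :: 'm::finite DR => real)"
proof (rule integrableI_bounded)
 let ?P = "Phi l :: 'm DR => real"
 have [measurable]: "?P \<in> bmeas (count_space UNIV \<Otimes>\<^sub>M lborel)"
  using Phi_measurable[of l] by(simp add:dual_measure_def)
 have slice: "(\<integral>\<^sup>+\<alpha>. ennreal (?P (\<alpha>, \<xi>)) \<partial>count_space UNIV) =
   ennreal (if 0 < \<xi> then Phi_const l * (\<xi> powr (l - 1) * exp (- (1 * \<xi>))) else 0)" for \<xi>
 proof (cases "0 < \<xi>")
  case True
  let ?g = "%\<alpha> :: int^'m. \<Prod>i\<in>UNIV. exp_coeff (\<xi> / real CARD('m)) (\<alpha> $ i)"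
  have P: "?P (\<alpha>, \<xi>) = Phi_const l * \<xi> powr (l - 1) * exp (- 2 * \<xi>) * ?g \<alpha>" for \<alpha>
   using True by(simp add:Phi_eq)
  have "(\<integral>\<^sup>+\<alpha>. ennreal (?P (\<alpha>, \<xi>)) \<partial>count_space UNIV) = ennreal (LINT \<alpha>|count_space UNIV. ?P (\<alpha>, \<xi>))"
  proof (rule nn_integral_eq_integral)
   show "integrable (count_space UNIV) (%\<alpha>. ?P (\<alpha>, \<xi>))"
    unfolding P by(intro integrable_mult_right exp_coeff_prod)
   show "AE \<alpha> in count_space UNIV. 0 <= ?P (\<alpha>, \<xi>)" by(rule AE_I2) (rule Phi_nonneg[OF l])
  qed
  also have "(LINT \<alpha>|count_space UNIV. ?P (\<alpha>, \<xi>)) = Phi_const l * \<xi> powr (l - 1) * exp (- 2 * \<xi>) * exp \<xi>"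
   unfolding P LINT_mult_right exp_coeff_prod(2) by simp
  also have "... = Phi_const l * (\<xi> powr (l - 1) * exp (- (1 * \<xi>)))"
   by(simp add:mult.assoc exp_add[symmetric])
  finally show ?thesis using True by simp
 qed (simp add:Phi_eq)
 have "(\<integral>\<^sup>+\<beta>. ennreal (norm (?P \<beta>)) \<partial>DRm) = (\<integral>\<^sup>+\<beta>. ennreal (?P \<beta>) \<partial>(count_space UNIV \<Otimes>\<^sub>M lborel))"
  by(simp only:real_norm_def abs_of_nonneg[OF Phi_nonneg[OF l]] dual_measure_def)
 also have "... = (\<integral>\<^sup>+\<xi>. (\<integral>\<^sup>+\<alpha>. ennreal (?P (\<alpha>, \<xi>)) \<partial>count_space UNIV) \<partial>lborel)"
  by(rule dual.nn_integral_snd[symmetric]) measurable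
 also have "... = (\<integral>\<^sup>+\<xi>. ennreal (Phi_const l) * ennreal (if 0 < \<xi> then \<xi> powr (l - 1) * exp (- \<xi>) else 0) \<partial>lborel)"
  unfolding slice using Phi_const_pos[OF l] by(intro nn_integral_cong) (auto simp:ennreal_mult)
 also have "... = ennreal (Phi_const l) * ennreal (Gamma l)"
  by(subst nn_integral_cmult) (auto simp:nn_integral_Gamma[OF l])
 also have "... < \<infinity>" by(simp add:ennreal_mult_less_top)
 finally show "(\<integral>\<^sup>+\<beta>. ennreal (norm (?P \<beta>)) \<partial>DRm) < \<infinity>" .
qed (rule Phi_measurable)

lemma inv_fourier_Phi:
 fixes p :: "'m::finite TR"
 assumes l: "0 < l" and p: "fst p \<in> torus"
 shows "inv_fourier (%\<beta>. cor (Phi l \<beta>)) p = phi l p"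
proof -
 let ?F = "%\<beta> :: 'm DR. cor (Phi l \<beta>) * echar \<beta> p"
 have ps: "p \<in> space TRm" using p by(cases p) auto
 have R: "1 / 2 <= Re (phi_base p)" by(rule Re_phi_base[OF p])
 have "integrable DRm (%\<beta> :: 'm DR. echar \<beta> p * cor (Phi l \<beta>))"
  by(rule integrable_bounded_mult[where B = 1]) (auto simp:cmod_echar[OF ps] intro!:integrable_of_real Phi_integrable l)
 hence i: "integrable (count_space UNIV \<Otimes>\<^sub>M lborel) (%(\<alpha>, \<xi>). ?F (\<alpha>, \<xi>))"
  by(simp add:dual_measure_def mult.commute case_prod_unfold)
 have slice: "(LINT \<alpha>|count_space UNIV. ?F (\<alpha>, \<xi>)) = cor (Phi_const l) *
   (if 0 < \<xi> then cor (\<xi> powr (l - 1)) * exp (- ((2 * phi_base p) * cor \<xi>)) else 0)" for \<xi>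
 proof (cases "0 < \<xi>")
  case True
  let ?z = "%i. cor (\<xi> / real CARD('m)) * fst p $ i"
  have "cor (exp_coeff (\<xi> / real CARD('m)) k) * (fst p $ i) powi k = exp_coeff (?z i) k" for i k
   by(simp add:exp_coeff_def power_int_def) (simp add:power_mult_distrib[symmetric])
  hence "cor (\<Prod>i\<in>UNIV. exp_coeff (\<xi> / real CARD('m)) (\<alpha> $ i)) * chr \<alpha> (fst p) =
    (\<Prod>i\<in>UNIV. exp_coeff (?z i) (\<alpha> $ i))" for \<alpha>
   unfolding chr_def of_real_prod prod.distrib[symmetric] by simp
  hence "?F (\<alpha>, \<xi>) = cor (Phi_const l * \<xi> powr (l - 1) * exp (- 2 * \<xi>)) * iexp (\<xi> * snd p) *
    (\<Prod>i\<in>UNIV. exp_coeff (?z i) (\<alpha> $ i))" for \<alpha>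
   using True by(simp add:Phi_eq echar_def mult_ac)
  hence "(LINT \<alpha>|count_space UNIV. ?F (\<alpha>, \<xi>)) =
    cor (Phi_const l * \<xi> powr (l - 1) * exp (- 2 * \<xi>)) * iexp (\<xi> * snd p) * exp (\<Sum>i\<in>UNIV. ?z i)"
   by(simp only:LINT_mult_right exp_coeff_prod(2))
  also have "... = cor (Phi_const l) * (cor (\<xi> powr (l - 1)) *
    (exp (cor (- 2 * \<xi>)) * (iexp (\<xi> * snd p) * exp (\<Sum>i\<in>UNIV. ?z i))))"
   unfolding exp_of_real[of "- 2 * \<xi>"] by(simp add:mult_ac)
  \<comment> \<open>The sum over \<alpha> has contributed \<xi> / (n - 1) times the sum of the
    coordinates of \<open>fst p\<close> to the exponent; everything assembles to -2 \<xi> phi_base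
    p.\<close>
  also have "exp (cor (- 2 * \<xi>)) * (iexp (\<xi> * snd p) * exp (\<Sum>i\<in>UNIV. ?z i)) = exp (- ((2 * phi_base p) * cor \<xi>))"
   unfolding exp_add[symmetric] sum_distrib_left[symmetric] phi_base_def cayley_def
   by(rule arg_cong[where f = exp]) (simp add:field_simps)
  finally show ?thesis using True by simp
 qed (simp add:Phi_eq)
 have "(LINT \<beta>|DRm. ?F \<beta>) = (LINT \<xi>|lborel. (LINT \<alpha>|count_space UNIV. ?F (\<alpha>, \<xi>)))"
  using dual.integral_snd[OF i] by(simp add:dual_measure_def case_prod_unfold)
 also have "... = cor (Phi_const l) * (cor (Gamma l) * (2 * phi_base p) powr (- cor l))"
  unfolding slice LINT_mult_right
  using R by(subst Gamma_integral_complex_scale(2)[OF l]) auto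
 also have "(2 * phi_base p) powr (- cor l) = cor (2 powr (- l)) * phi l p"
  using powr_times_real_left[of 2 "phi_base p" "- cor l"] powr_of_real[of 2 "- l"] by(simp add:phi_eq)
 finally have "inv_fourier (%\<beta>. cor (Phi l \<beta>)) p =
   cor (1 / sqrt (2 * pi) * (Phi_const l * (Gamma l * 2 powr (- l)))) * phi l p"
  unfolding inv_fourier_def by simp
 \<comment> \<open>This fixes the constant: 2 powr (l + 1/2) sqrt pi is sqrt (2 pi) 2 powr l, and 2
   powr (-l) comes from the factor 2 in front of \<open>phi_base\<close>.\<close>
 moreover have "1 / sqrt (2 * pi) * (Phi_const l * (Gamma l * 2 powr (- l))) = 1"
 proof -
  have "2 powr (l + 1/2) * 2 powr (- l) = (2::real) powr (1/2)" by(simp add:powr_add[symmetric])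
  hence "2 powr (l + 1/2) * 2 powr (- l) = sqrt 2" by(simp add:powr_half_sqrt)
  thus ?thesis using Gamma_real_pos[OF l] by(simp add:Phi_const_def real_sqrt_mult field_simps)
 qed
 ultimately show ?thesis by(simp only:of_real_1 mult_1)
qed

lemma fourier_continuous:
 fixes f :: "'m::finite TR => complex"
 assumes f: "integrable TRm f"
 shows "continuous_on UNIV (%\<xi>. fourier f (\<alpha>, \<xi>))"
 unfolding continuous_on_sequentially
proof (intro allI ballI impI)
 fix x :: "nat => real" and a assume x: "(\<forall>n. x n \<in> UNIV) \<and> x ----> a"
 have [measurable]: "f \<in> bmeas TRm" using f by auto
 have "(%n. LINT p|TRm. f p * cnj (echar (\<alpha>, x n) p)) ----> (LINT p|TRm. f p * cnj (echar (\<alpha>, a) p))"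
 proof (rule integral_dominated_convergence)
  show "integrable TRm (%p. cmod (f p))" using f by(rule integrable_norm)
  show "AE p in TRm. (%n. f p * cnj (echar (\<alpha>, x n) p)) ----> f p * cnj (echar (\<alpha>, a) p)"
   unfolding echar_def using x by(intro AE_I2) (auto intro!:tendsto_intros)
  show "AE p in TRm. norm (f p * cnj (echar (\<alpha>, x n) p)) <= cmod (f p)" for n
   by(intro AE_I2) (simp add:norm_mult cmod_echar)
 qed measurable
 thus "((%\<xi>. fourier f (\<alpha>, \<xi>)) \<circ> x) ----> fourier f (\<alpha>, a)"
  unfolding o_def fourier_eq by(intro tendsto_intros)
qed

text \<open>The critical point is \<xi> = 0; there the exponent l + |\<alpha>| - 1 is positive
  because l > 1.\<close>

lemma Phi_continuous:
 assumes l: "1 < l" shows "continuous_on UNIV (%\<xi>. Phi l (\<alpha>, \<xi>))"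
proof (cases "\<forall>i. 0 <= \<alpha> $ i")
 case True
 have s: "0 <= (\<Sum>i\<in>UNIV. \<alpha> $ i)" using True by(intro sum_nonneg) auto
 let ?s = "l + real_of_int (\<Sum>i\<in>UNIV. \<alpha> $ i) - 1"
 have s: "0 < ?s" using l s by linarith
 obtain K where K: "Phi l (\<alpha>, \<xi>) = K * (exp (- 2 * \<xi>) * (max 0 \<xi> powr ?s))" for \<xi>
 proof
  show "Phi l (\<alpha>, \<xi>) = (2 powr (l + 1/2) * sqrt pi / Gamma l / real CARD('a) powi (\<Sum>i\<in>UNIV. \<alpha> $ i) *
    (1 / (\<Prod>i\<in>UNIV. fact (nat (\<alpha> $ i))))) * (exp (- 2 * \<xi>) * (max 0 \<xi> powr ?s))" for \<xi>
   using True unfolding Phi_def by(auto simp:max_def)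
 qed
 have c1: "continuous_on UNIV (%\<xi>. max 0 \<xi> powr ?s)"
  using s by(intro continuous_on_powr' continuous_intros) (auto simp:max_def)
 have c2: "continuous_on UNIV (%\<xi>::real. exp (- 2 * \<xi>))" by(intro continuous_intros)
 show ?thesis unfolding K by(rule continuous_on_mult_left[OF continuous_on_mult[OF c2 c1]])
next
 case False
 hence Z: "Phi l (\<alpha>, \<xi>) = 0" for \<xi> unfolding Phi_def by(simp only:case_prod_conv simp_thms if_False)
 show ?thesis unfolding Z by(rule continuous_on_const)
qed

lemma continuous_AE_eq:
 fixes f g :: "real => 'a::real_normed_vector"
 assumes f: "continuous_on UNIV f" and g: "continuous_on UNIV g" and ae: "AE x in lborel. f x = g x"
 shows "f x = g x"
proof (rule ccontr)
 assume ne: "f x ~= g x"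
 have o: "open {x. f x ~= g x}" by(rule open_Collect_neq[OF f g])
 hence "{x. f x ~= g x} \<in> sets lborel" by simp
 hence "{x. f x ~= g x} \<in> null_sets lborel"
  using ae AE_iff_null_sets[of "{x. f x ~= g x}" lborel] by simp
 hence "negligible {x. f x ~= g x}"
  unfolding negligible_iff_null_sets by(rule null_sets_completionI)
 thus False using open_not_negligible[OF o] ne by auto
qed

text \<open>Both sides are tested against \<open>gauss_dual\<close>, with adjointness used twice:
  once to reach \<open>inv_fourier\<close> of the candidate, which is phi, and once to return with
  \<open>fourier\<close> of phi.\<close>

theorem fourier_phi:
 fixes \<beta> :: "'m::finite DR"
 assumes l: "1 < l"
 shows "fourier (phi l) \<beta> = cor (Phi l \<beta>)"
proof -
 let ?p = "phi l :: 'm TR => complex" and ?P = "%\<beta> :: 'm DR. cor (Phi l \<beta>)"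
 have l0: "0 < l" using l by simp
 have pint: "integrable TRm ?p" by(rule phi_integrable[OF l])
 have Pint: "integrable DRm ?P" by(intro integrable_of_real Phi_integrable l0)
 have fm [measurable]: "fourier ?p \<in> bmeas DRm" using pint by(intro fourier_measurable) auto
 have Pm [measurable]: "?P \<in> bmeas DRm" using Pint by auto
 let ?B = "(LINT p|TRm. cmod (?p p)) / sqrt (2 * pi)"
 have ae: "AE \<beta> in DRm. fourier ?p \<beta> - ?P \<beta> = 0"
 proof (rule gauss_dual_total)
  fix \<alpha> :: "int^'m"
  let ?w = "%\<xi>. exp (- ((cor \<xi>)^2 / 2))"
  have wi: "integrable lborel ?w" using gaussian_integral(1)[of 0] by simp
  have "integrable lborel (%\<xi>. fourier ?p (\<alpha>, \<xi>) * ?w \<xi>)"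
   by(rule integrable_bounded_mult[OF wi, where B = ?B])
    (auto intro!:norm_fourier_le pint measurable_dual_slice[OF fm])
  moreover have "integrable lborel (%\<xi>. ?P (\<alpha>, \<xi>))"
   using dual.AE_integrable_fst'[OF Pint[unfolded dual_measure_def]] by(simp add:AE_count_space)
  hence "integrable lborel (%\<xi>. ?w \<xi> * ?P (\<alpha>, \<xi>))"
   by(rule integrable_bounded_mult[where B = 1]) (auto simp:norm_exp power2_eq_square)
  ultimately show "integrable lborel (%\<xi>. (fourier ?p (\<alpha>, \<xi>) - ?P (\<alpha>, \<xi>)) * ?w \<xi>)"
   by(simp add:left_diff_distrib mult.commute[of "?P _"])
 next
  fix i :: "(int^'m) \<times> complex"
  let ?g = "gauss_dual i"
  have gm [measurable]: "?g \<in> bmeas DRm" using gauss_dual_integrable[of i] by auto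
  have gi: "integrable DRm (%\<beta>. cnj (?g \<beta>))" by(rule integrable_cnj[OF gauss_dual_integrable])
  have bg: "\<exists>B. \<forall>\<beta>. cmod (?g \<beta>) <= B"
   using norm_fourier_le[OF gauss_integrable, of i] unfolding fourier_gauss by auto
  then obtain B where B: "!!\<beta>. cmod (?g \<beta>) <= B" by auto
  have i1: "integrable DRm (%\<beta>. fourier ?p \<beta> * cnj (?g \<beta>))"
   by(rule integrable_bounded_mult[OF gi fm, where B = ?B]) (rule norm_fourier_le[OF pint])
  have i2: "integrable DRm (%\<beta>. cnj (?g \<beta>) * ?P \<beta>)"
   by(rule integrable_bounded_mult[OF Pint, where B = B]) (auto simp:B)
  have "(LINT \<beta>|DRm. cnj (?g \<beta>) * ?P \<beta>) = cnj (LINT \<beta>|DRm. fourier (gauss i) \<beta> * cnj (?P \<beta>))"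
   by(simp only:fourier_gauss LINT_cnj[symmetric] complex_cnj_mult complex_cnj_cnj complex_cnj_complex_of_real)
  also have "... = cnj (LINT p|TRm. gauss i p * cnj (inv_fourier ?P p))"
   by(simp only:fourier_adjoint[OF gauss_integrable Pint])
  also have "(LINT p|TRm. gauss i p * cnj (inv_fourier ?P p)) = (LINT p|TRm. gauss i p * cnj (?p p))"
   by(rule LINT_cong[OF refl]) (auto simp:inv_fourier_Phi[OF l0])
  also have "cnj ... = (LINT p|TRm. ?p p * cnj (inv_fourier ?g p))"
   by(simp only:inv_fourier_gauss_dual LINT_cnj[symmetric] complex_cnj_mult complex_cnj_cnj mult.commute)
  also have "... = (LINT \<beta>|DRm. fourier ?p \<beta> * cnj (?g \<beta>))"
   by(rule fourier_adjoint[OF pint gauss_dual_integrable])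
  finally have "(LINT \<beta>|DRm. fourier ?p \<beta> * cnj (?g \<beta>)) - (LINT \<beta>|DRm. cnj (?g \<beta>) * ?P \<beta>) = 0" by simp
  thus "(LINT \<beta>|DRm. (fourier ?p \<beta> - ?P \<beta>) * cnj (?g \<beta>)) = 0"
   using Bochner_Integration.integral_diff[OF i1 i2] by(simp add:left_diff_distrib mult.commute[of "?P _"])
 qed measurable
 obtain \<alpha> \<xi> where b: "\<beta> = (\<alpha>, \<xi>)" by(cases \<beta>)
 have "AE x in lborel. fourier ?p (\<alpha>, x) - ?P (\<alpha>, x) = 0"
  using dual.AE_pair[OF ae[unfolded dual_measure_def]] by(simp add:AE_count_space)
 hence "fourier ?p (\<alpha>, \<xi>) = ?P (\<alpha>, \<xi>)"
  by(intro continuous_AE_eq fourier_continuous[OF pint] continuous_on_of_real Phi_continuous[OF l]) simp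
 thus ?thesis by(simp add:b)
qed

text \<open>Being the transform of an integrable function, \<open>Phi\<close> is bounded by a
  multiple of an L^1 norm, uniformly in \<alpha>.\<close>

lemma Phi_bounded:
 assumes l: "1 < l" obtains B where "0 < B" "!!\<beta> :: 'm::finite DR. Phi l \<beta> <= B"
proof
 let ?B = "(LINT p|TRm. cmod ((phi l :: 'm TR => complex) p)) / sqrt (2 * pi)"
 have nn: "0 <= ?B" by(auto intro!:divide_nonneg_nonneg integral_nonneg_AE)
 thus "0 < ?B + 1" by linarith
 show "Phi l \<beta> <= ?B + 1" for \<beta> :: "'m DR"
  using norm_fourier_le[OF phi_integrable[OF l], of \<beta>] unfolding fourier_phi[OF l] by simp
qed

section \<open>The restriction operator and its adjoint\<close>

definition phi_nrm :: "'m::finite itself => real => real"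
 where "phi_nrm _ l = (LINT p|(TRm :: 'm TR measure). cmod (phi l p))"

lemma phi_nrm_nonneg: "0 <= phi_nrm TYPE('m::finite) l"
 unfolding phi_nrm_def by(rule integral_nonneg_AE) simp

lemma Phi_le:
 fixes \<beta> :: "'m::finite DR"
 assumes l: "1 < l" shows "sqrt (2 * pi) * Phi l \<beta> <= phi_nrm TYPE('m) l"
proof -
 have "0 <= Phi l \<beta>" using Phi_nonneg[of l \<beta>] l by simp
 hence "Phi l \<beta> <= phi_nrm TYPE('m) l / sqrt (2 * pi)"
  using norm_fourier_le[OF phi_integrable[OF l], of \<beta>] unfolding fourier_phi[OF l] phi_nrm_def by simp
 thus ?thesis by(simp add:field_simps)
qed

section \<open>Convolution with phi as multiplication on the dual\<close>

lemma sq_integrable_bounded: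
 assumes f: "integrable M f" and B: "!!x. x \<in> space M ==> cmod (f x) <= B"
 shows "sq_integrable M f"
 unfolding sq_integrable_def
proof
 show m: "f \<in> bmeas M" using f by auto
 show "integrable M (%x. (cmod (f x))^2)"
 proof (rule LINT_bound)
  show "integrable M (%x. B * cmod (f x))" by(rule integrable_mult_right[OF integrable_norm[OF f]])
  show "AE x in M. norm ((cmod (f x))^2) <= norm (B * cmod (f x))"
  proof (rule AE_I2)
   fix x assume "x \<in> space M"
   from B[OF this] have "cmod (f x) * cmod (f x) <= B * cmod (f x)" "0 <= B * cmod (f x)"
    using order_trans[OF norm_ge_zero B[OF \<open>x \<in> space M\<close>]] by(auto intro:mult_right_mono)
   thus "norm ((cmod (f x))^2) <= norm (B * cmod (f x))" by(simp add:power2_eq_square)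
  qed
 qed (use m in measurable)
qed

lemma Phi_sq_integrable:
 assumes l: "1 < l" shows "DR2 (%\<beta> :: 'm::finite DR. cor (Phi l \<beta>))"
proof -
 obtain B where B: "!!\<beta> :: 'm DR. Phi l \<beta> <= B" using Phi_bounded[OF l, where 'm = 'm] by blast
 show ?thesis
 proof (rule sq_integrable_bounded[where B = B])
  show "integrable DRm (%\<beta> :: 'm DR. cor (Phi l \<beta>))"
   using Phi_integrable[of l] l by(intro integrable_of_real) simp
  show "cmod (cor (Phi l \<beta>)) <= B" for \<beta> :: "'m DR"
   using B[of \<beta>] Phi_nonneg[of l \<beta>] l by simp
 qed
qed

lemma echar_mult_dual:
 assumes H: "DR2 H" and p: "p \<in> space TRm"
 shows "DR2 (%\<beta>. H \<beta> * cnj (echar \<beta> p))"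
proof (rule sq_integrable_bound[OF H, where C = 1])
 have [measurable]: "H \<in> bmeas DRm" using H by(simp add:sq_integrable_def)
 show "(%\<beta>. H \<beta> * cnj (echar \<beta> p)) \<in> bmeas DRm" by measurable
qed (simp add:norm_mult cmod_echar[OF p])

lemma echar_div:
 assumes p: "p \<in> space TRm" and q: "q \<in> space TRm"
 shows "echar \<beta> (TR_div p q) = echar \<beta> p * cnj (echar \<beta> q)"
proof -
 have t: "fst q \<in> torus" using q by auto
 have "chr \<alpha> (\<chi> i. fst p $ i / fst q $ i) = chr \<alpha> (fst p) * cnj (chr \<alpha> (fst q))" for \<alpha>
 proof -
  have "cnj (chr \<alpha> (fst q)) = inverse (chr \<alpha> (fst q))"
   using cmod_chr[OF t, of \<alpha>] by(simp add:divide_conv_cnj[of "chr \<alpha> (fst q)" 1] inverse_eq_divide)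
  thus ?thesis by(simp only:chr_def vec_lambda_beta power_int_divide_distrib prod_dividef) (simp only:divide_inverse)
 qed
 moreover have "iexp (x * (a - b)) = iexp (x * a) * cnj (iexp (x * b))" for x a b :: real
  by(simp add:exp_cnj exp_add[symmetric] algebra_simps)
 ultimately show ?thesis by(simp add:echar_def TR_div_def)
qed

text \<open>The value at p is the inner product of g with the conjugate of phi (p / q) as a function
  of q, which is the inverse transform of \<open>Phi\<close> times the conjugate character at p.
  Parseval then gives the formula at every p, not just almost everywhere.\<close>

lemma TR_conv_phi:
 assumes l: "1 < l" and g: "Plancherel.pair g G" and p: "p \<in> space TRm"
 shows "TR_conv g (phi l) p = cor (sqrt (2 * pi)) * inv_fourier (%\<beta>. cor (Phi l \<beta>) * G \<beta>) p"
proof -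
 let ?P = "%\<beta>. cor (Phi l \<beta>)"
 let ?H = "%\<beta>. ?P \<beta> * cnj (echar \<beta> p)"
 have H2: "DR2 ?H" by(rule echar_mult_dual[OF Phi_sq_integrable[OF l] p])
 have "integrable DRm (%\<beta>. cnj (echar \<beta> p) * ?P \<beta>)"
  by(rule integrable_bounded_mult[where B = 1]) (use Phi_integrable[of l] l cmod_echar[OF p] in auto)
 hence H1: "integrable DRm ?H" by(simp add:mult.commute)
 have "cnj (inv_fourier ?H q) = phi l (TR_div p q)" if q: "q \<in> space TRm" for q
 proof -
  have "fst (TR_div p q) \<in> torus" using p q by(simp add:TR_div_def torus_def norm_divide mem_Times_iff)
  hence "phi l (TR_div p q) = inv_fourier ?P (TR_div p q)" using inv_fourier_Phi[of l "TR_div p q"] l by simp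
  also have "... = cnj (inv_fourier ?H q)"
   unfolding inv_fourier_def complex_cnj_mult LINT_cnj[symmetric]
   by(simp add:echar_div[OF p q] mult_ac)
  finally show ?thesis by simp
 qed
 hence "TR_conv g (phi l) p = L2_ip TRm g (inv_fourier ?H)"
  unfolding TR_conv_def L2_ip_def by(intro LINT_cong) auto
 also have "... = L2_ip DRm G ?H" by(rule Plancherel.pair_ip[OF g pair_inv_fourier[OF H1 H2]])
 also have "... = cor (sqrt (2 * pi)) * inv_fourier (%\<beta>. ?P \<beta> * G \<beta>) p"
  unfolding L2_ip_def inv_fourier_def by(simp add:mult_ac)
 finally show ?thesis .
qed

lemma sq_integrable_cong:
 assumes "sq_integrable M f" "!!x. x \<in> space M ==> f x = g x"
 shows "sq_integrable M g"
 using assms measurable_cong[of M g f borel] Bochner_Integration.integrable_cong[of M M "%x. (cmod (g x))^2" "%x. (cmod (f x))^2"]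
 by(simp add:sq_integrable_def)

lemma pair_cong_space:
 assumes "Plancherel.pair f F" "!!p. p \<in> space TRm ==> f p = g p"
 shows "Plancherel.pair g F"
proof -
 have f: "TR2 f" "DR2 F" using Plancherel.pair_V[OF assms(1)] Plancherel.pair_W[OF assms(1)] by auto
 have g: "TR2 g" by(rule sq_integrable_cong[OF f(1) assms(2)])
 have "AE p in TRm. f p = g p" by(rule AE_I2) (rule assms(2))
 hence "ip_dist (L2_ip TRm) f g = 0" using L2_dist_zero_iff[OF f(1) g] by simp
 from Plancherel.pair_cong[OF assms(1) _ _ this Plancherel.W.dist_self] show ?thesis using f g by simp
qed

lemma Phi_mult:
 assumes l: "1 < l" and G: "DR2 G"
 shows "integrable DRm (%\<beta>. cor (Phi l \<beta>) * G \<beta>)"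
  and "DR2 (%\<beta>. cor (Phi l \<beta>) * G \<beta>)"
proof -
 show "integrable DRm (%\<beta>. cor (Phi l \<beta>) * G \<beta>)"
  by(rule sq_integrable_mult[OF Phi_sq_integrable[OF l] G])
 hence m: "(%\<beta>. cor (Phi l \<beta>) * G \<beta>) \<in> bmeas DRm" by auto
 obtain B where B: "0 < B" "!!\<beta> :: 'a DR. Phi l \<beta> <= B" using Phi_bounded[OF l, where 'm = 'a] by blast
 show "DR2 (%\<beta>. cor (Phi l \<beta>) * G \<beta>)"
 proof (rule sq_integrable_bound[OF G m, where C = B], rule AE_I2)
  fix \<beta> :: "'a DR"
  show "cmod (cor (Phi l \<beta>) * G \<beta>) <= B * cmod (G \<beta>)"
   using B(2)[of \<beta>] Phi_nonneg[of l \<beta>] l by(simp add:norm_mult mult_right_mono)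
 qed
qed

lemma TR_conv_pair:
 assumes l: "1 < l" and g: "Plancherel.pair g G"
 shows "Plancherel.pair (TR_conv g (phi l)) (%\<beta>. cor (sqrt (2 * pi) * Phi l \<beta>) * G \<beta>)"
proof (rule pair_cong_space)
 have G: "DR2 G" using Plancherel.pair_W[OF g] by simp
 show "Plancherel.pair (%p. cor (sqrt (2 * pi)) * inv_fourier (%\<beta>. cor (Phi l \<beta>) * G \<beta>) p)
   (%\<beta>. cor (sqrt (2 * pi) * Phi l \<beta>) * G \<beta>)"
  using Plancherel.pair_scale[OF pair_inv_fourier[OF Phi_mult[OF l G]], of "cor (sqrt (2 * pi))"]
  by(simp add:mult.assoc)
qed (rule TR_conv_phi[OF l g, symmetric])

text \<open>The L^2 bound comes from the symbol, whose supremum is at most the L^1 norm of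
  phi.\<close>

lemma TR_conv_bound:
 fixes g :: "'m::finite TR => complex"
 assumes l: "1 < l" and g: "TR2 g"
 shows "TR2 (TR_conv g (phi l))" and "TR_nrm (TR_conv g (phi l)) <= phi_nrm TYPE('m) l * TR_nrm g"
proof -
 obtain G where G: "Plancherel.pair g G" using Plancherel.pair_exists[of g] g by auto
 have G2: "DR2 G" using Plancherel.pair_W[OF G] by simp
 note P = TR_conv_pair[OF l G]
 show "TR2 (TR_conv g (phi l))" using Plancherel.pair_V[OF P] by simp
 let ?F = "%\<beta>. cor (sqrt (2 * pi) * Phi l \<beta>) * G \<beta>"
 have F2: "DR2 ?F" using Plancherel.pair_W[OF P] by simp
 let ?M = "phi_nrm TYPE('m) l"
 have "(LINT \<beta>|DRm. (cmod (?F \<beta>))^2) <= (LINT \<beta>|DRm. ?M\<^sup>2 * (cmod (G \<beta>))^2)"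
 proof (rule integral_mono)
  show "integrable DRm (%\<beta>. (cmod (?F \<beta>))^2)" using F2 by(simp add:sq_integrable_def)
  show "integrable DRm (%\<beta>. ?M\<^sup>2 * (cmod (G \<beta>))^2)" using G2 by(intro integrable_mult_right) (simp add:sq_integrable_def)
  fix \<beta> :: "'m DR"
  have "(sqrt (2 * pi) * Phi l \<beta>)^2 <= ?M\<^sup>2" using Phi_le[OF l, of \<beta>] Phi_nonneg[of l \<beta>] l by(intro power_mono) auto
  thus "(cmod (?F \<beta>))^2 <= ?M\<^sup>2 * (cmod (G \<beta>))^2"
   unfolding norm_mult power_mult_distrib norm_of_real power2_abs by(intro mult_right_mono) (auto simp:power_mult_distrib)
 qed
 hence "ip_norm (L2_ip DRm) ?F <= sqrt (?M\<^sup>2 * (LINT \<beta>|DRm. (cmod (G \<beta>))^2))"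
  unfolding L2_nrm by simp
 also have "... = ?M * ip_norm (L2_ip DRm) G"
  unfolding L2_nrm real_sqrt_mult using phi_nrm_nonneg[where 'm = 'm, of l] by simp
 finally show "TR_nrm (TR_conv g (phi l)) <= ?M * TR_nrm g"
  by(simp only:Plancherel.pair_nrm[OF P] Plancherel.pair_nrm[OF G])
qed

text \<open>Both R f and the adjoint integral are first controlled for truncations; this lets the
  uniform norm bound pass to the pointwise limit.\<close>

lemma L2_Fatou:
 assumes s: "!!k::nat. sq_integrable M (s k)" and C: "!!k. ip_norm (L2_ip M) (s k) <= C"
  and h [measurable]: "h \<in> bmeas M" and lim: "!!x. x \<in> space M ==> (%k. s k x) ----> h x"
 shows "sq_integrable M h" "ip_norm (L2_ip M) h <= C"
proof -
 have [measurable]: "s k \<in> bmeas M" for k using s[of k] by(simp add:sq_integrable_def)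
 have nn: "0 <= ip_norm (L2_ip M) (s k)" for k unfolding L2_nrm by simp
 have C0: "0 <= C" using order_trans[OF nn C] .
 have "(\<integral>\<^sup>+x. ennreal ((cmod (h x))^2) \<partial>M) = (\<integral>\<^sup>+x. liminf (%k. ennreal ((cmod (s k x))^2)) \<partial>M)"
 proof (rule nn_integral_cong)
  fix x assume "x \<in> space M"
  from lim[OF this] have "(%k. ennreal ((cmod (s k x))^2)) ----> ennreal ((cmod (h x))^2)"
   by(intro tendsto_ennrealI tendsto_power tendsto_norm)
  thus "ennreal ((cmod (h x))^2) = liminf (%k. ennreal ((cmod (s k x))^2))"
   by(rule lim_imp_Liminf[OF sequentially_bot, symmetric])
 qed
 also have "... <= liminf (%k. \<integral>\<^sup>+x. ennreal ((cmod (s k x))^2) \<partial>M)"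
  by(rule nn_integral_liminf) measurable
 also have "... <= ennreal (C\<^sup>2)"
 proof (rule order_trans[OF Liminf_le_Limsup[OF sequentially_bot] Limsup_bounded], rule always_eventually, rule allI)
  fix k
  have "(\<integral>\<^sup>+x. ennreal ((cmod (s k x))^2) \<partial>M) = ennreal ((ip_norm (L2_ip M) (s k))^2)"
   unfolding L2_nrm_sq using s[of k] by(intro nn_integral_eq_integral) (auto simp:sq_integrable_def)
  also have "... <= ennreal (C\<^sup>2)" by(intro ennreal_leI power_mono C nn)
  finally show "(\<integral>\<^sup>+x. ennreal ((cmod (s k x))^2) \<partial>M) <= ennreal (C\<^sup>2)" .
 qed
 finally have le: "(\<integral>\<^sup>+x. ennreal ((cmod (h x))^2) \<partial>M) <= ennreal (C\<^sup>2)" .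
 have i: "integrable M (%x. (cmod (h x))^2)"
  by(rule integrableI_bounded) (use le in \<open>auto intro:le_less_trans\<close>)
 thus "sq_integrable M h" by(simp add:sq_integrable_def)
 have "ennreal (LINT x|M. (cmod (h x))^2) <= ennreal (C\<^sup>2)"
  using le nn_integral_eq_integral[OF i] by simp
 hence "(LINT x|M. (cmod (h x))^2) <= C\<^sup>2" by(subst (asm) ennreal_le_iff) auto
 thus "ip_norm (L2_ip M) h <= C" unfolding L2_nrm using C0 by(metis real_le_lsqrt real_sqrt_le_iff real_sqrt_unique)
qed

section \<open>Truncation in the variable y\<close>

definition cut :: "nat => ('m::finite TR => complex) => 'm TR => complex"
 where "cut N g q = (if \<bar>snd q\<bar> <= real N then g q else 0)"

lemma cut_measurable:
 assumes [measurable]: "g \<in> bmeas TRm" shows "cut N g \<in> bmeas TRm"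
 unfolding cut_def[abs_def] by measurable

lemma cut_sq_integrable: "TR2 g ==> TR2 (cut N g)"
 by(rule sq_integrable_bound[of _ g _ 1]) (auto intro:cut_measurable simp:cut_def sq_integrable_def)

lemma cut_nrm:
 assumes g: "TR2 g" shows "TR_nrm (cut N g) <= TR_nrm g"
 unfolding L2_nrm
proof (intro real_sqrt_le_mono integral_mono)
 show "integrable TRm (%x. (cmod (cut N g x))^2)" using cut_sq_integrable[OF g, of N] by(simp add:sq_integrable_def)
 show "integrable TRm (%x. (cmod (g x))^2)" using g by(simp add:sq_integrable_def)
 show "(cmod (cut N g x))^2 <= (cmod (g x))^2" for x by(simp add:cut_def)
qed

lemma cut_tendsto: "(%N. cut N g q) ----> g q"
proof (rule tendsto_eventually)
 obtain N0 :: nat where N0: "\<bar>snd q\<bar> <= real N0" using real_arch_simple by blast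
 show "\<forall>\<^sub>F N in sequentially. cut N g q = g q"
  using eventually_ge_at_top[of N0] by eventually_elim (use N0 in \<open>auto simp:cut_def\<close>)
qed

lemma cut_dist_tendsto:
 assumes g: "TR2 g" shows "(%N. ip_dist (L2_ip TRm) (cut N g) g) ----> 0"
proof (rule L2_dominated_convergence[where u = g])
 show m: "g \<in> bmeas TRm" using g by(simp add:sq_integrable_def)
 show "cut N g \<in> bmeas TRm" for N by(rule cut_measurable[OF m])
 show "AE x in TRm. (%N. cut N g x) ----> g x" by(rule AE_I2) (rule cut_tendsto)
qed (auto simp:g cut_def)

lemma compact_strip: "compact ((torus :: (complex^'m::finite) set) \<times> {- real N..real N})"
 by(intro compact_Times compact_torus) simp

text \<open>A compact part of the orbit has positive distance to the sphere. This is the gain from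
  truncating, since it bounds the kernels uniformly on the ball.\<close>

lemma orbit_bound:
 obtains r where "0 <= r" "r < 1" "!!q :: 'm::finite TR. fst q \<in> torus ==> \<bar>snd q\<bar> <= real N ==> norm (orbit q) <= r"
proof -
 let ?S = "(torus :: (complex^'m) set) \<times> {- real N..real N}"
 have ne: "((\<chi> i. 1) :: complex^'m, 0::real) \<in> ?S" by(auto simp:torus_def)
 have "continuous_on ?S (%q. norm (orbit q))"
  by(intro continuous_on_norm continuous_on_subset[OF continuous_orbit]) simp
 from continuous_attains_sup[OF compact_strip _ this] ne
 obtain q where q: "q \<in> ?S" "!!q'. q' \<in> ?S ==> norm (orbit q') <= norm (orbit q)" by blast
 show ?thesis
 proof
  show "norm (orbit q) < 1" using q(1) by(intro orbit_in_ball) auto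
  show "norm (orbit q') <= norm (orbit q)" if "fst q' \<in> torus" "\<bar>snd q'\<bar> <= real N" for q' :: "'m TR"
   using that by(intro q(2)) (cases q', auto)
 qed simp
qed

section \<open>Integral formulas in the coordinates (t, y)\<close>

definition cay :: "real => 'm::finite TR => complex"
 where "cay l p = cayley (snd p) powr (- cor l)"

definition restr :: "real => (complex^('m::finite option) => complex) => 'm TR => complex"
 where "restr l f p = cay l p * f (orbit p)"

text \<open>Forced by the reproducing property: the value of R f at q is the inner product of f with
  \<open>cnj (cay l q)\<close> times the kernel at \<open>orbit q\<close>, and the adjoint
  integrates g against these vectors.\<close>

definition restr_adj :: "real => ('m::finite TR => complex) => complex^('m option) => complex"
 where "restr_adj l g w = (LINT q|TRm. g q * cnj (cay l q) * bkernel l (orbit q) w)"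

text \<open>\<open>CARD('m option)\<close> is n, so the hypothesis is l > n.\<close>

locale quasi_parabolic =
 fixes l :: real and ty :: "'m::finite itself"
 assumes l_gt: "real CARD('m option) < l"
begin

lemma l1: "1 < l" and l0: "0 < l" and lh: "1 / 2 < l"
proof -
 have "(2::nat) <= CARD('m option)" by(simp add:card_UNIV_option Suc_leI)
 hence "2 <= real CARD('m option)" by linarith
 thus "1 < l" "0 < l" "1 / 2 < l" using l_gt by linarith+
qed

lemma cay_sq: "TR2 (cay l :: 'm TR => complex)"
 using cayley_sq_integrable[OF lh] by(simp add:cay_def[abs_def])

lemma weight_integrable: "TR2 (g :: 'm TR => complex) ==> integrable TRm (%q. g q * cnj (cay l q))"
 by(intro sq_integrable_mult sq_integrable_cnj cay_sq)

lemma orbit_le1: "(q :: 'm TR) \<in> space TRm ==> norm (orbit q) <= 1"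
 by(intro less_imp_le orbit_in_ball) auto

lemma restr_adj_integrable:
 "TR2 g ==> norm w < 1 ==> integrable TRm (%q :: 'm TR. g q * cnj (cay l q) * bkernel l (orbit q) w)"
 by(rule bkernel_integral_bound[OF l0 weight_integrable orbit_measurable orbit_le1])

lemma restr_adj_holomorphic:
 assumes g: "TR2 (g :: 'm TR => complex)"
 shows "mv_holomorphic_on (restr_adj l g) (ball 0 1)"
 unfolding restr_adj_def[abs_def]
 by(rule bkernel_integral_holomorphic[OF l0 weight_integrable[OF g] orbit_measurable orbit_le1])

lemma restr_restr_adj:
 assumes p: "(p :: 'm TR) \<in> space TRm"
 shows "restr l (restr_adj l g) p = TR_conv g (phi l) p"
proof -
 have "restr l (restr_adj l g) p = (LINT q|TRm. cay l p * (g q * cnj (cay l q) * bkernel l (orbit q) (orbit p)))"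
  unfolding restr_def restr_adj_def by(rule integral_mult_right_zero[symmetric])
 also have "... = TR_conv g (phi l) p"
  unfolding TR_conv_def
 proof (rule LINT_cong[OF refl])
  fix q :: "'m TR" assume "q \<in> space TRm"
  hence "phi l (TR_div p q) = cay l p * (cnj (cay l q) * bkernel l (orbit q) (orbit p))"
   using p kernel_identity[of p q l] unfolding cay_def by auto
  thus "cay l p * (g q * cnj (cay l q) * bkernel l (orbit q) (orbit p)) = g q * phi l (TR_div p q)"
   by(simp only:mult_ac)
 qed
 finally show ?thesis .
qed

lemma bergman_continuous: "f \<in> bergman_space l ==> continuous_on (ball 0 1) (f :: complex^('m option) => complex)"
 by(auto simp:bergman_space_def intro:mv_holomorphic_continuous)

lemma restr_measurable:
 assumes f: "(f :: complex^('m option) => complex) \<in> bergman_space l"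
 shows "restr l f \<in> bmeas TRm"
proof -
 have "orbit \<in> measurable (TRm :: 'm TR measure) (restrict_space borel (ball 0 1))"
  by(rule measurable_restrict_space2[OF _ orbit_measurable]) (simp add:orbit_in_ball Pi_def)
 from measurable_compose[OF this borel_measurable_continuous_on_restrict[OF bergman_continuous[OF f]]]
 have [measurable]: "(%q :: 'm TR. f (orbit q)) \<in> bmeas TRm" .
 have [measurable]: "(cay l :: 'm TR => complex) \<in> bmeas TRm" using cay_sq by(simp add:sq_integrable_def)
 show ?thesis unfolding restr_def[abs_def] by measurable
qed

lemma cut_kernel_bound:
 obtains K where "0 <= K" "!!(q :: 'm TR) w. q \<in> space TRm ==> norm w < 1 ==>
  cmod (cut N g q * cnj (cay l q) * bkernel l (orbit q) w) <= cmod (cut N g q * cnj (cay l q)) * K"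
proof -
 obtain r where r: "0 <= r" "r < 1" "!!q :: 'm TR. fst q \<in> torus ==> \<bar>snd q\<bar> <= real N ==> norm (orbit q) <= r"
  using orbit_bound[where 'm = 'm, of N] by blast
 show ?thesis
 proof
  show "0 <= (1 - r) powr (- l)" by simp
  fix q :: "'m TR" and w :: "complex^('m option)"
  assume q: "q \<in> space TRm" and w: "norm w < 1"
  show "cmod (cut N g q * cnj (cay l q) * bkernel l (orbit q) w) <= cmod (cut N g q * cnj (cay l q)) * (1 - r) powr (- l)"
  proof (cases "\<bar>snd q\<bar> <= real N")
   case True
   hence o: "norm (orbit q) <= r" using q by(intro r(3)) auto
   have "norm (orbit q) * norm w <= r * 1" using o w r(1) by(intro mult_mono) auto
   hence "cmod (bkernel l (orbit q) w) <= (1 - r) powr (- l)" using norm_bkernel_le[OF l0 _ r(2)] by simp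
   thus ?thesis unfolding norm_mult[of "cut N g q * cnj (cay l q)"] by(rule mult_left_mono) simp
  qed (simp add:cut_def)
 qed
qed

lemma restr_adj_cut_bergman:
 assumes g: "TR2 (g :: 'm TR => complex)"
 shows "restr_adj l (cut N g) \<in> bergman_space l"
proof -
 note cg = cut_sq_integrable[OF g, of N]
 obtain K where K: "0 <= K" "!!(q :: 'm TR) w. q \<in> space TRm ==> norm w < 1 ==>
   cmod (cut N g q * cnj (cay l q) * bkernel l (orbit q) w) <= cmod (cut N g q * cnj (cay l q)) * K"
  using cut_kernel_bound[of N g] by blast
 show ?thesis
 proof (rule bounded_holomorphic_bergman[OF l_gt restr_adj_holomorphic[OF cg]])
  fix w :: "complex^('m option)" assume w: "norm w < 1"
  have "cmod (restr_adj l (cut N g) w) <= (LINT q|TRm. cmod (cut N g q * cnj (cay l q) * bkernel l (orbit q) w))"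
   unfolding restr_adj_def by(rule integral_norm_bound)
  also have "... <= (LINT q|TRm. cmod (cut N g q * cnj (cay l q)) * K)"
   by(intro integral_mono integrable_norm restr_adj_integrable[OF cg w] integrable_mult_left weight_integrable[OF cg] K(2) w)
  finally show "cmod (restr_adj l (cut N g) w) <= (LINT q|TRm. cmod (cut N g q * cnj (cay l q)) * K)" .
 qed
qed

lemma bergman_integrable:
 assumes f: "(f :: complex^('m option) => complex) \<in> bergman_space l"
 shows "integrable (bergman_measure l) f"
proof -
 interpret finite_measure "bergman_measure l :: (complex^('m option)) measure" by(rule finite_measure_bergman[OF l_gt])
 have "sq_integrable (bergman_measure l :: (complex^('m option)) measure) (%_. 1)" by(simp add:sq_integrable_def)
 from sq_integrable_mult[OF _ this, of f] f show ?thesis by(simp add:bergman_space_def)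
qed

text \<open>Fubini over the group and the ball, then the reproducing property in the inner integral.
  Truncation supplies the majorant K |a| |f|.\<close>

lemma adjoint_cut:
 assumes f: "(f :: complex^('m option) => complex) \<in> bergman_space l" and g: "TR2 (g :: 'm TR => complex)"
 shows "bergman_ip l f (restr_adj l (cut N g)) = (LINT q|TRm. restr l f q * cnj (cut N g q))"
proof -
 let ?B = "bergman_measure l :: (complex^('m option)) measure" and ?T = "TRm :: 'm TR measure"
 interpret fB: finite_measure ?B by(rule finite_measure_bergman[OF l_gt])
 interpret pair_sigma_finite ?T ?B
  using sigma_finite_TR fB.sigma_finite_measure_axioms by(simp add:pair_sigma_finite_def)
 note cg = cut_sq_integrable[OF g, of N]
 define a where "a q = cut N g q * cnj (cay l q)" for q :: "'m TR"
 obtain K where K: "0 <= K" "!!(q :: 'm TR) w. q \<in> space TRm ==> norm w < 1 ==>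
   cmod (a q * bkernel l (orbit q) w) <= cmod (a q) * K"
  using cut_kernel_bound[of N g] unfolding a_def by blast
 have ai: "integrable ?T a" unfolding a_def[abs_def] by(rule weight_integrable[OF cg])
 have fi: "integrable ?B f" by(rule bergman_integrable[OF f])
 have idm: "(%w. w) \<in> bmeas ?B"
  by(subst measurable_cong_sets[OF sets_bergman refl]) (rule measurable_restrict_space1, simp)
 have [measurable]: "a \<in> bmeas ?T" "f \<in> bmeas ?B" using ai fi by auto
 let ?k = "%q w. bkernel l (orbit q) w"
 have km [measurable]: "(%x. ?k (fst x) (snd x)) \<in> bmeas (?T \<Otimes>\<^sub>M ?B)"
  unfolding bkernel_def
 proof (rule powr_measurable)
  have [measurable]: "(%x. orbit (fst x)) \<in> bmeas (?T \<Otimes>\<^sub>M ?B)"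
   by(rule measurable_compose[OF measurable_fst orbit_measurable])
  have [measurable]: "snd \<in> bmeas (?T \<Otimes>\<^sub>M ?B)"
   by(rule measurable_compose[OF measurable_snd idm])
  show "(%x. 1 - herm (snd x) (orbit (fst x))) \<in> bmeas (?T \<Otimes>\<^sub>M ?B)"
   unfolding herm_def by measurable
  fix x assume x: "x \<in> space (?T \<Otimes>\<^sub>M ?B)"
  hence o: "norm (orbit (fst x)) <= 1" and w: "norm (snd x) < 1"
   by(auto simp:space_pair_measure intro!:less_imp_le[OF orbit_in_ball])
  have "cmod (herm (snd x) (orbit (fst x))) <= norm (snd x) * norm (orbit (fst x))" by(rule norm_herm_le)
  also have "... <= norm (snd x) * 1" using o by(intro mult_left_mono) auto
  finally show "0 < Re (1 - herm (snd x) (orbit (fst x)))"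
   using w complex_Re_le_cmod[of "herm (snd x) (orbit (fst x))"] by simp
 qed
 have i: "integrable (?T \<Otimes>\<^sub>M ?B) (%(q, w). cnj (a q) * (f w * cnj (?k q w)))"
  unfolding case_prod_unfold
 proof (rule LINT_bound)
  show "integrable (?T \<Otimes>\<^sub>M ?B) (%x. cor K * (a (fst x) * f (snd x)))"
   by(rule integrable_mult_right[OF integrable_mult_pair[OF ai fi]])
  show "AE x in ?T \<Otimes>\<^sub>M ?B. norm (cnj (a (fst x)) * (f (snd x) * cnj (?k (fst x) (snd x)))) <= norm (cor K * (a (fst x) * f (snd x)))"
  proof (rule AE_I2)
   fix x assume "x \<in> space (?T \<Otimes>\<^sub>M ?B)"
   hence "cmod (a (fst x) * ?k (fst x) (snd x)) <= cmod (a (fst x)) * K" by(intro K(2)) (auto simp:space_pair_measure)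
   hence "cmod (a (fst x) * ?k (fst x) (snd x)) * cmod (f (snd x)) <= cmod (a (fst x)) * K * cmod (f (snd x))"
    by(rule mult_right_mono) simp
   thus "norm (cnj (a (fst x)) * (f (snd x) * cnj (?k (fst x) (snd x)))) <= norm (cor K * (a (fst x) * f (snd x)))"
    using K(1) by(simp add:norm_mult mult_ac)
  qed
  show "(%x. cnj (a (fst x)) * (f (snd x) * cnj (?k (fst x) (snd x)))) \<in> bmeas (?T \<Otimes>\<^sub>M ?B)" by measurable
 qed
 have "bergman_ip l f (restr_adj l (cut N g)) = (LINT w|?B. (LINT q|?T. cnj (a q) * (f w * cnj (?k q w))))"
  unfolding L2_ip_def
 proof (rule LINT_cong[OF refl])
  fix w
  have "f w * cnj (restr_adj l (cut N g) w) = (LINT q|?T. f w * cnj (a q * ?k q w))"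
   unfolding restr_adj_def a_def LINT_cnj[symmetric] by(rule integral_mult_right_zero[symmetric])
  thus "f w * cnj (restr_adj l (cut N g) w) = (LINT q|?T. cnj (a q) * (f w * cnj (?k q w)))"
   by(simp add:mult_ac)
 qed
 also have "... = (LINT q|?T. (LINT w|?B. cnj (a q) * (f w * cnj (?k q w))))"
  by(rule Fubini_integral[OF i])
 also have "... = (LINT q|?T. restr l f q * cnj (cut N g q))"
 proof (rule LINT_cong[OF refl])
  fix q :: "'m TR" assume q: "q \<in> space TRm"
  have "(LINT w|?B. cnj (a q) * (f w * cnj (?k q w))) = cnj (a q) * L2_ip ?B f (?k q)"
   unfolding L2_ip_def by(rule integral_mult_right_zero)
  also have "L2_ip ?B f (?k q) = f (orbit q)" using q by(intro bergman_reproducing[OF l_gt f] orbit_in_ball) auto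
  finally show "(LINT w|?B. cnj (a q) * (f w * cnj (?k q w))) = restr l f q * cnj (cut N g q)"
   by(simp add:a_def restr_def mult_ac)
 qed
 finally show ?thesis .
qed

lemma bergman_L2: "f \<in> bergman_space l ==> sq_integrable (bergman_measure l) f"
 by(simp add:bergman_space_def)

text \<open>With h the image of the truncated g, the square of the norm of h is the inner product of
  R h with the truncated g, and R h is a convolution with phi. The bound must not depend on N, hence
  the bound by the symbol rather than the kernel bound on the strip.\<close>

lemma restr_adj_cut_nrm:
 assumes g: "TR2 (g :: 'm TR => complex)"
 shows "ip_norm (bergman_ip l) (restr_adj l (cut N g)) <= sqrt (phi_nrm TYPE('m) l) * TR_nrm g"
proof -
 let ?c = "cut N g"
 note cg = cut_sq_integrable[OF g, of N]
 note T = TR_conv_bound[OF l1 cg]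
 interpret B: ip_space "Collect (sq_integrable (bergman_measure l :: (complex^('m option)) measure))" "bergman_ip l" by(rule ip_space_L2)
 have h: "restr_adj l ?c \<in> bergman_space l" by(rule restr_adj_cut_bergman[OF g])
 have "(ip_norm (bergman_ip l) (restr_adj l ?c))^2 = Re (LINT q|TRm. restr l (restr_adj l ?c) q * cnj (?c q))"
  using B.nrm_sq[of "restr_adj l ?c"] bergman_L2[OF h] adjoint_cut[OF h g, of N] by simp
 also have "(LINT q|TRm. restr l (restr_adj l ?c) q * cnj (?c q)) = L2_ip TRm (TR_conv ?c (phi l)) ?c"
  unfolding L2_ip_def by(rule LINT_cong[OF refl]) (simp only:restr_restr_adj)
 also have "Re ... <= cmod ..." by(rule complex_Re_le_cmod)
 also have "... <= TR_nrm (TR_conv ?c (phi l)) * TR_nrm ?c"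
  using T cg by(intro Plancherel.V.Cauchy_Schwarz) auto
 also have "... <= (phi_nrm TYPE('m) l * TR_nrm ?c) * TR_nrm ?c" by(intro mult_right_mono T) (simp add:L2_nrm)
 also have "... = (sqrt (phi_nrm TYPE('m) l) * TR_nrm ?c)^2" using phi_nrm_nonneg[where 'm = 'm, of l] by(simp add:power2_eq_square)
 also have "... <= (sqrt (phi_nrm TYPE('m) l) * TR_nrm g)^2"
  using cut_nrm[OF g, of N] phi_nrm_nonneg[where 'm = 'm, of l] by(intro power_mono mult_left_mono) (auto simp:L2_nrm)
 finally show ?thesis
  by(rule power2_le_imp_le) (use phi_nrm_nonneg[where 'm = 'm, of l] in \<open>simp add:L2_nrm\<close>)
qed

text \<open>Duality on truncations: the squared norm of the truncated R f is the inner product of f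
  with the adjoint integral of that truncation. Cancelling one factor of the norm gives a bound
  uniform in N.\<close>

lemma restr_bounded:
 assumes f: "(f :: complex^('m option) => complex) \<in> bergman_space l"
 shows "TR2 (restr l f)" and "TR_nrm (restr l f) <= sqrt (phi_nrm TYPE('m) l) * ip_norm (bergman_ip l) f"
proof -
 interpret B: ip_space "Collect (sq_integrable (bergman_measure l :: (complex^('m option)) measure))" "bergman_ip l" by(rule ip_space_L2)
 have cutcut: "cut N (cut N g) = cut N g" for N and g :: "'m TR => complex" by(auto simp:cut_def)
 \<comment> \<open>On the strip, f along the orbit is bounded, so the truncated restriction is
   dominated by the square integrable \<open>cay l\<close>.\<close>
 have c2: "TR2 (cut N (restr l f))" for N
 proof -
  let ?S = "(torus :: (complex^'m) set) \<times> {- real N..real N}"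
  have "continuous_on ?S (%q. f (orbit q))"
   by(rule continuous_on_compose2[OF bergman_continuous[OF f] continuous_on_subset[OF continuous_orbit]]) (auto simp:orbit_in_ball)
  hence "bounded ((%q. f (orbit q)) ` ?S)" by(intro compact_imp_bounded compact_continuous_image compact_strip)
  then obtain C where C: "!!q. q \<in> ?S ==> cmod (f (orbit q)) <= C" unfolding bounded_iff by blast
  show ?thesis
  proof (rule sq_integrable_bound[OF cay_sq cut_measurable[OF restr_measurable[OF f]], where C = "\<bar>C\<bar>"], rule AE_I2)
   fix q :: "'m TR" assume q: "q \<in> space TRm"
   show "cmod (cut N (restr l f) q) <= \<bar>C\<bar> * cmod (cay l q)"
   proof (cases "\<bar>snd q\<bar> <= real N")
    case True
    hence "cmod (f (orbit q)) <= C" using q by(intro C) (cases q, auto)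
    hence "cmod (f (orbit q)) <= \<bar>C\<bar>" by linarith
    from mult_right_mono[OF this norm_ge_zero[of "cay l q"]] show ?thesis
     by(simp add:cut_def restr_def norm_mult mult.commute)
   qed (simp add:cut_def)
  qed
 qed
 have n: "TR_nrm (cut N (restr l f)) <= sqrt (phi_nrm TYPE('m) l) * ip_norm (bergman_ip l) f" for N
 proof -
  let ?c = "cut N (restr l f)"
  have h: "restr_adj l ?c \<in> bergman_space l" using restr_adj_cut_bergman[OF c2, of N N] by(simp add:cutcut)
  have "cor ((TR_nrm ?c)^2) = L2_ip TRm ?c ?c" using Plancherel.V.ip_self[of ?c] c2 by simp
  also have "... = (LINT q|TRm. restr l f q * cnj (?c q))"
   unfolding L2_ip_def by(rule LINT_cong[OF refl]) (simp add:cut_def)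
  also have "... = bergman_ip l f (restr_adj l ?c)" using adjoint_cut[OF f c2, of N N] by(simp add:cutcut)
  finally have "(TR_nrm ?c)^2 = cmod (bergman_ip l f (restr_adj l ?c))"
   by(metis abs_of_nonneg norm_of_real zero_le_power2)
  also have "... <= ip_norm (bergman_ip l) f * ip_norm (bergman_ip l) (restr_adj l ?c)"
   using bergman_L2[OF f] bergman_L2[OF h] by(intro B.Cauchy_Schwarz) auto
  also have "... <= ip_norm (bergman_ip l) f * (sqrt (phi_nrm TYPE('m) l) * TR_nrm ?c)"
   using restr_adj_cut_nrm[OF c2, of N N] by(intro mult_left_mono) (auto simp:cutcut L2_nrm)
  finally have *: "TR_nrm ?c * TR_nrm ?c <= (sqrt (phi_nrm TYPE('m) l) * ip_norm (bergman_ip l) f) * TR_nrm ?c"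
   by(simp only:power2_eq_square mult_ac)
  have nn: "0 <= TR_nrm ?c" by(simp add:L2_nrm)
  have "0 <= sqrt (phi_nrm TYPE('m) l) * ip_norm (bergman_ip l) f" using phi_nrm_nonneg[where 'm = 'm, of l] by(simp add:L2_nrm)
  \<comment> \<open>Cancelling the norm is legitimate unless it vanishes, and then the bound is
    trivial.\<close>
  thus ?thesis using * nn by(cases "TR_nrm ?c = 0") (auto simp:mult_le_cancel_right)
 qed
 show "TR2 (restr l f)" "TR_nrm (restr l f) <= sqrt (phi_nrm TYPE('m) l) * ip_norm (bergman_ip l) f"
  by(rule L2_Fatou[OF c2 n restr_measurable[OF f] cut_tendsto])+
qed

text \<open>At each point of the ball the integrals of the truncations converge by domination; Fatou
  on the ball preserves the norm bound.\<close>

lemma restr_adj_bounded: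
 assumes g: "TR2 (g :: 'm TR => complex)"
 shows "restr_adj l g \<in> bergman_space l" and "ip_norm (bergman_ip l) (restr_adj l g) <= sqrt (phi_nrm TYPE('m) l) * TR_nrm g"
proof -
 have hol: "mv_holomorphic_on (restr_adj l g) (ball 0 1)" by(rule restr_adj_holomorphic[OF g])
 have lim: "(%N. restr_adj l (cut N g) w) ----> restr_adj l g w" if "w \<in> space (bergman_measure l)" for w
 proof -
  have w: "norm w < 1" using that by simp
  show ?thesis unfolding restr_adj_def
  proof (rule integral_dominated_convergence[OF _ _ integrable_norm[OF restr_adj_integrable[OF g w]]])
   show "(%q. g q * cnj (cay l q) * bkernel l (orbit q) w) \<in> bmeas TRm"
    using restr_adj_integrable[OF g w] by auto
   show "(%q. cut N g q * cnj (cay l q) * bkernel l (orbit q) w) \<in> bmeas TRm" for N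
    using restr_adj_integrable[OF cut_sq_integrable[OF g, of N] w] by auto
   show "AE q in TRm. (%N. cut N g q * cnj (cay l q) * bkernel l (orbit q) w) ----> g q * cnj (cay l q) * bkernel l (orbit q) w"
    by(intro AE_I2 tendsto_mult tendsto_const cut_tendsto)
   show "AE q in TRm. norm (cut N g q * cnj (cay l q) * bkernel l (orbit q) w) <= norm (g q * cnj (cay l q) * bkernel l (orbit q) w)" for N
    by(rule AE_I2) (simp add:cut_def)
  qed
 qed
 have m: "restr_adj l g \<in> bmeas (bergman_measure l)"
  by(rule continuous_measurable_bergman[OF mv_holomorphic_continuous[OF hol]])
 have s: "sq_integrable (bergman_measure l) (restr_adj l (cut N g))" for N by(rule bergman_L2[OF restr_adj_cut_bergman[OF g]])
 note F = L2_Fatou[OF s restr_adj_cut_nrm[OF g] m lim]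
 show "restr_adj l g \<in> bergman_space l" using F(1) hol by(simp add:bergman_space_def)
 show "ip_norm (bergman_ip l) (restr_adj l g) <= sqrt (phi_nrm TYPE('m) l) * TR_nrm g" by(rule F(2))
qed

section \<open>The adjoint relation without truncation\<close>

lemma restr_adj_lin:
 assumes g: "TR2 (g :: 'm TR => complex)" and h: "TR2 h" and w: "norm w < 1"
 shows "restr_adj l (%q. g q + c * h q) w = restr_adj l g w + c * restr_adj l h w"
proof -
 have "(g q + c * h q) * cnj (cay l q) * bkernel l (orbit q) w =
   g q * cnj (cay l q) * bkernel l (orbit q) w + c * (h q * cnj (cay l q) * bkernel l (orbit q) w)" for q
  by(simp add:algebra_simps)
 thus ?thesis unfolding restr_adj_def
  by(simp only:Bochner_Integration.integral_add[OF restr_adj_integrable[OF g w] integrable_mult_right[OF restr_adj_integrable[OF h w]]]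
   integral_mult_right_zero)
qed

lemma L2_ip_cong:
 assumes "!!x. x \<in> space N ==> f x = f' x" "!!x. x \<in> space N ==> g x = g' x"
 shows "L2_ip N f g = L2_ip N f' g'"
 unfolding L2_ip_def by(rule LINT_cong[OF refl]) (simp add:assms)

lemma L2_nrm_cong:
 assumes "!!x. x \<in> space N ==> f x = f' x"
 shows "ip_norm (L2_ip N) f = ip_norm (L2_ip N) f'"
 unfolding ip_norm_def using L2_ip_cong[of N f f' f f'] assms by simp

lemma adjoint:
 assumes f: "(f :: complex^('m option) => complex) \<in> bergman_space l" and g: "TR2 (g :: 'm TR => complex)"
 shows "bergman_ip l f (restr_adj l g) = L2_ip TRm (restr l f) g"
proof (rule LIMSEQ_unique)
 interpret B: ip_space "Collect (sq_integrable (bergman_measure l :: (complex^('m option)) measure))" "bergman_ip l" by(rule ip_space_L2)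
 note Rf = restr_bounded[OF f]
 have c: "TR2 (cut N g)" for N by(rule cut_sq_integrable[OF g])
 have eq: "bergman_ip l f (restr_adj l (cut N g)) = L2_ip TRm (restr l f) (cut N g)" for N
  using adjoint_cut[OF f g, of N] by(simp add:L2_ip_def)
 have "(%N. cnj (L2_ip TRm (cut N g) (restr l f))) ----> cnj (L2_ip TRm g (restr l f))"
  by(intro tendsto_cnj Plancherel.V.ip_tendsto cut_dist_tendsto g) (use c g Rf in auto)
 moreover have "cnj (L2_ip TRm h (restr l f)) = L2_ip TRm (restr l f) h" if "TR2 h" for h
  using Plancherel.V.ip_cnj[of h "restr l f"] that Rf by simp
 ultimately show "(%N. bergman_ip l f (restr_adj l (cut N g))) ----> L2_ip TRm (restr l f) g"
  by(simp add:eq c g)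
 have d: "ip_dist (bergman_ip l) (restr_adj l (cut N g)) (restr_adj l g) <= sqrt (phi_nrm TYPE('m) l) * ip_dist (L2_ip TRm) (cut N g) g" for N
 proof -
  have "ip_dist (bergman_ip l) (restr_adj l (cut N g)) (restr_adj l g) = ip_norm (bergman_ip l) (restr_adj l (%q. cut N g q - g q))"
   unfolding ip_dist_def by(rule L2_nrm_cong) (use restr_adj_lin[OF c g, of _ N "-1"] in simp)
  also have "... <= sqrt (phi_nrm TYPE('m) l) * TR_nrm (%q. cut N g q - g q)"
   using Plancherel.V.diff[of "cut N g" g] c g by(intro restr_adj_bounded) auto
  finally show ?thesis unfolding ip_dist_def .
 qed
 have "(%N. sqrt (phi_nrm TYPE('m) l) * ip_dist (L2_ip TRm) (cut N g) g) ----> sqrt (phi_nrm TYPE('m) l) * 0"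
  by(intro tendsto_mult tendsto_const cut_dist_tendsto g)
 hence up: "(%N. sqrt (phi_nrm TYPE('m) l) * ip_dist (L2_ip TRm) (cut N g) g) ----> 0" by(simp only:mult_zero_right)
 have lim: "(%N. ip_dist (bergman_ip l) (restr_adj l (cut N g)) (restr_adj l g)) ----> 0"
 proof (rule tendsto_sandwich[OF _ _ tendsto_const up])
  show "\<forall>\<^sub>F N in sequentially. 0 <= ip_dist (bergman_ip l) (restr_adj l (cut N g)) (restr_adj l g)"
   by(simp add:ip_dist_def L2_nrm)
 qed (rule always_eventually, rule allI, rule d)
 have "(%N. cnj (bergman_ip l (restr_adj l (cut N g)) f)) ----> cnj (bergman_ip l (restr_adj l g) f)"
  using bergman_L2[OF restr_adj_cut_bergman[OF g]] bergman_L2[OF restr_adj_bounded(1)[OF g]] bergman_L2[OF f]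
  by(intro tendsto_cnj B.ip_tendsto lim) auto
 moreover have "cnj (bergman_ip l h f) = bergman_ip l f h" if "h \<in> bergman_space l" for h
  using B.ip_cnj[of h f] bergman_L2[OF that] bergman_L2[OF f] by simp
 ultimately show "(%N. bergman_ip l f (restr_adj l (cut N g))) ----> bergman_ip l f (restr_adj l g)"
  using restr_adj_cut_bergman[OF g] restr_adj_bounded(1)[OF g] by simp
qed

lemma restriction_op_eq: "restriction_op l f = twist l (restr l f)"
 unfolding restriction_op_eq_twist restr_def[abs_def] cay_def ..

text \<open>The integral formula provides a witness for the choice in
  \<open>hilbert_adjoint\<close>. The chosen function may differ from it outside the ball, but
  inside its values are inner products with kernels, which the adjoint relation determines.\<close>

lemma restriction_adj_eq:
 assumes g: "(g :: 'm cov => complex) \<in> L2_chi l"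
 shows "restriction_adj l g \<in> bergman_space l"
  and "\<forall>f\<in>bergman_space l. chi_ip l (restriction_op l f) g = bergman_ip l f (restriction_adj l g)"
  and "norm z < 1 ==> restriction_adj l g z = restr_adj l (untwist l g) z"
proof -
 interpret B: ip_space "Collect (sq_integrable (bergman_measure l :: (complex^('m option)) measure))" "bergman_ip l" by(rule ip_space_L2)
 have u: "TR2 (untwist l g)" by(rule untwist_sq_integrable[OF g])
 let ?P = "%h. h \<in> bergman_space l \<and> (\<forall>f\<in>bergman_space l. restriction_op l f \<in> L2_chi l \<longrightarrow> chi_ip l (restriction_op l f) g = bergman_ip l f h)"
 have R: "restriction_op l f \<in> (L2_chi l :: ('m cov => complex) set)" if "f \<in> bergman_space l" for f
  unfolding restriction_op_eq by(rule twist_in_L2_chi[OF restr_bounded(1)[OF that]])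
 have "?P (restr_adj l (untwist l g))"
  using restr_adj_bounded(1)[OF u] adjoint[OF _ u] by(simp add:restriction_op_eq chi_ip_def)
 hence P: "?P (restriction_adj l g)"
  unfolding restriction_adj_def hilbert_adjoint_def by(rule someI[where P = ?P])
 thus h: "restriction_adj l g \<in> bergman_space l" and
  a: "\<forall>f\<in>bergman_space l. chi_ip l (restriction_op l f) g = bergman_ip l f (restriction_adj l g)" using R by blast+
 show "restriction_adj l g z = restr_adj l (untwist l g) z" if z: "norm z < 1"
 proof -
  have k: "bkernel l z \<in> bergman_space l" by(rule bkernel_bergman[OF l_gt z])
  have v: "h z = cnj (bergman_ip l (bkernel l z) h)" if "h \<in> bergman_space l" for h
   using bergman_reproducing[OF l_gt that z] B.ip_cnj[of "bkernel l z" h] bergman_L2[OF that] bergman_L2[OF k] by simp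
  have "bergman_ip l (bkernel l z) (restriction_adj l g) = chi_ip l (restriction_op l (bkernel l z)) g" using a k by simp
  also have "... = bergman_ip l (bkernel l z) (restr_adj l (untwist l g))"
   using adjoint[OF k u] by(simp add:restriction_op_eq chi_ip_def)
  finally show ?thesis using v[OF h] v[OF restr_adj_bounded(1)[OF u]] by simp
 qed
qed

lemma RR_adj_eq:
 assumes f: "(f :: 'm cov => complex) \<in> L2_chi l" and p: "p \<in> space TRm"
 shows "untwist l (RR_adj l f) p = TR_conv (untwist l f) (phi l) p"
proof -
 have "untwist l (RR_adj l f) p = cay l p * restriction_adj l f (orbit p)"
  by(simp add:RR_adj_def restriction_op_eq restr_def)
 also have "... = restr l (restr_adj l (untwist l f)) p"
  unfolding restr_def using p by(subst restriction_adj_eq(3)[OF f orbit_in_ball]) auto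
 finally show ?thesis by(simp only:restr_restr_adj[OF p])
qed

lemma RR_adj_formula:
 assumes f: "f \<in> L2_chi l" and h: "((t :: complex^'m), y, x) \<in> P_cover"
 shows "RR_adj l f (t, y, x) = exp (- 2 * cor pi * \<i> * cor l * cor x) * TR_conv (untwist l f) (phi l) (t, y)"
proof -
 have t: "t \<in> torus" using h by(simp add:P_cover_def)
 have "RR_adj l f (t, y, x) = exp (- 2 * cor pi * \<i> * cor l * cor x) * untwist l (RR_adj l f) (t, y)"
  by(simp add:RR_adj_def restriction_op_eq) (simp add:twist_def)
 thus ?thesis using RR_adj_eq[OF f, of "(t, y)"] t by simp
qed

lemma RR_adj_in: "f \<in> L2_chi l ==> RR_adj l (f :: 'm cov => complex) \<in> L2_chi l"
 unfolding RR_adj_def restriction_op_eq by(intro twist_in_L2_chi restr_bounded(1) restriction_adj_eq(1))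

lemma RR_adj_pair:
 assumes f: "(f :: 'm cov => complex) \<in> L2_chi l" and F: "Plancherel.pair (untwist l f) F"
 shows "Plancherel.pair (untwist l (RR_adj l f)) (%\<beta>. cor (sqrt (2 * pi) * Phi l \<beta>) * F \<beta>)"
 by(rule pair_cong_space[OF TR_conv_pair[OF l1 F]]) (simp add:RR_adj_eq[OF f])

lemma restriction_op_bounded:
 "bounded_operator (bergman_space l :: (complex^('m option) => complex) set) (bergman_ip l) (L2_chi l) (chi_ip l) (restriction_op l)"
 unfolding bounded_operator_def
proof (intro conjI ballI allI exI[of _ "sqrt (phi_nrm TYPE('m) l)"])
 interpret C: ip_space "L2_chi l :: ('m cov => complex) set" "chi_ip l" by(rule ip_space_L2_chi)
 fix f g :: "complex^('m option) => complex" and c :: complex assume f: "f \<in> bergman_space l"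
 show "restriction_op l f \<in> (L2_chi l :: ('m cov => complex) set)"
  unfolding restriction_op_eq by(rule twist_in_L2_chi[OF restr_bounded(1)[OF f]])
 have "restriction_op l (%x. f x + g x) = (%y. restriction_op l f y + restriction_op l g y)"
  by(simp add:restriction_op_def fun_eq_iff algebra_simps)
 thus "chi_d l (restriction_op l (%x. f x + g x)) (%y :: 'm cov. restriction_op l f y + restriction_op l g y) = 0"
  by(simp only:ip_dist_def diff_self) (rule C.nrm_zero)
 have "restriction_op l (%x. c * f x) = (%y. c * restriction_op l f y)"
  by(simp add:restriction_op_def fun_eq_iff algebra_simps)
 thus "chi_d l (restriction_op l (%x. c * f x)) (%y :: 'm cov. c * restriction_op l f y) = 0"
  by(simp only:ip_dist_def diff_self) (rule C.nrm_zero)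
 show "ip_norm (chi_ip l) (restriction_op l f :: 'm cov => complex) <= sqrt (phi_nrm TYPE('m) l) * ip_norm (bergman_ip l) f"
  unfolding chi_nrm restriction_op_eq untwist_twist by(rule restr_bounded(2)[OF f])
qed

lemma restriction_adj_bounded:
 "bounded_operator (L2_chi l :: ('m cov => complex) set) (chi_ip l) (bergman_space l) (bergman_ip l) (restriction_adj l)"
 unfolding bounded_operator_def
proof (intro conjI ballI allI exI[of _ "sqrt (phi_nrm TYPE('m) l)"])
 interpret C: ip_space "L2_chi l :: ('m cov => complex) set" "chi_ip l" by(rule ip_space_L2_chi)
 interpret B: ip_space "Collect (sq_integrable (bergman_measure l :: (complex^('m option)) measure))" "bergman_ip l" by(rule ip_space_L2)
 have z: "ip_dist (bergman_ip l) h h' = 0" if "!!w :: complex^('m option). norm w < 1 ==> h w = h' w" for h h'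
  unfolding ip_dist_def using L2_nrm_cong[of "bergman_measure l" "%x. h x - h' x" "%x. 0"] that B.nrm_zero by simp
 fix f g :: "'m cov => complex" and c :: complex assume f: "f \<in> L2_chi l"
 show "restriction_adj l f \<in> bergman_space l" by(rule restriction_adj_eq(1)[OF f])
 show "ip_dist (bergman_ip l) (restriction_adj l (%x. f x + g x)) (%y. restriction_adj l f y + restriction_adj l g y) = 0" if g: "g \<in> L2_chi l"
  by(rule z) (use restr_adj_lin[OF untwist_sq_integrable[OF f] untwist_sq_integrable[OF g], of _ 1] in
   \<open>simp add:restriction_adj_eq(3)[OF f] restriction_adj_eq(3)[OF g] restriction_adj_eq(3)[OF C.add[OF f g]] untwist_add\<close>)
 show "ip_dist (bergman_ip l) (restriction_adj l (%x. c * f x)) (%y. c * restriction_adj l f y) = 0"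
 proof (rule z)
  fix w :: "complex^('m option)" assume w: "norm w < 1"
  have "restr_adj l (%p. c * untwist l f p) w = c * restr_adj l (untwist l f) w"
   unfolding restr_adj_def mult.assoc by(rule integral_mult_right_zero)
  thus "restriction_adj l (%x. c * f x) w = c * restriction_adj l f w"
   by(simp add:restriction_adj_eq(3)[OF f w] restriction_adj_eq(3)[OF C.scale[OF f] w] untwist_scale)
 qed
 have "ip_norm (bergman_ip l) (restriction_adj l f) = ip_norm (bergman_ip l) (restr_adj l (untwist l f))"
  by(rule L2_nrm_cong) (simp add:restriction_adj_eq(3)[OF f])
 thus "ip_norm (bergman_ip l) (restriction_adj l f) <= sqrt (phi_nrm TYPE('m) l) * ip_norm (chi_ip l) f"
  using restr_adj_bounded(2)[OF untwist_sq_integrable[OF f]] by(simp add:chi_nrm)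
qed

end

section \<open>Fourier multipliers and positive square roots\<close>

lemma bounded_operatorD:
 assumes "bounded_operator V ipV W ipW T"
 shows "!!f. f \<in> V ==> T f \<in> W"
  and "!!f g. f \<in> V ==> g \<in> V ==> ip_dist ipW (T (%x. f x + g x)) (%y. T f y + T g y) = 0"
  and "!!f c. f \<in> V ==> ip_dist ipW (T (%x. c * f x)) (%y. c * T f y) = 0"
  and "\<exists>K. \<forall>f\<in>V. ip_norm ipW (T f) <= K * ip_norm ipV f"
 using assms unfolding bounded_operator_def by simp_all

context ip_space
begin

text \<open><S f, g> is itself a semi-inner product, and its Cauchy-Schwarz inequality with v and S
  v gives <S v, S v> = 0.\<close>

lemma positive_zero:
 assumes S: "bounded_operator V ip V ip S" and sa: "!!f g. f \<in> V ==> g \<in> V ==> ip (S f) g = ip f (S g)"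
  and pos: "!!f. f \<in> V ==> 0 <= Re (ip (S f) f)" and v: "v \<in> V" and z: "Re (ip (S v) v) = 0"
 shows "ip_norm ip (S v) = 0"
proof -
 have SV: "S f \<in> V" if "f \<in> V" for f using S that by(simp add:bounded_operator_def)
 interpret Q: ip_space V "%f g. ip (S f) g"
 proof
  show "(%x. 0) \<in> V" by(rule zero)
  fix f g h :: "'a => complex" and c :: complex
  show "f \<in> V ==> g \<in> V ==> (%x. f x + g x) \<in> V" by(rule add)
  show "f \<in> V ==> (%x. c * f x) \<in> V" by(rule scale)
  show "ip (S (%x. f x + g x)) h = ip (S f) h + ip (S g) h" if f: "f \<in> V" and g: "g \<in> V" and h: "h \<in> V"
  proof -
   have "ip_dist ip (S (%x. f x + g x)) (%y. S f y + S g y) = 0" using S f g by(simp add:bounded_operator_def)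
   from dist_zero_ip[OF SV[OF add[OF f g]] add[OF SV[OF f] SV[OF g]] h this]
   show ?thesis using ip_add[OF SV[OF f] SV[OF g] h] by simp
  qed
  show "ip (S (%x. c * f x)) h = c * ip (S f) h" if f: "f \<in> V" and h: "h \<in> V"
  proof -
   have "ip_dist ip (S (%x. c * f x)) (%y. c * S f y) = 0" using S f by(simp add:bounded_operator_def)
   from dist_zero_ip[OF SV[OF scale[OF f]] scale[OF SV[OF f]] h this]
   show ?thesis using ip_scale[OF SV[OF f] h] by simp
  qed
  show "ip (S g) f = cnj (ip (S f) g)" if "f \<in> V" "g \<in> V"
   using sa[OF that(2,1)] ip_cnj[OF SV[OF that(1)] that(2)] by simp
  show "f \<in> V ==> 0 <= Re (ip (S f) f)" by(rule pos)
 qed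
 have "ip_norm (%f g. ip (S f) g) v = 0" using z by(simp add:ip_norm_def)
 from Q.nrm_zero_ip[OF v SV[OF v] this] show ?thesis by(simp add:ip_norm_def)
qed

text \<open>Put v = S u - S' u. Commutation gives (S + S') v = (S^2 - S'^2) u = 0, so the two
  nonnegative numbers <S v, v> and <S' v, v> vanish, and S v and S' v are null. Then <v, v> = <S v,
  u> - <S' v, u> = 0.\<close>

lemma positive_sqrt_unique:
 assumes S: "is_positive_sqrt V ip A S" and S': "is_positive_sqrt V ip A S'" and A: "!!f. f \<in> V ==> A f \<in> V"
  and comm: "!!f. f \<in> V ==> ip_dist ip (S (S' f)) (S' (S f)) = 0" and u: "u \<in> V"
 shows "ip_dist ip (S u) (S' u) = 0"
proof -
 note IP = ip_space_axioms
 have Sb: "bounded_operator V ip V ip S" "bounded_operator V ip V ip S'" using S S' by(auto simp:is_positive_sqrt_def)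
 have SV: "S f \<in> V" and SV': "S' f \<in> V" if "f \<in> V" for f using Sb that by(auto simp:bounded_operator_def)
 have sa: "ip (S f) g = ip f (S g)" "ip (S' f) g = ip f (S' g)" if "f \<in> V" "g \<in> V" for f g
  using S S' that by(auto simp:is_positive_sqrt_def)
 have pos: "0 <= Re (ip (S f) f)" "0 <= Re (ip (S' f) f)" if "f \<in> V" for f using S S' that by(auto simp:is_positive_sqrt_def)
 have sq: "ip_dist ip (S (S f)) (A f) = 0" "ip_dist ip (S' (S' f)) (A f) = 0" if "f \<in> V" for f
  using S S' that by(auto simp:is_positive_sqrt_def)
 define v where "v = (%x. S u x - S' u x)"
 have v: "v \<in> V" unfolding v_def by(rule diff[OF SV[OF u] SV'[OF u]])
 have Sd: "ip (T v) w = ip (T (S u)) w - ip (T (S' u)) w"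
  if T: "bounded_operator V ip V ip T" and w: "w \<in> V" for T w
 proof -
  have TV: "T f \<in> V" if "f \<in> V" for f using T that by(simp add:bounded_operator_def)
  have "ip_dist ip (T v) (%y. T (S u) y - T (S' u) y) = 0"
   unfolding v_def by(rule bounded_operator_diff[OF IP T SV[OF u] SV'[OF u]])
  from dist_zero_ip[OF TV[OF v] diff[OF TV[OF SV[OF u]] TV[OF SV'[OF u]]] w this]
  show ?thesis using ip_diff[OF TV[OF SV[OF u]] TV[OF SV'[OF u]] w] by simp
 qed
 have "ip (S v) v + ip (S' v) v = 0"
 proof -
  have "ip (S (S u)) v = ip (A u) v" by(rule dist_zero_ip[OF SV[OF SV[OF u]] A[OF u] v sq(1)[OF u]])
  moreover have "ip (S' (S' u)) v = ip (A u) v" by(rule dist_zero_ip[OF SV'[OF SV'[OF u]] A[OF u] v sq(2)[OF u]])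
  moreover have "ip (S (S' u)) v = ip (S' (S u)) v" by(rule dist_zero_ip[OF SV[OF SV'[OF u]] SV'[OF SV[OF u]] v comm[OF u]])
  ultimately show ?thesis using Sd[OF Sb(1) v] Sd[OF Sb(2) v] by simp
 qed
 hence "Re (ip (S v) v) + Re (ip (S' v) v) = 0" by(metis plus_complex.simps(1) zero_complex.simps(1))
 hence "Re (ip (S v) v) = 0" "Re (ip (S' v) v) = 0" using pos[OF v] by linarith+
 hence "ip_norm ip (S v) = 0" "ip_norm ip (S' v) = 0"
  using positive_zero[OF Sb(1) sa(1) pos(1) v] positive_zero[OF Sb(2) sa(2) pos(2) v] by blast+
 hence "ip (S v) u = 0" "ip (S' v) u = 0"
  using nrm_zero_ip[OF SV[OF v] u] nrm_zero_ip[OF SV'[OF v] u] by blast+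
 hence "ip v (S u) - ip v (S' u) = 0" using sa[OF v u] by simp
 hence "ip v v = 0" using ip_diff2[OF SV[OF u] SV'[OF u] v] by(simp add:v_def)
 thus ?thesis by(simp add:ip_dist_def ip_norm_def v_def)
qed

end

section \<open>Operators with a bounded real symbol\<close>

lemma L2_nrm_mono:
 assumes g: "sq_integrable M g" and f: "f \<in> bmeas M" and le: "!!x. cmod (f x) <= C * cmod (g x)" and C: "0 <= C"
 shows "ip_norm (L2_ip M) f <= C * ip_norm (L2_ip M) g"
proof -
 have f2: "sq_integrable M f" by(rule sq_integrable_bound[OF g f, of C]) (simp add:le)
 have "(LINT x|M. (cmod (f x))^2) <= (LINT x|M. C\<^sup>2 * (cmod (g x))^2)"
 proof (rule integral_mono)
  show "integrable M (%x. (cmod (f x))^2)" using f2 by(simp add:sq_integrable_def)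
  show "integrable M (%x. C\<^sup>2 * (cmod (g x))^2)" using g by(intro integrable_mult_right) (simp add:sq_integrable_def)
  show "(cmod (f x))^2 <= C\<^sup>2 * (cmod (g x))^2" for x
   using power_mono[OF le[of x] norm_ge_zero, of 2] by(simp add:power_mult_distrib)
 qed
 hence "sqrt (LINT x|M. (cmod (f x))^2) <= sqrt (C\<^sup>2 * (LINT x|M. (cmod (g x))^2))" by simp
 thus ?thesis unfolding L2_nrm real_sqrt_mult using C by simp
qed

definition bounded_symbol :: "('m::finite DR => real) => bool"
 where "bounded_symbol a \<longleftrightarrow> a \<in> bmeas DRm \<and> (\<exists>C. \<forall>\<beta>. \<bar>a \<beta>\<bar> <= C)"

lemma bounded_symbolD:
 assumes "bounded_symbol a"
 obtains C where "a \<in> bmeas DRm" "0 <= C" "!!\<beta>. \<bar>a \<beta>\<bar> <= C"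
 using assms unfolding bounded_symbol_def by(meson abs_ge_zero order_trans)

lemma bounded_symbol_mult:
 assumes a: "bounded_symbol a" and G: "DR2 G"
 shows "DR2 (%\<beta>. cor (a \<beta>) * G \<beta>)"
proof -
 obtain C where C: "a \<in> bmeas DRm" "0 <= C" "!!\<beta>. \<bar>a \<beta>\<bar> <= C" using bounded_symbolD[OF a] by blast
 have [measurable]: "a \<in> bmeas DRm" "G \<in> bmeas DRm" using C G by(auto simp:sq_integrable_def)
 show ?thesis
  by(rule sq_integrable_bound[OF G, of _ C]) (auto simp:norm_mult intro!:mult_right_mono C(3))
qed

lemma bounded_symbol_comb:
 assumes a: "bounded_symbol a" and b: "bounded_symbol b"
 shows "bounded_symbol (%\<beta>. a \<beta> + c * b \<beta>)" "bounded_symbol (%\<beta>. a \<beta> * b \<beta>)"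
proof -
 obtain C where C: "a \<in> bmeas DRm" "0 <= C" "!!\<beta>. \<bar>a \<beta>\<bar> <= C" using bounded_symbolD[OF a] by blast
 obtain D where D: "b \<in> bmeas DRm" "0 <= D" "!!\<beta>. \<bar>b \<beta>\<bar> <= D" using bounded_symbolD[OF b] by blast
 note [measurable] = C(1) D(1)
 have "\<bar>a \<beta> + c * b \<beta>\<bar> <= C + \<bar>c\<bar> * D" for \<beta>
  using C(3)[of \<beta>] mult_left_mono[OF D(3)[of \<beta>] abs_ge_zero[of c]] abs_triangle_ineq[of "a \<beta>" "c * b \<beta>"] by(simp add:abs_mult)
 thus "bounded_symbol (%\<beta>. a \<beta> + c * b \<beta>)" unfolding bounded_symbol_def by(intro conjI exI allI) measurable
 have "\<bar>a \<beta> * b \<beta>\<bar> <= C * D" for \<beta> unfolding abs_mult by(intro mult_mono C D) auto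
 thus "bounded_symbol (%\<beta>. a \<beta> * b \<beta>)" unfolding bounded_symbol_def by(intro conjI exI allI) measurable
qed

definition multiplier :: "real => ('m::finite DR => real) =>
  (('m cov => complex) => 'm cov => complex) => bool"
 where "multiplier l a T \<longleftrightarrow> (\<forall>f\<in>L2_chi l. T f \<in> L2_chi l \<and>
  (\<forall>F. Plancherel.pair (untwist l f) F \<longrightarrow> Plancherel.pair (untwist l (T f)) (%\<beta>. cor (a \<beta>) * F \<beta>)))"

lemma multiplierD:
 assumes "multiplier l a T" "f \<in> L2_chi l"
 shows "T f \<in> L2_chi l" "Plancherel.pair (untwist l f) F ==> Plancherel.pair (untwist l (T f)) (%\<beta>. cor (a \<beta>) * F \<beta>)"
 using assms by(auto simp:multiplier_def)

text \<open>One representative operator for a bounded symbol; any other differs from it by null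
  functions.\<close>

definition mult_op :: "real => ('m::finite DR => real) =>
  ('m cov => complex) => 'm cov => complex"
 where "mult_op l a f = twist l (SOME h. Plancherel.pair h (%\<beta>. cor (a \<beta>) * fourier_L2 (untwist l f) \<beta>))"

lemma chi_pair:
 "f \<in> L2_chi l ==> Plancherel.pair (untwist l f) (fourier_L2 (untwist l f))"
 by(rule pair_fourier_L2[OF untwist_sq_integrable])

lemma pair_AE_cong:
 assumes F: "Plancherel.pair f F" and G: "DR2 G" and ae: "AE \<beta> in DRm. F \<beta> = G \<beta>"
 shows "Plancherel.pair f G"
proof -
 have F2: "DR2 F" using Plancherel.pair_W[OF F] by simp
 have "ip_dist (L2_ip DRm) F G = 0" using L2_dist_zero_iff[OF F2 G] ae by simp
 from Plancherel.pair_cong[OF F _ _ Plancherel.V.dist_self this] show ?thesis using G Plancherel.pair_V[OF F] by simp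
qed

lemma pair_AE_unique:
 assumes F: "Plancherel.pair f F" and G: "Plancherel.pair f G"
 shows "AE \<beta> in DRm. F \<beta> = G \<beta>"
 using Plancherel.pair_unique[OF F G] Plancherel.pair_W[OF F] Plancherel.pair_W[OF G] by(simp add:L2_dist_zero_iff)

lemma mult_op_multiplier:
 assumes a: "bounded_symbol a" shows "multiplier l a (mult_op l a)"
 unfolding multiplier_def
proof (intro ballI conjI allI impI)
 fix f :: "'a cov => complex" assume f: "f \<in> L2_chi l"
 note P = chi_pair[OF f]
 have "DR2 (%\<beta>. cor (a \<beta>) * fourier_L2 (untwist l f) \<beta>)"
  using Plancherel.pair_W[OF P] by(intro bounded_symbol_mult a) simp
 hence "\<exists>h. Plancherel.pair h (%\<beta>. cor (a \<beta>) * fourier_L2 (untwist l f) \<beta>)"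
  by(intro Plancherel.pair_exists_inv) simp
 hence s: "Plancherel.pair (untwist l (mult_op l a f)) (%\<beta>. cor (a \<beta>) * fourier_L2 (untwist l f) \<beta>)"
  unfolding mult_op_def untwist_twist by(rule someI_ex)
 thus "mult_op l a f \<in> L2_chi l"
  unfolding mult_op_def untwist_twist by(intro twist_in_L2_chi) (use Plancherel.pair_V in blast)
 fix F assume F: "Plancherel.pair (untwist l f) F"
 have "DR2 (%\<beta>. cor (a \<beta>) * F \<beta>)"
  using Plancherel.pair_W[OF F] by(intro bounded_symbol_mult a) simp
 moreover have "AE \<beta> in DRm. cor (a \<beta>) * fourier_L2 (untwist l f) \<beta> = cor (a \<beta>) * F \<beta>"
  using pair_AE_unique[OF P F] by eventually_elim simp
 ultimately show "Plancherel.pair (untwist l (mult_op l a f)) (%\<beta>. cor (a \<beta>) * F \<beta>)"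
  by(rule pair_AE_cong[OF s])
qed

lemma chi_ip_pair: "Plancherel.pair (untwist l f) F ==> Plancherel.pair (untwist l g) G ==> chi_ip l f g = L2_ip DRm F G"
 unfolding chi_ip_def by(rule Plancherel.pair_ip)

lemma chi_dist_pair: "Plancherel.pair (untwist l f) F ==> Plancherel.pair (untwist l g) G ==>
 chi_d l f g = ip_dist (L2_ip DRm) F G"
 unfolding chi_dist by(rule Plancherel.pair_dist)

lemma multiplier_bounded:
 assumes T: "multiplier l a T" and a: "bounded_symbol a"
 shows "bounded_operator (L2_chi l :: ('m::finite cov => complex) set) (chi_ip l) (L2_chi l) (chi_ip l) T"
proof -
 obtain C where C: "a \<in> bmeas DRm" "0 <= C" "!!\<beta>. \<bar>a \<beta>\<bar> <= C" using bounded_symbolD[OF a] by blast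
 interpret C: ip_space "L2_chi l :: ('m cov => complex) set" "chi_ip l" by(rule ip_space_L2_chi)
 show ?thesis unfolding bounded_operator_def
 proof (intro conjI ballI allI exI[of _ C])
  fix f g :: "'m cov => complex" and c :: complex assume f: "f \<in> L2_chi l"
  define F where "F = fourier_L2 (untwist l f)"
  have F: "Plancherel.pair (untwist l f) F" unfolding F_def by(rule chi_pair[OF f])
  note TF = multiplierD(2)[OF T f F]
  show "T f \<in> L2_chi l" by(rule multiplierD(1)[OF T f])
  show "chi_d l (T (%x. f x + g x)) (%y. T f y + T g y) = 0" if g: "g \<in> L2_chi l"
  proof -
   define G where "G = fourier_L2 (untwist l g)"
   have G: "Plancherel.pair (untwist l g) G" unfolding G_def by(rule chi_pair[OF g])
   note TG = multiplierD(2)[OF T g G]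
   have "Plancherel.pair (untwist l (%x. f x + g x)) (%\<beta>. F \<beta> + G \<beta>)" unfolding untwist_add by(rule Plancherel.pair_add[OF F G])
   from multiplierD(2)[OF T C.add[OF f g] this]
   have 1: "Plancherel.pair (untwist l (T (%x. f x + g x))) (%\<beta>. cor (a \<beta>) * F \<beta> + cor (a \<beta>) * G \<beta>)"
    by(simp only:distrib_left)
   have 2: "Plancherel.pair (untwist l (%y. T f y + T g y)) (%\<beta>. cor (a \<beta>) * F \<beta> + cor (a \<beta>) * G \<beta>)"
    unfolding untwist_add by(rule Plancherel.pair_add[OF TF TG])
   show ?thesis unfolding chi_dist_pair[OF 1 2] by(rule Plancherel.W.dist_self)
  qed
  show "chi_d l (T (%x. c * f x)) (%y. c * T f y) = 0"
  proof -
   have "Plancherel.pair (untwist l (%x. c * f x)) (%\<beta>. c * F \<beta>)" unfolding untwist_scale by(rule Plancherel.pair_scale[OF F])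
   from multiplierD(2)[OF T C.scale[OF f] this]
   have 1: "Plancherel.pair (untwist l (T (%x. c * f x))) (%\<beta>. c * (cor (a \<beta>) * F \<beta>))"
    by(simp only:mult.left_commute)
   have 2: "Plancherel.pair (untwist l (%y. c * T f y)) (%\<beta>. c * (cor (a \<beta>) * F \<beta>))"
    unfolding untwist_scale by(rule Plancherel.pair_scale[OF TF])
   show ?thesis unfolding chi_dist_pair[OF 1 2] by(rule Plancherel.W.dist_self)
  qed
  have F2: "DR2 F" using Plancherel.pair_W[OF F] by simp
  have "ip_norm (L2_ip DRm) (%\<beta>. cor (a \<beta>) * F \<beta>) <= C * ip_norm (L2_ip DRm) F"
   using bounded_symbol_mult[OF a F2] by(intro L2_nrm_mono F2 C) (auto simp:sq_integrable_def norm_mult intro!:mult_right_mono C)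
  thus "ip_norm (chi_ip l) (T f) <= C * ip_norm (chi_ip l) f"
   unfolding chi_nrm Plancherel.pair_nrm[OF TF] Plancherel.pair_nrm[OF F] .
 qed
qed

lemma multiplier_dist:
 assumes T: "multiplier l a T" and T': "multiplier l a T'" and f: "f \<in> L2_chi l"
 shows "chi_d l (T f) (T' f) = 0"
 unfolding chi_dist_pair[OF multiplierD(2)[OF T f chi_pair[OF f]] multiplierD(2)[OF T' f chi_pair[OF f]]]
 by(rule Plancherel.W.dist_self)

lemma multiplier_cong:
 assumes T: "multiplier l a T" and V: "!!f. f \<in> L2_chi l ==> T' f \<in> L2_chi l"
  and d: "!!f. f \<in> L2_chi l ==> chi_d l (T f) (T' f) = 0"
 shows "multiplier l a T'"
 unfolding multiplier_def
proof (intro ballI conjI allI impI V)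
 fix f :: "'a cov => complex" and F assume f: "f \<in> L2_chi l" and F: "Plancherel.pair (untwist l f) F"
 note P = multiplierD(2)[OF T f F]
 from Plancherel.pair_cong[OF P _ _ d[OF f, unfolded chi_dist] Plancherel.W.dist_self]
 show "Plancherel.pair (untwist l (T' f)) (%\<beta>. cor (a \<beta>) * F \<beta>)"
  using untwist_sq_integrable[OF V[OF f]] Plancherel.pair_W[OF P] by simp
qed

lemma multiplier_comp:
 assumes T: "multiplier l a T" and S: "multiplier l b S"
 shows "multiplier l (%\<beta>. a \<beta> * b \<beta>) (%f. T (S f))"
 unfolding multiplier_def of_real_mult mult.assoc
 using multiplierD[OF T] multiplierD[OF S] by simp

lemma multiplier_lin:
 assumes T: "multiplier l a T" and S: "multiplier l b S"
 shows "multiplier l (%\<beta>. a \<beta> + c * b \<beta>) (%f (x :: 'm::finite cov). T f x + cor c * S f x)"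
 unfolding multiplier_def
proof (intro ballI conjI allI impI)
 interpret C: ip_space "L2_chi l :: ('m cov => complex) set" "chi_ip l" by(rule ip_space_L2_chi)
 fix f :: "'m cov => complex" and F assume f: "f \<in> L2_chi l"
 show "(%x. T f x + cor c * S f x) \<in> L2_chi l"
  by(intro C.add C.scale multiplierD(1)[OF T f] multiplierD(1)[OF S f])
 assume F: "Plancherel.pair (untwist l f) F"
 from Plancherel.pair_add[OF multiplierD(2)[OF T f F] Plancherel.pair_scale[OF multiplierD(2)[OF S f F], of "cor c"]]
 show "Plancherel.pair (untwist l (%x. T f x + cor c * S f x)) (%\<beta>. cor (a \<beta> + c * b \<beta>) * F \<beta>)"
  by(simp add:untwist_add untwist_scale distrib_right mult.assoc)
qed

section \<open>Symbols whose multipliers commute with a given operator\<close>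

context
 fixes l :: real and S :: "('m::finite cov => complex) => 'm cov => complex"
 assumes S: "bounded_operator (L2_chi l) (chi_ip l) (L2_chi l) (chi_ip l) S"
begin

text \<open>Quantified over all operators with symbol a, since these agree only up to null
  functions; by \<open>commutingI\<close> it is enough to check one of them.\<close>

definition commuting :: "('m DR => real) => bool"
 where "commuting a \<longleftrightarrow> bounded_symbol a \<and> (\<forall>T. multiplier l a T \<longrightarrow> (\<forall>f\<in>L2_chi l. chi_d l (S (T f)) (T (S f)) = 0))"

interpretation C: ip_space "L2_chi l :: ('m cov => complex) set" "chi_ip l" by(rule ip_space_L2_chi)

lemma S_in: "f \<in> L2_chi l ==> S f \<in> L2_chi l" using S by(simp add:bounded_operator_def)

lemma S_cong:
 assumes "f \<in> L2_chi l" "g \<in> L2_chi l" "chi_d l f g = 0"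
 shows "chi_d l (S f) (S g) = 0"
proof -
 obtain K where K: "!!f. f \<in> L2_chi l ==> ip_norm (chi_ip l) (S f) <= K * ip_norm (chi_ip l) f" using bounded_operatorD(4)[OF S] by blast
 have "chi_d l (S f) (S g) <= K * chi_d l f g"
  by(rule C.bounded_operator_dist[OF ip_space_L2_chi S K assms(1,2)])
 thus ?thesis using assms(3) C.dist_nonneg[OF S_in[OF assms(1)] S_in[OF assms(2)]] by simp
qed

lemma dist_zero_trans:
 assumes "f \<in> L2_chi l" "g \<in> L2_chi l" "h \<in> L2_chi l" "chi_d l f g = 0" "chi_d l g h = 0"
 shows "chi_d l f (h :: 'm cov => complex) = 0"
 using C.dist_triangle[OF assms(1,2,3)] C.dist_nonneg[OF assms(1,3)] assms(4,5) by simp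

lemma commutingI:
 assumes a: "bounded_symbol a" and T: "multiplier l a T"
  and c: "!!f. f \<in> L2_chi l ==> chi_d l (S (T f)) (T (S f)) = 0"
 shows "commuting a"
 unfolding commuting_def
proof (intro conjI a allI impI ballI)
 fix T' and f :: "'m cov => complex" assume T': "multiplier l a T'" and f: "f \<in> L2_chi l"
 note d = multiplierD(1)[OF T] and d' = multiplierD(1)[OF T']
 have 1: "chi_d l (S (T' f)) (S (T f)) = 0"
  by(rule S_cong[OF d'[OF f] d[OF f] multiplier_dist[OF T' T f]])
 have 2: "chi_d l (T (S f)) (T' (S f)) = 0" by(rule multiplier_dist[OF T T' S_in[OF f]])
 have 3: "chi_d l (S (T' f)) (T (S f)) = 0"
  by(rule dist_zero_trans[OF S_in[OF d'[OF f]] S_in[OF d[OF f]] d[OF S_in[OF f]] 1 c[OF f]])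
 show "chi_d l (S (T' f)) (T' (S f)) = 0"
  by(rule dist_zero_trans[OF S_in[OF d'[OF f]] d[OF S_in[OF f]] d'[OF S_in[OF f]] 3 2])
qed

lemma commutingD: "commuting a ==> multiplier l a T ==> f \<in> L2_chi l ==> chi_d l (S (T f)) (T (S f)) = 0"
 and commuting_symbol: "commuting a ==> bounded_symbol a"
 unfolding commuting_def by blast+

text \<open>S respects sums and scalars only up to null functions, so the identity is checked on
  inner products with an arbitrary w, where null differences disappear.\<close>

lemma commuting_lin:
 assumes a: "commuting a" and b: "commuting b"
 shows "commuting (%\<beta>. a \<beta> + c * b \<beta>)"
proof -
 let ?A = "mult_op l a" and ?B = "mult_op l b" and ?c = "cor c"
 note A = mult_op_multiplier[OF commuting_symbol[OF a], of l] and B = mult_op_multiplier[OF commuting_symbol[OF b], of l]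
 show ?thesis
 proof (rule commutingI[OF bounded_symbol_comb(1)[OF commuting_symbol[OF a] commuting_symbol[OF b]] multiplier_lin[OF A B]])
  fix f :: "'m cov => complex" assume f: "f \<in> L2_chi l"
  note Af = multiplierD(1)[OF A f] and Bf = multiplierD(1)[OF B f]
  note ASf = multiplierD(1)[OF A S_in[OF f]] and BSf = multiplierD(1)[OF B S_in[OF f]]
  note cB = C.scale[OF Bf, of ?c]
  have 1: "chi_d l (S (%x. ?A f x + ?c * ?B f x)) (%y. S (?A f) y + S (%x. ?c * ?B f x) y) = 0"
   by(rule bounded_operatorD(2)[OF S Af cB])
  have 2: "chi_d l (S (%x. ?c * ?B f x)) (%y. ?c * S (?B f) y) = 0"
   by(rule bounded_operatorD(3)[OF S Bf])
  have ipS: "chi_ip l (S (%x. ?A f x + ?c * ?B f x)) w = chi_ip l (%x. ?A (S f) x + ?c * ?B (S f) x) w" if w: "w \<in> L2_chi l" for w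
  proof -
   have "chi_ip l (S (%x. ?A f x + ?c * ?B f x)) w = chi_ip l (S (?A f)) w + chi_ip l (S (%x. ?c * ?B f x)) w"
    using C.dist_zero_ip[OF S_in[OF C.add[OF Af cB]] C.add[OF S_in[OF Af] S_in[OF cB]] w 1] C.ip_add[OF S_in[OF Af] S_in[OF cB] w] by simp
   also have "chi_ip l (S (%x. ?c * ?B f x)) w = ?c * chi_ip l (S (?B f)) w"
    using C.dist_zero_ip[OF S_in[OF cB] C.scale[OF S_in[OF Bf]] w 2] C.ip_scale[OF S_in[OF Bf] w] by simp
   also have "chi_ip l (S (?A f)) w = chi_ip l (?A (S f)) w"
    by(rule C.dist_zero_ip[OF S_in[OF Af] ASf w commutingD[OF a A f]])
   also have "chi_ip l (S (?B f)) w = chi_ip l (?B (S f)) w"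
    by(rule C.dist_zero_ip[OF S_in[OF Bf] BSf w commutingD[OF b B f]])
   finally show ?thesis using C.ip_add[OF ASf C.scale[OF BSf] w] C.ip_scale[OF BSf w] by simp
  qed
  let ?d = "%x. S (%x. ?A f x + ?c * ?B f x) x - (?A (S f) x + ?c * ?B (S f) x)"
  have SA: "S (%x. ?A f x + ?c * ?B f x) \<in> L2_chi l" by(rule S_in[OF C.add[OF Af cB]])
  have AS: "(%x. ?A (S f) x + ?c * ?B (S f) x) \<in> L2_chi l" by(rule C.add[OF ASf C.scale[OF BSf]])
  have "chi_ip l ?d ?d = 0" unfolding C.ip_diff[OF SA AS C.diff[OF SA AS]] ipS[OF C.diff[OF SA AS]] by simp
  thus "chi_d l (S (%x. ?A f x + ?c * ?B f x)) (%x. ?A (S f) x + ?c * ?B (S f) x) = 0"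
   by(simp add:ip_dist_def ip_norm_def)
 qed
qed

lemma commuting_mult:
 assumes a: "commuting a" and b: "commuting b"
 shows "commuting (%\<beta>. a \<beta> * b \<beta>)"
proof -
 let ?A = "mult_op l a" and ?B = "mult_op l b"
 note A = mult_op_multiplier[OF commuting_symbol[OF a], of l] and B = mult_op_multiplier[OF commuting_symbol[OF b], of l]
 show ?thesis
 proof (rule commutingI[OF bounded_symbol_comb(2)[OF commuting_symbol[OF a] commuting_symbol[OF b]] multiplier_comp[OF A B]])
  fix f :: "'m cov => complex" assume f: "f \<in> L2_chi l"
  note Bf = multiplierD(1)[OF B f] and BSf = multiplierD(1)[OF B S_in[OF f]]
  have 1: "chi_d l (S (?A (?B f))) (?A (S (?B f))) = 0" by(rule commutingD[OF a A Bf])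
  obtain K where K: "!!f. f \<in> L2_chi l ==> ip_norm (chi_ip l) (?A f) <= K * ip_norm (chi_ip l) f"
   using bounded_operatorD(4)[OF multiplier_bounded[OF A commuting_symbol[OF a]]] by blast
  have "chi_d l (?A (S (?B f))) (?A (?B (S f))) <= K * chi_d l (S (?B f)) (?B (S f))"
   by(rule C.bounded_operator_dist[OF ip_space_L2_chi multiplier_bounded[OF A commuting_symbol[OF a]] K S_in[OF Bf] BSf])
  hence 2: "chi_d l (?A (S (?B f))) (?A (?B (S f))) = 0"
   using commutingD[OF b B f] C.dist_nonneg[OF multiplierD(1)[OF A S_in[OF Bf]] multiplierD(1)[OF A BSf]] by simp
  show "chi_d l (S (?A (?B f))) (?A (?B (S f))) = 0"
   by(rule dist_zero_trans[OF S_in[OF multiplierD(1)[OF A Bf]] multiplierD(1)[OF A S_in[OF Bf]] multiplierD(1)[OF A BSf] 1 2])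
 qed
qed

text \<open>Dominated convergence on the dual: bounded pointwise convergence of symbols gives strong
  convergence of the operators. Pointwise convergence of the square root iteration is therefore
  enough.\<close>

lemma multiplier_tendsto:
 assumes T: "!!k::nat. multiplier l (a k) (T k)" and T': "multiplier l b T'" and b: "bounded_symbol b"
  and a: "!!k. bounded_symbol (a k)" and C: "!!k \<beta>. \<bar>a k \<beta>\<bar> <= C" and lim: "!!\<beta>. (%k. a k \<beta>) ----> b \<beta>" and f: "f \<in> L2_chi l"
 shows "(%k. chi_d l (T k f) (T' (f :: 'm cov => complex))) ----> 0"
proof -
 note P = chi_pair[OF f]
 let ?F = "fourier_L2 (untwist l f)"
 have F2: "DR2 ?F" using Plancherel.pair_W[OF P] by simp
 have Cb: "\<bar>b \<beta>\<bar> <= C" for \<beta>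
  by(rule tendsto_upperbound[OF tendsto_rabs[OF lim]]) (auto simp:C)
 have "(%k. ip_dist (L2_ip DRm) (%\<beta>. cor (a k \<beta>) * ?F \<beta>) (%\<beta>. cor (b \<beta>) * ?F \<beta>)) ----> 0"
 proof (rule L2_dominated_convergence[where u = "%\<beta>. cor (2 * C) * ?F \<beta>"])
  show "(%\<beta>. cor (a k \<beta>) * ?F \<beta>) \<in> bmeas DRm" for k
   using bounded_symbol_mult[OF a F2] by(simp add:sq_integrable_def)
  show "(%\<beta>. cor (b \<beta>) * ?F \<beta>) \<in> bmeas DRm"
   using bounded_symbol_mult[OF b F2] by(simp add:sq_integrable_def)
  show "DR2 (%\<beta>. cor (2 * C) * ?F \<beta>)" by(rule sq_integrable_scale[OF F2])
  show "AE \<beta> in DRm. cmod (cor (a k \<beta>) * ?F \<beta> - cor (b \<beta>) * ?F \<beta>) <= cmod (cor (2 * C) * ?F \<beta>)" for k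
  proof (rule AE_I2)
   fix \<beta> :: "'m DR"
   have "\<bar>a k \<beta> - b \<beta>\<bar> <= \<bar>2 * C\<bar>" using C[of k \<beta>] Cb[of \<beta>] by linarith
   hence "cmod (cor (a k \<beta> - b \<beta>)) * cmod (?F \<beta>) <= cmod (cor (2 * C)) * cmod (?F \<beta>)"
    unfolding norm_of_real by(rule mult_right_mono) simp
   thus "cmod (cor (a k \<beta>) * ?F \<beta> - cor (b \<beta>) * ?F \<beta>) <= cmod (cor (2 * C) * ?F \<beta>)"
    by(simp only:norm_mult[symmetric] of_real_diff left_diff_distrib)
  qed
  show "AE \<beta> in DRm. (%k. cor (a k \<beta>) * ?F \<beta>) ----> cor (b \<beta>) * ?F \<beta>"
   by(intro AE_I2 tendsto_mult tendsto_const tendsto_of_real lim)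
 qed
 thus ?thesis using chi_dist_pair[OF multiplierD(2)[OF T f P] multiplierD(2)[OF T' f P]] by simp
qed

lemma commuting_limit:
 assumes a: "!!k::nat. commuting (a k)" and b: "bounded_symbol b" and C: "!!k \<beta>. \<bar>a k \<beta>\<bar> <= C" and lim: "!!\<beta>. (%k. a k \<beta>) ----> b \<beta>"
 shows "commuting b"
proof (rule commutingI[OF b mult_op_multiplier[OF b]])
 fix f :: "'m cov => complex" assume f: "f \<in> L2_chi l"
 note A = mult_op_multiplier[OF commuting_symbol[OF a]] and B = mult_op_multiplier[OF b, of l]
 let ?A = "%k. mult_op l (a k)" and ?B = "mult_op l b"
 obtain K where K: "!!f. f \<in> L2_chi l ==> ip_norm (chi_ip l) (S f) <= K * ip_norm (chi_ip l) f" using bounded_operatorD(4)[OF S] by blast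
 have Af: "?A k f \<in> L2_chi l" and ASf: "?A k (S f) \<in> L2_chi l" for k using multiplierD(1)[OF A] f S_in[OF f] by auto
 have Bf: "?B f \<in> L2_chi l" and BSf: "?B (S f) \<in> L2_chi l" using multiplierD(1)[OF B] f S_in[OF f] by auto
 have le: "chi_d l (S (?B f)) (?B (S f)) <= K * chi_d l (?A k f) (?B f) + chi_d l (?A k (S f)) (?B (S f))" for k
 proof -
  have "chi_d l (S (?B f)) (?B (S f)) <= chi_d l (S (?B f)) (S (?A k f)) + chi_d l (S (?A k f)) (?B (S f))"
   by(rule C.dist_triangle[OF S_in[OF Bf] S_in[OF Af] BSf])
  moreover have "chi_d l (S (?A k f)) (?B (S f)) <= chi_d l (S (?A k f)) (?A k (S f)) + chi_d l (?A k (S f)) (?B (S f))"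
   by(rule C.dist_triangle[OF S_in[OF Af] ASf BSf])
  moreover have "chi_d l (S (?A k f)) (?A k (S f)) = 0" by(rule commutingD[OF a A f])
  moreover have "chi_d l (S (?B f)) (S (?A k f)) <= K * chi_d l (?A k f) (?B f)"
   using C.bounded_operator_dist[OF ip_space_L2_chi S K Af Bf, of k] C.dist_commute[OF S_in[OF Bf] S_in[OF Af], of k] by simp
  ultimately show ?thesis by linarith
 qed
 have "(%k. K * chi_d l (?A k f) (?B f) + chi_d l (?A k (S f)) (?B (S f))) ----> K * 0 + 0"
  by(intro tendsto_add tendsto_mult tendsto_const multiplier_tendsto[OF A B b commuting_symbol[OF a] C lim] f S_in)
 hence "chi_d l (S (?B f)) (?B (S f)) <= K * 0 + 0"
  by(rule tendsto_lowerbound) (auto simp:le)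
 thus "chi_d l (S (?B f)) (?B (S f)) = 0" using C.dist_nonneg[OF S_in[OF Bf] BSf] by simp
qed

text \<open>The iteration \<open>x \<mapsto> x + (a - x\<^sup>2) / 2\<close> increases from 0 to the square root of \<open>a \<in> [0, 1]\<close>.\<close>

lemma commuting_sqrt:
 assumes a: "commuting a" and a01: "!!\<beta>. 0 <= a \<beta>" "!!\<beta>. a \<beta> <= 1"
 shows "commuting (%\<beta>. sqrt (a \<beta>))"
proof -
 define x where "x = rec_nat (%\<beta> :: 'm DR. 0 :: real) (%_ y \<beta>. y \<beta> + (1 / 2) * (a \<beta> + (- 1) * (y \<beta> * y \<beta>)))"
 have x0: "x 0 = (%\<beta>. 0)" and xS: "x (Suc k) = (%\<beta>. x k \<beta> + (1 / 2) * (a \<beta> + (- 1) * (x k \<beta> * x k \<beta>)))" for k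
  by(simp_all add: x_def)
 have c0: "commuting (%\<beta>. 0)" using commuting_lin[OF a a, of "- 1"] by simp
 have cx: "commuting (x k)" for k
 proof (induction k)
  case 0 show ?case unfolding x0 by(rule c0)
 next
  case (Suc k) show ?case unfolding xS by(rule commuting_lin[OF Suc commuting_lin[OF a commuting_mult[OF Suc Suc]]])
 qed
 have bnd: "0 <= x k \<beta> \<and> x k \<beta> <= sqrt (a \<beta>)" for k \<beta>
 proof (induction k)
  case 0 show ?case using a01 by(simp add:x0)
 next
  case (Suc k)
  let ?y = "x k \<beta>"
  obtain s where s: "0 <= s" "s <= 1" "s * s = a \<beta>" and se: "sqrt (a \<beta>) = s"
  proof (rule that[of "sqrt (a \<beta>)"])
   show "0 <= sqrt (a \<beta>)" "sqrt (a \<beta>) <= 1" "sqrt (a \<beta>) * sqrt (a \<beta>) = a \<beta>" using a01[of \<beta>] by simp_all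
  qed simp
  have y: "0 <= ?y" "?y <= s" using Suc unfolding se by auto
  \<comment> \<open>One step multiplies the error s - x by 1 - (s + x) / 2, which is nonnegative
    since s and x are at most 1; so the iterates never overshoot.\<close>
  have "u - (v + (1 / 2) * (b + (- 1) * (v * v))) = (u - v) * (1 - (u + v) / 2)" if "u * u = b" for u v b :: real
   unfolding that[symmetric] by(simp add:field_simps)
  from this[OF s(3)] have e: "s - x (Suc k) \<beta> = (s - ?y) * (1 - (s + ?y) / 2)" unfolding xS .
  have "s + ?y <= 1 + 1" by(rule add_mono[OF s(2) order_trans[OF y(2) s(2)]])
  hence "0 <= 1 - (s + ?y) / 2" by simp
  moreover have "0 <= s - ?y" using y(2) by simp
  ultimately have "0 <= (s - ?y) * (1 - (s + ?y) / 2)" by(intro mult_nonneg_nonneg)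
  moreover have "?y * ?y <= a \<beta>" unfolding s(3)[symmetric] using y s(1) by(intro mult_mono)
  hence "0 <= x (Suc k) \<beta>" unfolding xS using y(1) by simp
  ultimately show ?case using e unfolding se by simp
 qed
 have inc: "x k \<beta> <= x (Suc k) \<beta>" for k \<beta>
 proof -
  have "x k \<beta> * x k \<beta> <= sqrt (a \<beta>) * sqrt (a \<beta>)" using bnd[of k \<beta>] a01(1)[of \<beta>] by(intro mult_mono) simp_all
  thus ?thesis unfolding xS using a01[of \<beta>] by simp
 qed
 have lim: "(%k. x k \<beta>) ----> sqrt (a \<beta>)" for \<beta>
 proof -
  have i: "incseq (%k. x k \<beta>)" by(rule incseq_SucI) (rule inc)
  have "\<forall>k. x k \<beta> <= sqrt (a \<beta>)" using bnd by simp
  from incseq_convergent[OF i this] obtain L where L: "(%k. x k \<beta>) ----> L" .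
  have "(%k. x (Suc k) \<beta>) ----> L + (1 / 2) * (a \<beta> + (- 1) * (L * L))" unfolding xS by(intro tendsto_intros L)
  moreover have "(%k. x (Suc k) \<beta>) ----> L" by(rule LIMSEQ_Suc[OF L])
  ultimately have "L + (1 / 2) * (a \<beta> + (- 1) * (L * L)) = L" by(rule LIMSEQ_unique)
  hence "a \<beta> = L * L" by simp
  moreover have "0 <= L" by(rule tendsto_lowerbound[OF L]) (auto simp:bnd)
  ultimately show ?thesis using L by simp
 qed
 have s1: "\<bar>sqrt (a \<beta>)\<bar> <= 1" for \<beta> using a01[of \<beta>] by simp
 have "bounded_symbol (%\<beta>. sqrt (a \<beta>))"
 proof -
  have [measurable]: "a \<in> bmeas DRm" using commuting_symbol[OF a] by(simp add:bounded_symbol_def)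
  show ?thesis unfolding bounded_symbol_def by(intro conjI exI[of _ 1] allI s1) measurable
 qed
 moreover have "\<bar>x k \<beta>\<bar> <= 1" for k \<beta> using bnd[of k \<beta>] s1[of \<beta>] by linarith
 ultimately show ?thesis by(rule commuting_limit[OF cx _ _ lim])
qed

end

text \<open>On the dual, self-adjointness is reality of the symbol and positivity is its
  sign.\<close>

lemma multiplier_positive_sqrt:
 assumes T: "multiplier l a T" and a: "bounded_symbol a" "!!\<beta>. 0 <= a \<beta>" and A: "multiplier l (%\<beta>. a \<beta> * a \<beta>) A"
 shows "is_positive_sqrt (L2_chi l :: ('m::finite cov => complex) set) (chi_ip l) A T"
 unfolding is_positive_sqrt_def
proof (intro conjI ballI multiplier_bounded[OF T a(1)] multiplier_dist[OF multiplier_comp[OF T T] A])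
 fix f g :: "'m cov => complex" assume f: "f \<in> L2_chi l"
 note P = chi_pair[OF f]
 show "chi_ip l (T f) g = chi_ip l f (T g)" if g: "g \<in> L2_chi l"
  unfolding chi_ip_pair[OF multiplierD(2)[OF T f P] chi_pair[OF g]] chi_ip_pair[OF P multiplierD(2)[OF T g chi_pair[OF g]]] L2_ip_def
  by(simp add:mult_ac)
 have "chi_ip l (T f) f = (LINT \<beta>|DRm. cor (a \<beta> * (cmod (fourier_L2 (untwist l f) \<beta>))^2))"
  unfolding chi_ip_pair[OF multiplierD(2)[OF T f P] P] L2_ip_def
  by(simp only:mult.assoc complex_norm_square[symmetric] of_real_mult)
 also have "... = cor (LINT \<beta>|DRm. a \<beta> * (cmod (fourier_L2 (untwist l f) \<beta>))^2)" by(rule integral_complex_of_real)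
 finally show "0 <= Re (chi_ip l (T f) f)" by(simp add:a(2) Bochner_Integration.integral_nonneg)
qed

section \<open>Positive square roots and the closure of the range\<close>

context quasi_parabolic
begin

definition sym :: "'m DR => real" where "sym \<beta> = sqrt (2 * pi) * Phi l \<beta>"

lemma sym_nonneg: "0 <= sym \<beta>" unfolding sym_def using Phi_nonneg[OF l0, of \<beta>] by simp

lemma sym_zero_iff: "sym \<beta> = 0 \<longleftrightarrow> fourier (phi l) \<beta> = 0" unfolding sym_def fourier_phi[OF l1] by simp

lemma sym_bounded: "bounded_symbol sym"
proof -
 have [measurable]: "(Phi l :: 'm DR => real) \<in> bmeas DRm" by(rule Phi_measurable)
 have "\<bar>sym \<beta>\<bar> <= phi_nrm TYPE('m) l" for \<beta> using Phi_le[OF l1, of \<beta>] sym_nonneg[of \<beta>] by(simp add:sym_def)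
 thus ?thesis unfolding bounded_symbol_def sym_def[abs_def] by(intro conjI exI allI) measurable
qed

lemma sqrt_sym_bounded: "bounded_symbol (%\<beta>. sqrt (sym \<beta>))"
proof -
 obtain C where C: "sym \<in> bmeas DRm" "0 <= C" "!!\<beta>. \<bar>sym \<beta>\<bar> <= C" using bounded_symbolD[OF sym_bounded] by blast
 have "\<bar>sqrt (sym \<beta>)\<bar> <= sqrt C" for \<beta> using C(3)[of \<beta>] sym_nonneg[of \<beta>] by simp
 moreover have [measurable]: "sym \<in> bmeas DRm" by(rule C(1))
 have "(%\<beta>. sqrt (sym \<beta>)) \<in> bmeas DRm" by measurable
 ultimately show ?thesis unfolding bounded_symbol_def by(intro conjI exI[of _ "sqrt C"] allI)
qed

lemma RR_adj_multiplier: "multiplier l sym (RR_adj l)"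
 unfolding multiplier_def sym_def[abs_def] using RR_adj_in RR_adj_pair by blast

lemma RR_adj_bounded: "bounded_operator (L2_chi l :: ('m cov => complex) set) (chi_ip l) (L2_chi l) (chi_ip l) (RR_adj l)"
 by(rule multiplier_bounded[OF RR_adj_multiplier sym_bounded])

lemma sqrt_exists: "is_positive_sqrt (L2_chi l :: ('m cov => complex) set) (chi_ip l) (RR_adj l) (mult_op l (%\<beta>. sqrt (sym \<beta>)))"
 by(rule multiplier_positive_sqrt[OF mult_op_multiplier[OF sqrt_sym_bounded] sqrt_sym_bounded])
  (simp_all add: sym_nonneg RR_adj_multiplier)

text \<open>The root S is given only abstractly, so its symbol is found by comparison: S commutes
  with the explicit root \<open>mult_op l (%\<beta>. sqrt (sym \<beta>))\<close>, and commuting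
  positive roots agree up to null functions.\<close>

lemma sqrt_multiplier:
 assumes S: "is_positive_sqrt (L2_chi l :: ('m cov => complex) set) (chi_ip l) (RR_adj l) S"
 shows "multiplier l (%\<beta>. sqrt (sym \<beta>)) S"
proof -
 interpret C: ip_space "L2_chi l :: ('m cov => complex) set" "chi_ip l" by(rule ip_space_L2_chi)
 have Sb: "bounded_operator (L2_chi l) (chi_ip l) (L2_chi l) (chi_ip l) S" using S by(simp add:is_positive_sqrt_def)
 note S_in = S_in[OF Sb] and A_in = RR_adj_in
 note com = commutingI[OF Sb] commuting_lin[OF Sb] commuting_sqrt[OF Sb]
 \<comment> \<open>Up to null functions both sides are S applied three times.\<close>
 have SA: "chi_d l (S (RR_adj l f)) (RR_adj l (S f)) = 0" if f: "f \<in> L2_chi l" for f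
 proof -
  have d: "chi_d l (S (S f)) (RR_adj l f) = 0" if "f \<in> L2_chi l" for f using S that by(simp add:is_positive_sqrt_def)
  have "chi_d l (RR_adj l f) (S (S f)) = 0" using d[OF f] C.dist_commute[OF A_in[OF f] S_in[OF S_in[OF f]]] by simp
  hence "chi_d l (S (RR_adj l f)) (S (S (S f))) = 0"
   by(rule S_cong[OF Sb A_in[OF f] S_in[OF S_in[OF f]]])
  from dist_zero_trans[OF Sb S_in[OF A_in[OF f]] S_in[OF S_in[OF S_in[OF f]]] A_in[OF S_in[OF f]] this d[OF S_in[OF f]]]
  show ?thesis .
 qed
 define C where "C = phi_nrm TYPE('m) l"
 have C: "0 <= C" unfolding C_def by(rule phi_nrm_nonneg)
 \<comment> \<open>The square root iteration works for symbols in [0, 1]; the scalar is removed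
   again by 1 / sqrt k.\<close>
 define k where "k = 1 / (C + 1)"
 have k: "0 < k" using C by(simp add:k_def)
 have csym: "commuting l S sym" by(rule com(1)[OF sym_bounded RR_adj_multiplier SA])
 have czero: "commuting l S (%\<beta>. 0)" using com(2)[OF csym csym, of "- 1"] by simp
 have ck: "commuting l S (%\<beta>. k * sym \<beta>)" using com(2)[OF czero csym, of k] by simp
 have "commuting l S (%\<beta>. sqrt (k * sym \<beta>))"
 proof (rule com(3)[OF ck])
  fix \<beta> :: "'m DR"
  show "0 <= k * sym \<beta>" using k sym_nonneg[of \<beta>] by simp
  have "sym \<beta> <= C + 1" using Phi_le[OF l1, of \<beta>] by(simp add:C_def sym_def)
  thus "k * sym \<beta> <= 1" using C by(simp add:k_def divide_le_eq)
 qed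
 from com(2)[OF czero this, of "1 / sqrt k"] have cs: "commuting l S (%\<beta>. sqrt (sym \<beta>))"
  using k by(simp add:real_sqrt_mult)
 let ?S0 = "mult_op l (%\<beta>. sqrt (sym \<beta>))"
 note M = mult_op_multiplier[OF sqrt_sym_bounded, of l]
 show ?thesis
 proof (rule multiplier_cong[OF M S_in])
  fix f :: "'m cov => complex" assume f: "f \<in> L2_chi l"
  show "chi_d l (?S0 f) (S f) = 0"
  proof (rule C.positive_sqrt_unique[OF sqrt_exists S A_in _ f])
   fix g :: "'m cov => complex" assume g: "g \<in> L2_chi l"
   show "chi_d l (?S0 (S g)) (S (?S0 g)) = 0"
    using commutingD[OF Sb cs M g] C.dist_commute[OF multiplierD(1)[OF M S_in[OF g]] S_in[OF multiplierD(1)[OF M g]]] by simp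
  qed
 qed
qed

text \<open>The closure depends on the symbol only through its zero set, so one statement serves for
  R R^* and for its square roots.\<close>

lemma closure_range:
 assumes T: "multiplier l a T" and a: "bounded_symbol a" and a0: "!!\<beta>. 0 <= a \<beta>" and az: "!!\<beta>. a \<beta> = 0 \<longleftrightarrow> fourier (phi l) \<beta> = 0"
 shows "closure_of_range (L2_chi l) (chi_ip l) T = (B_space l :: ('m cov => complex) set)"
proof (intro equalityI subsetI)
 have [measurable]: "a \<in> bmeas DRm" using a by(simp add:bounded_symbol_def)
 fix f :: "'m cov => complex"
 let ?F = "fourier_L2 (untwist l f)"
 {
  assume "f \<in> closure_of_range (L2_chi l) (chi_ip l) T"
  hence f: "f \<in> L2_chi l" and app: "!!e. 0 < e ==> \<exists>g\<in>L2_chi l. chi_d l f (T g) < e"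
   by(auto simp:closure_of_range_def)
  note P = chi_pair[OF f]
  have F2: "DR2 ?F" using Plancherel.pair_W[OF P] by simp
  hence [measurable]: "?F \<in> bmeas DRm" by(simp add:sq_integrable_def)
  \<comment> \<open>The part of the transform where the symbol vanishes: no element of the range
    reaches it, so its norm is at most the distance of f to the range.\<close>
  define Z where "Z \<beta> = (if a \<beta> = 0 then ?F \<beta> else 0)" for \<beta>
  have Zm: "Z \<in> bmeas DRm" unfolding Z_def[abs_def] by measurable
  have Z2: "DR2 Z" by(rule sq_integrable_bound[OF F2 Zm, of 1]) (simp add:Z_def)
  have "ip_norm (L2_ip DRm) Z <= e" if e: "0 < e" for e
  proof -
   obtain g where g: "g \<in> L2_chi l" "chi_d l f (T g) < e" using app[OF e] by blast
   note Q = multiplierD(2)[OF T g(1) chi_pair[OF g(1)]]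
   let ?D = "%\<beta>. ?F \<beta> - cor (a \<beta>) * fourier_L2 (untwist l g) \<beta>"
   have "DR2 ?D" using Plancherel.pair_W[OF Plancherel.pair_diff[OF P Q]] by simp
   hence "ip_norm (L2_ip DRm) Z <= 1 * ip_norm (L2_ip DRm) ?D"
    by(rule L2_nrm_mono[OF _ Zm]) (auto simp:Z_def)
   also have "... = chi_d l f (T g)" unfolding chi_dist_pair[OF P Q] by(simp add:ip_dist_def)
   finally show ?thesis using g(2) by simp
  qed
  hence "ip_norm (L2_ip DRm) Z <= 0" by(rule field_le_epsilon[of _ 0, simplified])
  hence "ip_norm (L2_ip DRm) Z = 0" by(rule antisym) (simp add:L2_nrm)
  hence "AE \<beta> in DRm. Z \<beta> = 0" using L2_nrm_zero_iff[OF Z2] by simp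
  hence "AE \<beta> in DRm. fourier (phi l :: 'm TR => complex) \<beta> = 0 \<longrightarrow> ?F \<beta> = 0"
   by eventually_elim (auto simp:Z_def az)
  thus "f \<in> B_space l" using f by(simp add:B_space_def)
 next
  assume "f \<in> B_space l"
  hence f: "f \<in> L2_chi l" and van: "AE \<beta> in DRm. fourier (phi l :: 'm TR => complex) \<beta> = 0 \<longrightarrow> ?F \<beta> = 0"
   by(auto simp:B_space_def)
  note P = chi_pair[OF f]
  have F2: "DR2 ?F" using Plancherel.pair_W[OF P] by simp
  hence [measurable]: "?F \<in> bmeas DRm" by(simp add:sq_integrable_def)
  \<comment> \<open>Division by the symbol is safe where it exceeds 1 / (N + 1); \<open>G N\<close>
    is the transform of the preimage and \<open>H N\<close> that of its image.\<close>
  define H where "H N \<beta> = (if 1 / real (Suc N) < a \<beta> then ?F \<beta> else 0)" for N \<beta>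
  define G where "G N \<beta> = (if 1 / real (Suc N) < a \<beta> then ?F \<beta> / cor (a \<beta>) else 0)" for N \<beta>
  have Hm: "H N \<in> bmeas DRm" and Gm: "G N \<in> bmeas DRm" for N
   unfolding H_def[abs_def] G_def[abs_def] by measurable
  have G2: "DR2 (G N)" for N
  proof (rule sq_integrable_bound[OF F2 Gm, of _ "real (Suc N)"], rule AE_I2)
   fix \<beta> :: "'m DR"
   show "cmod (G N \<beta>) <= real (Suc N) * cmod (?F \<beta>)"
   proof (cases "1 / real (Suc N) < a \<beta>")
    case True
    hence "1 <= a \<beta> * real (Suc N)" by(simp add:divide_less_eq)
    hence "inverse (a \<beta>) <= real (Suc N)" using True a0[of \<beta>] by(cases "a \<beta> = 0") (auto simp:field_simps)
    from mult_right_mono[OF this norm_ge_zero[of "?F \<beta>"]] show ?thesis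
     using True a0[of \<beta>] by(simp add:G_def norm_mult norm_inverse divide_inverse mult.commute)
   qed (simp add:G_def)
  qed
  have aG: "cor (a \<beta>) * G N \<beta> = H N \<beta>" for N \<beta>
  proof (cases "1 / real (Suc N) < a \<beta>")
   case True
   moreover have "0 < 1 / real (Suc N)" by simp
   ultimately have "a \<beta> ~= 0" by linarith
   thus ?thesis using True by(simp add:G_def H_def)
  qed (simp add:G_def H_def)
  have lim: "(%N. ip_dist (L2_ip DRm) (H N) ?F) ----> 0"
  proof (rule L2_dominated_convergence[OF Hm _ F2])
   show "AE \<beta> in DRm. cmod (H N \<beta> - ?F \<beta>) <= cmod (?F \<beta>)" for N by(rule AE_I2) (simp add:H_def)
   show "AE \<beta> in DRm. (%N. H N \<beta>) ----> ?F \<beta>" using van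
   proof eventually_elim
    case (elim \<beta>)
    show ?case
    proof (cases "a \<beta> = 0")
     case True
     hence "?F \<beta> = 0" using elim az by simp
     hence "H N \<beta> = ?F \<beta>" for N by(simp add:H_def)
     thus ?thesis by simp
    next
     case False
     hence "0 < a \<beta>" using a0[of \<beta>] by simp
     then obtain N0 where N0: "inverse (real (Suc N0)) < a \<beta>" using reals_Archimedean by blast
     show ?thesis
     proof (rule tendsto_eventually, rule eventually_mono[OF eventually_ge_at_top[of N0]])
      fix N assume "N0 <= N"
      hence "1 / real (Suc N) <= 1 / real (Suc N0)" by(intro divide_left_mono) auto
      thus "H N \<beta> = ?F \<beta>" using N0 by(simp add:H_def inverse_eq_divide)
     qed
    qed
   qed
  qed measurable
  show "f \<in> closure_of_range (L2_chi l) (chi_ip l) T"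
   unfolding closure_of_range_def
  proof (intro CollectI conjI f allI impI)
   fix e :: real assume e: "0 < e"
   obtain N where N: "ip_dist (L2_ip DRm) (H N) ?F < e"
    using order_tendstoD(2)[OF lim e] by(auto simp:eventually_sequentially)
   obtain h where h: "Plancherel.pair h (G N)" using Plancherel.pair_exists_inv[of "G N"] G2 by auto
   let ?g = "twist l h"
   have g: "?g \<in> L2_chi l" using Plancherel.pair_V[OF h] by(intro twist_in_L2_chi) simp
   have Q: "Plancherel.pair (untwist l (T ?g)) (H N)"
    using multiplierD(2)[OF T g, of "G N"] h by(simp add:aG)
   have "chi_d l f (T ?g) = ip_dist (L2_ip DRm) ?F (H N)" by(rule chi_dist_pair[OF P Q])
   also have "... = ip_dist (L2_ip DRm) (H N) ?F"
    by(rule Plancherel.W.dist_commute[OF Plancherel.pair_W[OF P] Plancherel.pair_W[OF Q]])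
   finally have "chi_d l f (T ?g) < e" using N by simp
   thus "\<exists>g\<in>L2_chi l. chi_d l f (T g) < e" by(rule bexI[OF _ g])
  qed
 }
qed

end

section \<open>Schwartz functions\<close>

lemma TR_continuous_measurable:
 fixes f :: "'m::finite TR => complex"
 assumes f: "continuous_on (torus \<times> UNIV) f"
 shows "f \<in> bmeas TRm"
proof -
 have "(%p. p) \<in> measurable TRm (borel :: 'm TR measure)" by(rule measurable_TR) simp
 hence "(%p. p) \<in> measurable TRm (restrict_space borel ((torus :: (complex^'m) set) \<times> UNIV))"
  by(intro measurable_restrict_space2) auto
 from measurable_compose[OF this borel_measurable_continuous_on_restrict[OF f]] show ?thesis by simp
qed

lemma TR_partials_Nil [simp]: "TR_partials [] f = f"
 and TR_partials_Cons: "TR_partials (d # ds) f = TR_partial d (TR_partials ds f)"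
 by(simp_all add: TR_partials_def)

lemma schwartz_bdd:
 assumes "f \<in> schwartz_space"
 shows "\<exists>B. \<forall>p\<in>torus \<times> UNIV. \<bar>snd p\<bar> ^ k * cmod (TR_partials ds f p) <= B"
proof -
 have "bounded ((%p. cor (snd p) ^ k * TR_partials ds f p) ` (torus \<times> UNIV))"
  using assms by(simp add:schwartz_space_def)
 then obtain B where B: "\<forall>x\<in>(%p. cor (snd p) ^ k * TR_partials ds f p) ` (torus \<times> UNIV). cmod x <= B"
  unfolding bounded_iff by blast
 have "\<bar>snd p\<bar> ^ k * cmod (TR_partials ds f p) <= B" if "p \<in> torus \<times> UNIV" for p
  using bspec[OF B imageI[OF that]] by(simp add:norm_mult norm_power)
 thus ?thesis by blast
qed

lemma schwartz_seminorm_upper: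
 assumes f: "f \<in> schwartz_space" and p: "p \<in> torus \<times> UNIV"
 shows "\<bar>snd p\<bar> ^ k * cmod (TR_partials ds f p) <= schwartz_seminorm (k, ds) f"
proof -
 obtain B where B: "\<forall>p\<in>torus \<times> UNIV. \<bar>snd p\<bar> ^ k * cmod (TR_partials ds f p) <= B" using schwartz_bdd[OF f] by blast
 have "bdd_above ((%p. \<bar>snd p\<bar> ^ k * cmod (TR_partials ds f p)) ` (torus \<times> UNIV))"
  by(rule bdd_aboveI2[where M = B]) (rule bspec[OF B])
 from cSUP_upper[OF p this] show ?thesis by(simp add:schwartz_seminorm_def)
qed

text \<open>This is |cayley|^(-2). It lies in L^1 and L^2, and with the seminorms of weights 1 and
  y^2 as coefficient it dominates every test function.\<close>

definition decay :: "'m::finite TR => real"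
 where "decay p = (1 + (snd p)^2 / 4) powr (- 1)"

lemma decay_eq: "decay p = 1 / (1 + (snd p)^2 / 4)"
proof -
 have "0 < 1 + (snd p)^2 / 4" by(rule add_pos_nonneg) simp_all
 thus ?thesis unfolding decay_def powr_minus_divide by simp
qed

lemma decay_integrable: "integrable TRm (%p. cor (decay p))"
 unfolding decay_def by(intro integrable_of_real TR_integrable_snd cayley_powr_integrable) simp

lemma decay_sq: "TR2 (%p. cor (decay p))"
proof (rule sq_integrable_bounded[OF decay_integrable, of 1])
 fix p :: "'a TR"
 have "0 < 1 + (snd p)^2 / 4" by(rule add_pos_nonneg) simp_all
 hence "decay p <= 1" unfolding decay_eq by(simp add:pos_divide_le_eq)
 moreover have "0 <= decay p" by(simp add:decay_def)
 ultimately show "cmod (cor (decay p)) <= 1" by simp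
qed

definition schwartz_const :: "('m::finite TR => complex) => real"
 where "schwartz_const f = schwartz_seminorm (0, []) f + schwartz_seminorm (2, []) f"

lemma schwartz_le:
 assumes f: "f \<in> schwartz_space" and p: "p \<in> torus \<times> UNIV"
 shows "cmod (f p) <= schwartz_const f * decay p"
proof -
 let ?y = "(snd p)^2"
 have a: "cmod (f p) <= schwartz_seminorm (0, []) f" using schwartz_seminorm_upper[OF f p, of 0 "[]"] by simp
 have b: "?y * cmod (f p) <= schwartz_seminorm (2, []) f" using schwartz_seminorm_upper[OF f p, of 2 "[]"] by simp
 have "0 <= ?y * cmod (f p)" by simp
 hence "cmod (f p) + ?y * cmod (f p) / 4 <= schwartz_const f" unfolding schwartz_const_def using a b by linarith
 hence c: "cmod (f p) * (1 + ?y / 4) <= schwartz_const f" by(simp add:algebra_simps)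
 have "0 < 1 + ?y / 4" by(rule add_pos_nonneg) simp_all
 thus ?thesis unfolding decay_eq using c by(simp add:pos_le_divide_eq)
qed

lemma schwartz_continuous: "f \<in> schwartz_space ==> continuous_on (torus \<times> UNIV) f"
proof -
 assume "f \<in> schwartz_space"
 hence "TR_smooth f" by(simp add:schwartz_space_def)
 from this[unfolded TR_smooth_def, THEN spec, of "[]", THEN conjunct1] show "continuous_on (torus \<times> UNIV) f" by simp
qed

lemma schwartz_integrable:
 fixes f :: "'m::finite TR => complex"
 assumes f: "f \<in> schwartz_space"
 shows "integrable TRm f" and "TR2 f" and "TR_nrm f <= schwartz_const f * TR_nrm (%p :: 'm TR. cor (decay p))"
proof -
 have m: "f \<in> bmeas TRm" by(rule TR_continuous_measurable[OF schwartz_continuous[OF f]])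
 have le: "cmod (f p) <= schwartz_const f * decay p" if "p \<in> space TRm" for p
  using that schwartz_le[OF f, of p] by simp
 have d: "0 <= decay p" for p :: "'m TR" by(simp add:decay_def)
 have "((\<chi> i. 1) :: complex^'m, 0::real) \<in> torus \<times> UNIV" by(auto simp:torus_def)
 from order_trans[OF norm_ge_zero schwartz_le[OF f this]] have C0: "0 <= schwartz_const f" by(simp add:decay_def)
 show "integrable TRm f"
 proof (rule LINT_bound[OF _ m])
  show "integrable TRm (%p. cor (schwartz_const f) * cor (decay p))"
   by(rule integrable_mult_right[OF decay_integrable])
  show "AE p in TRm. norm (f p) <= norm (cor (schwartz_const f) * cor (decay p))"
   by(rule AE_I2, drule le) (simp add:norm_mult C0 d)
 qed
 show f2: "TR2 f"
  by(rule sq_integrable_bound[OF decay_sq m, of "schwartz_const f"], rule AE_I2, drule le) (simp add:d)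
 have "(LINT p|TRm. (cmod (f p))^2) <= (LINT p|(TRm :: 'm TR measure). (schwartz_const f)^2 * (cmod (cor (decay p)))^2)"
 proof (rule integral_mono)
  show "integrable TRm (%p. (cmod (f p))^2)" using f2 by(simp add:sq_integrable_def)
  show "integrable TRm (%p :: 'm TR. (schwartz_const f)^2 * (cmod (cor (decay p)))^2)"
   by(intro integrable_mult_right conjunct2[OF decay_sq[unfolded sq_integrable_def]])
  fix p :: "'m TR" assume "p \<in> space TRm"
  from power_mono[OF le[OF this] norm_ge_zero, of 2]
  show "(cmod (f p))^2 <= (schwartz_const f)^2 * (cmod (cor (decay p)))^2"
   by(simp add:power_mult_distrib)
 qed
 hence "TR_nrm f <= sqrt ((schwartz_const f)^2 * (LINT p|(TRm :: 'm TR measure). (cmod (cor (decay p)))^2))"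
  unfolding L2_nrm by(simp only:integral_mult_right_zero real_sqrt_le_mono)
 thus "TR_nrm f <= schwartz_const f * TR_nrm (%p :: 'm TR. cor (decay p))"
  unfolding L2_nrm real_sqrt_mult using C0 by simp
qed

section \<open>Translations of test functions\<close>

lemma TR_flow_mult: "TR_mult (TR_flow d s q) p = TR_flow d s (TR_mult q p)"
 by(cases d; cases q) (auto simp:TR_mult_def vec_eq_iff)

text \<open>The flows commute with translations, so derivatives of a translate are translates of
  derivatives.\<close>

lemma TR_partials_translate: "TR_partials ds (%q. f (TR_mult q p)) = (%q. TR_partials ds f (TR_mult q p))"
proof (induction ds)
 case (Cons d ds)
 show ?case unfolding TR_partials_Cons Cons TR_partial_def TR_flow_mult ..
qed simp

lemma TR_mult_in:
 fixes p q :: "'m::finite TR"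
 assumes "q \<in> torus \<times> UNIV" "p \<in> torus \<times> UNIV" shows "TR_mult q p \<in> torus \<times> UNIV"
 using assms by(auto simp:TR_mult_def torus_def norm_mult)

lemma continuous_translate:
 fixes p :: "'m::finite TR"
 assumes f: "continuous_on (torus \<times> UNIV) f" and p: "p \<in> torus \<times> UNIV"
 shows "continuous_on (torus \<times> UNIV) (%q. f (TR_mult q p))"
proof (rule continuous_on_compose2[OF f])
 show "continuous_on (torus \<times> UNIV) (%q :: 'm TR. TR_mult q p)"
  unfolding TR_mult_def by(intro continuous_intros)
 show "(%q. TR_mult q p) ` (torus \<times> UNIV) \<subseteq> torus \<times> UNIV" by(rule image_subsetI) (rule TR_mult_in[OF _ p])
qed

lemma schwartz_translate:
 fixes p :: "'m::finite TR"
 assumes f: "f \<in> schwartz_space" and p: "p \<in> torus \<times> UNIV"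
 shows "(%q. f (TR_mult q p)) \<in> schwartz_space"
 unfolding schwartz_space_def mem_Collect_eq TR_smooth_def TR_partials_translate TR_flow_mult
proof (intro CollectI conjI allI ballI)
 fix ds d k and q :: "'m TR"
 have sm: "TR_smooth f" using f by(simp add:schwartz_space_def)
 show "continuous_on (torus \<times> UNIV) (%q. TR_partials ds f (TR_mult q p))"
  using sm by(intro continuous_translate p) (simp add:TR_smooth_def)
 show "(%s. TR_partials ds f (TR_flow d s (TR_mult q p))) differentiable at 0" if "q \<in> torus \<times> UNIV"
  by(rule sm[unfolded TR_smooth_def, THEN spec, of ds, THEN conjunct2, THEN spec, of d, THEN bspec, OF TR_mult_in[OF that p]])
 obtain B0 where B0: "\<forall>q\<in>torus \<times> UNIV. \<bar>snd q\<bar> ^ 0 * cmod (TR_partials ds f q) <= B0" using schwartz_bdd[OF f] by blast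
 obtain Bk where Bk: "\<forall>q\<in>torus \<times> UNIV. \<bar>snd q\<bar> ^ k * cmod (TR_partials ds f q) <= Bk" using schwartz_bdd[OF f] by blast
 let ?y = "\<bar>snd p\<bar>"
 show "bounded ((%q. cor (snd q) ^ k * TR_partials ds f (TR_mult q p)) ` (torus \<times> UNIV))"
  unfolding bounded_iff
 proof (intro exI[of _ "2 ^ k * (Bk + ?y ^ k * B0)"] ballI, elim imageE)
  fix x and q :: "'m TR"
  assume x: "x = cor (snd q) ^ k * TR_partials ds f (TR_mult q p)" and q: "q \<in> torus \<times> UNIV"
  let ?q = "TR_mult q p"
  let ?G = "cmod (TR_partials ds f ?q)" and ?z = "\<bar>snd ?q\<bar>"
  have "snd q = snd ?q - snd p" by(simp add:TR_mult_def)
  \<comment> \<open>The weight in q is split between the weight at the translated point and the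
    constant |snd p|, at the cost of 2^k.\<close>
  hence "\<bar>snd q\<bar> <= 2 * max ?z ?y" by linarith
  hence "\<bar>snd q\<bar> ^ k <= (2 * max ?z ?y) ^ k" by(rule power_mono) simp
  also have "... <= 2 ^ k * (?z ^ k + ?y ^ k)" by(simp add:power_mult_distrib max_def)
  finally have "\<bar>snd q\<bar> ^ k * ?G <= 2 ^ k * (?z ^ k + ?y ^ k) * ?G" by(rule mult_right_mono) simp
  also have "... = 2 ^ k * (?z ^ k * ?G + ?y ^ k * ?G)" by(simp add:algebra_simps)
  also have "... <= 2 ^ k * (Bk + ?y ^ k * B0)"
  proof (rule mult_left_mono[OF add_mono])
   show "?z ^ k * ?G <= Bk" by(rule bspec[OF Bk TR_mult_in[OF q p]])
   have "?G <= B0" using bspec[OF B0 TR_mult_in[OF q p]] by simp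
   thus "?y ^ k * ?G <= ?y ^ k * B0" by(rule mult_left_mono) simp
  qed simp
  finally show "cmod x <= 2 ^ k * (Bk + ?y ^ k * B0)" by(simp add:x norm_mult norm_power)
 qed
qed

section \<open>Gaussian packets as test functions\<close>

lemma continuous_on_chr: "continuous_on torus (chr \<alpha>)"
 unfolding chr_def by(intro continuous_intros) (auto simp:torus_nz)

lemma continuous_on_echar: "continuous_on (torus \<times> UNIV) (echar \<beta>)"
 unfolding echar_def by(intro continuous_intros continuous_on_compose2[OF continuous_on_chr]) auto

text \<open>A class that contains the packets and is stable under all invariant derivatives; the
  packets alone are not, since differentiation in y produces polynomial factors.\<close>

definition hermite :: "int^'m::finite => complex => complex poly => 'm TR => complex"
 where "hermite \<alpha> c P p = chr \<alpha> (fst p) * (poly P (cor (snd p)) * exp (c * cor (snd p) - (cor (snd p))\<^sup>2 / 2))"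

lemma gauss_hermite: "gauss i = hermite (fst i) (snd i) 1"
 by(simp add:fun_eq_iff gauss_def hermite_def)

lemma hermite_derivative:
 "\<exists>P'. \<forall>p. ((%s. hermite \<alpha> c P (TR_flow d s p)) has_vector_derivative hermite \<alpha> c P' p) (at 0)"
proof (cases d)
 case None
 show ?thesis
 \<comment> \<open>The second summand is P times c - y, the derivative of the exponent.\<close>
 proof (intro exI[of _ "pderiv P + [:c, - 1:] * P"] allI)
  fix p :: "'a TR"
  obtain t y where p: "p = (t, y)" by(cases p)
  let ?y = "cor y"
  have 1: "((%z. poly P (?y + z)) has_field_derivative poly (pderiv P) (?y + 0) * 1) (at 0)"
   by(rule DERIV_chain2[OF poly_DERIV]) (auto intro!:derivative_eq_intros)
  have 2: "((%z. exp (c * (?y + z) - (?y + z)\<^sup>2 / 2)) has_field_derivative exp (c * ?y - ?y\<^sup>2 / 2) * (c - ?y)) (at 0)"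
   by(auto intro!:derivative_eq_intros)
  have "((%z. chr \<alpha> t * (poly P (?y + z) * exp (c * (?y + z) - (?y + z)\<^sup>2 / 2))) has_field_derivative
    hermite \<alpha> c (pderiv P + [:c, - 1:] * P) p) (at (cor 0))"
   using DERIV_cmult[OF DERIV_mult[OF 1 2], of "chr \<alpha> t"] by(simp add:hermite_def p algebra_simps)
  from has_vector_derivative_real_field[OF this]
  show "((%s. hermite \<alpha> c P (TR_flow d s p)) has_vector_derivative hermite \<alpha> c (pderiv P + [:c, - 1:] * P) p) (at 0)"
   by(simp add:None p hermite_def)
 qed
next
 case (Some i)
 show ?thesis
 proof (intro exI[of _ "smult (\<i> * of_int (\<alpha> $ i)) P"] allI)
  fix p :: "'a TR"
  obtain t y where p: "p = (t, y)" by(cases p)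
  let ?a = "cor (real_of_int (\<alpha> $ i))"
  let ?C = "hermite \<alpha> c P p"
  have chr: "chr \<alpha> (\<chi> j. if j = i then t $ j * cis s else t $ j) = chr \<alpha> t * exp (\<i> * ?a * cor s)" for s
  proof -
   have "(if j = i then t $ j * cis s else t $ j) powi \<alpha> $ j = t $ j powi \<alpha> $ j * (if j = i then cis (of_int (\<alpha> $ i) * s) else 1)" for j
    by(simp add:power_int_mult_distrib cis_power_int)
   hence "chr \<alpha> (\<chi> j. if j = i then t $ j * cis s else t $ j) = chr \<alpha> t * cis (of_int (\<alpha> $ i) * s)"
    unfolding chr_def by(simp add:prod.distrib prod.delta)
   thus ?thesis by(simp add:cis_conv_exp mult_ac)
  qed
  have "((%z. ?C * exp (\<i> * ?a * z)) has_field_derivative hermite \<alpha> c (smult (\<i> * of_int (\<alpha> $ i)) P) p) (at (cor 0))"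
   by(auto intro!:derivative_eq_intros simp:hermite_def)
  from has_vector_derivative_real_field[OF this]
  show "((%s. hermite \<alpha> c P (TR_flow d s p)) has_vector_derivative hermite \<alpha> c (smult (\<i> * of_int (\<alpha> $ i)) P) p) (at 0)"
   by(simp add:Some p hermite_def chr mult_ac)
 qed
qed

lemma hermite_partials: "\<exists>P'. TR_partials ds (hermite \<alpha> c P) = hermite \<alpha> c P'"
proof (induction ds)
 case Nil show ?case by(intro exI[of _ P]) simp
next
 case (Cons d ds)
 then obtain Q where Q: "TR_partials ds (hermite \<alpha> c P) = hermite \<alpha> c Q" by blast
 obtain R where R: "\<forall>p. ((%s. hermite \<alpha> c Q (TR_flow d s p)) has_vector_derivative hermite \<alpha> c R p) (at 0)"
  using hermite_derivative by blast
 have "TR_partial d (hermite \<alpha> c Q) = hermite \<alpha> c R"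
  unfolding TR_partial_def fun_eq_iff by(intro allI vector_derivative_at R[rule_format])
 thus ?case unfolding TR_partials_Cons Q by blast
qed

lemma poly_exp_bound: "\<exists>K n. 0 <= K \<and> 0 <= n \<and> (\<forall>z::complex. cmod (poly P z) <= K * exp (n * cmod z))"
proof (induction P)
 case 0 show ?case by(intro exI[of _ 0]) simp
next
 case (pCons a P)
 then obtain K n where K: "0 <= K" and n: "0 <= n" and b: "!!z. cmod (poly P z) <= K * exp (n * cmod z)" by blast
 have "cmod (poly (pCons a P) z) <= (cmod a + K) * exp ((n + 1) * cmod z)" for z
 proof -
  have "cmod (poly (pCons a P) z) <= cmod a + cmod z * cmod (poly P z)"
   using norm_triangle_ineq[of a "z * poly P z"] by(simp add:norm_mult)
  moreover have "cmod a * 1 <= cmod a * exp ((n + 1) * cmod z)" using n by(intro mult_left_mono) auto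
  moreover have "cmod z * cmod (poly P z) <= exp (cmod z) * (K * exp (n * cmod z))"
  proof (rule mult_mono[OF _ b])
   show "cmod z <= exp (cmod z)" using exp_ge_add_one_self[of "cmod z"] by linarith
  qed auto
  moreover have "exp (cmod z) * (K * exp (n * cmod z)) = K * exp ((n + 1) * cmod z)"
   by(simp add:distrib_right exp_add)
  ultimately show ?thesis by(simp only:distrib_right)
 qed
 thus ?case using K n by(intro exI[of _ "cmod a + K"] exI[of _ "n + 1"]) auto
qed

lemma hermite_schwartz: "hermite \<alpha> c P \<in> schwartz_space"
 unfolding schwartz_space_def TR_smooth_def
proof (intro CollectI conjI allI ballI)
 fix ds d k and p :: "'a TR"
 obtain Q where Q: "TR_partials ds (hermite \<alpha> c P) = hermite \<alpha> c Q" using hermite_partials by blast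
 show "continuous_on (torus \<times> UNIV) (TR_partials ds (hermite \<alpha> c P))"
  unfolding Q hermite_def by(intro continuous_intros continuous_on_compose2[OF continuous_on_chr]) auto
 obtain R where R: "\<forall>p. ((%s. hermite \<alpha> c Q (TR_flow d s p)) has_vector_derivative hermite \<alpha> c R p) (at 0)"
  using hermite_derivative by blast
 show "(%s. TR_partials ds (hermite \<alpha> c P) (TR_flow d s p)) differentiable at 0"
  unfolding Q by(rule differentiableI_vector[OF R[rule_format]])
 obtain K n where K: "0 <= K" and n: "0 <= n" and b: "!!z. cmod (poly (monom 1 k * Q) z) <= K * exp (n * cmod z)"
  using poly_exp_bound[of "monom 1 k * Q"] by blast
 \<comment> \<open>Here exp (n |y|) bounds the polynomial up to a constant and |Re c| the
   exponential growth; r |y| - y^2 / 2 \<le> r^2 / 2 removes the dependence on y.\<close>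
 define r where "r = n + \<bar>Re c\<bar>"
 show "bounded ((%p. cor (snd p) ^ k * TR_partials ds (hermite \<alpha> c P) p) ` (torus \<times> UNIV))"
  unfolding bounded_iff Q
 proof (intro exI[of _ "K * exp (r\<^sup>2 / 2)"] ballI, elim imageE)
  fix x and p :: "'a TR"
  assume x: "x = cor (snd p) ^ k * hermite \<alpha> c Q p" and p: "p \<in> torus \<times> UNIV"
  let ?y = "snd p"
  have "cmod (chr \<alpha> (fst p)) = 1" using p by(intro cmod_chr) auto
  hence "cmod x = cmod (poly (monom 1 k * Q) (cor ?y)) * exp (Re c * ?y - ?y\<^sup>2 / 2)"
   by(simp add:x hermite_def norm_mult norm_power poly_monom power2_eq_square)
  also have "... <= (K * exp (n * \<bar>?y\<bar>)) * exp (Re c * ?y - ?y\<^sup>2 / 2)"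
   using b[of "cor ?y"] by(intro mult_right_mono) auto
  also have "... = K * exp (n * \<bar>?y\<bar> + (Re c * ?y - ?y\<^sup>2 / 2))" by(simp only:mult.assoc exp_add)
  also have "... <= K * exp (r\<^sup>2 / 2)"
  proof (intro mult_left_mono K)
   have "Re c * ?y <= \<bar>Re c\<bar> * \<bar>?y\<bar>" using abs_ge_self[of "Re c * ?y"] by(simp add:abs_mult)
   moreover have "0 <= (\<bar>?y\<bar> - r)^2" by simp
   hence "r * \<bar>?y\<bar> - ?y\<^sup>2 / 2 <= r\<^sup>2 / 2" by(simp add:power2_eq_square algebra_simps)
   ultimately have "n * \<bar>?y\<bar> + (Re c * ?y - ?y\<^sup>2 / 2) <= r\<^sup>2 / 2" unfolding r_def distrib_right by linarith
   thus "exp (n * \<bar>?y\<bar> + (Re c * ?y - ?y\<^sup>2 / 2)) <= exp (r\<^sup>2 / 2)" by simp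
  qed
  finally show "cmod x <= K * exp (r\<^sup>2 / 2)" .
 qed
qed

section \<open>Translation invariance\<close>

lemma torus_continuous:
 fixes g :: "complex^'m::finite => complex"
 assumes g: "continuous_on torus g" shows "integrable torus_haar g"
proof -
 have m: "g \<in> bmeas torus_haar"
  unfolding measurable_cong_sets[OF sets_torus_haar refl] by(rule borel_measurable_continuous_on_restrict[OF g])
 have "bounded (g ` torus)" by(intro compact_imp_bounded compact_continuous_image compact_torus g)
 then obtain B where "\<forall>t\<in>torus. cmod (g t) <= B" by(auto simp:bounded_iff)
 with m show ?thesis by(intro torus_integrable_bounded) auto
qed

text \<open>Translation multiplies the integral of a character by its value at s, which changes
  nothing: the integral is 0 unless the character is trivial. Uniform approximation by trigonometric
  polynomials extends this to continuous g.\<close>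

lemma torus_haar_invariant_real:
 fixes g :: "complex^'m::finite => real"
 assumes g: "continuous_on torus g" and s: "s \<in> torus"
 shows "(LINT t|torus_haar. cor (g (\<chi> i. t $ i * s $ i))) = (LINT t|torus_haar. cor (g t))"
proof -
 let ?m = "%t :: complex^'m. \<chi> i. t $ i * s $ i"
 have mt: "?m t \<in> torus" if "t \<in> torus" for t using that s by(simp add:torus_def norm_mult)
 have mc: "continuous_on torus ?m" by(intro continuous_intros)
 have cmp: "continuous_on torus (%t. h (?m t))" if "continuous_on torus h" for h :: "complex^'m => complex"
  by(rule continuous_on_compose2[OF that mc]) (auto simp:mt)
 have gc: "continuous_on torus (%t. cor (g t))" by(intro continuous_intros g)
 have tp: "continuous_on torus p \<and> (LINT t|torus_haar. p (?m t)) = (LINT t|torus_haar. p t)" if "trig_poly p" for p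
  using that
 proof (induction rule: trig_poly.induct)
  case (trig_poly_step p c \<alpha>)
  have ch: "chr \<alpha> (?m t) = chr \<alpha> s * chr \<alpha> t" for t
   by(simp add:chr_def power_int_mult_distrib prod.distrib mult.commute)
  have ci: "integrable torus_haar (chr \<alpha>)" by(rule torus_continuous[OF continuous_on_chr])
  have "(LINT t|torus_haar. p (?m t) + c * chr \<alpha> (?m t)) = (LINT t|torus_haar. p (?m t)) + c * (chr \<alpha> s * (LINT t|torus_haar. chr \<alpha> t))"
   unfolding ch using torus_continuous[OF cmp] trig_poly_step ci by(subst Bochner_Integration.integral_add) auto
  also have "chr \<alpha> s * (LINT t|torus_haar. chr \<alpha> t) = (LINT t|torus_haar. chr \<alpha> t)" by(simp add:integral_chr)
  finally have "(LINT t|torus_haar. p (?m t) + c * chr \<alpha> (?m t)) = (LINT t|torus_haar. p t + c * chr \<alpha> t)"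
   using torus_continuous trig_poly_step ci by(subst Bochner_Integration.integral_add) auto
  thus ?case using trig_poly_step by(auto intro!:continuous_intros continuous_on_chr)
 qed simp
 let ?g = "%t. cor (g t)"
 let ?D = "(LINT t|torus_haar. ?g (?m t)) - (LINT t|torus_haar. ?g t)"
 have near: "cmod ((LINT t|torus_haar. h t) - (LINT t|torus_haar. k t)) <= e"
  if "continuous_on torus h" "continuous_on torus k" "!!t. t \<in> torus ==> cmod (h t - k t) <= e" for h k :: "complex^'m => complex" and e
 proof -
  note i = torus_continuous[OF that(1)] torus_continuous[OF that(2)]
  have "cmod (LINT t|torus_haar. h t - k t) <= (LINT t|torus_haar. cmod (h t - k t))" by(rule integral_norm_bound)
  also have "... <= (LINT t|(torus_haar :: (complex^'m) measure). e)"
   using i that(3) by(intro integral_mono) auto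
  also have "... = e" by(simp add:measure_def emeasure_torus)
  finally show ?thesis using Bochner_Integration.integral_diff[OF i] by simp
 qed
 have "cmod ?D <= e" if e: "0 < e" for e
 proof -
  have "0 < e / 2" using e by simp
  then obtain q where q: "real_polynomial_function q" "!!t. t \<in> torus ==> \<bar>g t - q t\<bar> < e / 2"
   using Stone_Weierstrass_real_polynomial_function[OF compact_torus g] by blast
  obtain p where p: "trig_poly p" "!!t. t \<in> torus ==> cor (q t) = p t"
   using real_polynomial_function_trig_poly[OF q(1)] by blast
  have d: "cmod (?g t - p t) <= e / 2" if "t \<in> torus" for t
  proof -
   have "cmod (?g t - p t) = \<bar>g t - q t\<bar>" unfolding p(2)[OF that, symmetric] of_real_diff[symmetric] by(rule norm_of_real)
   thus ?thesis using q(2)[OF that] by simp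
  qed
  have pc: "continuous_on torus p" using tp[OF p(1)] by simp
  have "cmod ((LINT t|torus_haar. ?g (?m t)) - (LINT t|torus_haar. p (?m t))) <= e / 2"
   by(rule near[OF cmp[OF gc] cmp[OF pc]]) (rule d[OF mt])
  moreover have "cmod ((LINT t|torus_haar. ?g t) - (LINT t|torus_haar. p t)) <= e / 2" by(rule near[OF gc pc d])
  ultimately show ?thesis
   using tp[OF p(1)] norm_triangle_ineq4[of "(LINT t|torus_haar. ?g (?m t)) - (LINT t|torus_haar. p t)" "(LINT t|torus_haar. ?g t) - (LINT t|torus_haar. p t)"]
   by simp
 qed
 hence "cmod ?D <= 0" by(rule field_le_epsilon[of _ 0, simplified])
 thus ?thesis by simp
qed

lemma torus_haar_invariant:
 fixes g :: "complex^'m::finite => complex"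
 assumes g: "continuous_on torus g" and s: "s \<in> torus"
 shows "(LINT t|torus_haar. g (\<chi> i. t $ i * s $ i)) = (LINT t|torus_haar. g t)"
proof -
 let ?m = "%t :: complex^'m. \<chi> i. t $ i * s $ i"
 have c: "continuous_on torus (%t. Re (g t))" "continuous_on torus (%t. Im (g t))" by(intro continuous_intros g)+
 have cm: "continuous_on torus (%t. g (?m t))"
  by(rule continuous_on_compose2[OF g]) (use s in \<open>auto intro!:continuous_intros simp:torus_def norm_mult\<close>)
 have cc: "continuous_on torus (%t. cor (Re (h t)))" "continuous_on torus (%t. cor (Im (h t)))"
  if "continuous_on torus h" for h :: "complex^'m => complex" by(intro continuous_intros that)+
 have split: "(LINT t|torus_haar. h t) = (LINT t|torus_haar. cor (Re (h t))) + \<i> * (LINT t|torus_haar. cor (Im (h t)))"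
  if "continuous_on torus h" for h :: "complex^'m => complex"
 proof -
  have "(LINT t|torus_haar. h t) = (LINT t|torus_haar. cor (Re (h t)) + \<i> * cor (Im (h t)))"
   by(simp only:complex_eq[symmetric])
  also have "... = (LINT t|torus_haar. cor (Re (h t))) + (LINT t|torus_haar. \<i> * cor (Im (h t)))"
   by(intro Bochner_Integration.integral_add integrable_mult_right torus_continuous cc that)
  finally show ?thesis by(simp only:integral_mult_right_zero)
 qed
 show ?thesis unfolding split[OF g] split[OF cm] torus_haar_invariant_real[OF c(1) s] torus_haar_invariant_real[OF c(2) s] ..
qed

text \<open>Fubini and invariance in each variable; continuity lets the torus invariance be applied
  to every slice.\<close>

lemma TR_translate:
 fixes h :: "'m::finite TR => complex"
 assumes c: "continuous_on (torus \<times> UNIV) h" and h: "integrable TRm h"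
  and hp: "integrable TRm (%q. h (TR_mult q p))" and p: "p \<in> torus \<times> UNIV"
 shows "(LINT q|TRm. h (TR_mult q p)) = (LINT q|TRm. h q)"
proof -
 obtain s x where sx: "p = (s, x)" and s: "s \<in> torus" using p by auto
 have snd: "(LINT q|TRm. k q) = (LINT y|lborel. (LINT t|torus_haar. k (t, y)))" if "integrable TRm k"
  for k :: "'m TR => complex"
  using TR.integral_snd[of "%t y. k (t, y)"] that by(simp add:TR_measure_def case_prod_unfold)
 define K where "K y = (LINT t|torus_haar. h (t, y))" for y
 have "(LINT t|torus_haar. h (TR_mult (t, y) p)) = K (x + 1 * y)" for y
 proof -
  have "continuous_on torus (%t. h (t, x + y))"
   by(rule continuous_on_compose2[OF c]) (auto intro!:continuous_intros)
  from torus_haar_invariant[OF this s] show ?thesis by(simp add:TR_mult_def sx K_def add.commute)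
 qed
 hence "(LINT q|TRm. h (TR_mult q p)) = (LINT y|lborel. K (x + 1 * y))" unfolding snd[OF hp] by simp
 also have "... = (LINT y|lborel. K y)" using lborel_integral_real_affine[of 1 K x] by simp
 finally show ?thesis unfolding snd[OF h] K_def .
qed

lemma echar_mult: "p \<in> torus \<times> UNIV ==> q \<in> torus \<times> UNIV ==> echar \<beta> (TR_mult q p) = echar \<beta> q * echar \<beta> p"
 by(auto simp:echar_def TR_mult_def chr_def power_int_mult_distrib prod.distrib exp_add distrib_left mult_ac)

lemma fourier_integrand:
 assumes "integrable TRm f" shows "integrable TRm (%p. f p * cnj (echar \<beta> p))"
proof -
 have "integrable TRm (%p. cnj (echar \<beta> p) * f p)"
  by(rule integrable_bounded_mult[OF assms, where B = 1]) (auto simp:cmod_echar)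
 thus ?thesis by(simp add:mult.commute)
qed

lemma fourier_translate:
 assumes c: "continuous_on (torus \<times> UNIV) f" and f: "integrable TRm f"
  and fp: "integrable TRm (%q. f (TR_mult q p))" and p: "p \<in> torus \<times> UNIV"
 shows "fourier (%q. f (TR_mult q p)) \<beta> = echar \<beta> p * fourier f \<beta>"
proof -
 let ?h = "%q. f q * cnj (echar \<beta> q)"
 have e1: "echar \<beta> p * cnj (echar \<beta> p) = 1" using cmod_echar[of p \<beta>] p by(simp add:complex_norm_square[symmetric])
 have hp: "?h (TR_mult q p) = cnj (echar \<beta> p) * (f (TR_mult q p) * cnj (echar \<beta> q))" if "q \<in> space TRm" for q
  using that by(simp add:echar_mult[OF p] mult_ac)
 have i: "integrable TRm (%q. cnj (echar \<beta> p) * (f (TR_mult q p) * cnj (echar \<beta> q)))"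
  by(rule integrable_mult_right[OF fourier_integrand[OF fp]])
 have "integrable TRm (%q. ?h (TR_mult q p))"
  by(rule Bochner_Integration.integrable_cong[OF refl, THEN iffD2, OF _ i]) (rule hp)
 moreover have "continuous_on (torus \<times> UNIV) ?h" by(intro continuous_intros c continuous_on_echar)
 ultimately have "(LINT q|TRm. ?h q) = (LINT q|TRm. ?h (TR_mult q p))"
  by(intro TR_translate[symmetric] fourier_integrand f p)
 also have "... = (LINT q|TRm. cnj (echar \<beta> p) * (f (TR_mult q p) * cnj (echar \<beta> q)))"
  by(rule LINT_cong[OF refl hp])
 also have "... = cnj (echar \<beta> p) * (LINT q|TRm. f (TR_mult q p) * cnj (echar \<beta> q))" by(rule integral_mult_right_zero)
 finally have h: "(LINT q|TRm. ?h q) = cnj (echar \<beta> p) * (LINT q|TRm. f (TR_mult q p) * cnj (echar \<beta> q))" .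
 have "echar \<beta> p * (LINT q|TRm. ?h q) = (echar \<beta> p * cnj (echar \<beta> p)) * (LINT q|TRm. f (TR_mult q p) * cnj (echar \<beta> q))"
  unfolding h by(simp only:mult.assoc)
 hence X: "echar \<beta> p * (LINT q|TRm. ?h q) = (LINT q|TRm. f (TR_mult q p) * cnj (echar \<beta> q))"
  by(simp only:e1 mult_1)
 show ?thesis unfolding fourier_eq X[symmetric] by(rule mult.left_commute)
qed

text \<open>Turns the bilinear pairing in \<open>distribution_fourier\<close> into an inner product
  with the transform of the conjugate, to which Parseval applies.\<close>

lemma fourier_reflect: "fourier f (- \<alpha>, - \<xi>) = cnj (fourier (%p. cnj (f p)) (\<alpha>, \<xi>))"
proof -
 have "f p * cnj (echar (- \<alpha>, - \<xi>) p) = cnj (cnj (f p) * cnj (echar (\<alpha>, \<xi>) p))" if "p \<in> space TRm" for p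
  using that by(auto simp:echar_def chr_minus exp_cnj)
 hence "(LINT p|TRm. f p * cnj (echar (- \<alpha>, - \<xi>) p)) = cnj (LINT p|TRm. cnj (f p) * cnj (echar (\<alpha>, \<xi>) p))"
  unfolding LINT_cnj[symmetric] by(rule LINT_cong[OF refl])
 thus ?thesis unfolding fourier_eq by simp
qed

section \<open>The distribution with Fourier transform \<open>sqrt \<phi>\<close>\<close>

context quasi_parabolic
begin

definition root_Phi :: "'m DR => complex" where "root_Phi \<beta> = cor (sqrt (Phi l \<beta>))"

lemma csqrt_phi: "csqrt (fourier (phi l) (\<beta> :: 'm DR)) = root_Phi \<beta>"
 unfolding fourier_phi[OF l1] root_Phi_def by(rule csqrt_of_real[OF Phi_nonneg[OF l0]])

text \<open>Integrability of \<open>Phi\<close> is square integrability of its root; with it the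
  pairing against transforms of test functions is an L^2 inner product, hence well defined and
  tempered.\<close>

lemma root_Phi_sq: "DR2 (root_Phi :: 'm DR => complex)"
proof -
 have [measurable]: "(Phi l :: 'm DR => real) \<in> bmeas DRm" by(rule Phi_measurable)
 have "(root_Phi :: 'm DR => complex) \<in> bmeas DRm" unfolding root_Phi_def[abs_def] by measurable
 moreover have "(cmod (root_Phi \<beta>))^2 = Phi l \<beta>" for \<beta> :: "'m DR"
  using Phi_nonneg[OF l0, of \<beta>] by(simp add:root_Phi_def)
 ultimately show ?thesis unfolding sq_integrable_def using Phi_integrable[OF l0, where 'm = 'm] by simp
qed

lemma root_Phi_mult:
 assumes G: "DR2 (G :: 'm DR => complex)"
 shows "integrable DRm (%\<beta>. root_Phi \<beta> * G \<beta>)" "DR2 (%\<beta>. root_Phi \<beta> * G \<beta>)"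
proof -
 show i: "integrable DRm (%\<beta>. root_Phi \<beta> * G \<beta>)" by(rule sq_integrable_mult[OF root_Phi_sq G])
 obtain B where B: "0 < B" "!!\<beta> :: 'm DR. Phi l \<beta> <= B" using Phi_bounded[OF l1, where 'm = 'm] by blast
 show "DR2 (%\<beta>. root_Phi \<beta> * G \<beta>)"
 proof (rule sq_integrable_bound[OF G borel_measurable_integrable[OF i], of "sqrt B"], rule AE_I2)
  fix \<beta> :: "'m DR"
  have "cmod (root_Phi \<beta>) <= sqrt B" using B(2)[of \<beta>] Phi_nonneg[OF l0, of \<beta>] by(simp add:root_Phi_def)
  thus "cmod (root_Phi \<beta> * G \<beta>) <= sqrt B * cmod (G \<beta>)" unfolding norm_mult by(rule mult_right_mono) simp
 qed
qed

lemma schwartz_cnj_pair: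
 assumes f: "f \<in> (schwartz_space :: ('m TR => complex) set)"
 shows "Plancherel.pair (%p. cnj (f p)) (fourier (%p. cnj (f p)))"
 by(rule pair_fourier[OF integrable_cnj[OF schwartz_integrable(1)[OF f]] sq_integrable_cnj[OF schwartz_integrable(2)[OF f]]])

lemma root_pairing:
 assumes f: "f \<in> (schwartz_space :: ('m TR => complex) set)"
 shows "(%(\<alpha>, \<xi>). csqrt (fourier (phi l) (\<alpha>, \<xi>)) * fourier f (- \<alpha>, - \<xi>)) = (%\<beta>. root_Phi \<beta> * cnj (fourier (%p. cnj (f p)) \<beta>))"
  and "integrable DRm (%\<beta>. root_Phi \<beta> * cnj (fourier (%p. cnj (f p)) \<beta>))"
proof -
 show "(%(\<alpha>, \<xi>). csqrt (fourier (phi l) (\<alpha>, \<xi>)) * fourier f (- \<alpha>, - \<xi>)) = (%\<beta>. root_Phi \<beta> * cnj (fourier (%p. cnj (f p)) \<beta>))"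
  by(rule ext) (auto simp:csqrt_phi fourier_reflect)
 show "integrable DRm (%\<beta>. root_Phi \<beta> * cnj (fourier (%p. cnj (f p)) \<beta>))"
  using Plancherel.pair_W[OF schwartz_cnj_pair[OF f]] by(intro sq_integrable_mult root_Phi_sq sq_integrable_cnj) simp
qed

definition root_dist :: "('m TR => complex) => complex"
 where "root_dist f = (LINT \<beta>|DRm. root_Phi \<beta> * cnj (fourier (%p. cnj (f p)) \<beta>))"

lemma root_dist_fourier: "distribution_fourier root_dist (%q. csqrt (fourier (phi l :: 'm TR => complex) q))"
 unfolding distribution_fourier_def
proof (intro ballI conjI)
 fix f :: "'m TR => complex" assume f: "f \<in> schwartz_space"
 show "integrable DRm (%(\<alpha>, \<xi>). csqrt (fourier (phi l) (\<alpha>, \<xi>)) * fourier f (- \<alpha>, - \<xi>))"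
  unfolding root_pairing(1)[OF f] by(rule root_pairing(2)[OF f])
 show "root_dist f = (LINT (\<alpha>, \<xi>)|DRm. csqrt (fourier (phi l) (\<alpha>, \<xi>)) * fourier f (- \<alpha>, - \<xi>))"
  unfolding root_pairing(1)[OF f] root_dist_def ..
qed

lemma root_dist_tempered: "tempered_distribution (root_dist :: ('m TR => complex) => complex)"
 unfolding tempered_distribution_def
proof (intro conjI ballI allI)
 fix f g :: "'m TR => complex" and c :: complex assume f: "f \<in> schwartz_space"
 note fi = fourier_integrand[OF integrable_cnj[OF schwartz_integrable(1)[OF f]]]
 show "root_dist (%p. f p + g p) = root_dist f + root_dist g" if g: "g \<in> schwartz_space"
 proof -
  note gi = fourier_integrand[OF integrable_cnj[OF schwartz_integrable(1)[OF g]]]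
  have "fourier (%p. cnj (f p + g p)) \<beta> = fourier (%p. cnj (f p)) \<beta> + fourier (%p. cnj (g p)) \<beta>" for \<beta>
   unfolding fourier_eq complex_cnj_add distrib_right by(simp only:Bochner_Integration.integral_add[OF fi gi] distrib_left)
  thus ?thesis unfolding root_dist_def
   by(simp only:complex_cnj_add distrib_left Bochner_Integration.integral_add[OF root_pairing(2)[OF f] root_pairing(2)[OF g]])
 qed
 have "fourier (%p. cnj (c * f p)) \<beta> = cnj c * fourier (%p. cnj (f p)) \<beta>" for \<beta>
  unfolding fourier_eq complex_cnj_mult mult.assoc by(simp only:integral_mult_right_zero mult.left_commute)
 hence "root_Phi \<beta> * cnj (fourier (%p. cnj (c * f p)) \<beta>) = c * (root_Phi \<beta> * cnj (fourier (%p. cnj (f p)) \<beta>))" for \<beta>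
  by(simp only:complex_cnj_mult complex_cnj_cnj mult.left_commute)
 thus "root_dist (%p. c * f p) = c * root_dist f" unfolding root_dist_def by(simp only:integral_mult_right_zero)
next
 let ?N = "ip_norm (L2_ip DRm) (root_Phi :: 'm DR => complex)"
 let ?D = "TR_nrm (%p :: 'm TR. cor (decay p))"
 have N: "0 <= ?N" by(simp add:L2_nrm)
 \<comment> \<open>Cauchy-Schwarz, Plancherel and domination by \<open>decay\<close> reduce the
   estimate to the two undifferentiated seminorms with weights 1 and y^2.\<close>
 show "\<exists>C K. finite K \<and> (\<forall>f\<in>(schwartz_space :: ('m TR => complex) set). cmod (root_dist f) <= C * (\<Sum>\<kappa>\<in>K. schwartz_seminorm \<kappa> f))"
 proof (intro exI[of _ "?N * ?D"] exI[of _ "{(0, []), (2, [])}"] conjI ballI)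
  fix f :: "'m TR => complex" assume f: "f \<in> schwartz_space"
  let ?F = "fourier (%p. cnj (f p))"
  note P = schwartz_cnj_pair[OF f]
  have F: "DR2 ?F" using Plancherel.pair_W[OF P] by simp
  have "cmod (root_dist f) = cmod (L2_ip DRm root_Phi ?F)" unfolding root_dist_def L2_ip_def ..
  also have "... <= ?N * ip_norm (L2_ip DRm) ?F"
   using root_Phi_sq F by(intro Plancherel.W.Cauchy_Schwarz) auto
  also have "ip_norm (L2_ip DRm) ?F = TR_nrm f" by(rule trans[OF Plancherel.pair_nrm[OF P, symmetric]]) (simp add:L2_nrm)
  also have "?N * TR_nrm f <= ?N * (schwartz_const f * ?D)" by(rule mult_left_mono[OF schwartz_integrable(3)[OF f] N])
  also have "... = ?N * ?D * (\<Sum>\<kappa>\<in>{(0, []), (2, [])}. schwartz_seminorm \<kappa> f)" by(simp add:schwartz_const_def)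
  finally show "cmod (root_dist f) <= ?N * ?D * (\<Sum>\<kappa>\<in>{(0, []), (2, [])}. schwartz_seminorm \<kappa> f)" .
 qed simp
qed

text \<open>Stated for every \<omega> with this transform, since the square root formula is claimed
  for all of them. Translating by p multiplies the transform by the character at p, and the pairing
  becomes an inverse transform evaluated at p.\<close>

lemma distribution_translate:
 fixes \<omega> :: "('m TR => complex) => complex"
 assumes \<omega>: "distribution_fourier \<omega> (%q. csqrt (fourier (phi l) q))"
  and \<psi>: "\<psi> \<in> schwartz_space" and p: "p \<in> torus \<times> UNIV"
 shows "\<omega> (%q. \<psi> (TR_mult q p)) = cor (sqrt (2 * pi)) * cnj (inv_fourier (%\<beta>. root_Phi \<beta> * fourier (%q. cnj (\<psi> q)) \<beta>) p)"
proof -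
 let ?\<psi> = "%q. \<psi> (TR_mult q p)"
 note tr = schwartz_translate[OF \<psi> p]
 have cs: "continuous_on (torus \<times> UNIV) (%q. cnj (\<psi> q))" by(intro continuous_intros schwartz_continuous[OF \<psi>])
 have F: "fourier (%q. cnj (?\<psi> q)) \<beta> = echar \<beta> p * fourier (%q. cnj (\<psi> q)) \<beta>" for \<beta>
  by(rule fourier_translate[OF cs integrable_cnj[OF schwartz_integrable(1)[OF \<psi>]] integrable_cnj[OF schwartz_integrable(1)[OF tr]] p])
 have "\<omega> ?\<psi> = (LINT (\<alpha>, \<xi>)|DRm. csqrt (fourier (phi l) (\<alpha>, \<xi>)) * fourier ?\<psi> (- \<alpha>, - \<xi>))"
  by(rule conjunct2[OF bspec[OF \<omega>[unfolded distribution_fourier_def] tr]])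
 also have "... = (LINT \<beta>|DRm. root_Phi \<beta> * cnj (echar \<beta> p * fourier (%q. cnj (\<psi> q)) \<beta>))"
  unfolding root_pairing(1)[OF tr] F ..
 also have "... = cnj (LINT \<beta>|DRm. root_Phi \<beta> * fourier (%q. cnj (\<psi> q)) \<beta> * echar \<beta> p)"
  unfolding LINT_cnj[symmetric] by(simp add:root_Phi_def mult_ac)
 finally show ?thesis unfolding inv_fourier_def by simp
qed

lemma quarter_sq: "(2 * pi) powr (1 / 4) * (2 * pi) powr (1 / 4) = sqrt (2 * pi)"
 by(simp add:powr_add[symmetric] powr_half_sqrt)

lemma sqrt_sym_eq: "cor (sqrt (sym \<beta>)) = cor ((2 * pi) powr (1 / 4)) * root_Phi (\<beta> :: 'm DR)"
proof -
 have "sqrt (sqrt (2 * pi)) = (2 * pi) powr (1 / 4)"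
  by(rule real_sqrt_unique) (simp_all add: power2_eq_square quarter_sq)
 thus ?thesis by(simp add:sym_def root_Phi_def real_sqrt_mult)
qed

text \<open>S has symbol (2 pi) powr (1/4) times \<open>root_Phi\<close>, whereas convolution with
  \<omega> multiplies by sqrt (2 pi) times \<open>root_Phi\<close>; the quotient is the factor (2
  pi) powr (1/4) in front of S f. The identity itself is Parseval for f and the translated
  pairing.\<close>

lemma sqrt_convolution:
 fixes S :: "('m cov => complex) => 'm cov => complex"
 assumes S: "multiplier l (%\<beta>. sqrt (sym \<beta>)) S" and \<omega>: "distribution_fourier \<omega> (%q. csqrt (fourier (phi l) q))" and f: "f \<in> L2_chi l"
 shows "is_distribution_conv (untwist l f) \<omega> (%p. cor ((2 * pi) powr (1 / 4)) * untwist l (S f) p)"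
proof -
 let ?c = "cor ((2 * pi) powr (1 / 4))" and ?s = "cor (sqrt (2 * pi))"
 define F where "F = fourier_L2 (untwist l f)"
 have F: "Plancherel.pair (untwist l f) F" unfolding F_def by(rule chi_pair[OF f])
 have cc: "?c * ?c = ?s" unfolding of_real_mult[symmetric] quarter_sq ..
 have "Plancherel.pair (%p. ?c * untwist l (S f) p) (%\<beta>. ?c * (cor (sqrt (sym \<beta>)) * F \<beta>))"
  by(rule Plancherel.pair_scale[OF multiplierD(2)[OF S f F]])
 moreover have "?c * (cor (sqrt (sym \<beta>)) * F \<beta>) = ?s * (root_Phi \<beta> * F \<beta>)" for \<beta>
  unfolding sqrt_sym_eq cc[symmetric] by(simp only:mult.assoc)
 ultimately have G: "Plancherel.pair (%p. ?c * untwist l (S f) p) (%\<beta>. ?s * (root_Phi \<beta> * F \<beta>))" by(simp only:)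
 show ?thesis unfolding is_distribution_conv_def
 proof (intro conjI ballI)
  show "TR2 (%p. ?c * untwist l (S f) p)" using Plancherel.pair_V[OF G] by simp
  fix \<psi> :: "'m TR => complex" assume \<psi>: "\<psi> \<in> schwartz_space"
  let ?\<psi> = "%q. cnj (\<psi> q)"
  let ?H = "%\<beta>. root_Phi \<beta> * fourier ?\<psi> \<beta>"
  note P = schwartz_cnj_pair[OF \<psi>]
  have P2: "DR2 (fourier ?\<psi>)" using Plancherel.pair_W[OF P] by simp
  have H: "Plancherel.pair (inv_fourier ?H) ?H" by(rule pair_inv_fourier[OF root_Phi_mult[OF P2]])
  have H2: "TR2 (inv_fourier ?H)" using Plancherel.pair_V[OF H] by simp
  have eq: "untwist l f p * \<omega> (%q. \<psi> (TR_mult q p)) = ?s * (untwist l f p * cnj (inv_fourier ?H p))" if "p \<in> space TRm" for p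
   using distribution_translate[OF \<omega> \<psi>, of p] that by(simp only:space_TR mult.left_commute)
  have i: "integrable TRm (%p. ?s * (untwist l f p * cnj (inv_fourier ?H p)))"
   by(intro integrable_mult_right sq_integrable_mult sq_integrable_cnj H2 untwist_sq_integrable[OF f])
  show "integrable TRm (%p. untwist l f p * \<omega> (%q. \<psi> (TR_mult q p)))"
   by(rule Bochner_Integration.integrable_cong[OF refl, THEN iffD2, OF _ i]) (rule eq)
  have "(LINT p|TRm. untwist l f p * \<omega> (%q. \<psi> (TR_mult q p))) = ?s * L2_ip TRm (untwist l f) (inv_fourier ?H)"
   unfolding L2_ip_def integral_mult_right_zero[symmetric] by(rule LINT_cong[OF refl eq])
  also have "L2_ip TRm (untwist l f) (inv_fourier ?H) = L2_ip DRm F ?H" by(rule Plancherel.pair_ip[OF F H])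
  also have "?s * L2_ip DRm F ?H = L2_ip DRm (%\<beta>. ?s * (root_Phi \<beta> * F \<beta>)) (fourier ?\<psi>)"
   unfolding L2_ip_def integral_mult_right_zero[symmetric]
   by(rule LINT_cong[OF refl]) (simp add:root_Phi_def mult_ac)
  also have "... = L2_ip TRm (%p. ?c * untwist l (S f) p) ?\<psi>" by(rule Plancherel.pair_ip[OF G P, symmetric])
  finally show "(LINT p|TRm. untwist l f p * \<omega> (%q. \<psi> (TR_mult q p))) = (LINT p|TRm. ?c * untwist l (S f) p * \<psi> p)"
   by(simp add:L2_ip_def)
 qed
qed

end

text \<open>The conjugate of a packet agrees on the group with another packet, which is a test
  function; so g and h have the same pairings with a total family.\<close>

lemma distribution_conv_unique:
 fixes g h :: "'m::finite TR => complex"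
 assumes g: "is_distribution_conv f \<omega> g" and h: "is_distribution_conv f \<omega> h"
 shows "AE p in TRm. g p = h p"
proof -
 have g2: "TR2 g" and h2: "TR2 h" using g h by(simp_all add: is_distribution_conv_def)
 have D: "(LINT p|TRm. f p * \<omega> (%q. \<psi> (TR_mult q p))) = (LINT p|TRm. k p * \<psi> p)"
  if "is_distribution_conv f \<omega> k" "\<psi> \<in> schwartz_space" for k \<psi>
  by(rule conjunct2[OF bspec[OF conjunct2[OF that(1)[unfolded is_distribution_conv_def]] that(2)]])
 have eq: "L2_ip TRm g (gauss i) = L2_ip TRm h (gauss i)" for i :: "(int^'m) \<times> complex"
 proof -
  let ?j = "(- fst i, cnj (snd i))"
  have c: "cnj (gauss i p) = gauss ?j p" if "p \<in> space TRm" for p :: "'m TR"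
   using that by(auto simp:gauss_def chr_minus exp_cnj)
  have S: "gauss ?j \<in> (schwartz_space :: ('m TR => complex) set)" unfolding gauss_hermite by(rule hermite_schwartz)
  have "(LINT p|TRm. g p * gauss ?j p) = (LINT p|TRm. h p * gauss ?j p)"
   by(rule trans[OF D[OF g S, symmetric] D[OF h S]])
  moreover have "L2_ip TRm k (gauss i) = (LINT p|TRm. k p * gauss ?j p)" for k
   unfolding L2_ip_def by(rule LINT_cong[OF refl]) (simp only:c)
  ultimately show ?thesis by simp
 qed
 obtain G where G: "Plancherel.pair g G" using Plancherel.pair_exists[of g] g2 by auto
 have H: "Plancherel.pair h G" using G h2 unfolding Plancherel.pair_def by(simp add:eq)
 have "ip_dist (L2_ip TRm) g h = 0"
  unfolding Plancherel.pair_dist[OF G H] by(rule Plancherel.W.dist_self)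
 thus ?thesis using L2_dist_zero_iff[OF g2 h2] by simp
qed

theorem mainTheorem5:
  fixes n :: nat and l :: real
  assumes n: "2 \<le> n" "CARD('m::finite) = n - 1"
    and l: "real n < l"
  shows
    "(z0 :: complex^('m option)) \<in> ball 0 1 \<and>

     (\<forall>\<nu>>1/2. (D_fun \<nu> :: (complex^'m) \<times> real \<times> real \<Rightarrow> complex) \<in> L2_chi \<nu>) \<and>

     (\<forall>\<nu>>1. integrable TR_measure (phi \<nu> :: (complex^'m) \<times> real \<Rightarrow> complex)) \<and>

     bounded_operator (bergman_space l :: (complex^('m option) \<Rightarrow> complex) set) (bergman_ip l)
       (L2_chi l) (chi_ip l) (restriction_op l) \<and>
     bounded_operator (L2_chi l :: ((complex^'m) \<times> real \<times> real \<Rightarrow> complex) set) (chi_ip l)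
       (bergman_space l) (bergman_ip l) (restriction_adj l) \<and>
     bounded_operator (L2_chi l :: ((complex^'m) \<times> real \<times> real \<Rightarrow> complex) set) (chi_ip l)
       (L2_chi l) (chi_ip l) (RR_adj l) \<and>
     (\<forall>f\<in>bergman_space l. \<forall>g\<in>L2_chi l :: ((complex^'m) \<times> real \<times> real \<Rightarrow> complex) set.
        chi_ip l (restriction_op l f) g = bergman_ip l f (restriction_adj l g)) \<and>

     (\<forall>f\<in>L2_chi l. \<forall>(t :: complex^'m, y, x)\<in>P_cover.
        RR_adj l f (t, y, x) =
        exp (- 2 * complex_of_real pi * \<i> * complex_of_real l * complex_of_real x) *
        TR_conv (untwist l f) (phi l) (t, y)) \<and>

     (\<forall>(\<alpha> :: int^'m) \<xi>. fourier (phi l) (\<alpha>, \<xi>) =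
        (if 0 < \<xi> \<and> (\<forall>i. 0 \<le> \<alpha> $ i) then
           complex_of_real
             (2 powr (l + 1/2) * sqrt pi / Gamma l * exp (- 2 * \<xi>) *
              (\<xi> powr (l + real_of_int (\<Sum>i\<in>UNIV. \<alpha> $ i) - 1) /
                 real (n - 1) powi (\<Sum>i\<in>UNIV. \<alpha> $ i)) *
              (1 / (\<Prod>i\<in>UNIV. fact (nat (\<alpha> $ i)))))
         else 0)) \<and>

     closure_of_range (L2_chi l) (chi_ip l) (RR_adj l) =
       (B_space l :: ((complex^'m) \<times> real \<times> real \<Rightarrow> complex) set) \<and>

     (\<exists>S. is_positive_sqrt (L2_chi l :: ((complex^'m) \<times> real \<times> real \<Rightarrow> complex) set)
        (chi_ip l) (RR_adj l) S) \<and>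
     (\<exists>\<omega>. tempered_distribution \<omega> \<and>
        distribution_fourier \<omega>
          (\<lambda>q. csqrt (fourier (phi l :: (complex^'m) \<times> real \<Rightarrow> complex) q))) \<and>

     (\<forall>S. is_positive_sqrt (L2_chi l :: ((complex^'m) \<times> real \<times> real \<Rightarrow> complex) set)
        (chi_ip l) (RR_adj l) S \<longrightarrow>
        closure_of_range (L2_chi l) (chi_ip l) S = B_space l \<and>
        (\<forall>\<omega>. tempered_distribution \<omega> \<and>
           distribution_fourier \<omega> (\<lambda>q. csqrt (fourier (phi l) q)) \<longrightarrow>
           (\<forall>f\<in>L2_chi l.
              (\<exists>g. is_distribution_conv (untwist l f) \<omega> g) \<and>
              (\<forall>g. is_distribution_conv (untwist l f) \<omega> g \<longrightarrow>
                 (AE (t, y) in TR_measure. \<forall>x. (t, y, x) \<in> P_cover \<longrightarrow>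
                    S f (t, y, x) =
                    complex_of_real ((2 * pi) powr (- 1/4)) *
                    exp (- 2 * complex_of_real pi * \<i> * complex_of_real l * complex_of_real x) *
                    g (t, y))))))"
proof -
 interpret quasi_parabolic l "TYPE('m)"
  by unfold_locales (use n l in \<open>simp add:card_UNIV_option\<close>)
 have c1: "real (n - 1) = real CARD('m)" using n by simp
 have FT: "\<forall>(\<alpha> :: int^'m) \<xi>. fourier (phi l) (\<alpha>, \<xi>) =
    (if 0 < \<xi> \<and> (\<forall>i. 0 <= \<alpha> $ i) then
      cor
       (2 powr (l + 1/2) * sqrt pi / Gamma l * exp (- 2 * \<xi>) *
       (\<xi> powr (l + real_of_int (\<Sum>i\<in>UNIV. \<alpha> $ i) - 1) /
         real (n - 1) powi (\<Sum>i\<in>UNIV. \<alpha> $ i)) *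
       (1 / (\<Prod>i\<in>UNIV. fact (nat (\<alpha> $ i)))))
     else 0)"
  unfolding fourier_phi[OF l1] Phi_def c1 case_prod_conv if_distrib[of cor] of_real_0 by(intro allI refl)
 have SQ: "closure_of_range (L2_chi l) (chi_ip l) S = B_space l"
  if "is_positive_sqrt (L2_chi l :: ('m cov => complex) set) (chi_ip l) (RR_adj l) S" for S
  by(rule closure_range[OF sqrt_multiplier[OF that] sqrt_sym_bounded]) (simp_all add: sym_nonneg sym_zero_iff)
 have AEQ: "AE (t, y) in TRm. \<forall>x. (t, y, x) \<in> P_cover \<longrightarrow>
   S f (t, y, x) = cor ((2 * pi) powr (- 1/4)) *
    exp (- 2 * cor pi * \<i> * cor l * cor x) * g (t, y)"
  if S: "is_positive_sqrt (L2_chi l :: ('m cov => complex) set) (chi_ip l) (RR_adj l) S"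
   and \<omega>: "distribution_fourier \<omega> (%q. csqrt (fourier (phi l) q))" and f: "f \<in> L2_chi l"
   and g: "is_distribution_conv (untwist l f) \<omega> g" for S \<omega> f g
 proof -
  note M = sqrt_multiplier[OF S]
  \<comment> \<open>\<open>sqrt_convolution\<close> gives g as (2 pi) powr (1/4) times
    \<open>untwist l (S f)\<close>; solving for S f produces the exponent -1/4.\<close>
  have inv: "(2 * pi) powr (- 1/4) * (2 * pi) powr (1 / 4) = 1" by(simp add:powr_add[symmetric])
  show ?thesis using distribution_conv_unique[OF g sqrt_convolution[OF M \<omega> f]]
  proof eventually_elim
   case (elim p)
   obtain t y where p: "p = (t, y)" by(cases p)
   have "S f (t, y, x) = cor ((2 * pi) powr (- 1/4)) *
     exp (- 2 * cor pi * \<i> * cor l * cor x) * g (t, y)" if x: "(t, y, x) \<in> P_cover" for x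
   proof -
    have "cor ((2 * pi) powr (- 1/4)) * g (t, y) =
      cor ((2 * pi) powr (- 1/4) * (2 * pi) powr (1 / 4)) * untwist l (S f) (t, y)"
     using elim unfolding p of_real_mult by(simp only:mult.assoc)
    hence "untwist l (S f) (t, y) = cor ((2 * pi) powr (- 1/4)) * g (t, y)"
     unfolding inv of_real_1 mult_1 by(rule sym)
    thus ?thesis unfolding cover_eq_twist[OF multiplierD(1)[OF M f] x] by(simp only:mult.left_commute mult.assoc)
   qed
   thus ?case unfolding p by simp
  qed
 qed
 have CV: "\<exists>g. is_distribution_conv (untwist l f) \<omega> g"
  if S: "is_positive_sqrt (L2_chi l :: ('m cov => complex) set) (chi_ip l) (RR_adj l) S"
   and \<omega>: "distribution_fourier \<omega> (%q. csqrt (fourier (phi l) q))" and f: "f \<in> L2_chi l"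
  for S \<omega> and f :: "'m cov => complex"
  by(rule exI, rule sqrt_convolution[OF sqrt_multiplier[OF S] \<omega> f])
 have RR: "\<forall>f\<in>L2_chi l. \<forall>(t :: complex^'m, y, x)\<in>P_cover. RR_adj l f (t, y, x) =
   exp (- 2 * cor pi * \<i> * cor l * cor x) * TR_conv (untwist l f) (phi l) (t, y)"
  by(intro ballI, clarify) (rule RR_adj_formula)
 show ?thesis
  apply (intro conjI)
  subgoal by(rule z0_in_ball)
  subgoal by(intro allI impI D_fun_in_L2_chi)
  subgoal by(intro allI impI phi_integrable)
  subgoal by(rule restriction_op_bounded)
  subgoal by(rule restriction_adj_bounded)
  subgoal by(rule RR_adj_bounded)
  subgoal by(intro ballI) (rule bspec[OF restriction_adj_eq(2)])
  subgoal by(rule RR)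
  subgoal by(rule FT)
  subgoal by(rule closure_range[OF RR_adj_multiplier sym_bounded sym_nonneg sym_zero_iff])
  subgoal by(rule exI, rule sqrt_exists)
  subgoal by(rule exI, rule conjI[OF root_dist_tempered root_dist_fourier])
  apply (intro allI impI conjI ballI)
  subgoal premises h for S by(rule SQ[OF h])
  subgoal premises h for S \<omega> f by(rule CV[OF h(1) conjunct2[OF h(2)] h(3)])
  subgoal premises h for S \<omega> f g by(rule AEQ[OF h(1) conjunct2[OF h(2)] h(3,4)])
  done
qed

end
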